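(* Let $a,b,\sigma,\rho\in\mathbb{R}$, $q\in(0,1)$, and let $(X(t))_{t\ge 0}$ be the process satisfying the stochastic pantograph equation $$dX(t)=\{aX(t)+bX(qt)\}\,dt+\{\sigma X(t)+\rho X(qt)\}\,dB(t),\quad t\ge 0,\qquad X(0)=X_0 .$$ (i) Let $\rho=0$ and $\mathbb{E}(|X_0|^2)<\infty$. If $a>0$, then there is a constant $C>0$ such that $$\mathbb{E}(|X(t)|)\le C\,\mathbb{E}(|X_0|)\,e^{at},\quad t\ge0,$$ and $$\limsup_{t\to\infty}\frac1t\log|X(t)|\le a\quad\text{a.s.}$$ (ii) Let $\rho\neq0$ and $\mathbb{E}(|X_0|^2)<\infty$. If $2a+\sigma^2>0$, then there is a constant $C>0$ such that $$\mathbb{E}(|X(t)|^2)\le C\,\mathbb{E}(|X_0|^2)\,e^{(2a+\sigma^2)t},\quad t\ge0,$$ and $$\limsup_{t\to\infty}\frac1t\log|X(t)|\le a+\frac12\sigma^2\quad\text{a.s.}$$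
   Context: $(B(t))_{t\ge0}$ is a standard one-dimensional Brownian motion on a probability space $(\Omega,\mathcal{F},\mathbb{P})$; the initial value $X_0$ is a real random variable independent of $B$ with $\mathbb{E}(|X_0|^2)<\infty$. The solution $X$ is the pathwise unique strong solution: the continuous process, adapted to the (completed) filtration generated by $X_0$ and $B$, satisfying the integrated (Itô) form of the equation. Existence and uniqueness may be taken as known. Convention: $\log 0=-\infty$. *)

theory Defs
  imports "HOL-Probability.Probability"
begin

text \<open>Processes have type \<open>real \<Rightarrow> 'a \<Rightarrow> real\<close>; only their values at times \<open>t \<ge> 0\<close> matter.\<close>

definition continuous_process :: "'a measure \<Rightarrow> (real \<Rightarrow> 'a \<Rightarrow> real) \<Rightarrow> bool" where
  "continuous_process M X \<longleftrightarrow> (AE \<omega> in M. continuous_on {0..} (\<lambda>t. X t \<omega>))"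

definition brownian_motion :: "'a measure \<Rightarrow> (real \<Rightarrow> 'a \<Rightarrow> real) \<Rightarrow> bool" where
  "brownian_motion M B \<longleftrightarrow>
     prob_space M \<and>
     (\<forall>t\<ge>0. B t \<in> borel_measurable M) \<and>
     (AE \<omega> in M. B 0 \<omega> = 0) \<and>
     (\<forall>s t. 0 \<le> s \<and> s < t \<longrightarrow>
        distributed M lborel (\<lambda>\<omega>. B t \<omega> - B s \<omega>)
          (\<lambda>x. ennreal (normal_density 0 (sqrt (t - s)) x))) \<and>
     (\<forall>(\<tau> :: nat \<Rightarrow> real) n. 0 \<le> \<tau> 0 \<and> mono \<tau> \<longrightarrow>
        prob_space.indep_vars M (\<lambda>_. borel) (\<lambda>i \<omega>. B (\<tau> (Suc i)) \<omega> - B (\<tau> i) \<omega>) {..<n}) \<and>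
     continuous_process M B"

definition independent_of_process ::
    "'a measure \<Rightarrow> ('a \<Rightarrow> real) \<Rightarrow> (real \<Rightarrow> 'a \<Rightarrow> real) \<Rightarrow> bool" where
  "independent_of_process M X0 B \<longleftrightarrow>
     X0 \<in> borel_measurable M \<and>
     prob_space.indep_set M
       {X0 -` A \<inter> space M | A. A \<in> sets borel}
       {(\<lambda>\<omega>. \<lambda>s\<in>{0..}. B s \<omega>) -` A \<inter> space M | A. A \<in> sets (Pi\<^sub>M {0..} (\<lambda>_. borel))}"

text \<open>
  The filtration generated by \<open>X0\<close> and \<open>B\<close>, completed by the null events of \<open>M\<close>. Since
  \<open>null_sets M\<close> contains only measurable sets, each \<open>F t\<close> is a sub-sigma-algebra of \<open>M\<close>
  even if \<open>M\<close> is not complete; for complete \<open>M\<close> this is the usual augmentation.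
\<close>

definition completed_filtration ::
    "'a measure \<Rightarrow> ('a \<Rightarrow> real) \<Rightarrow> (real \<Rightarrow> 'a \<Rightarrow> real) \<Rightarrow> real \<Rightarrow> 'a measure" where
  "completed_filtration M X0 B t =
     sigma (space M)
       ({X0 -` A \<inter> space M | A. A \<in> sets borel} \<union>
        {B s -` A \<inter> space M | s A. 0 \<le> s \<and> s \<le> t \<and> A \<in> sets borel} \<union>
        null_sets M)"

definition adapted_process :: "(real \<Rightarrow> 'a measure) \<Rightarrow> (real \<Rightarrow> 'a \<Rightarrow> real) \<Rightarrow> bool" where
  "adapted_process F X \<longleftrightarrow> (\<forall>t\<ge>0. X t \<in> borel_measurable (F t))"

text \<open>
  Convergence to 0 in probability. The events are covered by measurable ones, so that a
  non-measurable set (to which \<open>measure M\<close> assigns 0) cannot satisfy the condition vacuously.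
  For measurable \<open>Z n\<close> this says \<open>measure M {\<omega> \<in> space M. e < Z n \<omega>} \<longlonglongrightarrow> 0\<close> for all \<open>e > 0\<close>.
\<close>

definition null_in_probability :: "'a measure \<Rightarrow> (nat \<Rightarrow> 'a \<Rightarrow> ennreal) \<Rightarrow> bool" where
  "null_in_probability M Z \<longleftrightarrow>
     (\<forall>\<epsilon>>0. \<forall>\<delta>>0. eventually (\<lambda>n. \<exists>A\<in>sets M.
        {\<omega> \<in> space M. ennreal \<epsilon> < Z n \<omega>} \<subseteq> A \<and> measure M A < \<delta>) sequentially)"

text \<open>
  The elementary process \<open>\<Sum>i<k. \<xi> i * 1(\<tau> i, \<tau> (i+1)]\<close> and its stochastic integral over
  \<open>[0, t]\<close>.
\<close>

definition elementary_process ::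
    "nat \<Rightarrow> (nat \<Rightarrow> real) \<Rightarrow> (nat \<Rightarrow> 'a \<Rightarrow> real) \<Rightarrow> real \<Rightarrow> 'a \<Rightarrow> real" where
  "elementary_process k \<tau> \<xi> s \<omega> = (\<Sum>i<k. \<xi> i \<omega> * indicator {\<tau> i<..\<tau> (Suc i)} s)"

definition elementary_integral ::
    "(real \<Rightarrow> 'a \<Rightarrow> real) \<Rightarrow> nat \<Rightarrow> (nat \<Rightarrow> real) \<Rightarrow> (nat \<Rightarrow> 'a \<Rightarrow> real) \<Rightarrow> real \<Rightarrow> 'a \<Rightarrow> real" where
  "elementary_integral B k \<tau> \<xi> t \<omega> =
     (\<Sum>i<k. \<xi> i \<omega> * (B (min t (\<tau> (Suc i))) \<omega> - B (min t (\<tau> i)) \<omega>))"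

definition elementary_integrand ::
    "(real \<Rightarrow> 'a measure) \<Rightarrow> nat \<Rightarrow> (nat \<Rightarrow> real) \<Rightarrow> (nat \<Rightarrow> 'a \<Rightarrow> real) \<Rightarrow> bool" where
  "elementary_integrand F k \<tau> \<xi> \<longleftrightarrow>
     0 \<le> \<tau> 0 \<and> mono \<tau> \<and>
     (\<forall>i<k. \<xi> i \<in> borel_measurable (F (\<tau> i)) \<and> bounded (\<xi> i ` space (F (\<tau> i))))"

text \<open>
  \<open>I\<close> is the process \<open>t \<mapsto> \<integral>\<^sub>0\<^sup>t H dB\<close>: the continuous adapted process that is the limit in
  probability, at each time, of the integrals of elementary processes that approximate \<open>H\<close> in
  \<open>L\<^sup>2([0, t])\<close> in probability. Such an \<open>I\<close> is unique up to indistinguishability, and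
  does not depend on the approximating sequence.
\<close>

definition ito_integral ::
    "'a measure \<Rightarrow> (real \<Rightarrow> 'a measure) \<Rightarrow> (real \<Rightarrow> 'a \<Rightarrow> real) \<Rightarrow>
     (real \<Rightarrow> 'a \<Rightarrow> real) \<Rightarrow> (real \<Rightarrow> 'a \<Rightarrow> real) \<Rightarrow> bool" where
  "ito_integral M F B H I \<longleftrightarrow>
     adapted_process F I \<and> continuous_process M I \<and>
     (\<exists>(k :: nat \<Rightarrow> nat) (\<tau> :: nat \<Rightarrow> nat \<Rightarrow> real) (\<xi> :: nat \<Rightarrow> nat \<Rightarrow> 'a \<Rightarrow> real).
        (\<forall>n. elementary_integrand F (k n) (\<tau> n) (\<xi> n)) \<and>
        (\<forall>t\<ge>0. null_in_probability M (\<lambda>n \<omega>. \<integral>\<^sup>+s\<in>{0..t}.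
           ennreal ((elementary_process (k n) (\<tau> n) (\<xi> n) s \<omega> - H s \<omega>)\<^sup>2) \<partial>lborel)) \<and>
        (\<forall>t\<ge>0. null_in_probability M (\<lambda>n \<omega>.
           ennreal \<bar>elementary_integral B (k n) (\<tau> n) (\<xi> n) t \<omega> - I t \<omega>\<bar>)))"

definition pantograph_solution ::
    "'a measure \<Rightarrow> (real \<Rightarrow> 'a \<Rightarrow> real) \<Rightarrow> real \<Rightarrow> real \<Rightarrow> real \<Rightarrow> real \<Rightarrow> real \<Rightarrow>
     ('a \<Rightarrow> real) \<Rightarrow> (real \<Rightarrow> 'a \<Rightarrow> real) \<Rightarrow> bool" where
  "pantograph_solution M B a b \<sigma> \<rho> q X0 X \<longleftrightarrow>
     adapted_process (completed_filtration M X0 B) X \<and> continuous_process M X \<and>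
     (\<exists>I. ito_integral M (completed_filtration M X0 B) B (\<lambda>s \<omega>. \<sigma> * X s \<omega> + \<rho> * X (q * s) \<omega>) I \<and>
        (AE \<omega> in M. \<forall>t\<ge>0.
           X t \<omega> = X0 \<omega> + (LBINT s:{0..t}. a * X s \<omega> + b * X (q * s) \<omega>) + I t \<omega>))"

text \<open>Logarithm on the nonnegative reals with \<open>log 0 = -\<infinity>\<close> (the library has \<open>ln 0 = 0\<close>).\<close>

definition elog :: "real \<Rightarrow> ereal" where
  "elog x = (if x = 0 then -\<infinity> else ereal (ln x))"

end

theory Submission
  imports Defs
begin

text \<open>
  No stopping times are needed. The stochastic integral of the solution is an almost sure limit of
  Riemann sums along a subsequence of partitions. Restricted to the decreasing events that the path
  has stayed in a ball of radius \<open>K\<close> so far (tested at rational times), the solution is square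
  integrable, and orthogonality of the increments of \<open>B\<close> gives a Gronwall bound for its second
  moment that is uniform in \<open>K\<close>. The solution then has the mean-square expansion
  \<open>X(s + h) = X(s) + h (a X(s) + b X(q s)) + (\<sigma> X(s) + \<rho> X(q s)) (B(s + h) - B(s)) + remainder\<close>,
  so that \<open>E X(t)\<^sup>2\<close> obeys a differential inequality with delay. It is compared with
  \<open>exp (\<gamma> t + \<kappa> (1 - exp (- \<mu> t)))\<close>, \<open>\<gamma> = 2 a + \<sigma>\<^sup>2 > 0\<close>: the delayed second moment is smaller
  by the factor \<open>exp (- \<gamma> (1 - q) t)\<close>, hence absorbed by the bounded correction in the exponent.
  The maximal inequality on \<open>[n, n + 1]\<close> and the Borel-Cantelli lemma turn this into pathwise growth.

  For \<open>\<rho> = 0\<close> the second moment is too large by \<open>\<sigma>\<^sup>2 / 2\<close> in the exponent. With the geometric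
  Brownian motion \<open>G(r, t)\<close> started at time \<open>r\<close>, variation of constants reads
  \<open>X(t) = X\<^sub>0 G(0, t) + b \<integral>\<^bsub>0\<^esub>\<^bsup>t\<^esup> X(q r) G(r, t) dr\<close>. Since \<open>G(r, t)\<close> has mean
  \<open>exp (a (t - r))\<close> and is independent of \<open>X(q r)\<close>, the first moment satisfies a deterministic
  delayed Gronwall inequality. Almost every path satisfies one as well, because \<open>B(t) / t\<close> tends to
  \<open>0\<close> and so \<open>G(r, t)\<close> is at most a constant times \<open>exp (a (t - r) + \<delta> t)\<close> for every \<open>\<delta> > 0\<close>.
\<close>

section \<open>Square-integrable functions\<close>

text \<open>The stochastic integral is available only as a limit in probability of elementary
  integrals, so there is no Ito formula to appeal to. What survives an almost sure limit of Riemann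
  sums is an upper bound of the second moment (Fatou) and orthogonality to the past (weak
  convergence), and both are read off from finite sums. Since an increment over a step h has size
  \<open>sqrt h\<close>, these two facts alone give expansions whose errors, of order
  \<open>h * sqrt h\<close>, are negligible against h. The obstacle is circularity: no moment of the
  solution is assumed at positive times, whereas a Gronwall argument needs a finite bound to start
  from. Indicators of decreasing adapted events break it, because such an indicator can be put
  inside every summand without changing the sum on the final event, and it leaves each coefficient
  measurable with respect to its past. The factors in front of the exponentials depend only on q and
  the coefficients: along a delayed time the exponential loses a positive part of its rate, so the
  logarithmic derivative of the correction is integrable over the half-line. This is where
  positivity of the leading rate enters.\<close>

definition L2 :: "'a measure \<Rightarrow> ('a \<Rightarrow> real) set" where
  "L2 M = {f. f \<in> borel_measurable M \<and> integrable M (\<lambda>x. (f x)\<^sup>2)}"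

lemma L2_measurable: "f \<in> L2 M \<Longrightarrow> f \<in> borel_measurable M"
  by (simp add: L2_def)

lemma L2_integrable_square: "f \<in> L2 M \<Longrightarrow> integrable M (\<lambda>x. (f x)\<^sup>2)"
  by (simp add: L2_def)

lemma abs_mult_le_squares: "\<bar>x * y\<bar> \<le> x\<^sup>2 + (y::real)\<^sup>2"
proof -
  have "2 * \<bar>x\<bar> * \<bar>y\<bar> \<le> \<bar>x\<bar>\<^sup>2 + \<bar>y\<bar>\<^sup>2" by (rule sum_squares_bound)
  moreover have "0 \<le> \<bar>x\<bar> * \<bar>y\<bar>" by simp
  ultimately show ?thesis unfolding abs_mult power2_abs mult.assoc by linarith
qed

lemma weighted_AM_GM:
  fixes x y :: real
  assumes "0 < c"
  shows "2 * \<bar>x * y\<bar> \<le> c * x\<^sup>2 + y\<^sup>2 / c"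
proof -
  have "0 \<le> (sqrt c * \<bar>x\<bar> - \<bar>y\<bar> / sqrt c)\<^sup>2" by simp
  also have "\<dots> = c * x\<^sup>2 + y\<^sup>2 / c - 2 * \<bar>x * y\<bar>"
    using assms by (simp add: power2_diff power_mult_distrib power_divide abs_mult)
  finally show ?thesis by simp
qed

lemma L2_mult_integrable:
  assumes "f \<in> L2 M" "g \<in> L2 M"
  shows "integrable M (\<lambda>x. f x * g x)"
proof (rule Bochner_Integration.integrable_bound)
  show "integrable M (\<lambda>x. (f x)\<^sup>2 + (g x)\<^sup>2)"
    using assms by (simp add: L2_def)
  show "(\<lambda>x. f x * g x) \<in> borel_measurable M"
    using assms by (auto simp: L2_def intro: borel_measurable_times)
  show "AE x in M. norm (f x * g x) \<le> norm ((f x)\<^sup>2 + (g x)\<^sup>2)"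
    using abs_mult_le_squares by (auto intro!: AE_I2 order_trans[OF _ abs_ge_self])
qed

lemma L2_cmult: "f \<in> L2 M \<Longrightarrow> (\<lambda>x. c * f x) \<in> L2 M"
  by (auto simp: L2_def power_mult_distrib intro: borel_measurable_times)

lemma L2_add:
  assumes "f \<in> L2 M" "g \<in> L2 M" shows "(\<lambda>x. f x + g x) \<in> L2 M"
  using assms L2_mult_integrable[OF assms]
  by (auto simp: L2_def power2_sum mult.assoc)

lemma L2_diff:
  assumes "f \<in> L2 M" "g \<in> L2 M" shows "(\<lambda>x. f x - g x) \<in> L2 M"
  using L2_add[OF assms(1) L2_cmult[OF assms(2), of "-1"]] by simp

lemma L2_zero: "(\<lambda>x. 0) \<in> L2 M"
  by (simp add: L2_def)

lemma L2_sum: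
  assumes "\<And>i. i \<in> I \<Longrightarrow> f i \<in> L2 M" shows "(\<lambda>x. \<Sum>i\<in>I. f i x) \<in> L2 M"
  using assms by (induction I rule: infinite_finite_induct) (auto simp: L2_zero L2_add)

lemma L2_abs: "f \<in> L2 M \<Longrightarrow> (\<lambda>x. \<bar>f x\<bar>) \<in> L2 M"
  by (auto simp: L2_def intro: borel_measurable_abs)

lemma L2_bound:
  assumes "g \<in> L2 M" "f \<in> borel_measurable M" "AE x in M. \<bar>f x\<bar> \<le> \<bar>g x\<bar>"
  shows "f \<in> L2 M"
proof -
  have "integrable M (\<lambda>x. (f x)\<^sup>2)"
  proof (rule Bochner_Integration.integrable_bound)
    show "integrable M (\<lambda>x. (g x)\<^sup>2)" using assms(1) by (simp add: L2_def)
    show "(\<lambda>x. (f x)\<^sup>2) \<in> borel_measurable M" using assms(2) by simp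
    show "AE x in M. norm ((f x)\<^sup>2) \<le> norm ((g x)\<^sup>2)"
      using assms(3) by eventually_elim (simp add: abs_le_square_iff)
  qed
  then show ?thesis using assms(2) by (simp add: L2_def)
qed

lemma L2_indicator:
  assumes "f \<in> L2 M" "A \<in> sets M" shows "(\<lambda>x. f x * indicator A x) \<in> L2 M"
  by (rule L2_bound[OF assms(1)])
    (use assms L2_measurable[OF assms(1)] in \<open>auto simp: abs_mult indicator_def\<close>)

lemma (in finite_measure) L2_const: "(\<lambda>x. c) \<in> L2 M"
  by (simp add: L2_def)

lemma (in finite_measure) L2_integrable: "f \<in> L2 M \<Longrightarrow> integrable M f"
  using L2_mult_integrable[OF _ L2_const[of 1], of f] by simp

lemma L2_product_bound:
  assumes "f \<in> L2 M" "g \<in> L2 M" "0 < c"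
  shows "2 * (\<integral>x. \<bar>f x * g x\<bar> \<partial>M) \<le> c * (\<integral>x. (f x)\<^sup>2 \<partial>M) + (\<integral>x. (g x)\<^sup>2 \<partial>M) / c"
proof -
  have "(\<integral>x. 2 * \<bar>f x * g x\<bar> \<partial>M) \<le> (\<integral>x. c * (f x)\<^sup>2 + (g x)\<^sup>2 / c \<partial>M)"
    using assms L2_mult_integrable[OF assms(1,2)]
    by (intro integral_mono) (auto simp: L2_def weighted_AM_GM)
  then show ?thesis using assms by (simp add: L2_def)
qed

text \<open>A weighted substitute for Cauchy-Schwarz. The weight is chosen at each use, for example
  as \<open>sqrt h\<close>, as \<open>h * sqrt h\<close> or as an exponential delay factor, so that
  two factors of different order of magnitude contribute equally.\<close>

lemma L2_abs_product_bound:
  assumes "f \<in> L2 M" "g \<in> L2 M" "0 < c"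
  shows "2 * \<bar>\<integral>x. f x * g x \<partial>M\<bar> \<le> c * (\<integral>x. (f x)\<^sup>2 \<partial>M) + (\<integral>x. (g x)\<^sup>2 \<partial>M) / c"
proof -
  have "\<bar>\<integral>x. f x * g x \<partial>M\<bar> \<le> (\<integral>x. \<bar>f x * g x\<bar> \<partial>M)"
    by (rule integral_abs_bound)
  then show ?thesis using L2_product_bound[OF assms] by linarith
qed

lemma sum_power2_le: "((x::real) + y)\<^sup>2 \<le> 2 * x\<^sup>2 + 2 * y\<^sup>2"
  using sum_squares_bound[of x y] by (simp add: power2_sum)

lemma L2_add_bound:
  assumes "f \<in> L2 M" "g \<in> L2 M"
  shows "(\<integral>x. (f x + g x)\<^sup>2 \<partial>M) \<le> 2 * (\<integral>x. (f x)\<^sup>2 \<partial>M) + 2 * (\<integral>x. (g x)\<^sup>2 \<partial>M)"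
proof -
  have "(\<integral>x. (f x + g x)\<^sup>2 \<partial>M) \<le> (\<integral>x. 2 * (f x)\<^sup>2 + 2 * (g x)\<^sup>2 \<partial>M)"
    using assms L2_add[OF assms] by (intro integral_mono) (auto simp: L2_def sum_power2_le)
  then show ?thesis using assms by (simp add: L2_def)
qed

lemma L2_diff_bound:
  assumes "f \<in> L2 M" "g \<in> L2 M"
  shows "(\<integral>x. (f x - g x)\<^sup>2 \<partial>M) \<le> 2 * (\<integral>x. (f x)\<^sup>2 \<partial>M) + 2 * (\<integral>x. (g x)\<^sup>2 \<partial>M)"
  using L2_add_bound[OF assms(1) L2_cmult[OF assms(2), of "-1"]] by simp

lemma L2_square_add:
  assumes "f \<in> L2 M" "g \<in> L2 M"
  shows "(\<integral>x. (f x + g x)\<^sup>2 \<partial>M) =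
    (\<integral>x. (f x)\<^sup>2 \<partial>M) + 2 * (\<integral>x. f x * g x \<partial>M) + (\<integral>x. (g x)\<^sup>2 \<partial>M)"
  using assms L2_mult_integrable[OF assms]
  by (simp add: power2_sum mult.assoc L2_def)

text \<open>Cauchy-Schwarz with each weight split as \<open>sqrt (w i) * sqrt (w i)\<close>. With
  the step lengths as weights it is the discrete form of bounding the square of a time integral by
  the length times the integral of the square.\<close>

lemma square_sum_le_weighted:
  fixes f w :: "nat \<Rightarrow> real"
  assumes "\<And>i. i < n \<Longrightarrow> 0 \<le> w i"
  shows "(\<Sum>i<n. f i * w i)\<^sup>2 \<le> (\<Sum>i<n. w i) * (\<Sum>i<n. (f i)\<^sup>2 * w i)"
proof -
  have "(\<Sum>i<n. (f i * sqrt (w i)) * sqrt (w i))\<^sup>2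
      \<le> (\<Sum>i<n. (f i * sqrt (w i))\<^sup>2) * (\<Sum>i<n. (sqrt (w i))\<^sup>2)"
    by (rule Cauchy_Schwarz_ineq_sum)
  moreover have "(\<Sum>i<n. (f i * sqrt (w i)) * sqrt (w i)) = (\<Sum>i<n. f i * w i)"
    using assms by (intro sum.cong) auto
  moreover have "(\<Sum>i<n. (f i * sqrt (w i))\<^sup>2) = (\<Sum>i<n. (f i)\<^sup>2 * w i)"
    using assms by (intro sum.cong) (auto simp: power_mult_distrib)
  moreover have "(\<Sum>i<n. (sqrt (w i))\<^sup>2) = (\<Sum>i<n. w i)"
    using assms by (intro sum.cong) auto
  ultimately show ?thesis by (simp add: mult.commute)
qed

lemma L2_weighted_sum_bound:
  fixes w :: "nat \<Rightarrow> real"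
  assumes "\<And>i. i < n \<Longrightarrow> 0 \<le> w i" "\<And>i. i < n \<Longrightarrow> f i \<in> L2 M"
  shows "(\<integral>x. (\<Sum>i<n. f i x * w i)\<^sup>2 \<partial>M)
    \<le> (\<Sum>i<n. w i) * (\<Sum>i<n. (\<integral>x. (f i x)\<^sup>2 \<partial>M) * w i)"
proof -
  have 1: "(\<lambda>x. \<Sum>i<n. f i x * w i) \<in> L2 M"
    using assms(2) by (intro L2_sum) (auto simp: mult.commute[of _ "w _"] intro: L2_cmult)
  have "(\<integral>x. (\<Sum>i<n. f i x * w i)\<^sup>2 \<partial>M) \<le> (\<integral>x. (\<Sum>i<n. w i) * (\<Sum>i<n. (f i x)\<^sup>2 * w i) \<partial>M)"
    using assms(2) 1
    by (intro integral_mono square_sum_le_weighted assms(1)) (auto simp: L2_def)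
  also have "\<dots> = (\<Sum>i<n. w i) * (\<Sum>i<n. (\<integral>x. (f i x)\<^sup>2 \<partial>M) * w i)"
    using assms(2) by (subst Bochner_Integration.integral_mult_right_zero, subst Bochner_Integration.integral_sum) (auto simp: L2_def)
  finally show ?thesis .
qed

text \<open>Only the inequality of Fatou's lemma is used, so almost sure convergence of Riemann sums
  is enough and convergence in mean square does not have to be established. Second-moment bounds for
  pathwise and stochastic integrals come from here.\<close>

lemma L2_Fatou:
  assumes S: "\<And>m. S m \<in> L2 M" and J [measurable]: "J \<in> borel_measurable M"
    and lim: "AE x in M. (\<lambda>m. S m x) \<longlonglongrightarrow> J x"
    and bound: "\<And>m. (\<integral>x. (S m x)\<^sup>2 \<partial>M) \<le> K"
  shows "J \<in> L2 M" "(\<integral>x. (J x)\<^sup>2 \<partial>M) \<le> K"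
proof -
  have [measurable]: "S m \<in> borel_measurable M" for m using S by (simp add: L2_def)
  have K: "0 \<le> K" by (rule order_trans[OF _ bound]) simp
  have "(\<integral>\<^sup>+x. ennreal ((J x)\<^sup>2) \<partial>M) = (\<integral>\<^sup>+x. liminf (\<lambda>m. ennreal ((S m x)\<^sup>2)) \<partial>M)"
  proof (rule nn_integral_cong_AE)
    show "AE x in M. ennreal ((J x)\<^sup>2) = liminf (\<lambda>m. ennreal ((S m x)\<^sup>2))"
      using lim
    proof eventually_elim
      case (elim x)
      then have "(\<lambda>m. ennreal ((S m x)\<^sup>2)) \<longlonglongrightarrow> ennreal ((J x)\<^sup>2)"
        by (intro tendsto_ennrealI tendsto_intros)
      then show ?case by (metis lim_imp_Liminf trivial_limit_sequentially)
    qed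
  qed
  also have "\<dots> \<le> liminf (\<lambda>m. \<integral>\<^sup>+x. ennreal ((S m x)\<^sup>2) \<partial>M)"
    by (rule nn_integral_liminf) simp
  also have "\<dots> \<le> ennreal K"
    using S bound
    by (intro Liminf_le always_eventually allI) (auto simp: L2_def nn_integral_eq_integral intro!: ennreal_leI)
  finally have *: "(\<integral>\<^sup>+x. ennreal ((J x)\<^sup>2) \<partial>M) \<le> ennreal K" .
  then have "integrable M (\<lambda>x. (J x)\<^sup>2)"
    by (intro integrableI_nonneg) (auto simp: less_top[symmetric] top_unique intro: le_less_trans)
  then show "J \<in> L2 M" by (simp add: L2_def)
  show "(\<integral>x. (J x)\<^sup>2 \<partial>M) \<le> K"
    using * K by (intro integral_real_bounded)
qed

text \<open>Convergence almost everywhere together with boundedness in mean square gives weak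
  convergence: \<open>\<bar>\<xi> D\<bar> \<le> \<epsilon> \<bar>\<xi>\<bar> + \<theta> D\<^sup>2 + \<xi>\<^sup>2 1{\<bar>D\<bar> > \<epsilon>} / \<theta>\<close>, and the last
  term vanishes by dominated convergence.\<close>

lemma (in finite_measure) L2_weak_limit:
  assumes S: "\<And>m. S m \<in> L2 M" and J: "J \<in> L2 M" and \<xi>: "\<xi> \<in> L2 M"
    and lim: "AE x in M. (\<lambda>m. S m x) \<longlonglongrightarrow> J x"
    and bound: "\<And>m. (\<integral>x. (S m x)\<^sup>2 \<partial>M) \<le> K"
  shows "(\<lambda>m. \<integral>x. \<xi> x * S m x \<partial>M) \<longlonglongrightarrow> (\<integral>x. \<xi> x * J x \<partial>M)"
proof -
  have [measurable]: "S m \<in> borel_measurable M" "J \<in> borel_measurable M" "\<xi> \<in> borel_measurable M" for m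
    using S J \<xi> by (auto simp: L2_def)
  define D where "D m x = S m x - J x" for m x
  have D: "D m \<in> L2 M" for m unfolding D_def by (intro L2_diff S J)
  have [measurable]: "D m \<in> borel_measurable M" for m using D by (simp add: L2_def)
  define C where "C = 2 * K + 2 * (\<integral>x. (J x)\<^sup>2 \<partial>M)"
  have "0 \<le> K" by (rule order_trans[OF _ bound]) simp
  then have C: "0 \<le> C" unfolding C_def by simp
  have DC: "(\<integral>x. (D m x)\<^sup>2 \<partial>M) \<le> C" for m
    using L2_diff_bound[OF S J, of m] bound[of m] by (simp add: C_def D_def)
  have i\<xi>: "integrable M (\<lambda>x. \<bar>\<xi> x\<bar>)" using L2_integrable[OF \<xi>] by simp
  have i\<xi>2: "integrable M (\<lambda>x. (\<xi> x)\<^sup>2)" using \<xi> by (simp add: L2_def)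
  have main: "eventually (\<lambda>m. \<bar>\<integral>x. \<xi> x * D m x \<partial>M\<bar> < e) sequentially" if e: "0 < e" for e
  proof -
    \<comment> \<open>The summand 1 here and in \<open>\<epsilon>\<close> keeps the quotients
      meaningful when \<open>C\<close> or the mean of \<open>\<bar>\<xi> x\<bar>\<close> is 0; each
      of the three terms then stays below \<open>e / 3\<close>.\<close>
    define \<theta> where "\<theta> = e / (3 * (C + 1))"
    have \<theta>: "0 < \<theta>" "\<theta> * C < e / 3" using e C by (auto simp: \<theta>_def field_simps)
    define \<epsilon> where "\<epsilon> = e / (3 * ((\<integral>x. \<bar>\<xi> x\<bar> \<partial>M) + 1))"
    have \<xi>0: "0 \<le> (\<integral>x. \<bar>\<xi> x\<bar> \<partial>M)" by simp
    have \<epsilon>: "0 < \<epsilon>" "\<epsilon> * (\<integral>x. \<bar>\<xi> x\<bar> \<partial>M) < e / 3"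
      using e \<xi>0 by (auto simp: \<epsilon>_def field_simps add_pos_nonneg)
    let ?I = "\<lambda>m x. (\<xi> x)\<^sup>2 * indicator {x. \<bar>D m x\<bar> > \<epsilon>} x :: real"
    have meas: "?I m \<in> borel_measurable M" for m
    proof -
      have "(\<lambda>x. (\<xi> x)\<^sup>2 * (if \<bar>D m x\<bar> > \<epsilon> then 1 else 0)) \<in> borel_measurable M"
        by measurable
      then show ?thesis by (simp add: indicator_def of_bool_def)
    qed
    have limI: "(\<lambda>m. \<integral>x. ?I m x \<partial>M) \<longlonglongrightarrow> (\<integral>x. 0 \<partial>M)"
    proof (rule integral_dominated_convergence[where w="\<lambda>x. (\<xi> x)\<^sup>2"])
      show "AE x in M. (\<lambda>m. ?I m x) \<longlonglongrightarrow> 0"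
        using lim
      proof eventually_elim
        case (elim x)
        then have "(\<lambda>m. D m x) \<longlonglongrightarrow> 0" unfolding D_def by (simp add: LIM_zero)
        then have "eventually (\<lambda>m. \<bar>D m x\<bar> < \<epsilon>) sequentially"
          using \<epsilon>(1) by (auto simp: tendsto_iff)
        then have "eventually (\<lambda>m. ?I m x = 0) sequentially"
          by eventually_elim auto
        then show ?case by (rule tendsto_eventually)
      qed
    qed (auto simp: i\<xi>2 meas indicator_def)
    have intI: "integrable M (?I m)" for m
      by (rule Bochner_Integration.integrable_bound[OF i\<xi>2 meas]) (auto simp: indicator_def)
    have "0 < \<theta> * e / 3" using e \<theta>(1) by simp
    with limI have "eventually (\<lambda>m. dist (\<integral>x. ?I m x \<partial>M) (\<integral>x. 0 \<partial>M) < \<theta> * e / 3) sequentially"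
      by (rule tendstoD)
    then have "eventually (\<lambda>m. \<bar>\<integral>x. ?I m x \<partial>M\<bar> < \<theta> * e / 3) sequentially"
      by (simp only: integral_zero dist_real_def diff_zero)
    then show ?thesis
    proof eventually_elim
      case (elim m)
      have "\<bar>\<xi> x * D m x\<bar> \<le> \<epsilon> * \<bar>\<xi> x\<bar> + \<theta> * (D m x)\<^sup>2 + ?I m x / \<theta>" for x
      proof (cases "\<bar>D m x\<bar> > \<epsilon>")
        case True
        have "2 * \<bar>D m x * \<xi> x\<bar> \<le> \<theta> * (D m x)\<^sup>2 + (\<xi> x)\<^sup>2 / \<theta>"
          by (rule weighted_AM_GM[OF \<theta>(1)])
        then have "\<bar>\<xi> x * D m x\<bar> \<le> \<theta> * (D m x)\<^sup>2 + (\<xi> x)\<^sup>2 / \<theta>"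
          by (simp add: mult.commute)
        moreover have "0 \<le> \<epsilon> * \<bar>\<xi> x\<bar>" using \<epsilon> by simp
        ultimately show ?thesis using True by (simp add: indicator_def)
      next
        case False
        then have "\<bar>\<xi> x\<bar> * \<bar>D m x\<bar> \<le> \<bar>\<xi> x\<bar> * \<epsilon>" by (intro mult_left_mono) auto
        moreover have "0 \<le> \<theta> * (D m x)\<^sup>2" using \<theta> by simp
        ultimately show ?thesis using False by (simp add: indicator_def abs_mult mult.commute)
      qed
      then have "(\<integral>x. \<bar>\<xi> x * D m x\<bar> \<partial>M) \<le> (\<integral>x. \<epsilon> * \<bar>\<xi> x\<bar> + \<theta> * (D m x)\<^sup>2 + ?I m x / \<theta> \<partial>M)"
        using D[of m] i\<xi> intI L2_mult_integrable[OF \<xi> D, of m]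
        by (intro integral_mono) (auto simp: L2_def)
      also have "\<dots> = \<epsilon> * (\<integral>x. \<bar>\<xi> x\<bar> \<partial>M) + \<theta> * (\<integral>x. (D m x)\<^sup>2 \<partial>M) + (\<integral>x. ?I m x \<partial>M) / \<theta>"
        using D[of m] i\<xi> intI by (simp add: L2_def)
      also have "\<dots> < e / 3 + e / 3 + e / 3"
      proof -
        have "(\<integral>x. ?I m x \<partial>M) / \<theta> < e / 3"
          using elim \<theta>(1) by (simp add: pos_divide_less_eq abs_less_iff mult.commute)
        moreover have "\<theta> * (\<integral>x. (D m x)\<^sup>2 \<partial>M) \<le> \<theta> * C"
          using DC[of m] \<theta>(1) by simp
        ultimately show ?thesis using \<epsilon>(2) \<theta>(2) by linarith
      qed
      finally show ?case
        using integral_abs_bound[of M "\<lambda>x. \<xi> x * D m x"] by linarith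
    qed
  qed
  have "(\<lambda>m. \<integral>x. \<xi> x * D m x \<partial>M) \<longlonglongrightarrow> 0"
    using main by (auto simp: tendsto_iff)
  moreover have "(\<integral>x. \<xi> x * D m x \<partial>M) = (\<integral>x. \<xi> x * S m x \<partial>M) - (\<integral>x. \<xi> x * J x \<partial>M)" for m
    using L2_mult_integrable[OF \<xi> S, of m] L2_mult_integrable[OF \<xi> J]
    by (simp add: D_def right_diff_distrib)
  ultimately show ?thesis by (simp add: LIM_zero_iff)
qed

section \<open>Deterministic estimates\<close>

text \<open>If \<open>u\<close> exceeds \<open>A * g\<close> by at most \<open>\<theta> * g\<close>,
  one application of \<open>step\<close> lowers the excess to \<open>\<theta> * (g - 1)\<close>, and
  \<open>g - 1 \<le> (1 - 1 / G) * g\<close> makes this a contraction. The iteration starts from any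
  finite bound \<open>\<beta>\<close>, whose size disappears in the limit. Only boundedness of
  \<open>u\<close> enters, so the lemma applies to moments before their continuity is known.\<close>

lemma Gronwall_contraction:
  fixes u g :: "real \<Rightarrow> real"
  assumes A: "0 \<le> A" and g1: "\<And>t. t \<in> S \<Longrightarrow> 1 \<le> g t" and gG: "\<And>t. t \<in> S \<Longrightarrow> g t \<le> G"
    and bd: "\<And>t. t \<in> S \<Longrightarrow> u t \<le> \<beta>"
    and step: "\<And>\<theta> t. 0 \<le> \<theta> \<Longrightarrow> (\<And>t. t \<in> S \<Longrightarrow> u t \<le> (A + \<theta>) * g t) \<Longrightarrow> t \<in> S \<Longrightarrow>
      u t \<le> A + (A + \<theta>) * (g t - 1)"
    and t: "t \<in> S"
  shows "u t \<le> A * g t"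
proof -
  have G: "1 \<le> G" using g1[OF t] gG[OF t] by linarith
  define r where "r = 1 - 1 / G"
  have r: "0 \<le> r" "r < 1" using G by (auto simp: r_def)
  define \<beta>' where "\<beta>' = max \<beta> 0"
  have iter: "\<forall>t\<in>S. u t \<le> (A + \<beta>' * r ^ n) * g t" for n
  proof (induction n)
    case 0
    show ?case
    proof
      fix t assume t: "t \<in> S"
      have "u t \<le> \<beta>' * 1" using bd[OF t] by (simp add: \<beta>'_def)
      also have "\<dots> \<le> (A + \<beta>') * g t" using A g1[OF t] by (intro mult_mono) (auto simp: \<beta>'_def)
      finally show "u t \<le> (A + \<beta>' * r ^ 0) * g t" by simp
    qed
  next
    case (Suc n)
    show ?case
    proof
      fix t assume t: "t \<in> S"
      define \<theta> where "\<theta> = \<beta>' * r ^ n"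
      have \<theta>: "0 \<le> \<theta>" using r by (simp add: \<theta>_def \<beta>'_def)
      have "u t \<le> A + (A + \<theta>) * (g t - 1)"
        by (rule step[OF \<theta> _ t]) (use Suc in \<open>auto simp: \<theta>_def\<close>)
      also have "\<dots> = A * g t + \<theta> * (g t - 1)" by (simp add: algebra_simps)
      also have "\<dots> \<le> A * g t + \<theta> * (r * g t)"
      proof -
        have "1 \<le> G" by (rule G)
        then have "g t - 1 \<le> r * g t" using gG[OF t] by (simp add: r_def field_simps)
        then show ?thesis using \<theta> by (simp add: mult_left_mono)
      qed
      also have "\<dots> = (A + \<beta>' * r ^ Suc n) * g t" by (simp add: \<theta>_def algebra_simps)
      finally show "u t \<le> (A + \<beta>' * r ^ Suc n) * g t" .
    qed
  qed
  have "(\<lambda>n. (A + \<beta>' * r ^ n) * g t) \<longlonglongrightarrow> (A + \<beta>' * 0) * g t"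
    using r by (intro tendsto_intros LIMSEQ_power_zero) auto
  then show ?thesis
    using iter t by (intro LIMSEQ_le_const[where X="\<lambda>n. (A + \<beta>' * r ^ n) * g t"]) auto
qed

text \<open>The nodes form a monotone sequence on all natural numbers, of which the first
  \<open>N m\<close> steps count. The explicit mesh bound, in place of mere convergence of the mesh
  to 0, passes to subsequences whose j-th index is at least j.\<close>

definition fine_partitions :: "real \<Rightarrow> real \<Rightarrow> (nat \<Rightarrow> nat) \<Rightarrow> (nat \<Rightarrow> nat \<Rightarrow> real) \<Rightarrow> bool" where
  "fine_partitions s t N u \<longleftrightarrow> (\<forall>m. mono (u m) \<and> u m 0 = s \<and> u m (N m) = t \<and>
     (\<forall>i<N m. u m (Suc i) - u m i \<le> (t - s) / Suc m))"

lemma fine_partitionsD: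
  assumes "fine_partitions s t N u"
  shows "mono (u m)" "u m 0 = s" "u m (N m) = t"
    "i < N m \<Longrightarrow> u m (Suc i) - u m i \<le> (t - s) / Suc m"
    "s \<le> u m i" "i \<le> N m \<Longrightarrow> u m i \<le> t" "u m i \<le> u m (Suc i)"
    "(\<Sum>i<N m. u m (Suc i) - u m i) = t - s"
proof -
  show *: "mono (u m)" "u m 0 = s" "u m (N m) = t"
    "i < N m \<Longrightarrow> u m (Suc i) - u m i \<le> (t - s) / Suc m"
    using assms by (auto simp: fine_partitions_def)
  show "s \<le> u m i" "i \<le> N m \<Longrightarrow> u m i \<le> t" "u m i \<le> u m (Suc i)"
    using monoD[OF *(1), of 0 i] monoD[OF *(1), of i "N m"] monoD[OF *(1), of i "Suc i"] * by auto
  show "(\<Sum>i<N m. u m (Suc i) - u m i) = t - s"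
    using * by (simp add: sum_lessThan_telescope)
qed

lemma integral_telescope:
  fixes f :: "real \<Rightarrow> real" and v :: "nat \<Rightarrow> real"
  assumes v: "mono v" and f: "f integrable_on {v 0..v n}"
  shows "(\<Sum>i<n. integral {v i..v (Suc i)} f) = integral {v 0..v n} f"
  using f
proof (induction n)
  case (Suc n)
  have le: "v 0 \<le> v n" "v n \<le> v (Suc n)" using v by (auto simp: mono_def)
  have "f integrable_on {v 0..v n}"
    by (rule integrable_on_subinterval[OF Suc.prems]) (use le in auto)
  then have "(\<Sum>i<Suc n. integral {v i..v (Suc i)} f)
      = integral {v 0..v n} f + integral {v n..v (Suc n)} f"
    using Suc.IH by simp
  also have "\<dots> = integral {v 0..v (Suc n)} f"
    by (rule Henstock_Kurzweil_Integration.integral_combine[OF le Suc.prems])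
  finally show ?case .
qed simp

lemma Riemann_sums_tendsto:
  fixes f :: "real \<Rightarrow> real"
  assumes f: "continuous_on {s..t} f" and P: "fine_partitions s t N u"
  shows "(\<lambda>m. \<Sum>i<N m. f (u m i) * (u m (Suc i) - u m i)) \<longlonglongrightarrow> integral {s..t} f"
proof (rule LIMSEQ_I)
  fix e :: real assume e: "0 < e"
  note P = fine_partitionsD[OF P]
  have st: "s \<le> t" using P(1-3)[of 0] by (metis monoD le0)
  \<comment> \<open>The added 1 covers the degenerate interval \<open>s = t\<close>.\<close>
  define e' where "e' = e / (2 * (t - s + 1))"
  have e': "0 < e'" "e' * (t - s) < e"
  proof -
    show "0 < e'" using e st by (simp add: e'_def)
    have "e' * (t - s) \<le> e' * (t - s + 1)" using \<open>0 < e'\<close> by simp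
    also have "\<dots> = e / 2" using st by (simp add: e'_def divide_simps)
    finally show "e' * (t - s) < e" using e by simp
  qed
  have "uniformly_continuous_on {s..t} f"
    using f by (simp add: compact_uniformly_continuous)
  then obtain d where d: "0 < d"
    "\<And>x y. x \<in> {s..t} \<Longrightarrow> y \<in> {s..t} \<Longrightarrow> dist y x < d \<Longrightarrow> dist (f y) (f x) < e'"
    unfolding uniformly_continuous_on_def using e' by metis
  have "(\<lambda>m. (t - s) / real (Suc m)) \<longlonglongrightarrow> 0"
    using tendsto_mult_left[OF LIMSEQ_inverse_real_of_nat, of "t - s"] by (simp add: divide_inverse)
  then have "eventually (\<lambda>m. (t - s) / real (Suc m) < d) sequentially"
    using d(1) by (rule order_tendstoD)
  then obtain m0 where m0: "\<And>m. m \<ge> m0 \<Longrightarrow> (t - s) / real (Suc m) < d"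
    unfolding eventually_sequentially by blast
  have fi: "f integrable_on {s..t}" using f by (rule integrable_continuous_interval)
  show "\<exists>no. \<forall>n\<ge>no. norm ((\<Sum>i<N n. f (u n i) * (u n (Suc i) - u n i)) - integral {s..t} f) < e"
  proof (intro exI allI impI)
    fix m assume m: "m0 \<le> m"
    have piece: "\<bar>f (u m i) * (u m (Suc i) - u m i) - integral {u m i..u m (Suc i)} f\<bar>
        \<le> e' * (u m (Suc i) - u m i)" if i: "i < N m" for i
    proof -
      have le: "u m i \<le> u m (Suc i)" "s \<le> u m i" "u m (Suc i) \<le> t"
        using P(5,7)[of m i] P(6)[of "Suc i" m] i by auto
      have fi': "f integrable_on {u m i..u m (Suc i)}"
        by (rule integrable_on_subinterval[OF fi]) (use le in auto)
      have "norm (integral {u m i..u m (Suc i)} (\<lambda>r. f (u m i) - f r)) \<le> e' * (u m (Suc i) - u m i)"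
      proof (rule integral_bound[OF le(1)])
        show "continuous_on {u m i..u m (Suc i)} (\<lambda>r. f (u m i) - f r)"
          using le by (intro continuous_intros continuous_on_subset[OF f]) auto
        fix r assume r: "r \<in> {u m i..u m (Suc i)}"
        have "dist (f (u m i)) (f r) < e'"
          using r le P(4)[OF i] m0[OF m] by (intro d(2)) (auto simp: dist_real_def)
        then show "norm (f (u m i) - f r) \<le> e'" by (simp add: dist_real_def)
      qed
      moreover have "integral {u m i..u m (Suc i)} (\<lambda>r. f (u m i) - f r)
          = f (u m i) * (u m (Suc i) - u m i) - integral {u m i..u m (Suc i)} f"
        using fi' le(1) by (subst Henstock_Kurzweil_Integration.integral_diff) (auto simp: mult.commute)
      ultimately show ?thesis by simp
    qed
    have "integral {s..t} f = (\<Sum>i<N m. integral {u m i..u m (Suc i)} f)"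
      using integral_telescope[OF P(1), of f m "N m"] fi P(2,3) by simp
    then have "\<bar>(\<Sum>i<N m. f (u m i) * (u m (Suc i) - u m i)) - integral {s..t} f\<bar>
        = \<bar>\<Sum>i<N m. f (u m i) * (u m (Suc i) - u m i) - integral {u m i..u m (Suc i)} f\<bar>"
      by (simp add: sum_subtractf)
    also have "\<dots> \<le> (\<Sum>i<N m. e' * (u m (Suc i) - u m i))"
      by (rule order_trans[OF sum_abs sum_mono]) (use piece in auto)
    also have "\<dots> = e' * (t - s)" using P(8) by (simp add: sum_distrib_left[symmetric])
    finally show "norm ((\<Sum>i<N m. f (u m i) * (u m (Suc i) - u m i)) - integral {s..t} f) < e"
      using e' by simp
  qed
qed

section \<open>Brownian motion relative to a filtration\<close>

text \<open>Independence from the past is assumed on events only, the form that an argument on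
  generating pi-systems delivers for the completed filtration; the product rule for expectations is
  derived in \<open>increment_product\<close>.\<close>

locale brownian_filtration = prob_space M for M :: "'a measure" +
  fixes F :: "real \<Rightarrow> 'a measure" and B :: "real \<Rightarrow> 'a \<Rightarrow> real"
  assumes F_space: "space (F t) = space M"
    and F_sets: "sets (F t) \<subseteq> sets M"
    and F_mono: "s \<le> t \<Longrightarrow> sets (F s) \<subseteq> sets (F t)"
    and B_adapted: "0 \<le> t \<Longrightarrow> B t \<in> borel_measurable (F t)"
    and B_normal: "0 \<le> s \<Longrightarrow> s < t \<Longrightarrow> distributed M lborel (\<lambda>\<omega>. B t \<omega> - B s \<omega>)
          (\<lambda>x. ennreal (normal_density 0 (sqrt (t - s)) x))"
    and F_indep: "0 \<le> s \<Longrightarrow> s < t \<Longrightarrow> A \<in> sets (F s) \<Longrightarrow> C \<in> sets borel \<Longrightarrow>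
        prob (A \<inter> ((\<lambda>\<omega>. B t \<omega> - B s \<omega>) -` C \<inter> space M))
          = prob A * prob ((\<lambda>\<omega>. B t \<omega> - B s \<omega>) -` C \<inter> space M)"
    and B_zero: "AE \<omega> in M. B 0 \<omega> = 0"
    and B_continuous: "AE \<omega> in M. continuous_on {0..} (\<lambda>t. B t \<omega>)"

text \<open>Completing the square: the exponential tilt moves the mean of the normal law from 0 to
  \<open>c * s\<^sup>2\<close>. Exponential moments of an increment thereby reduce to the total mass
  and the mean of a shifted normal density.\<close>

lemma normal_density_exp_shift:
  assumes "0 < s"
  shows "normal_density 0 s x * exp (c * x) = exp (c\<^sup>2 * s\<^sup>2 / 2) * normal_density (c * s\<^sup>2) s x"
proof -
  have "- (x - 0)\<^sup>2 / (2 * s\<^sup>2) + c * x = c\<^sup>2 * s\<^sup>2 / 2 + - (x - c * s\<^sup>2)\<^sup>2 / (2 * s\<^sup>2)"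
    using assms by (simp add: field_simps power2_eq_square)
  then have "exp (- (x - 0)\<^sup>2 / (2 * s\<^sup>2)) * exp (c * x)
      = exp (c\<^sup>2 * s\<^sup>2 / 2) * exp (- (x - c * s\<^sup>2)\<^sup>2 / (2 * s\<^sup>2))"
    by (simp only: exp_add[symmetric])
  then show ?thesis by (simp add: normal_density_def)
qed

context brownian_filtration
begin

lemma F_measurable_M: "(f :: 'a \<Rightarrow> real) \<in> borel_measurable (F t) \<Longrightarrow> f \<in> borel_measurable M"
  using F_sets[of t] F_space[of t] by (auto simp: measurable_def)

lemma F_measurable_mono: "(f :: 'a \<Rightarrow> real) \<in> borel_measurable (F s) \<Longrightarrow> s \<le> t \<Longrightarrow> f \<in> borel_measurable (F t)"
  using F_mono[of s t] F_space by (auto simp: measurable_def)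

lemma B_measurable: "0 \<le> t \<Longrightarrow> B t \<in> borel_measurable M"
  using B_adapted F_measurable_M by blast

abbreviation dB :: "real \<Rightarrow> real \<Rightarrow> 'a \<Rightarrow> real" where
  "dB s t \<omega> \<equiv> B t \<omega> - B s \<omega>"

lemma dB_measurable: "0 \<le> s \<Longrightarrow> s \<le> t \<Longrightarrow> dB s t \<in> borel_measurable (F t)"
  using B_adapted[of t] F_measurable_mono[OF B_adapted, of s t] by (intro borel_measurable_diff) auto

lemma dB_measurable_M: "0 \<le> s \<Longrightarrow> s \<le> t \<Longrightarrow> dB s t \<in> borel_measurable M"
  using dB_measurable F_measurable_M by blast

text \<open>Independence on events is lifted to the generated sigma-algebras, hence to
  \<open>\<xi>\<close> paired with \<open>g\<close> of the increment. A general \<open>g\<close>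
  serves the increment itself, its square and its exponential alike.\<close>

lemma increment_product:
  fixes \<xi> :: "'a \<Rightarrow> real" and g :: "real \<Rightarrow> real"
  assumes s: "0 \<le> s" "s \<le> t" and \<xi>: "\<xi> \<in> borel_measurable (F s)" "integrable M \<xi>"
    and g [measurable]: "g \<in> borel_measurable borel" and ig: "integrable M (\<lambda>\<omega>. g (dB s t \<omega>))"
  shows "integrable M (\<lambda>\<omega>. \<xi> \<omega> * g (dB s t \<omega>))"
    and "(\<integral>\<omega>. \<xi> \<omega> * g (dB s t \<omega>) \<partial>M) = (\<integral>\<omega>. \<xi> \<omega> \<partial>M) * (\<integral>\<omega>. g (dB s t \<omega>) \<partial>M)"
proof -
  have "integrable M (\<lambda>\<omega>. \<xi> \<omega> * g (dB s t \<omega>)) \<and>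
    (\<integral>\<omega>. \<xi> \<omega> * g (dB s t \<omega>) \<partial>M) = (\<integral>\<omega>. \<xi> \<omega> \<partial>M) * (\<integral>\<omega>. g (dB s t \<omega>) \<partial>M)"
  \<comment> \<open>For \<open>s = t\<close> the increment is 0, and neither the normal law nor the
    independence assumption, which require \<open>s < t\<close>, is available.\<close>
  proof (cases "s = t")
    case True
    have "integrable M (\<lambda>\<omega>. \<xi> \<omega> * g 0)" by (intro Bochner_Integration.integrable_mult_left \<xi>(2))
    then show ?thesis using True by (simp add: prob_space)
  next
    case False
    then have st: "s < t" using s by simp
    have m: "dB s t \<in> borel_measurable M" using dB_measurable_M s by simp
    let ?D = "{(\<lambda>\<omega>. dB s t \<omega>) -` C \<inter> space M | C. C \<in> sets borel}"
    have "indep_set (sets (F s)) ?D"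
      using F_sets m F_indep[OF s(1) st] by (intro indep_setI) (auto simp: measurable_def)
    moreover have "Int_stable (sets (F s))" by (auto simp: Int_stable_def)
    moreover have "Int_stable ?D"
    proof (rule Int_stableI)
      fix a b assume "a \<in> ?D" "b \<in> ?D"
      then obtain C D where "C \<in> sets borel" "D \<in> sets borel"
        "a = (\<lambda>\<omega>. dB s t \<omega>) -` C \<inter> space M" "b = (\<lambda>\<omega>. dB s t \<omega>) -` D \<inter> space M"
        by auto
      then show "a \<inter> b \<in> ?D" by (intro CollectI exI[of _ "C \<inter> D"]) auto
    qed
    ultimately have ind: "indep_set (sigma_sets (space M) (sets (F s))) (sigma_sets (space M) ?D)"
      by (rule indep_set_sigma_sets)
    have "indep_var borel \<xi> borel (dB s t)"
      unfolding indep_var_eq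
    proof (intro conjI)
      show "indep_set (sigma_sets (space M) {\<xi> -` A \<inter> space M |A. A \<in> sets borel})
        (sigma_sets (space M) ?D)"
        unfolding indep_set_def
      proof (rule indep_sets_mono_sets[OF ind[unfolded indep_set_def]])
        fix i :: bool
        have "{\<xi> -` A \<inter> space M |A. A \<in> sets borel} \<subseteq> sets (F s)"
          using measurable_sets[OF \<xi>(1)] F_space by auto
        then show "case_bool (sigma_sets (space M) {\<xi> -` A \<inter> space M |A. A \<in> sets borel}) (sigma_sets (space M) ?D) i
          \<subseteq> case_bool (sigma_sets (space M) (sets (F s))) (sigma_sets (space M) ?D) i"
          using sigma_sets_mono'[of "{\<xi> -` A \<inter> space M |A. A \<in> sets borel}" "sets (F s)" "space M"]
          by (cases i) auto
      qed
    qed (use F_measurable_M[OF \<xi>(1)] m in auto)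
    then have "indep_var borel (id \<circ> \<xi>) borel (g \<circ> dB s t)"
      by (rule indep_var_compose) auto
    then have "indep_var borel \<xi> borel (\<lambda>\<omega>. g (dB s t \<omega>))"
      by (simp add: comp_def)
    then show ?thesis
      using indep_var_integrable[OF _ \<xi>(2) ig] indep_var_lebesgue_integral[OF _ \<xi>(2) ig] by simp
  qed
  then show "integrable M (\<lambda>\<omega>. \<xi> \<omega> * g (dB s t \<omega>))"
    and "(\<integral>\<omega>. \<xi> \<omega> * g (dB s t \<omega>) \<partial>M) = (\<integral>\<omega>. \<xi> \<omega> \<partial>M) * (\<integral>\<omega>. g (dB s t \<omega>) \<partial>M)"
    by auto
qed

lemma dB_L2:
  assumes "0 \<le> s" "s \<le> t"
  shows "dB s t \<in> L2 M"
    and "(\<integral>\<omega>. dB s t \<omega> \<partial>M) = 0"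
    and "(\<integral>\<omega>. (dB s t \<omega>)\<^sup>2 \<partial>M) = t - s"
proof -
  have "dB s t \<in> L2 M \<and> (\<integral>\<omega>. dB s t \<omega> \<partial>M) = 0 \<and> (\<integral>\<omega>. (dB s t \<omega>)\<^sup>2 \<partial>M) = t - s"
  proof (cases "s = t")
    case True
    then show ?thesis by (simp add: L2_zero)
  next
    case False
    then have st: "s < t" and r: "0 < sqrt (t - s)" using assms by auto
    note D = B_normal[OF assms(1) st]
    have 1: "(\<integral>\<omega>. dB s t \<omega> \<partial>M) = 0"
      using distributed_integral[OF D, of "\<lambda>x. x"] integral_normal_moment_nz_1[OF r, of 0] by simp
    have 2: "(\<integral>\<omega>. (dB s t \<omega>)\<^sup>2 \<partial>M) = t - s"
      using distributed_integral[OF D, of "\<lambda>x. x\<^sup>2"] integral_normal_moment_even[OF r, of 0 1] st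
      by (simp add: fact_numeral)
    have 3: "integrable M (\<lambda>\<omega>. (dB s t \<omega>)\<^sup>2)"
      using distributed_integrable[OF D, of "\<lambda>x. x\<^sup>2"] integrable_normal_moment[OF r, of 0 2] by simp
    show ?thesis using 1 2 3 dB_measurable_M[OF assms] by (auto simp: L2_def)
  qed
  then show "dB s t \<in> L2 M" "(\<integral>\<omega>. dB s t \<omega> \<partial>M) = 0" "(\<integral>\<omega>. (dB s t \<omega>)\<^sup>2 \<partial>M) = t - s" by auto
qed

lemma exp_dB:
  assumes "0 \<le> s" "s \<le> t"
  shows "integrable M (\<lambda>\<omega>. exp (c * dB s t \<omega>))"
    and "(\<integral>\<omega>. exp (c * dB s t \<omega>) \<partial>M) = exp (c\<^sup>2 * (t - s) / 2)"
    and "integrable M (\<lambda>\<omega>. dB s t \<omega> * exp (c * dB s t \<omega>))"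
    and "(\<integral>\<omega>. dB s t \<omega> * exp (c * dB s t \<omega>) \<partial>M) = c * (t - s) * exp (c\<^sup>2 * (t - s) / 2)"
proof -
  have "integrable M (\<lambda>\<omega>. exp (c * dB s t \<omega>)) \<and>
    (\<integral>\<omega>. exp (c * dB s t \<omega>) \<partial>M) = exp (c\<^sup>2 * (t - s) / 2) \<and>
    integrable M (\<lambda>\<omega>. dB s t \<omega> * exp (c * dB s t \<omega>)) \<and>
    (\<integral>\<omega>. dB s t \<omega> * exp (c * dB s t \<omega>) \<partial>M) = c * (t - s) * exp (c\<^sup>2 * (t - s) / 2)"
  proof (cases "s = t")
    case True
    then show ?thesis by (simp add: prob_space)
  next
    case False
    then have st: "s < t" and r: "0 < sqrt (t - s)" using assms by auto
    note D = B_normal[OF assms(1) st]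
    have sq: "(sqrt (t - s))\<^sup>2 = t - s" using st by simp
    note shift = normal_density_exp_shift[OF r, of _ c, unfolded sq]
    have e1: "(\<lambda>x. normal_density 0 (sqrt (t - s)) x * exp (c * x))
        = (\<lambda>x. exp (c\<^sup>2 * (t - s) / 2) * normal_density (c * (t - s)) (sqrt (t - s)) x)"
      by (rule ext) (rule shift)
    have e2: "(\<lambda>x. normal_density 0 (sqrt (t - s)) x * (x * exp (c * x)))
        = (\<lambda>x. exp (c\<^sup>2 * (t - s) / 2) * (normal_density (c * (t - s)) (sqrt (t - s)) x * x))"
    proof
      fix x show "normal_density 0 (sqrt (t - s)) x * (x * exp (c * x))
        = exp (c\<^sup>2 * (t - s) / 2) * (normal_density (c * (t - s)) (sqrt (t - s)) x * x)"
        using arg_cong[OF shift[of x], of "\<lambda>y. y * x"] by (simp add: mult_ac)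
    qed
    have "integrable M (\<lambda>\<omega>. exp (c * dB s t \<omega>))"
      using distributed_integrable[OF D, of "\<lambda>x. exp (c * x)"] integrable_normal_density[OF r]
      by (simp add: e1)
    moreover have "(\<integral>\<omega>. exp (c * dB s t \<omega>) \<partial>M) = exp (c\<^sup>2 * (t - s) / 2)"
      using distributed_integral[OF D, of "\<lambda>x. exp (c * x)"] integral_normal_density[OF r]
      by (simp add: e1)
    moreover have "integrable M (\<lambda>\<omega>. dB s t \<omega> * exp (c * dB s t \<omega>))"
      using distributed_integrable[OF D, of "\<lambda>x. x * exp (c * x)"] integrable_normal_moment_nz_1[OF r]
      by (simp add: e2)
    moreover have "(\<integral>\<omega>. dB s t \<omega> * exp (c * dB s t \<omega>) \<partial>M) = c * (t - s) * exp (c\<^sup>2 * (t - s) / 2)"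
      using distributed_integral[OF D, of "\<lambda>x. x * exp (c * x)"] integral_normal_moment_nz_1[OF r]
      by (simp add: e2) (simp add: mult_ac)
    ultimately show ?thesis by blast
  qed
  then show "integrable M (\<lambda>\<omega>. exp (c * dB s t \<omega>))"
    and "(\<integral>\<omega>. exp (c * dB s t \<omega>) \<partial>M) = exp (c\<^sup>2 * (t - s) / 2)"
    and "integrable M (\<lambda>\<omega>. dB s t \<omega> * exp (c * dB s t \<omega>))"
    and "(\<integral>\<omega>. dB s t \<omega> * exp (c * dB s t \<omega>) \<partial>M) = c * (t - s) * exp (c\<^sup>2 * (t - s) / 2)"
    by auto
qed

text \<open>The admissible coefficients of an increment of \<open>B\<close> that starts at
  \<open>s\<close>, and the test variables to which later increments are orthogonal.\<close>

definition L2F :: "real \<Rightarrow> ('a \<Rightarrow> real) set" where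
  "L2F s = L2 M \<inter> borel_measurable (F s)"

lemma L2F_mono: "\<xi> \<in> L2F s \<Longrightarrow> s \<le> t \<Longrightarrow> \<xi> \<in> L2F t"
  unfolding L2F_def by (blast intro: F_measurable_mono)

lemma L2F_I: "\<xi> \<in> borel_measurable (F s) \<Longrightarrow> integrable M (\<lambda>\<omega>. (\<xi> \<omega>)\<^sup>2) \<Longrightarrow> \<xi> \<in> L2F s"
  unfolding L2F_def L2_def by (intro IntI CollectI conjI F_measurable_M[of \<xi> s])

lemma L2F_L2: "\<xi> \<in> L2F s \<Longrightarrow> \<xi> \<in> L2 M"
  unfolding L2F_def by (rule IntD1)

lemma L2F_measurable: "\<xi> \<in> L2F s \<Longrightarrow> \<xi> \<in> borel_measurable (F s)"
  unfolding L2F_def by (rule IntD2)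

lemma L2F_add: "f \<in> L2F s \<Longrightarrow> g \<in> L2F s \<Longrightarrow> (\<lambda>x. f x + g x) \<in> L2F s"
  unfolding L2F_def by (intro IntI L2_add borel_measurable_add) auto

lemma L2F_diff: "f \<in> L2F s \<Longrightarrow> g \<in> L2F s \<Longrightarrow> (\<lambda>x. f x - g x) \<in> L2F s"
  unfolding L2F_def by (intro IntI L2_diff borel_measurable_diff) auto

lemma L2F_cmult: "f \<in> L2F s \<Longrightarrow> (\<lambda>x. c * f x) \<in> L2F s"
  unfolding L2F_def by (intro IntI L2_cmult borel_measurable_times borel_measurable_const) auto

lemma L2F_indicator:
  assumes "f \<in> L2F s" "A \<in> sets (F s)" shows "(\<lambda>x. f x * indicator A x) \<in> L2F s"
proof -
  have "(indicator A :: 'a \<Rightarrow> real) \<in> borel_measurable (F s)" using assms(2) by (rule borel_measurable_indicator)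
  then show ?thesis
    using assms subsetD[OF F_sets assms(2)] unfolding L2F_def
    by (intro IntI L2_indicator borel_measurable_times) auto
qed

lemma increment_L2:
  assumes s: "0 \<le> s" "s \<le> t" and \<xi>: "\<xi> \<in> L2F s"
    and g [measurable]: "g \<in> borel_measurable borel" and ig: "(\<lambda>\<omega>. g (dB s t \<omega>)) \<in> L2 M"
  shows "(\<lambda>\<omega>. \<xi> \<omega> * g (dB s t \<omega>)) \<in> L2 M"
    and "(\<integral>\<omega>. (\<xi> \<omega> * g (dB s t \<omega>))\<^sup>2 \<partial>M) = (\<integral>\<omega>. (\<xi> \<omega>)\<^sup>2 \<partial>M) * (\<integral>\<omega>. (g (dB s t \<omega>))\<^sup>2 \<partial>M)"
proof -
  have m: "dB s t \<in> borel_measurable M" by (rule dB_measurable_M[OF s])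
  have "(\<lambda>\<omega>. (\<xi> \<omega>)\<^sup>2) \<in> borel_measurable (F s)" using L2F_measurable[OF \<xi>] by (rule borel_measurable_power)
  note P = increment_product[OF s this _, of "\<lambda>x. (g x)\<^sup>2"]
  have P': "integrable M (\<lambda>\<omega>. (\<xi> \<omega>)\<^sup>2 * (g (dB s t \<omega>))\<^sup>2)"
    "(\<integral>\<omega>. (\<xi> \<omega>)\<^sup>2 * (g (dB s t \<omega>))\<^sup>2 \<partial>M) = (\<integral>\<omega>. (\<xi> \<omega>)\<^sup>2 \<partial>M) * (\<integral>\<omega>. (g (dB s t \<omega>))\<^sup>2 \<partial>M)"
    using \<xi> ig by (auto intro!: P simp: L2_def L2F_def)
  show "(\<lambda>\<omega>. \<xi> \<omega> * g (dB s t \<omega>)) \<in> L2 M"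
    using P' \<xi> ig by (auto simp: L2_def L2F_def power_mult_distrib intro: borel_measurable_times)
  show "(\<integral>\<omega>. (\<xi> \<omega> * g (dB s t \<omega>))\<^sup>2 \<partial>M) = (\<integral>\<omega>. (\<xi> \<omega>)\<^sup>2 \<partial>M) * (\<integral>\<omega>. (g (dB s t \<omega>))\<^sup>2 \<partial>M)"
    using P' by (simp add: power_mult_distrib)
qed

lemma increment_mult_dB:
  assumes s: "0 \<le> s" "s \<le> t" and \<xi>: "\<xi> \<in> L2F s"
  shows "(\<lambda>\<omega>. \<xi> \<omega> * dB s t \<omega>) \<in> L2F t"
    and "(\<integral>\<omega>. (\<xi> \<omega> * dB s t \<omega>)\<^sup>2 \<partial>M) = (\<integral>\<omega>. (\<xi> \<omega>)\<^sup>2 \<partial>M) * (t - s)"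
proof -
  have "\<xi> \<in> borel_measurable (F t)" using L2F_measurable[OF \<xi>] s F_measurable_mono by blast
  then have "(\<lambda>\<omega>. \<xi> \<omega> * dB s t \<omega>) \<in> borel_measurable (F t)"
    using dB_measurable[OF s] by (rule borel_measurable_times)
  then show "(\<lambda>\<omega>. \<xi> \<omega> * dB s t \<omega>) \<in> L2F t"
    using increment_L2(1)[OF s \<xi>, of "\<lambda>x. x"] dB_L2(1)[OF s] by (auto simp: L2F_def)
  show "(\<integral>\<omega>. (\<xi> \<omega> * dB s t \<omega>)\<^sup>2 \<partial>M) = (\<integral>\<omega>. (\<xi> \<omega>)\<^sup>2 \<partial>M) * (t - s)"
    using increment_L2(2)[OF s \<xi>, of "\<lambda>x. x"] dB_L2[OF s] by simp
qed

lemma increment_orthogonal: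
  assumes s: "0 \<le> s" "s \<le> t" and \<xi>: "\<xi> \<in> L2F s" and \<eta>: "\<eta> \<in> L2F s"
  shows "(\<integral>\<omega>. \<eta> \<omega> * (\<xi> \<omega> * dB s t \<omega>) \<partial>M) = 0"
proof -
  have "(\<integral>\<omega>. (\<eta> \<omega> * \<xi> \<omega>) * dB s t \<omega> \<partial>M) = (\<integral>\<omega>. \<eta> \<omega> * \<xi> \<omega> \<partial>M) * (\<integral>\<omega>. dB s t \<omega> \<partial>M)"
    using L2_mult_integrable[OF L2F_L2[OF \<eta>] L2F_L2[OF \<xi>]] L2_integrable[OF dB_L2(1)[OF s]]
      borel_measurable_times[OF L2F_measurable[OF \<eta>] L2F_measurable[OF \<xi>]]
    by (intro increment_product(2)[OF s, of _ "\<lambda>x. x"]) auto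
  then show ?thesis using dB_L2(2)[OF s] by (simp add: mult.assoc)
qed

text \<open>The Ito isometry for finite sums, by induction: the partial sum is known at
  \<open>u k\<close>, hence orthogonal to the next summand, and the second moment of that summand
  factors by independence.\<close>

lemma elementary_isometry:
  fixes u :: "nat \<Rightarrow> real"
  assumes u: "mono u" "0 \<le> u 0" and \<xi>: "\<And>i. i < n \<Longrightarrow> \<xi> i \<in> L2F (u i)"
  shows "(\<lambda>\<omega>. \<Sum>i<n. \<xi> i \<omega> * dB (u i) (u (Suc i)) \<omega>) \<in> L2F (u n)"
    and "(\<integral>\<omega>. (\<Sum>i<n. \<xi> i \<omega> * dB (u i) (u (Suc i)) \<omega>)\<^sup>2 \<partial>M)
      = (\<Sum>i<n. (\<integral>\<omega>. (\<xi> i \<omega>)\<^sup>2 \<partial>M) * (u (Suc i) - u i))"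
proof -
  have u0: "0 \<le> u i" "u i \<le> u (Suc i)" for i
    using monoD[OF u(1), of 0 i] monoD[OF u(1), of i "Suc i"] u(2) by auto
  have "(\<lambda>\<omega>. \<Sum>i<k. \<xi> i \<omega> * dB (u i) (u (Suc i)) \<omega>) \<in> L2F (u k) \<and>
    (\<integral>\<omega>. (\<Sum>i<k. \<xi> i \<omega> * dB (u i) (u (Suc i)) \<omega>)\<^sup>2 \<partial>M)
      = (\<Sum>i<k. (\<integral>\<omega>. (\<xi> i \<omega>)\<^sup>2 \<partial>M) * (u (Suc i) - u i))" if "k \<le> n" for k
    using that
  proof (induction k)
    case 0
    show ?case by (simp add: L2F_def L2_zero)
  next
    case (Suc k)
    let ?S = "\<lambda>\<omega>. \<Sum>i<k. \<xi> i \<omega> * dB (u i) (u (Suc i)) \<omega>"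
    have S: "?S \<in> L2F (u k)" using Suc by auto
    have \<xi>k: "\<xi> k \<in> L2F (u k)" using Suc.prems \<xi> by auto
    note T = increment_mult_dB[OF u0 \<xi>k]
    have "(\<integral>\<omega>. (?S \<omega> + \<xi> k \<omega> * dB (u k) (u (Suc k)) \<omega>)\<^sup>2 \<partial>M)
      = (\<integral>\<omega>. (?S \<omega>)\<^sup>2 \<partial>M) + 2 * (\<integral>\<omega>. ?S \<omega> * (\<xi> k \<omega> * dB (u k) (u (Suc k)) \<omega>) \<partial>M)
        + (\<integral>\<omega>. (\<xi> k \<omega> * dB (u k) (u (Suc k)) \<omega>)\<^sup>2 \<partial>M)"
      by (intro L2_square_add L2F_L2[OF S] L2F_L2[OF T(1)])
    then show ?case
      using Suc T increment_orthogonal[OF u0 \<xi>k S] L2F_add[OF L2F_mono[OF S u0(2)] T(1)] by simp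
  qed
  then show "(\<lambda>\<omega>. \<Sum>i<n. \<xi> i \<omega> * dB (u i) (u (Suc i)) \<omega>) \<in> L2F (u n)"
    and "(\<integral>\<omega>. (\<Sum>i<n. \<xi> i \<omega> * dB (u i) (u (Suc i)) \<omega>)\<^sup>2 \<partial>M)
      = (\<Sum>i<n. (\<integral>\<omega>. (\<xi> i \<omega>)\<^sup>2 \<partial>M) * (u (Suc i) - u i))"
    by auto
qed

lemma elementary_orthogonal:
  fixes u :: "nat \<Rightarrow> real"
  assumes u: "mono u" "0 \<le> u 0" and \<xi>: "\<And>i. i < n \<Longrightarrow> \<xi> i \<in> L2F (u i)" and \<eta>: "\<eta> \<in> L2F (u 0)"
  shows "(\<integral>\<omega>. \<eta> \<omega> * (\<Sum>i<n. \<xi> i \<omega> * dB (u i) (u (Suc i)) \<omega>) \<partial>M) = 0"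
proof -
  have u0: "0 \<le> u i" "u i \<le> u (Suc i)" "u 0 \<le> u i" for i
    using monoD[OF u(1), of 0 i] monoD[OF u(1), of i "Suc i"] u(2) by auto
  have "integrable M (\<lambda>\<omega>. \<eta> \<omega> * (\<xi> i \<omega> * dB (u i) (u (Suc i)) \<omega>))" if "i < n" for i
    by (intro L2_mult_integrable L2F_L2[OF \<eta>] L2F_L2[OF increment_mult_dB(1)[OF u0(1,2) \<xi>[OF that]]])
  then have "(\<integral>\<omega>. \<eta> \<omega> * (\<Sum>i<n. \<xi> i \<omega> * dB (u i) (u (Suc i)) \<omega>) \<partial>M)
      = (\<Sum>i<n. \<integral>\<omega>. \<eta> \<omega> * (\<xi> i \<omega> * dB (u i) (u (Suc i)) \<omega>) \<partial>M)"
    by (simp add: sum_distrib_left)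
  also have "\<dots> = 0"
    using increment_orthogonal[OF u0(1,2) \<xi> L2F_mono[OF \<eta> u0(3)]] by simp
  finally show ?thesis .
qed

end

section \<open>The completed filtration\<close>

text \<open>Arranges finitely many times as a chain from 0 in which \<open>s\<close> and
  \<open>t\<close> come last and adjacent. The final increment is then the one from \<open>s\<close>
  to \<open>t\<close>, and the earlier increments determine the path at all the given times.\<close>

lemma sorted_times:
  fixes T :: "real set"
  assumes T: "finite T" "T \<subseteq> {0..s}" and st: "0 \<le> s" "s < t"
  obtains \<tau> n where "\<tau> 0 = 0" "mono \<tau>" "T \<subseteq> \<tau> ` {..n}" "\<tau> n = s" "\<tau> (Suc n) = t"
proof -
  define U where "U = insert 0 (insert s T)"
  define l where "l = sorted_list_of_set U"
  have fin: "finite U" using T by (simp add: U_def)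
  have l: "set l = U" "sorted l" using fin by (simp_all add: l_def)
  have "l \<noteq> []" using l(1) by (auto simp: U_def)
  define n where "n = length l - 1"
  have n: "length l = Suc n" using \<open>l \<noteq> []\<close> by (simp add: n_def)
  \<comment> \<open>Beyond the list the chain continues with the constant \<open>t\<close>, so index
    \<open>Suc n\<close> gives \<open>t\<close> and monotonicity holds on all indices.\<close>
  define \<tau> where "\<tau> i = (if i \<le> n then l ! i else t)" for i
  have U: "U \<subseteq> {0..s}" "0 \<in> U" "s \<in> U" using T st by (auto simp: U_def)
  have nth: "l ! i \<in> U" if "i \<le> n" for i using nth_mem[of i l] that n l(1) by auto
  have "0 \<in> set l" "s \<in> set l" using U l(1) by auto
  then obtain i j where i: "i \<le> n" "l ! i = 0" and j: "j \<le> n" "l ! j = s"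
    using n by (auto simp: in_set_conv_nth less_Suc_eq_le)
  have "l ! 0 \<le> l ! i" "l ! j \<le> l ! n"
    using sorted_nth_mono[OF l(2), of 0 i] sorted_nth_mono[OF l(2), of j n] i(1) j(1) n by simp_all
  moreover have "0 \<le> l ! 0" "l ! n \<le> s" using nth[of 0] nth[of n] U(1) by auto
  ultimately have ends: "l ! 0 = 0" "l ! n = s" using i j by auto
  have "mono \<tau>"
  proof (rule monoI)
    fix a b :: nat assume ab: "a \<le> b"
    have "l ! a \<le> t" if "a \<le> n" using nth[OF that] U(1) st by auto
    then show "\<tau> a \<le> \<tau> b"
      using ab l(2) n by (auto simp: \<tau>_def intro!: sorted_nth_mono)
  qed
  moreover have "T \<subseteq> \<tau> ` {..n}"
  proof
    fix x assume "x \<in> T"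
    then have "x \<in> set l" using l(1) by (simp add: U_def)
    then obtain k where "k \<le> n" "l ! k = x" using n by (auto simp: in_set_conv_nth less_Suc_eq_le)
    then show "x \<in> \<tau> ` {..n}" by (auto simp: \<tau>_def intro!: image_eqI[of _ _ k])
  qed
  ultimately show ?thesis using that[of \<tau> n] ends by (simp add: \<tau>_def)
qed

text \<open>At the chosen times the path is a partial sum of increments over the chain, so the
  cylinder depends on the increments with index below \<open>n\<close> and is independent of the one
  with index \<open>n\<close>. Since \<open>B 0 = 0\<close> only almost surely, the cylinder and the
  event expressed through increments agree up to a null set.\<close>

lemma brownian_cylinder_indep:
  assumes B: "brownian_motion M B" and T: "finite T" "T \<subseteq> {0..s}" and st: "0 \<le> s" "s < t"
    and C: "\<And>r. C r \<in> sets borel" and D: "D \<in> sets borel"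
  shows "measure M ({\<omega>\<in>space M. \<forall>r\<in>T. B r \<omega> \<in> C r} \<inter> ((\<lambda>\<omega>. B t \<omega> - B s \<omega>) -` D \<inter> space M))
    = measure M {\<omega>\<in>space M. \<forall>r\<in>T. B r \<omega> \<in> C r} * measure M ((\<lambda>\<omega>. B t \<omega> - B s \<omega>) -` D \<inter> space M)"
proof -
  interpret prob_space M using B by (simp add: brownian_motion_def)
  have Bm: "0 \<le> t \<Longrightarrow> B t \<in> borel_measurable M" for t using B by (simp add: brownian_motion_def)
  have B0: "AE \<omega> in M. B 0 \<omega> = 0" using B by (simp add: brownian_motion_def)
  obtain \<tau> n where \<tau>: "\<tau> 0 = 0" "mono \<tau>" "T \<subseteq> \<tau> ` {..n}" "\<tau> n = s" "\<tau> (Suc n) = t"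
    using sorted_times[OF T st] by blast
  let ?\<Delta> = "\<lambda>i \<omega>. B (\<tau> (Suc i)) \<omega> - B (\<tau> i) \<omega>"
  have "indep_vars (\<lambda>_. borel) ?\<Delta> {..<Suc n}"
  proof -
    have "\<forall>(\<tau> :: nat \<Rightarrow> real) n. 0 \<le> \<tau> 0 \<and> mono \<tau> \<longrightarrow>
        indep_vars (\<lambda>_. borel) (\<lambda>i \<omega>. B (\<tau> (Suc i)) \<omega> - B (\<tau> i) \<omega>) {..<n}"
      using B unfolding brownian_motion_def by (elim conjE)
    then show ?thesis using \<tau>(1,2) by simp
  qed
  then have "indep_var (Pi\<^sub>M {..<n} (\<lambda>_. borel)) (\<lambda>\<omega>. \<lambda>i\<in>{..<n}. ?\<Delta> i \<omega>)
      (Pi\<^sub>M {n} (\<lambda>_. borel)) (\<lambda>\<omega>. \<lambda>i\<in>{n}. ?\<Delta> i \<omega>)"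
    by (rule indep_var_restrict) auto
  note ind = indep_varD[OF this]
  define J where "J = {i. i \<le> n \<and> \<tau> i \<in> T}"
  define XA where "XA = {f \<in> space (Pi\<^sub>M {..<n} (\<lambda>_. borel :: real measure)). \<forall>i\<in>J. (\<Sum>j<i. f j) \<in> C (\<tau> i)}"
  define XB where "XB = {f \<in> space (Pi\<^sub>M {n} (\<lambda>_. borel :: real measure)). f n \<in> D}"
  have fJ: "finite J" by (simp add: J_def)
  have "XA \<in> sets (Pi\<^sub>M {..<n} (\<lambda>_. borel))"
    unfolding XA_def
  proof (rule sets.sets_Collect_finite_All[OF _ fJ])
    fix i assume "i \<in> J"
    then have "(\<lambda>f. \<Sum>j<i. f j) \<in> borel_measurable (Pi\<^sub>M {..<n} (\<lambda>_. borel :: real measure))"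
      by (intro borel_measurable_sum measurable_component_singleton) (auto simp: J_def)
    from measurable_sets[OF this C, of "\<tau> i"]
    show "{f \<in> space (Pi\<^sub>M {..<n} (\<lambda>_. borel)). (\<Sum>j<i. f j) \<in> C (\<tau> i)} \<in> sets (Pi\<^sub>M {..<n} (\<lambda>_. borel))"
      by (simp add: vimage_def Int_def conj_commute)
  qed
  moreover have "XB \<in> sets (Pi\<^sub>M {n} (\<lambda>_. borel))"
  proof -
    have "(\<lambda>f. f n) \<in> borel_measurable (Pi\<^sub>M {n} (\<lambda>_. borel :: real measure))"
      by (intro measurable_component_singleton) auto
    from measurable_sets[OF this D] show ?thesis
      by (simp add: XB_def vimage_def Int_def conj_commute)
  qed
  ultimately have eq: "prob ((\<lambda>x. (\<lambda>i\<in>{..<n}. ?\<Delta> i x, \<lambda>i\<in>{n}. ?\<Delta> i x)) -` (XA \<times> XB) \<inter> space M)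
    = prob ((\<lambda>\<omega>. \<lambda>i\<in>{..<n}. ?\<Delta> i \<omega>) -` XA \<inter> space M) * prob ((\<lambda>\<omega>. \<lambda>i\<in>{n}. ?\<Delta> i \<omega>) -` XB \<inter> space M)"
    by (rule ind)
  have vB: "(\<lambda>\<omega>. \<lambda>i\<in>{n}. ?\<Delta> i \<omega>) -` XB \<inter> space M = (\<lambda>\<omega>. B t \<omega> - B s \<omega>) -` D \<inter> space M"
    by (auto simp: XB_def space_PiM \<tau>)
  have vA: "AE \<omega> in M. (\<omega> \<in> (\<lambda>\<omega>. \<lambda>i\<in>{..<n}. ?\<Delta> i \<omega>) -` XA \<inter> space M)
      \<longleftrightarrow> \<omega> \<in> {\<omega>\<in>space M. \<forall>r\<in>T. B r \<omega> \<in> C r}"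
    using B0
  proof eventually_elim
    case (elim \<omega>)
    have tele: "(\<Sum>j<i. (\<lambda>i\<in>{..<n}. ?\<Delta> i \<omega>) j) = B (\<tau> i) \<omega>" if "i \<le> n" for i
    proof -
      have "(\<Sum>j<i. (\<lambda>i\<in>{..<n}. ?\<Delta> i \<omega>) j) = (\<Sum>j<i. ?\<Delta> j \<omega>)"
        using that by (intro sum.cong) auto
      also have "\<dots> = B (\<tau> i) \<omega> - B (\<tau> 0) \<omega>" by (rule sum_lessThan_telescope)
      finally show ?thesis using elim \<tau>(1) by simp
    qed
    have "(\<forall>i\<in>J. (\<Sum>j<i. (\<lambda>i\<in>{..<n}. ?\<Delta> i \<omega>) j) \<in> C (\<tau> i)) \<longleftrightarrow> (\<forall>i\<in>J. B (\<tau> i) \<omega> \<in> C (\<tau> i))"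
      by (intro ball_cong refl, subst tele) (simp_all add: J_def)
    also have "\<dots> \<longleftrightarrow> (\<forall>r\<in>\<tau> ` J. B r \<omega> \<in> C r)" by auto
    also have "\<tau> ` J = T" using \<tau>(3) by (auto simp: J_def)
    finally show ?case by (auto simp: XA_def space_PiM)
  qed
  have m1: "{\<omega>\<in>space M. \<forall>r\<in>T. B r \<omega> \<in> C r} \<in> events"
  proof (rule sets.sets_Collect_finite_All[OF _ T(1)])
    fix r assume "r \<in> T"
    then have "B r \<in> borel_measurable M" using T Bm by auto
    from measurable_sets[OF this C, of r] show "{\<omega> \<in> space M. B r \<omega> \<in> C r} \<in> events"
      by (simp add: vimage_def Int_def conj_commute)
  qed
  have m2: "(\<lambda>\<omega>. B t \<omega> - B s \<omega>) -` D \<inter> space M \<in> events"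
    using st Bm[of t] Bm[of s] D by (intro measurable_sets[OF borel_measurable_diff]) auto
  have pos: "0 \<le> \<tau> i" for i using monoD[OF \<tau>(2), of 0 i] \<tau>(1) by simp
  have m3: "(\<lambda>\<omega>. \<lambda>i\<in>{..<n}. ?\<Delta> i \<omega>) -` XA \<inter> space M \<in> events"
    by (rule measurable_sets[OF measurable_restrict \<open>XA \<in> _\<close>]) (auto intro!: borel_measurable_diff Bm pos)
  have a: "prob ((\<lambda>\<omega>. \<lambda>i\<in>{..<n}. ?\<Delta> i \<omega>) -` XA \<inter> space M) = prob {\<omega>\<in>space M. \<forall>r\<in>T. B r \<omega> \<in> C r}"
    by (rule finite_measure_eq_AE[OF vA m3 m1])
  have "(\<lambda>x. (\<lambda>i\<in>{..<n}. ?\<Delta> i x, \<lambda>i\<in>{n}. ?\<Delta> i x)) -` (XA \<times> XB) \<inter> space M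
      = ((\<lambda>\<omega>. \<lambda>i\<in>{..<n}. ?\<Delta> i \<omega>) -` XA \<inter> space M) \<inter> ((\<lambda>\<omega>. B t \<omega> - B s \<omega>) -` D \<inter> space M)"
    unfolding vB[symmetric] by auto
  moreover have "prob (((\<lambda>\<omega>. \<lambda>i\<in>{..<n}. ?\<Delta> i \<omega>) -` XA \<inter> space M) \<inter> ((\<lambda>\<omega>. B t \<omega> - B s \<omega>) -` D \<inter> space M))
     = prob ({\<omega>\<in>space M. \<forall>r\<in>T. B r \<omega> \<in> C r} \<inter> ((\<lambda>\<omega>. B t \<omega> - B s \<omega>) -` D \<inter> space M))"
    by (rule finite_measure_eq_AE) (use vA m1 m2 m3 in auto)
  ultimately show ?thesis using eq a vB by simp
qed

text \<open>Two factorizations are combined on a pi-system of generators: \<open>X0\<close> is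
  independent of the whole path, and a cylinder of the path up to \<open>s\<close> is independent of
  the increment. The null sets are further members of the system, since they satisfy the product
  rule trivially and absorb intersections.\<close>

lemma completed_filtration_indep:
  assumes B: "brownian_motion M B" and X0: "independent_of_process M X0 B"
    and st: "0 \<le> s" "s < t" and A: "A \<in> sets (completed_filtration M X0 B s)" and D: "D \<in> sets borel"
  shows "measure M (A \<inter> ((\<lambda>\<omega>. B t \<omega> - B s \<omega>) -` D \<inter> space M))
    = measure M A * measure M ((\<lambda>\<omega>. B t \<omega> - B s \<omega>) -` D \<inter> space M)"
proof -
  interpret prob_space M using B by (simp add: brownian_motion_def)
  have Bm: "0 \<le> t \<Longrightarrow> B t \<in> borel_measurable M" for t using B by (simp add: brownian_motion_def)
  have X0m: "X0 \<in> borel_measurable M" using X0 by (simp add: independent_of_process_def)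
  note ind0 = X0[unfolded independent_of_process_def, THEN conjunct2, THEN indep_setD]
  let ?\<Delta> = "\<lambda>\<omega>. B t \<omega> - B s \<omega>"
  have \<Delta>m: "?\<Delta> \<in> borel_measurable M" using Bm st by auto
  define cyl where "cyl = (\<lambda>(A, T, C). X0 -` A \<inter> space M \<inter> {\<omega>\<in>space M. \<forall>r\<in>T. B r \<omega> \<in> C r})"
  define P where "P = {(A, T, C :: real \<Rightarrow> real set). A \<in> sets (borel :: real measure) \<and> finite T \<and> T \<subseteq> {0..s} \<and>
      (\<forall>r. C r \<in> sets (borel :: real measure))}"
  define E where "E = cyl ` P \<union> null_sets M"
  define G where "G = {?\<Delta> -` D \<inter> space M | D. D \<in> sets borel}"
  have cylm: "{\<omega>\<in>space M. \<forall>r\<in>T. B r \<omega> \<in> C r} \<in> events"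
    if "finite T" "T \<subseteq> {0..s}" "\<And>r. C r \<in> sets borel" for T C
  proof (rule sets.sets_Collect_finite_All[OF _ that(1)])
    fix r assume "r \<in> T"
    then have "B r \<in> borel_measurable M" using that Bm by auto
    from measurable_sets[OF this that(3), of r] show "{\<omega> \<in> space M. B r \<omega> \<in> C r} \<in> events"
      by (simp add: vimage_def Int_def conj_commute)
  qed
  have Eev: "E \<subseteq> events"
    using cylm measurable_sets[OF X0m] by (auto simp: E_def cyl_def P_def)
  have Gev: "G \<subseteq> events" using measurable_sets[OF \<Delta>m] by (auto simp: G_def)
  have proc: "prob (X0 -` A \<inter> space M \<inter> W) = prob (X0 -` A \<inter> space M) * prob W"
    if A: "A \<in> sets borel" and W: "W = (\<lambda>\<omega>. \<lambda>s\<in>{0..}. B s \<omega>) -` S \<inter> space M"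
      and S: "S \<in> sets (Pi\<^sub>M {0..} (\<lambda>_. borel))" for A W S
    by (rule ind0) (use that in auto)
  have coord: "(\<lambda>f. f r) \<in> borel_measurable (Pi\<^sub>M {0..} (\<lambda>_. borel :: real measure))" if "0 \<le> r" for r :: real
    using that by (intro measurable_component_singleton) auto
  have "indep_set E G"
  proof (rule indep_setI[OF Eev Gev])
    fix e g assume e: "e \<in> E" and "g \<in> G"
    then obtain D where D: "D \<in> sets borel" "g = ?\<Delta> -` D \<inter> space M" by (auto simp: G_def)
    show "prob (e \<inter> g) = prob e * prob g"
    proof (cases "e \<in> null_sets M")
      case True
      have "e \<inter> g \<in> null_sets M"
        using True \<open>g \<in> G\<close> Gev by (intro null_set_Int2) auto
      then show ?thesis using True by (simp add: measure_eq_0_null_sets)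
    next
      case False
      then obtain A T C where ATC: "(A, T, C) \<in> P" "e = cyl (A, T, C)"
        using e by (auto simp: E_def)
      then have A: "A \<in> sets borel" and T: "finite T" "T \<subseteq> {0..s}" and C: "\<And>r. C r \<in> sets borel"
        by (auto simp: P_def)
      let ?W = "{\<omega>\<in>space M. \<forall>r\<in>T. B r \<omega> \<in> C r}"
      have e_eq: "e = X0 -` A \<inter> space M \<inter> ?W" using ATC(2) by (simp add: cyl_def)
      define S1 where "S1 = {f \<in> space (Pi\<^sub>M {0..} (\<lambda>_. borel :: real measure)). \<forall>r\<in>T. f r \<in> C r}"
      have S1: "S1 \<in> sets (Pi\<^sub>M {0..} (\<lambda>_. borel))"
        unfolding S1_def
      proof (rule sets.sets_Collect_finite_All[OF _ T(1)])
        fix r assume "r \<in> T"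
        then show "{f \<in> space (Pi\<^sub>M {0..} (\<lambda>_. borel)). f r \<in> C r} \<in> sets (Pi\<^sub>M {0..} (\<lambda>_. borel))"
          using measurable_sets[OF coord C, of r r] T(2) by (auto simp: vimage_def Int_def conj_commute)
      qed
      have 1: "prob e = prob (X0 -` A \<inter> space M) * prob ?W"
        unfolding e_eq
        by (rule proc[OF A _ S1]) (use T(2) in \<open>auto simp: S1_def space_PiM\<close>)
      \<comment> \<open>The cylinder together with the increment is again an event of the whole
        path, so independence of \<open>X0\<close> applies a second time.\<close>
      define S2 where "S2 = S1 \<inter> ((\<lambda>f. f t - f s) -` D \<inter> space (Pi\<^sub>M {0..} (\<lambda>_. borel :: real measure)))"
      have S2: "S2 \<in> sets (Pi\<^sub>M {0..} (\<lambda>_. borel))"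
        unfolding S2_def using S1 st D(1) coord[of t] coord[of s]
        by (intro sets.Int measurable_sets[OF borel_measurable_diff]) auto
      have "prob (X0 -` A \<inter> space M \<inter> (?W \<inter> g)) = prob (X0 -` A \<inter> space M) * prob (?W \<inter> g)"
        by (rule proc[OF A _ S2]) (use T(2) st D(2) in \<open>auto simp: S1_def S2_def space_PiM\<close>)
      also have "prob (?W \<inter> g) = prob ?W * prob g"
        unfolding D(2) by (rule brownian_cylinder_indep[OF B T st C D(1)])
      finally show ?thesis using 1 by (simp add: e_eq Int_assoc)
    qed
  qed
  moreover have "Int_stable E"
  proof (rule Int_stableI)
    fix a b assume ab: "a \<in> E" "b \<in> E"
    show "a \<inter> b \<in> E"
    proof (cases "a \<in> null_sets M \<or> b \<in> null_sets M")
      case True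
      then show ?thesis
        using ab Eev null_set_Int1[of a M b] null_set_Int2[of b M a]
        by (auto simp: E_def Int_commute)
    next
      case False
      then obtain A T C A' T' C' where 1: "(A, T, C) \<in> P" "a = cyl (A, T, C)"
        and 2: "(A', T', C') \<in> P" "b = cyl (A', T', C')"
        using ab by (auto simp: E_def)
      \<comment> \<open>Times outside one of the two index sets receive \<open>UNIV\<close>, so that
        cylinders over different index sets intersect in a cylinder.\<close>
      define C'' where "C'' r = (if r \<in> T then C r else UNIV) \<inter> (if r \<in> T' then C' r else UNIV)" for r
      have "(A \<inter> A', T \<union> T', C'') \<in> P" using 1 2 by (auto simp: P_def C''_def)
      moreover have "a \<inter> b = cyl (A \<inter> A', T \<union> T', C'')"
        unfolding 1(2) 2(2) cyl_def C''_def by (auto split: if_splits)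
      ultimately show ?thesis by (auto simp: E_def)
    qed
  qed
  moreover have "Int_stable G"
  proof (rule Int_stableI)
    fix a b assume "a \<in> G" "b \<in> G"
    then obtain D D' where "D \<in> sets borel" "D' \<in> sets borel" "a = ?\<Delta> -` D \<inter> space M" "b = ?\<Delta> -` D' \<inter> space M"
      by (auto simp: G_def)
    then show "a \<inter> b \<in> G" unfolding G_def by (intro CollectI exI[of _ "D \<inter> D'"]) auto
  qed
  ultimately have main: "indep_set (sigma_sets (space M) E) (sigma_sets (space M) G)"
    by (rule indep_set_sigma_sets)
  have "A \<in> sigma_sets (space M) ({X0 -` A \<inter> space M | A. A \<in> sets borel} \<union>
        {B r -` A \<inter> space M | r A. 0 \<le> r \<and> r \<le> s \<and> A \<in> sets borel} \<union> null_sets M)"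
  proof -
    have "({X0 -` A \<inter> space M | A. A \<in> sets borel} \<union>
        {B r -` A \<inter> space M | r A. 0 \<le> r \<and> r \<le> s \<and> A \<in> sets borel} \<union> null_sets M) \<subseteq> Pow (space M)"
      using sets.sets_into_space[of _ M] by auto
    then show ?thesis using A by (simp add: completed_filtration_def sets_measure_of)
  qed
  also have "\<dots> \<subseteq> sigma_sets (space M) E"
  proof (rule sigma_sets_mono', intro Un_least)
    show "{X0 -` A \<inter> space M | A. A \<in> sets borel} \<subseteq> E"
    proof
      fix x assume "x \<in> {X0 -` A \<inter> space M | A. A \<in> sets borel}"
      then obtain A where "A \<in> sets borel" "x = X0 -` A \<inter> space M" by auto
      then have "(A, {}, \<lambda>_. UNIV) \<in> P" "x = cyl (A, {}, \<lambda>_. UNIV)" by (auto simp: P_def cyl_def)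
      then show "x \<in> E" by (auto simp: E_def)
    qed
    show "{B r -` A \<inter> space M | r A. 0 \<le> r \<and> r \<le> s \<and> A \<in> sets borel} \<subseteq> E"
    proof
      fix x assume "x \<in> {B r -` A \<inter> space M | r A. 0 \<le> r \<and> r \<le> s \<and> A \<in> sets borel}"
      then obtain r A where "0 \<le> r" "r \<le> s" "A \<in> sets borel" "x = B r -` A \<inter> space M" by auto
      then have "(UNIV, {r}, \<lambda>_. A) \<in> P" "x = cyl (UNIV, {r}, \<lambda>_. A)" by (auto simp: P_def cyl_def)
      then show "x \<in> E" by (auto simp: E_def)
    qed
  qed (auto simp: E_def)
  finally have "A \<in> sigma_sets (space M) E" .
  then show ?thesis
    by (rule indep_setD[OF main]) (use D in \<open>auto simp: G_def intro!: sigma_sets.Basic\<close>)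
qed

lemma completed_filtration_generators:
  assumes "brownian_motion M B" "independent_of_process M X0 B"
  shows "space (completed_filtration M X0 B t) = space M"
    and "sets (completed_filtration M X0 B t) \<subseteq> sets M"
    and "X0 \<in> borel_measurable (completed_filtration M X0 B t)"
    and "0 \<le> s \<Longrightarrow> s \<le> t \<Longrightarrow> B s \<in> borel_measurable (completed_filtration M X0 B t)"
    and "s \<le> t \<Longrightarrow> sets (completed_filtration M X0 B s) \<subseteq> sets (completed_filtration M X0 B t)"
proof -
  define Gen where "Gen t = {X0 -` A \<inter> space M | A. A \<in> sets borel} \<union>
        {B s -` A \<inter> space M | s A. 0 \<le> s \<and> s \<le> t \<and> A \<in> sets borel} \<union> null_sets M" for t
  have Gen_Pow: "Gen t \<subseteq> Pow (space M)" for t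
    using sets.sets_into_space[of _ M] by (auto simp: Gen_def)
  have F: "completed_filtration M X0 B t = sigma (space M) (Gen t)" for t
    by (simp add: completed_filtration_def Gen_def)
  show sp: "space (completed_filtration M X0 B t) = space M"
    using Gen_Pow by (simp add: F space_measure_of)
  have sets_F: "sets (completed_filtration M X0 B t) = sigma_sets (space M) (Gen t)" for t
    using Gen_Pow by (simp add: F sets_measure_of)
  have X0m: "X0 \<in> borel_measurable M" using assms(2) by (simp add: independent_of_process_def)
  have Bm: "0 \<le> t \<Longrightarrow> B t \<in> borel_measurable M" for t using assms(1) by (simp add: brownian_motion_def)
  have "Gen t \<subseteq> sets M" for t
    using measurable_sets[OF X0m] measurable_sets[OF Bm] by (auto simp: Gen_def)
  then show "sets (completed_filtration M X0 B t) \<subseteq> sets M"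
    unfolding sets_F by (rule sets.sigma_sets_subset)
  show "X0 \<in> borel_measurable (completed_filtration M X0 B t)"
    by (rule measurableI) (auto simp: sets_F sp Gen_def intro!: sigma_sets.Basic)
  show "B s \<in> borel_measurable (completed_filtration M X0 B t)" if "0 \<le> s" "s \<le> t"
    using that by (intro measurableI) (auto simp: sets_F sp Gen_def intro!: sigma_sets.Basic)
  show "sets (completed_filtration M X0 B s) \<subseteq> sets (completed_filtration M X0 B t)" if "s \<le> t"
  proof -
    have "Gen s \<subseteq> Gen t"
      unfolding Gen_def by (intro Un_mono order_refl) (use that order_trans[of _ s t] in blast)
    then show ?thesis unfolding sets_F by (rule sigma_sets_mono')
  qed
qed

lemma brownian_filtration_completed:
  assumes B: "brownian_motion M B" and X0: "independent_of_process M X0 B"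
  shows "brownian_filtration M (completed_filtration M X0 B) B"
proof -
  note gen = completed_filtration_generators[OF B X0]
  interpret prob_space M using B by (simp add: brownian_motion_def)
  show ?thesis
    by unfold_locales
      (use B gen completed_filtration_indep[OF B X0] in
        \<open>auto simp: brownian_motion_def continuous_process_def\<close>)
qed

section \<open>Ito integrals as limits of Riemann sums\<close>

lemma finite_set_enumeration:
  fixes U :: "real set"
  assumes "finite U" "U \<noteq> {}"
  shows "\<exists>(v :: nat \<Rightarrow> real) n. mono v \<and> v ` {..n} = U \<and>
    (\<forall>i j. i < j \<longrightarrow> j \<le> n \<longrightarrow> v i < v j) \<and> (\<forall>i. v i \<in> U)"
proof -
  define l where "l = sorted_list_of_set U"
  have l: "set l = U" "sorted_wrt (<) l" using assms by (simp_all add: l_def)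
  have ne: "l \<noteq> []" using l(1) assms(2) by auto
  define n where "n = length l - 1"
  have n: "length l = Suc n" using ne by (simp add: n_def)
  define v where "v i = l ! min i n" for i
  have strict: "v i < v j" if "i < j" "j \<le> n" for i j
    using sorted_wrt_nth_less[OF l(2), of i j] that n by (simp add: v_def min_def)
  have "mono v"
  proof (rule monoI)
    fix i j :: nat assume "i \<le> j"
    then have "min i n < min j n \<or> min i n = min j n" by auto
    then show "v i \<le> v j"
      using strict[of "min i n" "min j n"] by (auto simp: v_def min_def split: if_splits)
  qed
  moreover have "v ` {..n} = U"
  proof -
    have "v ` {..n} = (\<lambda>i. l ! i) ` {..<length l}"
      unfolding n lessThan_Suc_atMost by (intro image_cong refl) (simp add: v_def)
    also have "\<dots> = U" unfolding l(1)[symmetric] set_conv_nth by auto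
    finally show ?thesis .
  qed
  moreover have "v i \<in> U" for i unfolding l(1)[symmetric] v_def by (rule nth_mem) (simp add: n)
  ultimately show ?thesis using strict by (intro exI[of _ v] exI[of _ n]) simp
qed

lemma indicator_telescope:
  fixes v f :: "nat \<Rightarrow> real"
  assumes "p \<le> q" "q \<le> n"
  shows "(\<Sum>i<n. (if p \<le> i \<and> i < q then 1 else 0) * (f (Suc i) - f i)) = f q - f p"
proof -
  have "(\<Sum>i<n. (if p \<le> i \<and> i < q then 1 else 0) * (f (Suc i) - f i)) = (\<Sum>i\<in>{p..<q}. f (Suc i) - f i)"
    using assms by (intro sum.mono_neutral_cong_right) auto
  also have "\<dots> = f q - f p" using assms by (simp add: sum_Suc_diff')
  finally show ?thesis .
qed

context brownian_filtration
begin

text \<open>An inequality of Lenglart type for coefficients that are merely measurable: they are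
  switched off as soon as the accumulated quadratic variation would exceed \<open>\<delta>\<close>.
  This rule is known at the left end of each step, so the truncated sum has second moment at most
  \<open>\<delta>\<close> and Chebyshev applies; the two sums differ only where the quadratic
  variation exceeds \<open>\<delta>\<close>.\<close>

lemma elementary_integral_bound_in_probability:
  fixes u :: "nat \<Rightarrow> real" and \<xi> :: "nat \<Rightarrow> 'a \<Rightarrow> real"
  assumes u: "mono u" "0 \<le> u 0" and \<xi>: "\<And>i. i < n \<Longrightarrow> \<xi> i \<in> borel_measurable (F (u i))"
    and pos: "0 < \<epsilon>" "0 < \<delta>"
  shows "prob {\<omega>\<in>space M. \<epsilon> < \<bar>\<Sum>i<n. \<xi> i \<omega> * dB (u i) (u (Suc i)) \<omega>\<bar>}
    \<le> prob {\<omega>\<in>space M. \<delta> < (\<Sum>i<n. (\<xi> i \<omega>)\<^sup>2 * (u (Suc i) - u i))} + \<delta> / \<epsilon>\<^sup>2"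
proof -
  have u0: "0 \<le> u i" "u i \<le> u (Suc i)" for i
    using monoD[OF u(1), of 0 i] monoD[OF u(1), of i "Suc i"] u(2) by auto
  define V where "V k \<omega> = (\<Sum>i<k. (\<xi> i \<omega>)\<^sup>2 * (u (Suc i) - u i))" for k \<omega>
  have V_mono: "V i \<omega> \<le> V j \<omega>" if "i \<le> j" for i j \<omega>
    unfolding V_def using u0 that by (intro sum_mono2) (auto intro!: mult_nonneg_nonneg)
  have V_meas: "V (Suc k) \<in> borel_measurable (F (u k))" if "k < n" for k
    unfolding V_def
  proof (intro borel_measurable_sum borel_measurable_times borel_measurable_power borel_measurable_const)
    fix i assume "i \<in> {..<Suc k}"
    then have "u i \<le> u k" "i < n" using that monoD[OF u(1), of i k] by auto
    then show "\<xi> i \<in> borel_measurable (F (u k))" using F_measurable_mono[OF \<xi>] by blast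
  qed
  \<comment> \<open>\<open>V (Suc i)\<close> already contains the i-th term and is still known at
    \<open>u i\<close>. Setting the coefficient to 0 on degenerate steps makes its square bounded by
    \<open>\<delta>\<close> over the step length, hence integrable; such a step contributes nothing
    to the sum.\<close>
  define \<eta> where "\<eta> i \<omega> = (if u i < u (Suc i) then \<xi> i \<omega> * indicator {\<omega>\<in>space M. V (Suc i) \<omega> \<le> \<delta>} \<omega> else 0)"
    for i \<omega>
  have V_set: "{\<omega>\<in>space M. V (Suc i) \<omega> \<le> \<delta>} \<in> sets (F (u i))" if "i < n" for i
    using borel_measurable_le[OF V_meas[OF that] borel_measurable_const] F_space[of "u i"] by simp
  have \<eta>_meas: "\<eta> i \<in> borel_measurable (F (u i))" if "i < n" for i
    unfolding \<eta>_def using \<xi>[OF that] V_set[OF that]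
    by (cases "u i < u (Suc i)") (auto intro!: borel_measurable_times borel_measurable_indicator)
  have term_le: "(\<xi> i \<omega>)\<^sup>2 * (u (Suc i) - u i) \<le> V (Suc i) \<omega>" for i \<omega>
    unfolding V_def using u0 by (auto intro!: sum_nonneg mult_nonneg_nonneg)
  have \<eta>_sq: "(\<eta> i \<omega>)\<^sup>2 \<le> \<delta> / (u (Suc i) - u i)" for i \<omega>
  proof (cases "u i < u (Suc i) \<and> V (Suc i) \<omega> \<le> \<delta> \<and> \<omega> \<in> space M")
    case True
    then have "(\<xi> i \<omega>)\<^sup>2 * (u (Suc i) - u i) \<le> \<delta>" using term_le[of i \<omega>] by simp
    then show ?thesis using True by (simp add: \<eta>_def pos_le_divide_eq)
  next
    case False
    then have "\<eta> i \<omega> = 0" by (auto simp: \<eta>_def)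
    then show ?thesis using pos u0(2)[of i] by simp
  qed
  have \<eta>: "\<eta> i \<in> L2F (u i)" if "i < n" for i
  proof (rule L2F_I[OF \<eta>_meas[OF that]])
    have "\<eta> i \<in> borel_measurable M" using \<eta>_meas[OF that] by (rule F_measurable_M)
    then show "integrable M (\<lambda>\<omega>. (\<eta> i \<omega>)\<^sup>2)"
      using \<eta>_sq[of i]
      by (intro integrable_const_bound[where B="\<delta> / (u (Suc i) - u i)"])
        (auto intro: borel_measurable_power)
  qed
  have \<eta>_sum: "(\<Sum>i<k. (\<eta> i \<omega>)\<^sup>2 * (u (Suc i) - u i)) \<le> min \<delta> (V k \<omega>)" for k \<omega>
  proof (induction k)
    case 0
    then show ?case using pos by (simp add: V_def)
  next
    case (Suc k)
    show ?case
    proof (cases "u k < u (Suc k) \<and> V (Suc k) \<omega> \<le> \<delta> \<and> \<omega> \<in> space M")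
      case True
      then have "\<eta> k \<omega> = \<xi> k \<omega>" by (simp add: \<eta>_def)
      then show ?thesis using Suc True by (simp add: V_def)
    next
      case False
      then have "\<eta> k \<omega> = 0" by (auto simp: \<eta>_def)
      then show ?thesis using Suc V_mono[of k "Suc k" \<omega>] by simp
    qed
  qed
  let ?S = "\<lambda>\<omega>. \<Sum>i<n. \<eta> i \<omega> * dB (u i) (u (Suc i)) \<omega>"
  note iso = elementary_isometry[OF u \<eta>]
  have i\<eta>: "integrable M (\<lambda>\<omega>. (\<eta> i \<omega>)\<^sup>2)" if "i < n" for i
    using \<eta>[OF that] by (simp add: L2F_def L2_def)
  have "(\<integral>\<omega>. (?S \<omega>)\<^sup>2 \<partial>M) = (\<integral>\<omega>. (\<Sum>i<n. (\<eta> i \<omega>)\<^sup>2 * (u (Suc i) - u i)) \<partial>M)"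
    using i\<eta> by (simp add: iso(2))
  also have "\<dots> \<le> (\<integral>\<omega>. \<delta> \<partial>M)"
    using i\<eta> \<eta>_sum[of _ n] by (intro integral_mono Bochner_Integration.integrable_sum) auto
  finally have ES: "(\<integral>\<omega>. (?S \<omega>)\<^sup>2 \<partial>M) \<le> \<delta>" by (simp add: prob_space)
  have S2: "?S \<in> L2 M" by (rule L2F_L2[OF iso(1)])
  have "prob {\<omega>\<in>space M. \<epsilon>\<^sup>2 \<le> (?S \<omega>)\<^sup>2} \<le> (\<integral>\<omega>. (?S \<omega>)\<^sup>2 \<partial>M) / \<epsilon>\<^sup>2"
    using pos by (intro integral_Markov_inequality_measure[where A="{}"] L2_integrable_square[OF S2]) auto
  also have "\<dots> \<le> \<delta> / \<epsilon>\<^sup>2" using ES pos by (simp add: divide_right_mono)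
  finally have Markov: "prob {\<omega>\<in>space M. \<epsilon>\<^sup>2 \<le> (?S \<omega>)\<^sup>2} \<le> \<delta> / \<epsilon>\<^sup>2" .
  have V_M: "V n \<in> borel_measurable M"
    unfolding V_def using F_measurable_M[OF \<xi>]
    by (intro borel_measurable_sum borel_measurable_times borel_measurable_power borel_measurable_const) auto
  have sV: "{\<omega>\<in>space M. \<delta> < V n \<omega>} \<in> events"
    by (rule borel_measurable_less[OF borel_measurable_const V_M])
  have S_M: "(\<lambda>\<omega>. (?S \<omega>)\<^sup>2) \<in> borel_measurable M"
    using L2_measurable[OF S2] by (rule borel_measurable_power)
  have sS: "{\<omega>\<in>space M. \<epsilon>\<^sup>2 \<le> (?S \<omega>)\<^sup>2} \<in> events"
    by (rule borel_measurable_le[OF borel_measurable_const S_M])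
  have "{\<omega>\<in>space M. \<epsilon> < \<bar>\<Sum>i<n. \<xi> i \<omega> * dB (u i) (u (Suc i)) \<omega>\<bar>}
      \<subseteq> {\<omega>\<in>space M. \<delta> < V n \<omega>} \<union> {\<omega>\<in>space M. \<epsilon>\<^sup>2 \<le> (?S \<omega>)\<^sup>2}"
  proof
    fix \<omega> assume a: "\<omega> \<in> {\<omega>\<in>space M. \<epsilon> < \<bar>\<Sum>i<n. \<xi> i \<omega> * dB (u i) (u (Suc i)) \<omega>\<bar>}"
    show "\<omega> \<in> {\<omega>\<in>space M. \<delta> < V n \<omega>} \<union> {\<omega>\<in>space M. \<epsilon>\<^sup>2 \<le> (?S \<omega>)\<^sup>2}"
    proof (cases "V n \<omega> \<le> \<delta>")
      case True
      have "\<xi> i \<omega> * dB (u i) (u (Suc i)) \<omega> = \<eta> i \<omega> * dB (u i) (u (Suc i)) \<omega>" if "i < n" for i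
      proof (cases "u i < u (Suc i)")
        case True
        have "V (Suc i) \<omega> \<le> \<delta>" using V_mono[of "Suc i" n \<omega>] \<open>V n \<omega> \<le> \<delta>\<close> that by simp
        then show ?thesis using a True by (simp add: \<eta>_def)
      next
        case False
        then have "u (Suc i) = u i" using u0(2)[of i] by simp
        then show ?thesis by simp
      qed
      then have "(\<Sum>i<n. \<xi> i \<omega> * dB (u i) (u (Suc i)) \<omega>) = ?S \<omega>" by (intro sum.cong) auto
      then have "\<bar>\<epsilon>\<bar> \<le> \<bar>?S \<omega>\<bar>" using a pos by simp
      then have "\<epsilon>\<^sup>2 \<le> (?S \<omega>)\<^sup>2" by (simp only: abs_le_square_iff)
      then show ?thesis using a by simp
    qed (use a in auto)
  qed
  then have "prob {\<omega>\<in>space M. \<epsilon> < \<bar>\<Sum>i<n. \<xi> i \<omega> * dB (u i) (u (Suc i)) \<omega>\<bar>}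
      \<le> prob ({\<omega>\<in>space M. \<delta> < V n \<omega>} \<union> {\<omega>\<in>space M. \<epsilon>\<^sup>2 \<le> (?S \<omega>)\<^sup>2})"
    using sV sS by (intro finite_measure_mono) auto
  also have "\<dots> \<le> prob {\<omega>\<in>space M. \<delta> < V n \<omega>} + prob {\<omega>\<in>space M. \<epsilon>\<^sup>2 \<le> (?S \<omega>)\<^sup>2}"
    using sV sS by (intro measure_Un_le) auto
  finally show ?thesis using Markov by (simp add: V_def)
qed

text \<open>The jump times, clamped to \<open>[s, t]\<close>, are merged with a uniform grid of
  \<open>Suc m\<close> cells. On the common refinement the elementary process is constant on each
  step, and the mesh obeys a bound that does not depend on the given jump times.\<close>

lemma elementary_integral_refinement:
  assumes el: "elementary_integrand F k \<tau> \<xi>" and st: "0 \<le> s" "s \<le> t"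
  shows "\<exists>n (u :: nat \<Rightarrow> real) (\<eta> :: nat \<Rightarrow> 'a \<Rightarrow> real). mono u \<and> u 0 = s \<and> u n = t \<and>
    (\<forall>i<n. u (Suc i) - u i \<le> (t - s) / Suc m) \<and>
    (\<forall>i<n. \<eta> i \<in> borel_measurable (F (u i))) \<and>
    (\<forall>\<omega>. (\<Sum>i<n. \<eta> i \<omega> * dB (u i) (u (Suc i)) \<omega>)
      = elementary_integral B k \<tau> \<xi> t \<omega> - elementary_integral B k \<tau> \<xi> s \<omega>) \<and>
    (\<forall>i<n. \<forall>r \<omega>. u i < r \<longrightarrow> r \<le> u (Suc i) \<longrightarrow> elementary_process k \<tau> \<xi> r \<omega> = \<eta> i \<omega>)"
proof -
  have \<tau>: "0 \<le> \<tau> 0" "mono \<tau>" and \<xi>: "\<And>i. i < k \<Longrightarrow> \<xi> i \<in> borel_measurable (F (\<tau> i))"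
    using el by (auto simp: elementary_integrand_def)
  define c where "c x = max s (min t x)" for x
  define g where "g j = s + real j * ((t - s) / Suc m)" for j
  define U where "U = (\<lambda>i. c (\<tau> i)) ` {..k} \<union> g ` {..Suc m}"
  have g0: "g 0 = s" by (simp add: g_def)
  have gm: "g (Suc m) = t" by (simp add: g_def)
  have g_mono: "g i \<le> g j" if "i \<le> j" for i j
    unfolding g_def using that st by (intro add_left_mono mult_right_mono) auto
  have U_range: "U \<subseteq> {s..t}"
  proof -
    have "g j \<in> {s..t}" if "j \<le> Suc m" for j
      using g_mono[of 0 j] g_mono[OF that] by (simp add: g0 gm)
    then show ?thesis using st by (auto simp: U_def c_def)
  qed
  have "g 0 \<in> U" "g (Suc m) \<in> U" unfolding U_def by auto
  then have sU: "s \<in> U" and tU: "t \<in> U" by (simp_all only: g0 gm)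
  have "finite U" "U \<noteq> {}" using sU by (auto simp: U_def)
  from finite_set_enumeration[OF this] obtain u :: "nat \<Rightarrow> real" and n where u_n: "mono u \<and> u ` {..n} = U \<and>
    (\<forall>i j. i < j \<longrightarrow> j \<le> n \<longrightarrow> u i < u j) \<and> (\<forall>i. u i \<in> U)" by (elim exE)
  have u: "mono u" "u ` {..n} = U" "\<And>i j. i < j \<Longrightarrow> j \<le> n \<Longrightarrow> u i < u j" and uU: "\<And>i. u i \<in> U"
    using u_n by simp_all
  have ust: "s \<le> u i" "u i \<le> t" for i using uU[of i] U_range by auto
  have "s \<in> u ` {..n}" "t \<in> u ` {..n}" using sU tU u(2) by auto
  then obtain p q where "p \<le> n" "u p = s" "q \<le> n" "u q = t" by auto
  then have u0: "u 0 = s" and un: "u n = t"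
    using monoD[OF u(1), of 0 p] monoD[OF u(1), of q n] ust[of 0] ust[of n] by auto
  have consecutive: "x \<le> u i" if "x \<in> U" "x < u (Suc i)" "i < n" for x i
  proof -
    obtain j where j: "j \<le> n" "x = u j" using \<open>x \<in> U\<close> u(2) by auto
    have "\<not> Suc i \<le> j" using monoD[OF u(1), of "Suc i" j] that(2) j(2) by auto
    then show ?thesis using monoD[OF u(1), of j i] j(2) by simp
  qed
  \<comment> \<open>Evaluation at the right end, because the cells are open on the left; the value
    is nevertheless known at the left end, as shown below.\<close>
  define \<eta> where "\<eta> i = elementary_process k \<tau> \<xi> (u (Suc i))" for i
  have cl: "\<tau> l < r \<longleftrightarrow> c (\<tau> l) < r" if "s < r" "r \<le> t" for l r
    using that by (auto simp: c_def)
  have left: "\<tau> l < r \<longleftrightarrow> c (\<tau> l) \<le> u i" if "l \<le> k" "i < n" "u i < r" "r \<le> u (Suc i)" for l i r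
  proof -
    have r: "s < r" "r \<le> t" using ust[of i] ust[of "Suc i"] that by auto
    have "c (\<tau> l) \<in> U" using that by (auto simp: U_def)
    then have "c (\<tau> l) < r \<longleftrightarrow> c (\<tau> l) \<le> u i"
      using consecutive[of "c (\<tau> l)" i] that by auto
    then show ?thesis using cl[OF r] by simp
  qed
  have ind: "indicator {\<tau> l<..\<tau> (Suc l)} r = (if c (\<tau> l) \<le> u i \<and> \<not> c (\<tau> (Suc l)) \<le> u i then 1 else 0 :: real)"
    if "l < k" "i < n" "u i < r" "r \<le> u (Suc i)" for l i r
    using left[of l i r] left[of "Suc l" i r] that by (auto simp: indicator_def not_less[symmetric])
  have proc: "elementary_process k \<tau> \<xi> r \<omega>
      = (\<Sum>l<k. \<xi> l \<omega> * (if c (\<tau> l) \<le> u i \<and> \<not> c (\<tau> (Suc l)) \<le> u i then 1 else 0))"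
    if "i < n" "u i < r" "r \<le> u (Suc i)" for i r \<omega>
    unfolding elementary_process_def using that by (intro sum.cong) (simp_all add: ind)
  have \<eta>_eq: "\<eta> i \<omega> = (\<Sum>l<k. \<xi> l \<omega> * (if c (\<tau> l) \<le> u i \<and> \<not> c (\<tau> (Suc l)) \<le> u i then 1 else 0))"
    if "i < n" for i \<omega>
    unfolding \<eta>_def using proc[OF that, of "u (Suc i)" \<omega>] u(3)[of i "Suc i"] that by simp
  show ?thesis
  proof (intro exI[of _ n] exI[of _ u] exI[of _ \<eta>] conjI allI impI u(1) u0 un)
    show "u (Suc i) - u i \<le> (t - s) / Suc m" if i: "i < n" for i
    proof -
      \<comment> \<open>The last grid point not beyond \<open>u i\<close>. The next one belongs to
        \<open>U\<close> and lies beyond \<open>u i\<close>, so it is at least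
        \<open>u (Suc i)\<close>.\<close>
      define j where "j = Max {j. j \<le> m \<and> g j \<le> u i}"
      have fin: "finite {j. j \<le> m \<and> g j \<le> u i}" by simp
      have "0 \<in> {j. j \<le> m \<and> g j \<le> u i}" using ust(1)[of i] g0 by simp
      then have "j \<in> {j. j \<le> m \<and> g j \<le> u i}" unfolding j_def by (intro Max_in[OF fin]) blast
      then have j: "j \<le> m" "g j \<le> u i" by simp_all
      have jmax: "j' \<le> j" if "j' \<le> m" "g j' \<le> u i" for j'
        unfolding j_def using that by (intro Max_ge[OF fin]) simp
      have "\<not> g (Suc j) \<le> u i"
      proof (cases "Suc j \<le> m")
        case True
        then show ?thesis using jmax[of "Suc j"] by auto
      next
        case False
        then have "Suc j = Suc m" using j(1) by simp
        moreover have "u i < t" using u(3)[of i n] i un by simp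
        ultimately show ?thesis using gm by simp
      qed
      moreover have "g (Suc j) \<in> U" using j(1) by (auto simp: U_def)
      ultimately have "u (Suc i) \<le> g (Suc j)" using consecutive[of "g (Suc j)" i] i by force
      moreover have "g (Suc j) - g j = (t - s) / Suc m"
        unfolding g_def by (simp add: ring_distribs(2) del: times_divide_eq_right)
      ultimately show ?thesis using j(2) by linarith
    qed
    show "\<eta> i \<in> borel_measurable (F (u i))" if i: "i < n" for i
    proof -
      have "(\<lambda>\<omega>. \<xi> l \<omega> * (if c (\<tau> l) \<le> u i \<and> \<not> c (\<tau> (Suc l)) \<le> u i then 1 else 0)) \<in> borel_measurable (F (u i))"
        if "l < k" for l
      proof (cases "c (\<tau> l) \<le> u i")
        case True
        \<comment> \<open>Below \<open>t\<close> the clamp from above is inactive: a clamped jump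
          time at most \<open>u i\<close> means that the jump time itself is at most
          \<open>u i\<close>.\<close>
        have "u i < t" using u(3)[of i n] i un by simp
        then have "\<tau> l \<le> u i" using True by (auto simp: c_def)
        then have "\<xi> l \<in> borel_measurable (F (u i))" using \<xi>[OF that] F_measurable_mono by blast
        then show ?thesis by (intro borel_measurable_times borel_measurable_const)
      qed simp
      then have "(\<lambda>\<omega>. \<Sum>l<k. \<xi> l \<omega> * (if c (\<tau> l) \<le> u i \<and> \<not> c (\<tau> (Suc l)) \<le> u i then 1 else 0))
          \<in> borel_measurable (F (u i))"
        by (intro borel_measurable_sum) auto
      then show ?thesis using \<eta>_eq[OF i] by presburger
    qed
    show "elementary_process k \<tau> \<xi> r \<omega> = \<eta> i \<omega>" if "i < n" "u i < r" "r \<le> u (Suc i)" for i r \<omega>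
      using proc[OF that] \<eta>_eq[OF that(1)] by simp
    show "(\<Sum>i<n. \<eta> i \<omega> * dB (u i) (u (Suc i)) \<omega>)
      = elementary_integral B k \<tau> \<xi> t \<omega> - elementary_integral B k \<tau> \<xi> s \<omega>" for \<omega>
    proof -
      have tele: "(\<Sum>i<n. (if c (\<tau> l) \<le> u i \<and> \<not> c (\<tau> (Suc l)) \<le> u i then 1 else 0) * dB (u i) (u (Suc i)) \<omega>)
          = B (c (\<tau> (Suc l))) \<omega> - B (c (\<tau> l)) \<omega>" if "l < k" for l
      proof -
        have "c (\<tau> l) \<in> U" "c (\<tau> (Suc l)) \<in> U" using that by (auto simp: U_def)
        then obtain p q where p: "p \<le> n" "c (\<tau> l) = u p" and q: "q \<le> n" "c (\<tau> (Suc l)) = u q"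
          using u(2) by (metis atMost_iff imageE)
        have cm: "c (\<tau> l) \<le> c (\<tau> (Suc l))"
          using monoD[OF \<tau>(2), of l "Suc l"] by (auto simp: c_def)
        have iff: "u a \<le> u i \<longleftrightarrow> a \<le> i" if "a \<le> n" "i < n" for a i
          using u(3)[of i a] monoD[OF u(1), of a i] that by (meson leD linorder_le_less_linear)
        have pq: "p \<le> q"
        proof (rule ccontr)
          assume "\<not> p \<le> q"
          then have "u q < u p" using u(3)[of q p] p(1) by simp
          then show False using cm p q by simp
        qed
        have "(\<Sum>i<n. (if c (\<tau> l) \<le> u i \<and> \<not> c (\<tau> (Suc l)) \<le> u i then 1 else 0) * dB (u i) (u (Suc i)) \<omega>)
            = (\<Sum>i<n. (if p \<le> i \<and> i < q then 1 else 0) * (B (u (Suc i)) \<omega> - B (u i) \<omega>))"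
          using p q iff by (intro sum.cong) (auto simp: not_le)
        also have "\<dots> = B (u q) \<omega> - B (u p) \<omega>" by (rule indicator_telescope[OF pq q(1)])
        finally show ?thesis using p q by simp
      qed
      \<comment> \<open>Clamping to \<open>[s, t]\<close> turns the difference of the integrals up
        to \<open>t\<close> and up to \<open>s\<close> into a single sum.\<close>
      have clamp: "B (c x) \<omega> - B s \<omega> = B (min t x) \<omega> - B (min s x) \<omega>" for x
      proof (cases "x \<le> s")
        case True
        then have "c x = s" "min t x = x" "min s x = x" using st by (auto simp: c_def)
        then show ?thesis by simp
      next
        case False
        then have "c x = min t x" "min s x = s" using st by (auto simp: c_def)
        then show ?thesis by simp
      qed
      have "(\<Sum>i<n. \<eta> i \<omega> * dB (u i) (u (Suc i)) \<omega>)
        = (\<Sum>i<n. \<Sum>l<k. \<xi> l \<omega> * ((if c (\<tau> l) \<le> u i \<and> \<not> c (\<tau> (Suc l)) \<le> u i then 1 else 0) * dB (u i) (u (Suc i)) \<omega>))"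
        by (intro sum.cong) (simp_all add: \<eta>_eq sum_distrib_right mult.assoc)
      also have "\<dots> = (\<Sum>l<k. \<xi> l \<omega> * (B (c (\<tau> (Suc l))) \<omega> - B (c (\<tau> l)) \<omega>))"
        by (subst sum.swap) (intro sum.cong refl, simp add: sum_distrib_left[symmetric] tele)
      also have "\<dots> = elementary_integral B k \<tau> \<xi> t \<omega> - elementary_integral B k \<tau> \<xi> s \<omega>"
        unfolding elementary_integral_def sum_subtractf[symmetric]
      proof (intro sum.cong refl)
        fix l
        show "\<xi> l \<omega> * (B (c (\<tau> (Suc l))) \<omega> - B (c (\<tau> l)) \<omega>)
          = \<xi> l \<omega> * (B (min t (\<tau> (Suc l))) \<omega> - B (min t (\<tau> l)) \<omega>)
            - \<xi> l \<omega> * (B (min s (\<tau> (Suc l))) \<omega> - B (min s (\<tau> l)) \<omega>)"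
          using clamp[of "\<tau> l"] clamp[of "\<tau> (Suc l)"] by (simp add: right_diff_distrib[symmetric])
      qed
      finally show ?thesis .
    qed
  qed
qed

end

section \<open>Sampling at partition points and passage to almost sure limits\<close>

lemma sum_disjoint_indicator_le:
  fixes u c :: "nat \<Rightarrow> real"
  assumes u: "mono u" and X: "\<And>i. i < n \<Longrightarrow> u i < r \<Longrightarrow> r \<le> u (Suc i) \<Longrightarrow> c i \<le> X" "0 \<le> X"
  shows "(\<Sum>i<n. c i * indicator {u i<..u (Suc i)} r) \<le> X"
proof (cases "\<exists>i<n. u i < r \<and> r \<le> u (Suc i)")
  case True
  then obtain i where i: "i < n" "u i < r" "r \<le> u (Suc i)" by blast
  have "indicator {u j<..u (Suc j)} r = (0 :: real)" if "j \<noteq> i" for j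
  proof -
    have "Suc j \<le> i \<or> Suc i \<le> j" using that by linarith
    then have "u (Suc j) \<le> u i \<or> u (Suc i) \<le> u j" using u by (meson monoD)
    then show ?thesis using i by (auto simp: indicator_def)
  qed
  then have "(\<Sum>j<n. c j * indicator {u j<..u (Suc j)} r) = (\<Sum>j\<in>{i}. c j * indicator {u j<..u (Suc j)} r)"
    using i(1) by (intro sum.mono_neutral_right) auto
  also have "\<dots> \<le> X" using X i by simp
  finally show ?thesis .
next
  case False
  then have "(\<Sum>i<n. c i * indicator {u i<..u (Suc i)} r) = (\<Sum>i<n. 0)"
    by (intro sum.cong) (auto simp: indicator_def)
  then show ?thesis using X(2) by simp
qed

text \<open>The weighted sum is the integral of a step function and is compared pointwise with the
  integrand. This is the passage from a square distance integrated over time to one sampled at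
  partition points.\<close>

lemma weighted_sum_le_integral:
  fixes u c :: "nat \<Rightarrow> real"
  assumes u: "mono u" "0 \<le> u 0" "u n \<le> t" and c: "\<And>i. i < n \<Longrightarrow> 0 \<le> c i"
    and f [measurable]: "(\<lambda>r. f r * indicator {0..t} r) \<in> borel_measurable borel"
    and le: "\<And>i r. i < n \<Longrightarrow> u i < r \<Longrightarrow> r \<le> u (Suc i) \<Longrightarrow> c i \<le> f r + K" and K: "0 \<le> K"
      "\<And>r. 0 \<le> f r"
  shows "ennreal (\<Sum>i<n. c i * (u (Suc i) - u i)) \<le> (\<integral>\<^sup>+r\<in>{0..t}. ennreal (f r) \<partial>lborel) + ennreal (K * (u n - u 0))"
proof -
  have mono: "u i \<le> u (Suc i)" for i using u(1) by (simp add: mono_iff_le_Suc)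
  have range: "0 \<le> u i" "i \<le> n \<Longrightarrow> u i \<le> t" "u 0 \<le> u i" "i \<le> n \<Longrightarrow> u i \<le> u n" for i
    using monoD[OF u(1), of 0 i] monoD[OF u(1), of i n] u by auto
  have "ennreal (\<Sum>i<n. c i * (u (Suc i) - u i))
      = (\<Sum>i<n. ennreal (c i) * emeasure lborel {u i<..u (Suc i)})"
    using c mono by (subst sum_ennreal[symmetric]) (auto intro!: sum.cong simp: ennreal_mult)
  also have "\<dots> = (\<Sum>i<n. \<integral>\<^sup>+r. ennreal (c i) * indicator {u i<..u (Suc i)} r \<partial>lborel)"
    by (intro sum.cong refl) (simp add: nn_integral_cmult_indicator)
  also have "\<dots> = (\<integral>\<^sup>+r. (\<Sum>i<n. ennreal (c i) * indicator {u i<..u (Suc i)} r) \<partial>lborel)"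
    by (rule nn_integral_sum[symmetric]) simp
  also have "\<dots> \<le> (\<integral>\<^sup>+r. ennreal (f r * indicator {0..t} r) + ennreal K * indicator {u 0<..u n} r \<partial>lborel)"
  proof (rule nn_integral_mono)
    fix r
    have "(\<Sum>i<n. ennreal (c i) * indicator {u i<..u (Suc i)} r)
        = ennreal (\<Sum>i<n. c i * indicator {u i<..u (Suc i)} r)"
    proof -
      have "(\<Sum>i<n. ennreal (c i) * indicator {u i<..u (Suc i)} r)
          = (\<Sum>i<n. ennreal (c i * indicator {u i<..u (Suc i)} r))"
        by (intro sum.cong refl) (simp add: indicator_def)
      also have "\<dots> = ennreal (\<Sum>i<n. c i * indicator {u i<..u (Suc i)} r)"
        using c by (intro sum_ennreal mult_nonneg_nonneg) auto
      finally show ?thesis .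
    qed
    also have "\<dots> \<le> ennreal (f r * indicator {0..t} r + K * indicator {u 0<..u n} r)"
    proof (intro ennreal_leI sum_disjoint_indicator_le[OF u(1)])
      show "0 \<le> f r * indicator {0..t} r + K * indicator {u 0<..u n} r" using K by (auto simp: indicator_def)
      fix i assume i: "i < n" "u i < r" "r \<le> u (Suc i)"
      then have "r \<in> {0..t}" "r \<in> {u 0<..u n}"
        using range(1,3)[of i] range(2,4)[of "Suc i"] by auto
      then show "c i \<le> f r * indicator {0..t} r + K * indicator {u 0<..u n} r"
        using le[OF i] by simp
    qed
    also have "\<dots> = ennreal (f r * indicator {0..t} r) + ennreal K * indicator {u 0<..u n} r"
      using K by (auto simp: indicator_def ennreal_plus)
    finally show "(\<Sum>i<n. ennreal (c i) * indicator {u i<..u (Suc i)} r)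
      \<le> ennreal (f r * indicator {0..t} r) + ennreal K * indicator {u 0<..u n} r" .
  qed
  also have "\<dots> = (\<integral>\<^sup>+r. ennreal (f r * indicator {0..t} r) \<partial>lborel) + ennreal K * emeasure lborel {u 0<..u n}"
    by (subst nn_integral_add) (simp_all add: nn_integral_cmult_indicator)
  also have "(\<integral>\<^sup>+r. ennreal (f r * indicator {0..t} r) \<partial>lborel) = (\<integral>\<^sup>+r\<in>{0..t}. ennreal (f r) \<partial>lborel)"
    by (intro nn_integral_cong) (auto simp: indicator_def)
  also have "ennreal K * emeasure lborel {u 0<..u n} = ennreal (K * (u n - u 0))"
    using K range(3)[of n] by (simp add: ennreal_mult)
  finally show ?thesis .
qed

text \<open>Thresholds and probabilities \<open>(1/2)^j\<close> make Borel-Cantelli applicable. The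
  indices are arranged to satisfy \<open>j \<le> \<phi> j\<close>, which is what transfers mesh
  bounds to the selected partitions.\<close>

lemma (in prob_space) in_probability_imp_AE_subsequence:
  fixes Z :: "nat \<Rightarrow> 'a \<Rightarrow> real"
  assumes Z: "\<And>m. Z m \<in> borel_measurable M"
    and lim: "\<And>\<epsilon> \<theta>. 0 < \<epsilon> \<Longrightarrow> 0 < \<theta> \<Longrightarrow> eventually (\<lambda>m. prob {\<omega>\<in>space M. \<epsilon> < \<bar>Z m \<omega>\<bar>} < \<theta>) sequentially"
  obtains \<phi> :: "nat \<Rightarrow> nat" where "\<And>j. j \<le> \<phi> j" "AE \<omega> in M. (\<lambda>j. Z (\<phi> j) \<omega>) \<longlonglongrightarrow> 0"
proof -
  have "\<exists>m\<ge>j. prob {\<omega>\<in>space M. (1/2)^j < \<bar>Z m \<omega>\<bar>} < (1/2)^j" for j :: nat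
  proof -
    have "eventually (\<lambda>m. prob {\<omega>\<in>space M. (1/2)^j < \<bar>Z m \<omega>\<bar>} < (1/2)^j) sequentially"
      by (rule lim) auto
    then have "eventually (\<lambda>m. j \<le> m \<and> prob {\<omega>\<in>space M. (1/2)^j < \<bar>Z m \<omega>\<bar>} < (1/2)^j) sequentially"
      using eventually_ge_at_top[of j] by eventually_elim simp
    then show ?thesis by (auto simp: eventually_sequentially)
  qed
  then obtain \<phi> where \<phi>: "\<And>j. j \<le> \<phi> j" "\<And>j. prob {\<omega>\<in>space M. (1/2)^j < \<bar>Z (\<phi> j) \<omega>\<bar>} < (1/2)^j"
    by metis
  define A where "A j = {\<omega>\<in>space M. (1/2)^j < \<bar>Z (\<phi> j) \<omega>\<bar>}" for j
  have A: "A j \<in> events" for j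
    unfolding A_def by (rule borel_measurable_less[OF borel_measurable_const borel_measurable_abs[OF Z]])
  have "AE \<omega> in M. eventually (\<lambda>j. \<omega> \<in> space M - A j) sequentially"
  proof (rule borel_cantelli_AE1[OF A])
    show "emeasure M (A j) < \<infinity>" for j by (simp add: less_top[symmetric])
    show "summable (\<lambda>j. prob (A j))"
    proof (rule summable_comparison_test[of _ "\<lambda>j. (1/2::real)^j"])
      show "\<exists>N. \<forall>n\<ge>N. norm (prob (A n)) \<le> (1/2)^n"
        using \<phi>(2) by (auto simp: A_def less_imp_le)
    qed (simp add: summable_geometric)
  qed
  then have "AE \<omega> in M. (\<lambda>j. Z (\<phi> j) \<omega>) \<longlonglongrightarrow> 0"
  proof eventually_elim
    case (elim \<omega>)
    then have "eventually (\<lambda>j. norm (Z (\<phi> j) \<omega>) \<le> (1/2)^j) sequentially"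
      by eventually_elim (auto simp: A_def)
    moreover have "(\<lambda>j. (1/2::real)^j) \<longlonglongrightarrow> 0" by (rule LIMSEQ_power_zero) simp
    ultimately show ?case by (rule Lim_null_comparison)
  qed
  then show ?thesis using that \<phi>(1) by blast
qed

text \<open>Dominated convergence for indicators. It converts smallness along each path into small
  probability without any uniformity in \<open>\<omega>\<close>.\<close>

lemma (in prob_space) pointwise_null_imp_prob_null:
  assumes D: "\<And>m. D m \<in> events" and lim: "AE \<omega> in M. eventually (\<lambda>m. \<omega> \<notin> D m) sequentially"
  shows "(\<lambda>m. prob (D m)) \<longlonglongrightarrow> 0"
proof -
  have "(\<lambda>m. \<integral>\<omega>. indicator (D m) \<omega> \<partial>M) \<longlonglongrightarrow> (\<integral>\<omega>. (0 :: real) \<partial>M)"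
  proof (rule integral_dominated_convergence[where w="\<lambda>_. 1"])
    show "AE \<omega> in M. (\<lambda>m. indicator (D m) \<omega>) \<longlonglongrightarrow> (0 :: real)"
      using lim
    proof eventually_elim
      case (elim \<omega>)
      then have "eventually (\<lambda>m. indicator (D m) \<omega> = (0 :: real)) sequentially"
        by eventually_elim simp
      then show ?case by (rule tendsto_eventually)
    qed
  qed (use D in \<open>auto simp: indicator_def\<close>)
  then show ?thesis using D sets.sets_into_space[OF D] by (simp add: Int_absorb2)
qed

lemma null_in_probabilityD:
  assumes "null_in_probability M Z" "0 < \<epsilon>" "0 < \<delta>"
  shows "eventually (\<lambda>n. \<exists>A\<in>sets M. {\<omega> \<in> space M. ennreal \<epsilon> < Z n \<omega>} \<subseteq> A \<and> measure M A < \<delta>) sequentially"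
  using assms by (simp add: null_in_probability_def)

lemma (in prob_space) null_in_probability_prob:
  assumes null: "null_in_probability M (\<lambda>n \<omega>. ennreal \<bar>Z n \<omega>\<bar>)"
    and \<epsilon>: "0 < \<epsilon>" "0 < \<theta>"
  shows "eventually (\<lambda>m. prob {\<omega>\<in>space M. \<epsilon> < \<bar>Z m \<omega> :: real\<bar>} < \<theta>) sequentially"
proof -
  have "eventually (\<lambda>n. \<exists>A\<in>events. {\<omega> \<in> space M. ennreal \<epsilon> < ennreal \<bar>Z n \<omega>\<bar>} \<subseteq> A \<and> prob A < \<theta>) sequentially"
    using null \<epsilon> by (auto simp: null_in_probability_def)
  then show ?thesis
  proof eventually_elim
    case (elim n)
    then obtain A where A: "A \<in> events" "{\<omega> \<in> space M. ennreal \<epsilon> < ennreal \<bar>Z n \<omega>\<bar>} \<subseteq> A" "prob A < \<theta>"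
      by blast
    have "{\<omega> \<in> space M. \<epsilon> < \<bar>Z n \<omega>\<bar>} \<subseteq> A" using A(2) \<epsilon> by (auto simp: ennreal_less_iff)
    then have "prob {\<omega> \<in> space M. \<epsilon> < \<bar>Z n \<omega>\<bar>} \<le> prob A" using A(1) by (rule finite_measure_mono)
    then show ?case using A(3) by simp
  qed
qed

context brownian_filtration
begin

text \<open>Freezing \<open>H\<close> at the left end of a step costs twice the square distance of
  \<open>\<phi>\<close> and \<open>H\<close> integrated over time, small in probability by
  assumption, plus twice the squared oscillation of \<open>H\<close> over a step, small along each
  continuous path. The two modes of smallness are combined by removing an event for the first and
  applying dominated convergence to what remains.\<close>

lemma elementary_square_distance_null:
  fixes u :: "nat \<Rightarrow> nat \<Rightarrow> real" and \<eta> :: "nat \<Rightarrow> nat \<Rightarrow> 'a \<Rightarrow> real"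
  assumes H: "\<And>t. 0 \<le> t \<Longrightarrow> H t \<in> borel_measurable M"
    and Hc: "AE \<omega> in M. continuous_on {0..} (\<lambda>t. H t \<omega>)"
    and \<phi>m: "\<And>m \<omega>. (\<lambda>r. \<phi> m r \<omega>) \<in> borel_measurable borel"
    and null: "null_in_probability M (\<lambda>m \<omega>. \<integral>\<^sup>+r\<in>{0..t}. ennreal ((\<phi> m r \<omega> - H r \<omega>)\<^sup>2) \<partial>lborel)"
    and s: "0 \<le> s"
    and u: "\<And>m. mono (u m)" "\<And>m. u m 0 = s" "\<And>m. u m (N m) = t"
    and mesh: "\<And>m i. i < N m \<Longrightarrow> u m (Suc i) - u m i \<le> (t - s) / Suc m"
    and \<eta>: "\<And>m i. i < N m \<Longrightarrow> \<eta> m i \<in> borel_measurable M"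
    and \<phi>\<eta>: "\<And>m i r \<omega>. i < N m \<Longrightarrow> u m i < r \<Longrightarrow> r \<le> u m (Suc i) \<Longrightarrow> \<phi> m r \<omega> = \<eta> m i \<omega>"
    and \<delta>: "0 < \<delta>" "0 < \<theta>"
  shows "eventually (\<lambda>m. prob {\<omega>\<in>space M. \<delta> < (\<Sum>i<N m. (\<eta> m i \<omega> - H (u m i) \<omega>)\<^sup>2 * (u m (Suc i) - u m i))} < \<theta>)
    sequentially"
proof -
  define V where "V m \<omega> = (\<Sum>i<N m. (\<eta> m i \<omega> - H (u m i) \<omega>)\<^sup>2 * (u m (Suc i) - u m i))" for m \<omega>
  have um: "u m i \<le> u m (Suc i)" "s \<le> u m i" "i \<le> N m \<Longrightarrow> u m i \<le> t" for m i
    using monoD[OF u(1), of 0 i m] monoD[OF u(1), of i "Suc i" m] monoD[OF u(1), of i "N m" m] u(2,3) by auto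
  have st: "s \<le> t" using um(3)[of 0 0] u(2)[of 0] by simp
  have V: "V m \<in> borel_measurable M" for m
    unfolding V_def using \<eta>
    by (intro borel_measurable_sum borel_measurable_times borel_measurable_power borel_measurable_diff
        borel_measurable_const H order_trans[OF s um(2)]) auto
  define bad where "bad m = {\<omega> \<in> space M. ennreal (\<delta>/8) <
      (\<integral>\<^sup>+r\<in>{0..t}. ennreal ((\<phi> m r \<omega> - H r \<omega>)\<^sup>2) \<partial>lborel)}" for m
  have "eventually (\<lambda>m. \<exists>A\<in>events. bad m \<subseteq> A \<and> prob A < \<theta>/2) sequentially"
    unfolding bad_def by (rule null_in_probabilityD[OF null]) (use \<delta> in simp_all)
  then obtain m0 where m0: "\<And>m. m0 \<le> m \<Longrightarrow> \<exists>A\<in>events. bad m \<subseteq> A \<and> prob A < \<theta>/2"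
    unfolding eventually_sequentially by blast
  \<comment> \<open>\<open>bad m\<close> is not known to be an event, so a measurable cover is
    chosen. For \<open>m\<close> below \<open>m0\<close> none is guaranteed, whence the empty set in
    \<open>D\<close>.\<close>
  define A where "A m = (SOME A. A \<in> events \<and> bad m \<subseteq> A \<and> prob A < \<theta>/2)" for m
  have "A m \<in> events \<and> bad m \<subseteq> A m \<and> prob (A m) < \<theta>/2" if "m0 \<le> m" for m
    unfolding A_def by (rule someI_ex) (use m0[OF that] in blast)
  then have A: "\<And>m. m0 \<le> m \<Longrightarrow> A m \<in> events" "\<And>m. m0 \<le> m \<Longrightarrow> prob (A m) < \<theta>/2"
    "\<And>m. m0 \<le> m \<Longrightarrow> bad m \<subseteq> A m"
    by blast+
  define D where "D m = (if m0 \<le> m then {\<omega>\<in>space M. \<delta> < V m \<omega>} - A m else {})" for m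
  have sV: "{\<omega>\<in>space M. \<delta> < V m \<omega>} \<in> events" for m
    by (rule borel_measurable_less[OF borel_measurable_const V])
  have D: "D m \<in> events" for m unfolding D_def using sV A(1) by auto
  have "AE \<omega> in M. eventually (\<lambda>m. \<omega> \<notin> D m) sequentially"
    using Hc
  proof eventually_elim
    case (elim \<omega>)
    have cont: "continuous_on {0..t} (\<lambda>r. H r \<omega>)" using elim by (rule continuous_on_subset) auto
    then have uc: "uniformly_continuous_on {0..t} (\<lambda>r. H r \<omega>)"
      by (rule compact_uniformly_continuous) simp
    \<comment> \<open>Chosen so that the oscillation contributes at most \<open>\<delta>/4\<close>;
      the integrated distance contributes at most another \<open>\<delta>/4\<close>, and the sum
      stays below \<open>\<delta>\<close>.\<close>
    define e where "e = sqrt (\<delta> / (8 * (t - s + 1)))"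
    have e: "0 < e" using \<delta> st by (simp add: e_def)
    have cancel: "y / (8 * x) * x = y / 8" if "0 < x" for x y :: real using that by simp
    have "e\<^sup>2 = \<delta> / (8 * (t - s + 1))" using \<delta> st by (simp add: e_def del: distrib_left)
    then have "e\<^sup>2 * (t - s + 1) = \<delta> / 8" using cancel[of "t - s + 1" \<delta>] st by simp
    moreover have "e\<^sup>2 * (t - s) \<le> e\<^sup>2 * (t - s + 1)" by (rule mult_left_mono) simp_all
    ultimately have e2: "e\<^sup>2 * (t - s) \<le> \<delta> / 8" by simp
    obtain d where d: "0 < d" "\<And>x y. x \<in> {0..t} \<Longrightarrow> y \<in> {0..t} \<Longrightarrow> dist y x < d \<Longrightarrow> dist (H y \<omega>) (H x \<omega>) < e"
      using uc e unfolding uniformly_continuous_on_def by metis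
    have "(\<lambda>m. (t - s) / real (Suc m)) \<longlonglongrightarrow> 0"
      using tendsto_mult_left[OF LIMSEQ_inverse_real_of_nat, of "t - s"] by (simp add: divide_inverse)
    then have "eventually (\<lambda>m. (t - s) / real (Suc m) < d) sequentially" using d(1) by (rule order_tendstoD)
    then show ?case
    proof eventually_elim
      case (elim m)
      show ?case
      proof
        assume "\<omega> \<in> D m"
        then have m: "m0 \<le> m" and \<omega>: "\<omega> \<in> space M" "\<delta> < V m \<omega>" "\<omega> \<notin> A m" by (auto simp: D_def split: if_splits)
        have W: "(\<integral>\<^sup>+r\<in>{0..t}. ennreal ((\<phi> m r \<omega> - H r \<omega>)\<^sup>2) \<partial>lborel) \<le> ennreal (\<delta>/8)"
          using subsetD[OF A(3)[OF m], of \<omega>] \<omega> unfolding bad_def by (intro leI) auto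
        have meas: "(\<lambda>r. (\<phi> m r \<omega> - H r \<omega>)\<^sup>2 * indicator {0..t} r) \<in> borel_measurable borel"
        proof -
          have "(\<lambda>r. indicator {0..t} r *\<^sub>R H r \<omega>) \<in> borel_measurable borel"
            by (intro borel_measurable_continuous_on_indicator cont) simp
          then have "(\<lambda>r. (\<phi> m r \<omega> - indicator {0..t} r *\<^sub>R H r \<omega>)\<^sup>2 * indicator {0..t} r) \<in> borel_measurable borel"
            using \<phi>m[of m \<omega>]
            by (intro borel_measurable_times borel_measurable_power borel_measurable_diff) auto
          moreover have "(\<lambda>r. (\<phi> m r \<omega> - indicator {0..t} r *\<^sub>R H r \<omega>)\<^sup>2 * indicator {0..t} r)
              = (\<lambda>r. (\<phi> m r \<omega> - H r \<omega>)\<^sup>2 * indicator {0..t} r)"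
            by (rule ext) (auto simp: indicator_def)
          ultimately show ?thesis by simp
        qed
        have "ennreal (V m \<omega>) \<le> (\<integral>\<^sup>+r\<in>{0..t}. ennreal (2 * (\<phi> m r \<omega> - H r \<omega>)\<^sup>2) \<partial>lborel)
            + ennreal (2 * e\<^sup>2 * (u m (N m) - u m 0))"
          unfolding V_def
        proof (rule weighted_sum_le_integral[OF u(1)])
          show "(\<lambda>r. 2 * (\<phi> m r \<omega> - H r \<omega>)\<^sup>2 * indicator {0..t} r) \<in> borel_measurable borel"
            using borel_measurable_times[OF borel_measurable_const meas, of 2] by (simp add: mult.assoc)
          fix i r assume i: "i < N m" "u m i < r" "r \<le> u m (Suc i)"
          have "\<bar>H r \<omega> - H (u m i) \<omega>\<bar> < e"
            using d(2)[of "u m i" r] i mesh[OF i(1)] elim um(2)[of m i] um(3)[of i m] um(3)[of "Suc i" m] s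
            by (auto simp: dist_real_def)
          then have "(H r \<omega> - H (u m i) \<omega>)\<^sup>2 \<le> e\<^sup>2" using e by (simp add: abs_le_square_iff[symmetric])
          moreover have "(\<eta> m i \<omega> - H (u m i) \<omega>)\<^sup>2
              \<le> 2 * (\<phi> m r \<omega> - H r \<omega>)\<^sup>2 + 2 * (H r \<omega> - H (u m i) \<omega>)\<^sup>2"
            using sum_power2_le[of "\<phi> m r \<omega> - H r \<omega>" "H r \<omega> - H (u m i) \<omega>"] \<phi>\<eta>[OF i] by simp
          ultimately show "(\<eta> m i \<omega> - H (u m i) \<omega>)\<^sup>2 \<le> 2 * (\<phi> m r \<omega> - H r \<omega>)\<^sup>2 + 2 * e\<^sup>2" by linarith
        qed (use u s in auto)
        also have "(\<integral>\<^sup>+r\<in>{0..t}. ennreal (2 * (\<phi> m r \<omega> - H r \<omega>)\<^sup>2) \<partial>lborel)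
            = (\<integral>\<^sup>+r. 2 * ennreal ((\<phi> m r \<omega> - H r \<omega>)\<^sup>2 * indicator {0..t} r) \<partial>lborel)"
          by (intro nn_integral_cong) (auto simp: indicator_def ennreal_mult)
        also have "\<dots> = 2 * (\<integral>\<^sup>+r. ennreal ((\<phi> m r \<omega> - H r \<omega>)\<^sup>2 * indicator {0..t} r) \<partial>lborel)"
          using meas by (intro nn_integral_cmult) simp
        also have "(\<integral>\<^sup>+r. ennreal ((\<phi> m r \<omega> - H r \<omega>)\<^sup>2 * indicator {0..t} r) \<partial>lborel)
            = (\<integral>\<^sup>+r\<in>{0..t}. ennreal ((\<phi> m r \<omega> - H r \<omega>)\<^sup>2) \<partial>lborel)"
          by (intro nn_integral_cong) (auto simp: indicator_def)
        also have "2 * \<dots> + ennreal (2 * e\<^sup>2 * (u m (N m) - u m 0)) \<le> 2 * ennreal (\<delta>/8) + ennreal (2 * (\<delta>/8))"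
          using W e2 u by (intro add_mono mult_left_mono ennreal_leI) auto
        also have "2 * ennreal (\<delta>/8) = ennreal (2 * (\<delta>/8))"
          using ennreal_mult[of 2 "\<delta>/8"] \<delta> by simp
        also have "ennreal (2 * (\<delta>/8)) + ennreal (2 * (\<delta>/8)) = ennreal (2 * (\<delta>/8) + 2 * (\<delta>/8))"
          using \<delta> by (intro ennreal_plus[symmetric]) auto
        finally have "V m \<omega> \<le> 2 * (\<delta>/8) + 2 * (\<delta>/8)" using \<delta> by (subst (asm) ennreal_le_iff) auto
        then show False using \<omega>(2) \<delta> by simp
      qed
    qed
  qed
  from pointwise_null_imp_prob_null[OF D this]
  have "eventually (\<lambda>m. prob (D m) < \<theta>/2) sequentially" using \<delta> by (intro order_tendstoD) auto
  then show ?thesis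
    using eventually_ge_at_top[of m0]
  proof eventually_elim
    case (elim m)
    have "{\<omega>\<in>space M. \<delta> < V m \<omega>} \<subseteq> D m \<union> A m" using elim by (auto simp: D_def)
    then have "prob {\<omega>\<in>space M. \<delta> < V m \<omega>} \<le> prob (D m \<union> A m)"
      using D A(1) elim by (intro finite_measure_mono) auto
    also have "\<dots> \<le> prob (D m) + prob (A m)" using D A(1) elim by (intro measure_Un_le) auto
    finally show ?case using elim A(2)[of m] by (simp add: V_def)
  qed
qed

text \<open>On the refined partitions the approximating integral is a sum with coefficients
  \<open>\<eta>\<close>, and replacing them by \<open>H\<close> at the left ends changes it little
  in probability, by the quadratic variation bound; a subsequence converges almost surely. Apart
  from the value at time 0, later arguments see only Riemann sums of \<open>H\<close> itself and no
  longer the approximants of the definition.\<close>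

lemma ito_integral_Riemann:
  assumes I: "ito_integral M F B H I" and H: "adapted_process F H"
    and Hc: "AE \<omega> in M. continuous_on {0..} (\<lambda>t. H t \<omega>)" and st: "0 \<le> s" "s \<le> t"
  obtains N u where "fine_partitions s t N u"
    "AE \<omega> in M. (\<lambda>m. \<Sum>i<N m. H (u m i) \<omega> * dB (u m i) (u m (Suc i)) \<omega>) \<longlonglongrightarrow> I t \<omega> - I s \<omega>"
proof -
  obtain k :: "nat \<Rightarrow> nat" and \<tau> :: "nat \<Rightarrow> nat \<Rightarrow> real" and \<xi> :: "nat \<Rightarrow> nat \<Rightarrow> 'a \<Rightarrow> real" where
    el: "\<And>n. elementary_integrand F (k n) (\<tau> n) (\<xi> n)"
    and nullH: "\<And>t. 0 \<le> t \<Longrightarrow> null_in_probability M (\<lambda>n \<omega>. \<integral>\<^sup>+s\<in>{0..t}.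
           ennreal ((elementary_process (k n) (\<tau> n) (\<xi> n) s \<omega> - H s \<omega>)\<^sup>2) \<partial>lborel)"
    and nullI: "\<And>t. 0 \<le> t \<Longrightarrow> null_in_probability M (\<lambda>n \<omega>.
           ennreal \<bar>elementary_integral B (k n) (\<tau> n) (\<xi> n) t \<omega> - I t \<omega>\<bar>)"
    using I unfolding ito_integral_def by blast
  have IF: "\<forall>t\<ge>0. I t \<in> borel_measurable (F t)"
    using I unfolding ito_integral_def adapted_process_def by (elim conjE)
  then have Im: "0 \<le> t \<Longrightarrow> I t \<in> borel_measurable M" for t
    by (intro F_measurable_M[of "I t" t]) simp
  have HF: "0 \<le> t \<Longrightarrow> H t \<in> borel_measurable (F t)" for t
    using H by (simp add: adapted_process_def)
  have HM: "0 \<le> t \<Longrightarrow> H t \<in> borel_measurable M" for t by (intro F_measurable_M[of "H t" t] HF)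
  define J where "J m = elementary_integral B (k m) (\<tau> m) (\<xi> m)" for m
  define \<phi> where "\<phi> m = elementary_process (k m) (\<tau> m) (\<xi> m)" for m
  define P where "P m n u \<eta> \<longleftrightarrow> mono u \<and> u 0 = s \<and> u n = t \<and>
    (\<forall>i<n. u (Suc i) - u i \<le> (t - s) / Suc m) \<and> (\<forall>i<n. \<eta> i \<in> borel_measurable (F (u i))) \<and>
    (\<forall>\<omega>. (\<Sum>i<n. \<eta> i \<omega> * dB (u i) (u (Suc i)) \<omega>) = J m t \<omega> - J m s \<omega>) \<and>
    (\<forall>i<n. \<forall>r \<omega>. u i < r \<longrightarrow> r \<le> u (Suc i) \<longrightarrow> \<phi> m r \<omega> = \<eta> i \<omega>)"
    for m n and u :: "nat \<Rightarrow> real" and \<eta> :: "nat \<Rightarrow> 'a \<Rightarrow> real"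
  have "\<exists>n u \<eta>. P m n u \<eta>" for m
    unfolding P_def J_def \<phi>_def by (rule elementary_integral_refinement[OF el st])
  then obtain n u \<eta> where "\<And>m. P m (n m) (u m) (\<eta> m)" by metis
  note all = this[unfolded P_def]
  from all have u: "\<And>m. mono (u m)" "\<And>m. u m 0 = s" "\<And>m. u m (n m) = t"
    "\<And>m i. i < n m \<Longrightarrow> u m (Suc i) - u m i \<le> (t - s) / Suc m"
    and \<eta>: "\<And>m i. i < n m \<Longrightarrow> \<eta> m i \<in> borel_measurable (F (u m i))"
    and J: "\<And>m \<omega>. (\<Sum>i<n m. \<eta> m i \<omega> * dB (u m i) (u m (Suc i)) \<omega>) = J m t \<omega> - J m s \<omega>"
    and \<phi>\<eta>: "\<And>m i r \<omega>. i < n m \<Longrightarrow> u m i < r \<Longrightarrow> r \<le> u m (Suc i) \<Longrightarrow> \<phi> m r \<omega> = \<eta> m i \<omega>"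
    by blast+
  have u0: "0 \<le> u m i" "u m i \<le> u m (Suc i)" for m i
    using monoD[OF u(1), of 0 i m] monoD[OF u(1), of i "Suc i" m] u(2)[of m] st by auto
  define S where "S m \<omega> = (\<Sum>i<n m. H (u m i) \<omega> * dB (u m i) (u m (Suc i)) \<omega>)" for m \<omega>
  have SM: "S m \<in> borel_measurable M" for m
    unfolding S_def by (intro borel_measurable_sum borel_measurable_times HM dB_measurable_M u0)
  have JM: "J m t' \<in> borel_measurable M" if "0 \<le> t'" for m t'
  proof -
    have \<xi>M: "\<xi> m i \<in> borel_measurable M" if "i < k m" for i
      using el[of m] that by (intro F_measurable_M[of _ "\<tau> m i"]) (simp add: elementary_integrand_def)
    have \<tau>0: "0 \<le> \<tau> m i" for i
      using el[of m] monoD[of "\<tau> m" 0 i] by (auto simp: elementary_integrand_def intro: order_trans)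
    show ?thesis
      unfolding J_def elementary_integral_def using that \<tau>0 \<xi>M
      by (intro borel_measurable_sum borel_measurable_times borel_measurable_diff B_measurable) auto
  qed
  define Z where "Z m \<omega> = S m \<omega> - (I t \<omega> - I s \<omega>)" for m \<omega>
  have ZM: "Z m \<in> borel_measurable M" for m
    unfolding Z_def using st by (intro borel_measurable_diff SM Im) auto
  have "eventually (\<lambda>m. prob {\<omega>\<in>space M. \<epsilon> < \<bar>Z m \<omega>\<bar>} < \<theta>) sequentially" if \<epsilon>: "0 < \<epsilon>" "0 < \<theta>" for \<epsilon> \<theta>
  proof -
    \<comment> \<open>Three error terms share \<open>\<epsilon>\<close>. The first costs
      \<open>2 * \<theta>'\<close> because
      \<open>\<delta> / \<epsilon>'\<^sup>2 = \<theta>'\<close>, the others \<open>\<theta>'\<close>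
      each, four fifths of \<open>\<theta>\<close> in total.\<close>
    define \<epsilon>' where "\<epsilon>' = \<epsilon> / 3"
    define \<theta>' where "\<theta>' = \<theta> / 5"
    define \<delta> where "\<delta> = \<theta>' * \<epsilon>'\<^sup>2"
    have pos: "0 < \<epsilon>'" "0 < \<theta>'" "0 < \<delta>" using \<epsilon> by (auto simp: \<epsilon>'_def \<theta>'_def \<delta>_def)
    have \<phi>m: "(\<lambda>r. \<phi> m r \<omega>) \<in> borel_measurable borel" for m \<omega>
      unfolding \<phi>_def elementary_process_def
      by (intro borel_measurable_sum borel_measurable_times borel_measurable_const borel_measurable_indicator) auto
    have tt: "0 \<le> t" using st by simp
    have e1: "eventually (\<lambda>m. prob {\<omega>\<in>space M. \<delta> < (\<Sum>i<n m. (\<eta> m i \<omega> - H (u m i) \<omega>)\<^sup>2 * (u m (Suc i) - u m i))} < \<theta>')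
      sequentially"
    proof (rule elementary_square_distance_null[OF HM Hc \<phi>m nullH[OF tt, folded \<phi>_def] st(1) u _ \<phi>\<eta> pos(3,2)])
      fix m i assume "i < n m"
      then show "\<eta> m i \<in> borel_measurable M" by (intro F_measurable_M[OF \<eta>])
    qed
    have e2: "eventually (\<lambda>m. prob {\<omega>\<in>space M. \<epsilon>' < \<bar>J m t \<omega> - I t \<omega>\<bar>} < \<theta>') sequentially"
      unfolding J_def by (rule null_in_probability_prob[OF nullI[OF tt] pos(1,2)])
    have e3: "eventually (\<lambda>m. prob {\<omega>\<in>space M. \<epsilon>' < \<bar>J m s \<omega> - I s \<omega>\<bar>} < \<theta>') sequentially"
      unfolding J_def by (rule null_in_probability_prob[OF nullI[OF st(1)] pos(1,2)])
    show ?thesis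
      using e1 e2 e3
    proof eventually_elim
      case (elim m)
      define E1 where "E1 = {\<omega>\<in>space M. \<epsilon>' < \<bar>\<Sum>i<n m. (\<eta> m i \<omega> - H (u m i) \<omega>) * dB (u m i) (u m (Suc i)) \<omega>\<bar>}"
      define E2 where "E2 = {\<omega>\<in>space M. \<epsilon>' < \<bar>J m t \<omega> - I t \<omega>\<bar>}"
      define E3 where "E3 = {\<omega>\<in>space M. \<epsilon>' < \<bar>J m s \<omega> - I s \<omega>\<bar>}"
      have diff: "(\<Sum>i<n m. (\<eta> m i \<omega> - H (u m i) \<omega>) * dB (u m i) (u m (Suc i)) \<omega>) = J m t \<omega> - J m s \<omega> - S m \<omega>" for \<omega>
        using J[of m \<omega>] by (simp add: S_def left_diff_distrib sum_subtractf)
      have "prob E1 \<le> prob {\<omega>\<in>space M. \<delta> < (\<Sum>i<n m. (\<eta> m i \<omega> - H (u m i) \<omega>)\<^sup>2 * (u m (Suc i) - u m i))} + \<delta> / \<epsilon>'\<^sup>2"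
        unfolding E1_def
        by (rule elementary_integral_bound_in_probability[OF u(1) _ _ pos(1,3)])
          (use st u in \<open>auto intro!: borel_measurable_diff \<eta> HF u0\<close>)
      also have "\<delta> / \<epsilon>'\<^sup>2 = \<theta>'" using pos by (simp add: \<delta>_def)
      finally have p1: "prob E1 < 2 * \<theta>'" using elim(1) by simp
      have E1: "E1 \<in> events"
        unfolding E1_def diff using st
        by (intro borel_measurable_less borel_measurable_const borel_measurable_abs borel_measurable_diff SM JM) auto
      have E2: "E2 \<in> events"
        unfolding E2_def using st
        by (intro borel_measurable_less borel_measurable_const borel_measurable_abs borel_measurable_diff Im JM) auto
      have E3: "E3 \<in> events"
        unfolding E3_def using st
        by (intro borel_measurable_less borel_measurable_const borel_measurable_abs borel_measurable_diff Im JM) auto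
      have "{\<omega>\<in>space M. \<epsilon> < \<bar>Z m \<omega>\<bar>} \<subseteq> E1 \<union> (E2 \<union> E3)"
      proof
        fix \<omega> assume a: "\<omega> \<in> {\<omega>\<in>space M. \<epsilon> < \<bar>Z m \<omega>\<bar>}"
        show "\<omega> \<in> E1 \<union> (E2 \<union> E3)"
        proof (rule ccontr)
          assume "\<omega> \<notin> E1 \<union> (E2 \<union> E3)"
          then have "\<bar>J m t \<omega> - J m s \<omega> - S m \<omega>\<bar> \<le> \<epsilon>'" "\<bar>J m t \<omega> - I t \<omega>\<bar> \<le> \<epsilon>'" "\<bar>J m s \<omega> - I s \<omega>\<bar> \<le> \<epsilon>'"
            using a by (auto simp: E1_def E2_def E3_def diff)
          then have "\<bar>Z m \<omega>\<bar> \<le> 3 * \<epsilon>'" unfolding Z_def by linarith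
          then show False using a by (simp add: \<epsilon>'_def)
        qed
      qed
      then have "prob {\<omega>\<in>space M. \<epsilon> < \<bar>Z m \<omega>\<bar>} \<le> prob (E1 \<union> (E2 \<union> E3))"
        using E1 E2 E3 by (intro finite_measure_mono) auto
      also have "\<dots> \<le> prob E1 + prob (E2 \<union> E3)" using E1 E2 E3 by (intro measure_Un_le) auto
      also have "prob (E2 \<union> E3) \<le> prob E2 + prob E3" using E2 E3 by (intro measure_Un_le) auto
      finally have "prob {\<omega>\<in>space M. \<epsilon> < \<bar>Z m \<omega>\<bar>} \<le> prob E1 + (prob E2 + prob E3)" by simp
      moreover have "prob E2 < \<theta>'" "prob E3 < \<theta>'" using elim(2,3) by (simp_all add: E2_def E3_def)
      ultimately show ?case using p1 \<epsilon> unfolding \<theta>'_def by linarith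
    qed
  qed
  from in_probability_imp_AE_subsequence[OF ZM this]
  obtain \<psi> :: "nat \<Rightarrow> nat" where \<psi>: "\<And>j. j \<le> \<psi> j" "AE \<omega> in M. (\<lambda>j. Z (\<psi> j) \<omega>) \<longlonglongrightarrow> 0" by blast
  show ?thesis
  proof (rule that[of "\<lambda>j. n (\<psi> j)" "\<lambda>j. u (\<psi> j)"])
    have "(t - s) / Suc (\<psi> j) \<le> (t - s) / Suc j" for j
      using \<psi>(1)[of j] st by (intro divide_left_mono) auto
    then show "fine_partitions s t (\<lambda>j. n (\<psi> j)) (\<lambda>j. u (\<psi> j))"
      unfolding fine_partitions_def using u(1-3) by (intro allI conjI impI order_trans[OF u(4)]) auto
    show "AE \<omega> in M. (\<lambda>j. \<Sum>i<n (\<psi> j). H (u (\<psi> j) i) \<omega> * dB (u (\<psi> j) i) (u (\<psi> j) (Suc i)) \<omega>)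
        \<longlonglongrightarrow> I t \<omega> - I s \<omega>"
      using \<psi>(2) by eventually_elim (simp add: Z_def S_def LIM_zero_iff)
  qed
qed

text \<open>Every elementary integral vanishes at time 0, so the constant sequence
  \<open>- I 0\<close> tends to 0 in probability.\<close>

lemma ito_integral_zero:
  assumes I: "ito_integral M F B H I"
  shows "AE \<omega> in M. I 0 \<omega> = 0"
proof -
  obtain k :: "nat \<Rightarrow> nat" and \<tau> :: "nat \<Rightarrow> nat \<Rightarrow> real" and \<xi> :: "nat \<Rightarrow> nat \<Rightarrow> 'a \<Rightarrow> real" where
    el: "\<And>n. elementary_integrand F (k n) (\<tau> n) (\<xi> n)"
    and nullI: "null_in_probability M (\<lambda>n \<omega>.
           ennreal \<bar>elementary_integral B (k n) (\<tau> n) (\<xi> n) 0 \<omega> - I 0 \<omega>\<bar>)"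
    using I unfolding ito_integral_def by blast
  have zero: "elementary_integral B (k n) (\<tau> n) (\<xi> n) 0 \<omega> = 0" for n \<omega>
  proof -
    have "0 \<le> \<tau> n i" for i
      using el[of n] monoD[of "\<tau> n" 0 i] by (auto simp: elementary_integrand_def intro: order_trans)
    then have "min 0 (\<tau> n i) = 0" for i by simp
    then show ?thesis by (simp add: elementary_integral_def)
  qed
  have "\<forall>t\<ge>0. I t \<in> borel_measurable (F t)"
    using I unfolding ito_integral_def adapted_process_def by (elim conjE)
  then have Im: "I 0 \<in> borel_measurable M" by (intro F_measurable_M[of "I 0" 0]) simp
  have "eventually (\<lambda>m::nat. prob {\<omega>\<in>space M. \<epsilon> < \<bar>- I 0 \<omega>\<bar>} < \<theta>) sequentially" if "0 < \<epsilon>" "0 < \<theta>" for \<epsilon> \<theta>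
    using null_in_probability_prob[OF nullI that] by (simp add: zero)
  from in_probability_imp_AE_subsequence[OF borel_measurable_uminus[OF Im] this]
  have "AE \<omega> in M. (\<lambda>j::nat. - I 0 \<omega>) \<longlonglongrightarrow> 0" by blast
  then show ?thesis by eventually_elim (simp add: LIMSEQ_const_iff)
qed

end

section \<open>Mean-square estimates\<close>

lemma uniform_fine_partitions:
  assumes "s \<le> t"
  shows "fine_partitions s t Suc (\<lambda>m i. s + (t - s) * (real (min i (Suc m)) / real (Suc m)))"
  unfolding fine_partitions_def
proof (intro allI conjI impI)
  fix m
  show "mono (\<lambda>i. s + (t - s) * (real (min i (Suc m)) / real (Suc m)))"
  proof (rule monoI)
    fix i j :: nat assume "i \<le> j"
    then have "real (min i (Suc m)) \<le> real (min j (Suc m))" unfolding of_nat_le_iff by (simp add: min_def)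
    then show "s + (t - s) * (real (min i (Suc m)) / real (Suc m)) \<le> s + (t - s) * (real (min j (Suc m)) / real (Suc m))"
      using assms by (intro add_left_mono mult_left_mono divide_right_mono) auto
  qed
  show "s + (t - s) * (real (min 0 (Suc m)) / real (Suc m)) = s" by simp
  show "s + (t - s) * (real (min (Suc m) (Suc m)) / real (Suc m)) = t" by simp
  fix i assume "i < Suc m"
  then have "real (min (Suc i) (Suc m)) / real (Suc m) - real (min i (Suc m)) / real (Suc m) = 1 / real (Suc m)"
    by (simp add: diff_divide_distrib[symmetric])
  then have "(t - s) * (real (min (Suc i) (Suc m)) / real (Suc m)) - (t - s) * (real (min i (Suc m)) / real (Suc m))
      = (t - s) * (1 / real (Suc m))"
    unfolding right_diff_distrib[symmetric] by simp
  then show "s + (t - s) * (real (min (Suc i) (Suc m)) / real (Suc m))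
    - (s + (t - s) * (real (min i (Suc m)) / real (Suc m))) \<le> (t - s) / real (Suc m)" by simp
qed

lemma fine_partitions_exist:
  assumes "s \<le> t" obtains N u where "fine_partitions s t N u"
  using uniform_fine_partitions[OF assms] by blast

text \<open>\<open>lim\<close> of Riemann sums is a total and measurable function of
  \<open>\<omega>\<close>, and equals the integral wherever the path is continuous. With
  \<open>N\<close> a member of the filtration this yields an adapted version of a pathwise
  integral.\<close>

lemma measurable_integral_version:
  fixes g :: "real \<Rightarrow> 'a \<Rightarrow> real"
  assumes "s \<le> t" and g: "\<And>r. s \<le> r \<Longrightarrow> r \<le> t \<Longrightarrow> g r \<in> borel_measurable N"
  shows "\<exists>D\<in>borel_measurable N. \<forall>\<omega>. continuous_on {s..t} (\<lambda>r. g r \<omega>) \<longrightarrow> D \<omega> = integral {s..t} (\<lambda>r. g r \<omega>)"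
proof -
  obtain n u where P: "fine_partitions s t n u" using fine_partitions_exist[OF assms(1)] .
  note PD = fine_partitionsD[OF P]
  define R where "R m \<omega> = (\<Sum>i<n m. g (u m i) \<omega> * (u m (Suc i) - u m i))" for m \<omega>
  have R: "R m \<in> borel_measurable N" for m
    unfolding R_def using PD(5)[of m] PD(6)[of _ m]
    by (intro borel_measurable_sum borel_measurable_times borel_measurable_const g) auto
  show ?thesis
  proof (intro bexI[of _ "\<lambda>\<omega>. lim (\<lambda>m. R m \<omega>)"] allI impI)
    show "(\<lambda>\<omega>. lim (\<lambda>m. R m \<omega>)) \<in> borel_measurable N"
      by (rule borel_measurable_lim_metric[OF R])
    fix \<omega> assume "continuous_on {s..t} (\<lambda>r. g r \<omega>)"
    from Riemann_sums_tendsto[OF this P]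
    show "lim (\<lambda>m. R m \<omega>) = integral {s..t} (\<lambda>r. g r \<omega>)" unfolding R_def by (rule limI)
  qed
qed

text \<open>Riemann sums and Fatou. One factor \<open>t - s\<close> comes from Cauchy-Schwarz and
  the other from the length of the interval, so over a short step a time integral is an order
  smaller than a stochastic one.\<close>

lemma L2_integral_bound:
  fixes g :: "real \<Rightarrow> 'a \<Rightarrow> real"
  assumes st: "s \<le> t" and g: "\<And>r. s \<le> r \<Longrightarrow> r \<le> t \<Longrightarrow> g r \<in> L2 M"
    and bound: "\<And>r. s \<le> r \<Longrightarrow> r \<le> t \<Longrightarrow> (\<integral>\<omega>. (g r \<omega>)\<^sup>2 \<partial>M) \<le> K"
    and D: "D \<in> borel_measurable M"
    and eq: "AE \<omega> in M. continuous_on {s..t} (\<lambda>r. g r \<omega>) \<and> D \<omega> = integral {s..t} (\<lambda>r. g r \<omega>)"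
  shows "D \<in> L2 M" "(\<integral>\<omega>. (D \<omega>)\<^sup>2 \<partial>M) \<le> K * (t - s)\<^sup>2"
proof -
  obtain n u where P: "fine_partitions s t n u" using fine_partitions_exist[OF st] .
  note PD = fine_partitionsD[OF P]
  define R where "R m \<omega> = (\<Sum>i<n m. g (u m i) \<omega> * (u m (Suc i) - u m i))" for m \<omega>
  have gu: "g (u m i) \<in> L2 M" "(\<integral>\<omega>. (g (u m i) \<omega>)\<^sup>2 \<partial>M) \<le> K" if "i < n m" for m i
    using g[of "u m i"] bound[of "u m i"] PD(5)[of m i] PD(6)[of i m] that by auto
  have R: "R m \<in> L2 M" for m
    unfolding R_def using gu by (intro L2_sum) (auto simp: mult.commute[of _ "_ - _"] intro: L2_cmult)
  have lim: "AE \<omega> in M. (\<lambda>m. R m \<omega>) \<longlonglongrightarrow> D \<omega>"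
    using eq
  proof eventually_elim
    case (elim \<omega>)
    then show ?case unfolding R_def using Riemann_sums_tendsto[OF elim[THEN conjunct1] P] by simp
  qed
  have Rb: "(\<integral>\<omega>. (R m \<omega>)\<^sup>2 \<partial>M) \<le> K * (t - s)\<^sup>2" for m
  proof -
    have nn: "0 \<le> u m (Suc i) - u m i" for i using PD(7)[of m i] by simp
    have "(\<integral>\<omega>. (R m \<omega>)\<^sup>2 \<partial>M)
        \<le> (\<Sum>i<n m. u m (Suc i) - u m i) * (\<Sum>i<n m. (\<integral>\<omega>. (g (u m i) \<omega>)\<^sup>2 \<partial>M) * (u m (Suc i) - u m i))"
      unfolding R_def using gu nn by (intro L2_weighted_sum_bound) auto
    also have "\<dots> = (t - s) * (\<Sum>i<n m. (\<integral>\<omega>. (g (u m i) \<omega>)\<^sup>2 \<partial>M) * (u m (Suc i) - u m i))"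
      by (simp add: PD(8))
    also have "\<dots> \<le> (t - s) * (\<Sum>i<n m. K * (u m (Suc i) - u m i))"
      using gu nn st by (intro mult_left_mono sum_mono mult_right_mono) auto
    also have "\<dots> = K * (t - s)\<^sup>2"
      using PD(8)[of m] by (simp add: sum_distrib_left[symmetric] power2_eq_square)
    finally show ?thesis .
  qed
  show "D \<in> L2 M" by (rule L2_Fatou(1)[OF R D lim Rb])
  show "(\<integral>\<omega>. (D \<omega>)\<^sup>2 \<partial>M) \<le> K * (t - s)\<^sup>2" by (rule L2_Fatou(2)[OF R D lim Rb])
qed

text \<open>Left sums of an increasing function lie below its integral, here termwise from
  \<open>1 + x \<le> exp x\<close>. Thus the Gronwall estimate for the approximating sums carries no
  error term that depends on the mesh.\<close>

lemma exp_left_Riemann_sum: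
  fixes u :: "nat \<Rightarrow> real"
  assumes "mono u" "0 < \<kappa>"
  shows "(\<Sum>i<n. exp (\<kappa> * u i) * (u (Suc i) - u i)) \<le> (exp (\<kappa> * u n) - exp (\<kappa> * u 0)) / \<kappa>"
proof -
  have "exp (\<kappa> * u i) * (u (Suc i) - u i) \<le> exp (\<kappa> * u (Suc i)) / \<kappa> - exp (\<kappa> * u i) / \<kappa>" for i
  proof -
    have "1 + \<kappa> * (u (Suc i) - u i) \<le> exp (\<kappa> * (u (Suc i) - u i))" by (rule exp_ge_add_one_self)
    then have "exp (\<kappa> * u i) * (\<kappa> * (u (Suc i) - u i)) \<le> exp (\<kappa> * u i) * (exp (\<kappa> * (u (Suc i) - u i)) - 1)"
      by (intro mult_left_mono, linarith, simp)
    also have "\<dots> = exp (\<kappa> * u (Suc i)) - exp (\<kappa> * u i)"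
      by (simp add: right_diff_distrib exp_add[symmetric])
    finally have "exp (\<kappa> * u i) * (u (Suc i) - u i) * \<kappa> \<le> exp (\<kappa> * u (Suc i)) - exp (\<kappa> * u i)"
      by (simp add: mult_ac)
    then have "exp (\<kappa> * u i) * (u (Suc i) - u i) \<le> (exp (\<kappa> * u (Suc i)) - exp (\<kappa> * u i)) / \<kappa>"
      using assms(2) by (simp only: pos_le_divide_eq)
    then show ?thesis by (simp add: diff_divide_distrib)
  qed
  then have "(\<Sum>i<n. exp (\<kappa> * u i) * (u (Suc i) - u i)) \<le> (\<Sum>i<n. exp (\<kappa> * u (Suc i)) / \<kappa> - exp (\<kappa> * u i) / \<kappa>)"
    by (rule sum_mono)
  also have "\<dots> = exp (\<kappa> * u n) / \<kappa> - exp (\<kappa> * u 0) / \<kappa>" by (rule sum_lessThan_telescope)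
  finally show ?thesis by (simp add: diff_divide_distrib)
qed

context brownian_filtration
begin

lemma L2F_intro: "f \<in> L2 M \<Longrightarrow> f \<in> borel_measurable (F s) \<Longrightarrow> f \<in> L2F s"
  unfolding L2F_def by (rule IntI)

text \<open>Subtracting \<open>\<zeta> * dB\<close> from every Riemann sum replaces the integrand
  \<open>H\<close> by \<open>H - \<zeta>\<close>, since the increments telescope. With
  \<open>\<zeta> = 0\<close> this is the usual bound and the martingale property; with
  \<open>\<zeta>\<close> the integrand at time \<open>s\<close> it bounds the error of freezing the
  integrand. Orthogonality passes to the limit by weak convergence, the bound by Fatou.\<close>

lemma ito_integral_L2:
  assumes I: "ito_integral M F B H I" and H: "adapted_process F H"
    and Hc: "AE \<omega> in M. continuous_on {0..} (\<lambda>t. H t \<omega>)" and st: "0 \<le> s" "s \<le> t"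
    and HL: "\<And>r. s \<le> r \<Longrightarrow> r \<le> t \<Longrightarrow> H r \<in> L2 M"
    and \<zeta>: "\<zeta> \<in> L2F s"
    and bound: "\<And>r. s \<le> r \<Longrightarrow> r \<le> t \<Longrightarrow> (\<integral>\<omega>. (H r \<omega> - \<zeta> \<omega>)\<^sup>2 \<partial>M) \<le> K"
  shows "(\<lambda>\<omega>. I t \<omega> - I s \<omega> - \<zeta> \<omega> * dB s t \<omega>) \<in> L2F t"
    and "(\<integral>\<omega>. (I t \<omega> - I s \<omega> - \<zeta> \<omega> * dB s t \<omega>)\<^sup>2 \<partial>M) \<le> K * (t - s)"
    and "\<eta> \<in> L2F s \<Longrightarrow> (\<integral>\<omega>. \<eta> \<omega> * (I t \<omega> - I s \<omega> - \<zeta> \<omega> * dB s t \<omega>) \<partial>M) = 0"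
proof -
  obtain n u where P: "fine_partitions s t n u"
    and lim: "AE \<omega> in M. (\<lambda>m. \<Sum>i<n m. H (u m i) \<omega> * dB (u m i) (u m (Suc i)) \<omega>) \<longlonglongrightarrow> I t \<omega> - I s \<omega>"
    using ito_integral_Riemann[OF I H Hc st] .
  note PD = fine_partitionsD[OF P]
  let ?J = "\<lambda>\<omega>. I t \<omega> - I s \<omega> - \<zeta> \<omega> * dB s t \<omega>"
  define S where "S m \<omega> = (\<Sum>i<n m. (H (u m i) \<omega> - \<zeta> \<omega>) * dB (u m i) (u m (Suc i)) \<omega>)" for m \<omega>
  have IF: "\<forall>t\<ge>0. I t \<in> borel_measurable (F t)"
    using I unfolding ito_integral_def adapted_process_def by (elim conjE)
  have JF: "?J \<in> borel_measurable (F t)"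
  proof -
    have It: "I t \<in> borel_measurable (F t)" and "I s \<in> borel_measurable (F s)"
      by (rule IF[rule_format], use st in linarith)+
    moreover have "I s \<in> borel_measurable (F t)" by (rule F_measurable_mono[OF calculation(2) st(2)])
    ultimately show ?thesis
      by (intro borel_measurable_diff L2F_measurable[OF increment_mult_dB(1)[OF st \<zeta>]])
  qed
  have JM: "?J \<in> borel_measurable M" by (rule F_measurable_M[OF JF])
  have HF: "H r \<in> L2F r" if "s \<le> r" "r \<le> t" for r
  proof (rule L2F_intro[OF HL[OF that]])
    show "H r \<in> borel_measurable (F r)" using H that st by (simp add: adapted_process_def)
  qed
  have \<xi>: "(\<lambda>\<omega>. H (u m i) \<omega> - \<zeta> \<omega>) \<in> L2F (u m i)" if "i < n m" for m i
    using that PD(5)[of m i] PD(6)[of i m] by (intro L2F_diff HF L2F_mono[OF \<zeta>]) auto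
  have u0: "0 \<le> u m 0" for m using PD(2)[of m] st by simp
  note iso = elementary_isometry[OF PD(1) u0 \<xi>]
  have S: "S m \<in> L2 M" for m unfolding S_def by (rule L2F_L2[OF iso(1)])
  have lim': "AE \<omega> in M. (\<lambda>m. S m \<omega>) \<longlonglongrightarrow> ?J \<omega>"
    using lim
  proof eventually_elim
    case (elim \<omega>)
    have "S m \<omega> = (\<Sum>i<n m. H (u m i) \<omega> * dB (u m i) (u m (Suc i)) \<omega>) - \<zeta> \<omega> * dB s t \<omega>" for m
    proof -
      have "(\<Sum>i<n m. dB (u m i) (u m (Suc i)) \<omega>) = dB s t \<omega>"
        by (subst sum_lessThan_telescope) (simp add: PD(2,3))
      then show ?thesis
        by (simp add: S_def left_diff_distrib sum_subtractf sum_distrib_left[symmetric])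
    qed
    then show ?case using tendsto_diff[OF elim tendsto_const, of "\<zeta> \<omega> * dB s t \<omega>"] by simp
  qed
  have Sb: "(\<integral>\<omega>. (S m \<omega>)\<^sup>2 \<partial>M) \<le> K * (t - s)" for m
  proof -
    have "(\<integral>\<omega>. (S m \<omega>)\<^sup>2 \<partial>M) = (\<Sum>i<n m. (\<integral>\<omega>. (H (u m i) \<omega> - \<zeta> \<omega>)\<^sup>2 \<partial>M) * (u m (Suc i) - u m i))"
      unfolding S_def by (rule iso(2))
    also have "\<dots> \<le> (\<Sum>i<n m. K * (u m (Suc i) - u m i))"
    proof (rule sum_mono)
      fix i assume "i \<in> {..<n m}"
      then show "(\<integral>\<omega>. (H (u m i) \<omega> - \<zeta> \<omega>)\<^sup>2 \<partial>M) * (u m (Suc i) - u m i) \<le> K * (u m (Suc i) - u m i)"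
        using bound[of "u m i"] PD(5)[of m i] PD(6)[of i m] PD(7)[of m i] by (intro mult_right_mono) auto
    qed
    also have "\<dots> = K * (t - s)" using PD(8)[of m] by (simp add: sum_distrib_left[symmetric])
    finally show ?thesis .
  qed
  have JL: "?J \<in> L2 M" by (rule L2_Fatou(1)[OF S JM lim' Sb])
  then show "?J \<in> L2F t" using JF by (rule L2F_intro)
  show "(\<integral>\<omega>. (?J \<omega>)\<^sup>2 \<partial>M) \<le> K * (t - s)" by (rule L2_Fatou(2)[OF S JM lim' Sb])
  show "(\<integral>\<omega>. \<eta> \<omega> * ?J \<omega> \<partial>M) = 0" if \<eta>: "\<eta> \<in> L2F s"
  proof -
    have "(\<lambda>m. \<integral>\<omega>. \<eta> \<omega> * S m \<omega> \<partial>M) \<longlonglongrightarrow> (\<integral>\<omega>. \<eta> \<omega> * ?J \<omega> \<partial>M)"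
      by (rule L2_weak_limit[OF S JL L2F_L2[OF \<eta>] lim' Sb])
    moreover have "(\<integral>\<omega>. \<eta> \<omega> * S m \<omega> \<partial>M) = 0" for m
      unfolding S_def by (rule elementary_orthogonal[OF PD(1) u0 \<xi>]) (use \<eta> PD(2) in auto)
    ultimately show ?thesis by (simp add: LIMSEQ_const_iff)
  qed
qed

end

section \<open>The pantograph equation and finiteness of its second moments\<close>

locale pantograph = brownian_filtration M F B
  for M :: "'a measure" and F :: "real \<Rightarrow> 'a measure" and B :: "real \<Rightarrow> 'a \<Rightarrow> real" +
  fixes a b \<sigma> \<rho> q :: real and X0 :: "'a \<Rightarrow> real" and X I :: "real \<Rightarrow> 'a \<Rightarrow> real"
  assumes q: "0 < q" "q < 1"
    and X0_L2F: "X0 \<in> L2F 0"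
    and X_adapted: "adapted_process F X"
    and X_continuous: "AE \<omega> in M. continuous_on {0..} (\<lambda>t. X t \<omega>)"
    and I_ito: "ito_integral M F B (\<lambda>s \<omega>. \<sigma> * X s \<omega> + \<rho> * X (q * s) \<omega>) I"
    and X_equation: "AE \<omega> in M. \<forall>t\<ge>0.
        X t \<omega> = X0 \<omega> + integral {0..t} (\<lambda>s. a * X s \<omega> + b * X (q * s) \<omega>) + I t \<omega>"
begin

definition diffusion :: "real \<Rightarrow> 'a \<Rightarrow> real" where
  "diffusion s \<omega> = \<sigma> * X s \<omega> + \<rho> * X (q * s) \<omega>"

definition drift :: "real \<Rightarrow> 'a \<Rightarrow> real" where
  "drift s \<omega> = a * X s \<omega> + b * X (q * s) \<omega>"

lemma q_mult: "0 \<le> t \<Longrightarrow> 0 \<le> q * t" "0 \<le> t \<Longrightarrow> q * t \<le> t"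
  using q by (auto simp: mult_left_le_one_le)

lemma X_measurable: "0 \<le> t \<Longrightarrow> X t \<in> borel_measurable (F t)"
  using X_adapted by (simp add: adapted_process_def)

lemma X_measurable_M: "0 \<le> t \<Longrightarrow> X t \<in> borel_measurable M"
  by (intro F_measurable_M[of "X t" t] X_measurable)

lemma Xq_measurable: "0 \<le> t \<Longrightarrow> X (q * t) \<in> borel_measurable (F t)"
  using F_measurable_mono[of "X (q * t)" "q * t" t] X_measurable[of "q * t"] q_mult[of t] by simp

lemma lin_measurable: "0 \<le> t \<Longrightarrow> (\<lambda>\<omega>. \<alpha> * X t \<omega> + \<beta> * X (q * t) \<omega>) \<in> borel_measurable (F t)"
  by (intro borel_measurable_add borel_measurable_times borel_measurable_const X_measurable Xq_measurable)

lemma lin_continuous: "AE \<omega> in M. continuous_on {0..} (\<lambda>t. \<alpha> * X t \<omega> + \<beta> * X (q * t) \<omega>)"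
  using X_continuous
proof eventually_elim
  case (elim \<omega>)
  have "continuous_on {0..} (\<lambda>t. X (q * t) \<omega>)"
    by (rule continuous_on_compose2[OF elim]) (use q in \<open>auto intro!: continuous_intros\<close>)
  then show ?case using elim by (intro continuous_intros)
qed

lemma ito_diffusion: "ito_integral M F B diffusion I"
  using I_ito by (simp add: diffusion_def[abs_def])

lemma diffusion_adapted: "adapted_process F diffusion"
  using lin_measurable by (simp add: adapted_process_def diffusion_def[abs_def])

lemma diffusion_continuous: "AE \<omega> in M. continuous_on {0..} (\<lambda>t. diffusion t \<omega>)"
  using lin_continuous by (simp add: diffusion_def)

lemma drift_continuous: "AE \<omega> in M. continuous_on {0..} (\<lambda>t. drift t \<omega>)"
  using lin_continuous by (simp add: drift_def)

lemma I_measurable: "0 \<le> t \<Longrightarrow> I t \<in> borel_measurable (F t)"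
  using ito_diffusion unfolding ito_integral_def adapted_process_def by simp

lemma X_zero: "AE \<omega> in M. X 0 \<omega> = X0 \<omega>"
  using X_equation ito_integral_zero[OF I_ito] by eventually_elim simp

lemma X_increment:
  assumes "0 \<le> s" "s \<le> t"
  shows "AE \<omega> in M. continuous_on {s..t} (\<lambda>r. drift r \<omega>) \<and>
    X t \<omega> - X s \<omega> - (I t \<omega> - I s \<omega>) = integral {s..t} (\<lambda>r. drift r \<omega>)"
  using X_equation drift_continuous
proof eventually_elim
  case (elim \<omega>)
  have c: "continuous_on A (\<lambda>r. drift r \<omega>)" if "A \<subseteq> {0..}" for A
    using elim(2) that by (rule continuous_on_subset)
  have "integral {0..s} (\<lambda>r. drift r \<omega>) + integral {s..t} (\<lambda>r. drift r \<omega>) = integral {0..t} (\<lambda>r. drift r \<omega>)"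
    using assms by (intro Henstock_Kurzweil_Integration.integral_combine integrable_continuous_interval c) auto
  then show ?case
    using elim(1)[rule_format, of s] elim(1)[rule_format, of t] assms c[of "{s..t}"]
    by (auto simp: drift_def)
qed

text \<open>Rational times make the condition a countable intersection, so the event lies in
  \<open>F t\<close> although continuity of paths is only almost sure.\<close>

definition tame :: "real \<Rightarrow> real \<Rightarrow> 'a set" where
  "tame K t = {\<omega>\<in>space M. \<forall>p\<in>\<rat> \<inter> {0..t}. \<bar>X p \<omega>\<bar> \<le> K}"

lemma tame_sets: "tame K t \<in> sets (F t)"
proof -
  have "{\<omega>\<in>space (F t). \<forall>p\<in>\<rat> \<inter> {0..t}. \<bar>X p \<omega>\<bar> \<le> K} \<in> sets (F t)"
  proof (rule sets.sets_Collect_countable_All')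
    show "countable (\<rat> \<inter> {0..t})" using countable_rat by blast
    fix p assume "p \<in> \<rat> \<inter> {0..t}"
    then have "X p \<in> borel_measurable (F t)" using F_measurable_mono[of "X p" p t] X_measurable[of p] by auto
    then show "{\<omega>\<in>space (F t). \<bar>X p \<omega>\<bar> \<le> K} \<in> sets (F t)"
      by (intro borel_measurable_le borel_measurable_abs borel_measurable_const)
  qed
  then show ?thesis by (simp add: tame_def F_space)
qed

lemma tame_mono: "s \<le> t \<Longrightarrow> tame K t \<subseteq> tame K s"
  by (auto simp: tame_def)

lemma tame_bound:
  assumes c: "continuous_on {0..} (\<lambda>t. X t \<omega>)" and \<omega>: "\<omega> \<in> tame K t" and r: "0 \<le> r" "r \<le> t"
  shows "\<bar>X r \<omega>\<bar> \<le> K"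
proof (rule ccontr)
  assume "\<not> \<bar>X r \<omega>\<bar> \<le> K"
  then have e: "0 < \<bar>X r \<omega>\<bar> - K" by simp
  show False
  proof (cases "r = 0")
    case True
    have "0 \<in> \<rat> \<inter> {0..t}" using r by simp
    then have "\<bar>X 0 \<omega>\<bar> \<le> K" using \<omega> unfolding tame_def by blast
    then show False using e True by simp
  next
    case False
    obtain d where d: "0 < d" "\<And>x. x \<in> {0..} \<Longrightarrow> dist x r < d \<Longrightarrow> dist (X x \<omega>) (X r \<omega>) < \<bar>X r \<omega>\<bar> - K"
      using c e r unfolding continuous_on_iff by (metis atLeast_iff)
    obtain p where p: "p \<in> \<rat>" "max 0 (r - d) < p" "p < r"
      using Rats_dense_in_real[of "max 0 (r - d)" r] d(1) False r by auto
    have "dist (X p \<omega>) (X r \<omega>) < \<bar>X r \<omega>\<bar> - K" using p by (intro d(2)) (auto simp: dist_real_def)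
    moreover have "\<bar>X p \<omega>\<bar> \<le> K" using \<omega> p r by (auto simp: tame_def)
    ultimately show False by (simp add: dist_real_def)
  qed
qed

lemma tame_exhausts:
  assumes c: "continuous_on {0..} (\<lambda>t. X t \<omega>)" and \<omega>: "\<omega> \<in> space M" and t: "0 \<le> t"
  shows "eventually (\<lambda>n. \<omega> \<in> tame (real n) t) sequentially"
proof -
  have "compact ((\<lambda>r. X r \<omega>) ` {0..t})"
    by (intro compact_continuous_image continuous_on_subset[OF c]) auto
  then have "bounded ((\<lambda>r. X r \<omega>) ` {0..t})" by (rule compact_imp_bounded)
  then obtain K where "\<forall>x\<in>(\<lambda>r. X r \<omega>) ` {0..t}. norm x \<le> K" unfolding bounded_iff by (elim exE)
  then have K: "\<bar>X r \<omega>\<bar> \<le> K" if "r \<in> {0..t}" for r using that by simp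
  obtain n0 :: nat where n0: "K \<le> real n0" using real_arch_simple by blast
  have "\<omega> \<in> tame (real n) t" if n: "n0 \<le> n" for n
  proof -
    have "\<bar>X r \<omega>\<bar> \<le> real n" if "r \<in> {0..t}" for r
      using K[OF that] n0 n by linarith
    then show ?thesis using \<omega> by (auto simp: tame_def)
  qed
  then show ?thesis by (auto simp: eventually_sequentially)
qed

abbreviation Xtame :: "real \<Rightarrow> real \<Rightarrow> 'a \<Rightarrow> real" where
  "Xtame K t \<omega> \<equiv> X t \<omega> * indicator (tame K t) \<omega>"

text \<open>The crude bound \<open>K\<^sup>2\<close> is the finite start of the Gronwall iteration.
  It holds up to a null set, because \<open>tame\<close> controls rational times and continuity the
  others.\<close>

lemma Xtame_L2F:
  assumes "0 \<le> t" "0 \<le> K"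
  shows "Xtame K t \<in> L2F t" and "(\<integral>\<omega>. (Xtame K t \<omega>)\<^sup>2 \<partial>M) \<le> K\<^sup>2"
proof -
  have m: "Xtame K t \<in> borel_measurable (F t)"
    by (intro borel_measurable_times X_measurable assms borel_measurable_indicator tame_sets)
  have b: "AE \<omega> in M. \<bar>Xtame K t \<omega>\<bar> \<le> \<bar>K\<bar>"
    using X_continuous by eventually_elim (use tame_bound assms in \<open>auto simp: indicator_def\<close>)
  have L: "Xtame K t \<in> L2 M" by (rule L2_bound[OF L2_const F_measurable_M[OF m] b])
  then show "Xtame K t \<in> L2F t" using m by (simp add: L2F_def)
  have "(\<integral>\<omega>. (Xtame K t \<omega>)\<^sup>2 \<partial>M) \<le> (\<integral>\<omega>. K\<^sup>2 \<partial>M)"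
  proof (rule integral_mono_AE)
    show "AE \<omega> in M. (Xtame K t \<omega>)\<^sup>2 \<le> K\<^sup>2" using b by eventually_elim (simp only: abs_le_square_iff)
  qed (use L in \<open>simp_all add: L2_def\<close>)
  then show "(\<integral>\<omega>. (Xtame K t \<omega>)\<^sup>2 \<partial>M) \<le> K\<^sup>2" by (simp add: prob_space)
qed

text \<open>Since \<open>q * t \<le> t\<close> and the events decrease, the indicator at time
  \<open>t\<close> may be replaced by the larger one at time \<open>q * t\<close> next to the
  delayed value. The estimate thereby closes in the truncated moments alone.\<close>

lemma lin_tame_bound:
  assumes t: "0 \<le> t" and K: "0 \<le> K"
  shows "(\<lambda>\<omega>. (\<alpha> * X t \<omega> + \<beta> * X (q * t) \<omega>) * indicator (tame K t) \<omega>) \<in> L2F t"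
    and "(\<integral>\<omega>. ((\<alpha> * X t \<omega> + \<beta> * X (q * t) \<omega>) * indicator (tame K t) \<omega>)\<^sup>2 \<partial>M)
      \<le> 2 * \<alpha>\<^sup>2 * (\<integral>\<omega>. (Xtame K t \<omega>)\<^sup>2 \<partial>M) + 2 * \<beta>\<^sup>2 * (\<integral>\<omega>. (Xtame K (q * t) \<omega>)\<^sup>2 \<partial>M)"
proof -
  note qt = q_mult[OF t]
  have sub: "tame K t \<subseteq> tame K (q * t)" by (rule tame_mono[OF qt(2)])
  let ?g = "\<lambda>\<omega>. X (q * t) \<omega> * indicator (tame K t) \<omega> :: real"
  have g_eq: "?g = (\<lambda>\<omega>. Xtame K (q * t) \<omega> * indicator (tame K t) \<omega>)"
    using sub by (auto simp: indicator_def fun_eq_iff)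
  have gF: "?g \<in> L2F t"
    unfolding g_eq by (intro L2F_indicator L2F_mono[OF Xtame_L2F(1)[OF qt(1) K] qt(2)] tame_sets)
  have Xq: "Xtame K (q * t) \<in> L2 M" by (rule L2F_L2[OF Xtame_L2F(1)[OF qt(1) K]])
  have g_le: "(\<integral>\<omega>. (?g \<omega>)\<^sup>2 \<partial>M) \<le> (\<integral>\<omega>. (Xtame K (q * t) \<omega>)\<^sup>2 \<partial>M)"
  proof (rule integral_mono)
    fix \<omega>
    show "(?g \<omega>)\<^sup>2 \<le> (Xtame K (q * t) \<omega>)\<^sup>2" using sub by (auto simp: indicator_def)
  qed (intro L2_integrable_square L2F_L2[OF gF] Xq)+
  have eq: "(\<alpha> * X t \<omega> + \<beta> * X (q * t) \<omega>) * indicator (tame K t) \<omega> = \<alpha> * Xtame K t \<omega> + \<beta> * ?g \<omega>" for \<omega>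
    by (simp add: algebra_simps)
  show "(\<lambda>\<omega>. (\<alpha> * X t \<omega> + \<beta> * X (q * t) \<omega>) * indicator (tame K t) \<omega>) \<in> L2F t"
    unfolding eq by (intro L2F_add L2F_cmult Xtame_L2F t K gF)
  have "(\<integral>\<omega>. (\<alpha> * Xtame K t \<omega> + \<beta> * ?g \<omega>)\<^sup>2 \<partial>M)
      \<le> 2 * (\<integral>\<omega>. (\<alpha> * Xtame K t \<omega>)\<^sup>2 \<partial>M) + 2 * (\<integral>\<omega>. (\<beta> * ?g \<omega>)\<^sup>2 \<partial>M)"
    by (intro L2_add_bound L2_cmult L2F_L2[OF Xtame_L2F(1)[OF t K]] L2F_L2[OF gF])
  also have "\<dots> = 2 * \<alpha>\<^sup>2 * (\<integral>\<omega>. (Xtame K t \<omega>)\<^sup>2 \<partial>M) + 2 * \<beta>\<^sup>2 * (\<integral>\<omega>. (?g \<omega>)\<^sup>2 \<partial>M)"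
    by (simp add: power_mult_distrib mult.assoc)
  also have "\<dots> \<le> 2 * \<alpha>\<^sup>2 * (\<integral>\<omega>. (Xtame K t \<omega>)\<^sup>2 \<partial>M) + 2 * \<beta>\<^sup>2 * (\<integral>\<omega>. (Xtame K (q * t) \<omega>)\<^sup>2 \<partial>M)"
    using g_le by (intro add_left_mono mult_left_mono) auto
  finally show "(\<integral>\<omega>. ((\<alpha> * X t \<omega> + \<beta> * X (q * t) \<omega>) * indicator (tame K t) \<omega>)\<^sup>2 \<partial>M)
      \<le> 2 * \<alpha>\<^sup>2 * (\<integral>\<omega>. (Xtame K t \<omega>)\<^sup>2 \<partial>M) + 2 * \<beta>\<^sup>2 * (\<integral>\<omega>. (Xtame K (q * t) \<omega>)\<^sup>2 \<partial>M)"
    unfolding eq .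
qed

text \<open>The truncation is placed inside the summands, each at its own time. On
  \<open>tame K t\<close> all earlier truncations are inactive, so the truncated sums agree with the
  original ones and converge to the solution; elsewhere the outer indicator makes everything 0. The
  truncated sums are bounded by Cauchy-Schwarz and the isometry with constants free of
  \<open>K\<close>, and Fatou carries the bound to the limit.\<close>

lemma Xtame_step:
  assumes T: "0 \<le> t" "t \<le> T" and K: "0 \<le> K" and c: "0 \<le> c"
    and \<kappa>: "6 * (T * (a\<^sup>2 + b\<^sup>2) + \<sigma>\<^sup>2 + \<rho>\<^sup>2) \<le> \<kappa>" "0 < \<kappa>"
    and le: "\<And>r. 0 \<le> r \<Longrightarrow> r \<le> T \<Longrightarrow> (\<integral>\<omega>. (Xtame K r \<omega>)\<^sup>2 \<partial>M) \<le> c * exp (\<kappa> * r)"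
  shows "(\<integral>\<omega>. (Xtame K t \<omega>)\<^sup>2 \<partial>M) \<le> 3 * (\<integral>\<omega>. (X0 \<omega>)\<^sup>2 \<partial>M) + c * (exp (\<kappa> * t) - 1)"
proof -
  obtain n u where P: "fine_partitions 0 t n u"
    and lim: "AE \<omega> in M. (\<lambda>m. \<Sum>i<n m. diffusion (u m i) \<omega> * dB (u m i) (u m (Suc i)) \<omega>) \<longlonglongrightarrow> I t \<omega> - I 0 \<omega>"
    using ito_integral_Riemann[OF ito_diffusion diffusion_adapted diffusion_continuous order_refl T(1)] .
  note PD = fine_partitionsD[OF P]
  have uT: "0 \<le> u m i" "i < n m \<Longrightarrow> u m i \<le> T" "i < n m \<Longrightarrow> u m i \<le> t" for m i
    using PD(5)[of m i] PD(6)[of i m] T by auto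
  define dG where "dG r \<omega> = drift r \<omega> * indicator (tame K r) \<omega>" for r \<omega>
  define HG where "HG r \<omega> = diffusion r \<omega> * indicator (tame K r) \<omega>" for r \<omega>
  \<comment> \<open>The delay is given up here: the bound at \<open>q * r\<close> is replaced by the
    larger one at \<open>r\<close>. This loses the growth rate but suffices for finiteness.\<close>
  have lin: "2 * \<alpha>\<^sup>2 * (\<integral>\<omega>. (Xtame K r \<omega>)\<^sup>2 \<partial>M) + 2 * \<beta>\<^sup>2 * (\<integral>\<omega>. (Xtame K (q * r) \<omega>)\<^sup>2 \<partial>M)
      \<le> 2 * (\<alpha>\<^sup>2 + \<beta>\<^sup>2) * (c * exp (\<kappa> * r))" if r: "0 \<le> r" "r \<le> T" for r \<alpha> \<beta>
  proof -
    have "(\<integral>\<omega>. (Xtame K (q * r) \<omega>)\<^sup>2 \<partial>M) \<le> c * exp (\<kappa> * (q * r))" using q_mult[OF r(1)] r by (intro le) auto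
    also have "\<dots> \<le> c * exp (\<kappa> * r)" using q_mult[OF r(1)] c \<kappa> by (intro mult_left_mono) auto
    finally have "2 * \<beta>\<^sup>2 * (\<integral>\<omega>. (Xtame K (q * r) \<omega>)\<^sup>2 \<partial>M) \<le> 2 * \<beta>\<^sup>2 * (c * exp (\<kappa> * r))"
      by (rule mult_left_mono) simp
    moreover have "2 * \<alpha>\<^sup>2 * (\<integral>\<omega>. (Xtame K r \<omega>)\<^sup>2 \<partial>M) \<le> 2 * \<alpha>\<^sup>2 * (c * exp (\<kappa> * r))"
      by (rule mult_left_mono[OF le[OF r]]) simp
    ultimately show ?thesis by (simp add: algebra_simps)
  qed
  have dG: "dG r \<in> L2F r" "(\<integral>\<omega>. (dG r \<omega>)\<^sup>2 \<partial>M) \<le> 2 * (a\<^sup>2 + b\<^sup>2) * (c * exp (\<kappa> * r))"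
    and HG: "HG r \<in> L2F r" "(\<integral>\<omega>. (HG r \<omega>)\<^sup>2 \<partial>M) \<le> 2 * (\<sigma>\<^sup>2 + \<rho>\<^sup>2) * (c * exp (\<kappa> * r))"
    if r: "0 \<le> r" "r \<le> T" for r
    using lin_tame_bound[OF r(1) K, of a b] lin_tame_bound[OF r(1) K, of \<sigma> \<rho>] lin[OF r, of a b] lin[OF r, of \<sigma> \<rho>]
    unfolding dG_def HG_def drift_def diffusion_def by (blast intro: order_trans)+
  have sumexp: "(\<Sum>i<n m. exp (\<kappa> * u m i) * (u m (Suc i) - u m i)) \<le> (exp (\<kappa> * t) - 1) / \<kappa>" for m
    using exp_left_Riemann_sum[OF PD(1)[of m] \<kappa>(2), of "n m"] by (simp add: PD(2,3))
  define D where "D m \<omega> = (\<Sum>i<n m. dG (u m i) \<omega> * (u m (Suc i) - u m i))" for m \<omega>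
  define S where "S m \<omega> = (\<Sum>i<n m. HG (u m i) \<omega> * dB (u m i) (u m (Suc i)) \<omega>)" for m \<omega>
  have nn: "0 \<le> u m (Suc i) - u m i" for m i using PD(7)[of m i] by simp
  have dGu: "dG (u m i) \<in> L2 M" if "i < n m" for m i using L2F_L2[OF dG(1)] uT that by simp
  have DL: "D m \<in> L2 M" for m
    unfolding D_def using dGu by (intro L2_sum) (auto simp: mult.commute[of _ "_ - _"] intro: L2_cmult)
  have u0: "0 \<le> u m 0" for m using uT by simp
  have HGu: "HG (u m i) \<in> L2F (u m i)" if "i < n m" for m i using HG(1) uT that by simp
  note iso = elementary_isometry[OF PD(1) u0 HGu]
  have SL: "S m \<in> L2 M" for m unfolding S_def by (rule L2F_L2[OF iso(1)])
  have Db: "(\<integral>\<omega>. (D m \<omega>)\<^sup>2 \<partial>M) \<le> T * (2 * (a\<^sup>2 + b\<^sup>2) * c * ((exp (\<kappa> * t) - 1) / \<kappa>))" for m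
  proof -
    have "(\<integral>\<omega>. (D m \<omega>)\<^sup>2 \<partial>M)
        \<le> (\<Sum>i<n m. u m (Suc i) - u m i) * (\<Sum>i<n m. (\<integral>\<omega>. (dG (u m i) \<omega>)\<^sup>2 \<partial>M) * (u m (Suc i) - u m i))"
      unfolding D_def using dGu nn by (intro L2_weighted_sum_bound) auto
    also have "\<dots> = t * (\<Sum>i<n m. (\<integral>\<omega>. (dG (u m i) \<omega>)\<^sup>2 \<partial>M) * (u m (Suc i) - u m i))"
      by (simp add: PD(8))
    also have "\<dots> \<le> t * (\<Sum>i<n m. 2 * (a\<^sup>2 + b\<^sup>2) * (c * exp (\<kappa> * u m i)) * (u m (Suc i) - u m i))"
      using uT nn T by (intro mult_left_mono sum_mono mult_right_mono dG(2)) auto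
    also have "\<dots> = t * (2 * (a\<^sup>2 + b\<^sup>2) * c * (\<Sum>i<n m. exp (\<kappa> * u m i) * (u m (Suc i) - u m i)))"
      by (simp add: sum_distrib_left mult.assoc)
    also have "\<dots> \<le> T * (2 * (a\<^sup>2 + b\<^sup>2) * c * ((exp (\<kappa> * t) - 1) / \<kappa>))"
      using T c nn by (intro mult_mono sumexp order_refl mult_nonneg_nonneg sum_nonneg) auto
    finally show ?thesis .
  qed
  have Sb: "(\<integral>\<omega>. (S m \<omega>)\<^sup>2 \<partial>M) \<le> 2 * (\<sigma>\<^sup>2 + \<rho>\<^sup>2) * c * ((exp (\<kappa> * t) - 1) / \<kappa>)" for m
  proof -
    have "(\<integral>\<omega>. (S m \<omega>)\<^sup>2 \<partial>M) = (\<Sum>i<n m. (\<integral>\<omega>. (HG (u m i) \<omega>)\<^sup>2 \<partial>M) * (u m (Suc i) - u m i))"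
      unfolding S_def by (rule iso(2))
    also have "\<dots> \<le> (\<Sum>i<n m. 2 * (\<sigma>\<^sup>2 + \<rho>\<^sup>2) * (c * exp (\<kappa> * u m i)) * (u m (Suc i) - u m i))"
      using uT nn by (intro sum_mono mult_right_mono HG(2)) auto
    also have "\<dots> = 2 * (\<sigma>\<^sup>2 + \<rho>\<^sup>2) * c * (\<Sum>i<n m. exp (\<kappa> * u m i) * (u m (Suc i) - u m i))"
      by (simp add: sum_distrib_left mult.assoc)
    also have "\<dots> \<le> 2 * (\<sigma>\<^sup>2 + \<rho>\<^sup>2) * c * ((exp (\<kappa> * t) - 1) / \<kappa>)"
      using c by (intro mult_left_mono sumexp mult_nonneg_nonneg) auto
    finally show ?thesis .
  qed
  define Y where "Y m \<omega> = (X0 \<omega> + (D m \<omega> + S m \<omega>)) * indicator (tame K t) \<omega>" for m \<omega>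
  have X0L: "X0 \<in> L2 M" by (rule L2F_L2[OF X0_L2F])
  have tM: "tame K t \<in> events" using tame_sets F_sets by blast
  have sumL: "(\<lambda>\<omega>. X0 \<omega> + (D m \<omega> + S m \<omega>)) \<in> L2 M" for m by (intro L2_add X0L DL SL)
  have YL: "Y m \<in> L2 M" for m unfolding Y_def by (rule L2_indicator[OF sumL tM])
  have Xm: "Xtame K t \<in> borel_measurable M" by (rule L2_measurable[OF L2F_L2[OF Xtame_L2F(1)[OF T(1) K]]])
  have Ylim: "AE \<omega> in M. (\<lambda>m. Y m \<omega>) \<longlonglongrightarrow> Xtame K t \<omega>"
    using lim X_increment[OF order_refl T(1)] X_zero
  proof eventually_elim
    case (elim \<omega>)
    show ?case
    proof (cases "\<omega> \<in> tame K t")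
      case True
      have "\<omega> \<in> tame K (u m i)" if "i < n m" for m i
        using tame_mono[of "u m i" t K] uT that True by auto
      then have "D m \<omega> = (\<Sum>i<n m. drift (u m i) \<omega> * (u m (Suc i) - u m i))"
        "S m \<omega> = (\<Sum>i<n m. diffusion (u m i) \<omega> * dB (u m i) (u m (Suc i)) \<omega>)" for m
        unfolding D_def S_def dG_def HG_def by (auto intro!: sum.cong)
      moreover have "(\<lambda>m. \<Sum>i<n m. drift (u m i) \<omega> * (u m (Suc i) - u m i)) \<longlonglongrightarrow> integral {0..t} (\<lambda>r. drift r \<omega>)"
        by (rule Riemann_sums_tendsto[OF _ P]) (use elim(2) in blast)
      ultimately have "(\<lambda>m. X0 \<omega> + (D m \<omega> + S m \<omega>))
          \<longlonglongrightarrow> X0 \<omega> + (integral {0..t} (\<lambda>r. drift r \<omega>) + (I t \<omega> - I 0 \<omega>))"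
        using elim(1) by (intro tendsto_intros) auto
      moreover have "X0 \<omega> + (integral {0..t} (\<lambda>r. drift r \<omega>) + (I t \<omega> - I 0 \<omega>)) = X t \<omega>"
        using elim by auto
      ultimately show ?thesis using True by (simp add: Y_def)
    qed (simp add: Y_def)
  qed
  have Yb: "(\<integral>\<omega>. (Y m \<omega>)\<^sup>2 \<partial>M) \<le> 3 * (\<integral>\<omega>. (X0 \<omega>)\<^sup>2 \<partial>M) + c * (exp (\<kappa> * t) - 1)" for m
  proof -
    \<comment> \<open>The factor 3 from three summands times the factor 2 from
      \<open>lin_tame_bound\<close> is the 6 in the condition on \<open>\<kappa>\<close>.\<close>
    have "(\<integral>\<omega>. (Y m \<omega>)\<^sup>2 \<partial>M) \<le> (\<integral>\<omega>. 3 * (X0 \<omega>)\<^sup>2 + 3 * (D m \<omega>)\<^sup>2 + 3 * (S m \<omega>)\<^sup>2 \<partial>M)"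
    proof (rule integral_mono)
      fix \<omega>
      have three: "(x + (y + z))\<^sup>2 \<le> 3 * x\<^sup>2 + 3 * y\<^sup>2 + 3 * z\<^sup>2" for x y z :: real
      proof -
        have "3 * x\<^sup>2 + 3 * y\<^sup>2 + 3 * z\<^sup>2 - (x + (y + z))\<^sup>2 = (x - y)\<^sup>2 + (x - z)\<^sup>2 + (y - z)\<^sup>2"
          by (simp add: power2_eq_square algebra_simps)
        moreover have "0 \<le> (x - y)\<^sup>2 + (x - z)\<^sup>2 + (y - z)\<^sup>2" by simp
        ultimately show ?thesis by linarith
      qed
      have "(Y m \<omega>)\<^sup>2 \<le> (X0 \<omega> + (D m \<omega> + S m \<omega>))\<^sup>2" by (simp add: Y_def indicator_def)
      then show "(Y m \<omega>)\<^sup>2 \<le> 3 * (X0 \<omega>)\<^sup>2 + 3 * (D m \<omega>)\<^sup>2 + 3 * (S m \<omega>)\<^sup>2"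
        using three[of "X0 \<omega>" "D m \<omega>" "S m \<omega>"] by linarith
    qed (use YL X0L DL SL in \<open>auto simp: L2_def\<close>)
    also have "\<dots> = 3 * (\<integral>\<omega>. (X0 \<omega>)\<^sup>2 \<partial>M) + 3 * (\<integral>\<omega>. (D m \<omega>)\<^sup>2 \<partial>M) + 3 * (\<integral>\<omega>. (S m \<omega>)\<^sup>2 \<partial>M)"
      using X0L DL[of m] SL[of m] by (simp add: L2_def)
    also have "\<dots> \<le> 3 * (\<integral>\<omega>. (X0 \<omega>)\<^sup>2 \<partial>M) + 3 * (T * (2 * (a\<^sup>2 + b\<^sup>2) * c * ((exp (\<kappa> * t) - 1) / \<kappa>)))
        + 3 * (2 * (\<sigma>\<^sup>2 + \<rho>\<^sup>2) * c * ((exp (\<kappa> * t) - 1) / \<kappa>))"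
      using Db[of m] Sb[of m] by linarith
    also have "\<dots> = 3 * (\<integral>\<omega>. (X0 \<omega>)\<^sup>2 \<partial>M)
        + 6 * (T * (a\<^sup>2 + b\<^sup>2) + \<sigma>\<^sup>2 + \<rho>\<^sup>2) * (c * ((exp (\<kappa> * t) - 1) / \<kappa>))"
      by (simp add: algebra_simps)
    also have "\<dots> \<le> 3 * (\<integral>\<omega>. (X0 \<omega>)\<^sup>2 \<partial>M) + \<kappa> * (c * ((exp (\<kappa> * t) - 1) / \<kappa>))"
      using \<kappa> c T by (intro add_left_mono mult_right_mono mult_nonneg_nonneg divide_nonneg_nonneg) auto
    also have "\<kappa> * (c * ((exp (\<kappa> * t) - 1) / \<kappa>)) = c * (exp (\<kappa> * t) - 1)" using \<kappa> by simp
    finally show ?thesis .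
  qed
  show ?thesis by (rule L2_Fatou(2)[OF YL Xm Ylim Yb])
qed

text \<open>Gronwall applies to the truncated moments because they are finite; the resulting bound
  no longer contains \<open>K\<close>, which then tends to infinity along the integers, again by
  Fatou.\<close>

lemma second_moment_locally_bounded:
  assumes T: "0 \<le> T"
  obtains C where "0 < C" "\<And>t. 0 \<le> t \<Longrightarrow> t \<le> T \<Longrightarrow> X t \<in> L2F t"
    "\<And>t. 0 \<le> t \<Longrightarrow> t \<le> T \<Longrightarrow> (\<integral>\<omega>. (X t \<omega>)\<^sup>2 \<partial>M) \<le> C"
proof -
  \<comment> \<open>The summand 1 keeps \<open>\<kappa>\<close> positive when all coefficients
    vanish.\<close>
  define \<kappa> where "\<kappa> = 6 * (T * (a\<^sup>2 + b\<^sup>2) + \<sigma>\<^sup>2 + \<rho>\<^sup>2) + 1"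
  have nn: "0 \<le> 6 * (T * (a\<^sup>2 + b\<^sup>2) + \<sigma>\<^sup>2 + \<rho>\<^sup>2)" using T by simp
  have \<kappa>: "6 * (T * (a\<^sup>2 + b\<^sup>2) + \<sigma>\<^sup>2 + \<rho>\<^sup>2) \<le> \<kappa>" "0 < \<kappa>"
    using nn by (auto simp: \<kappa>_def)
  define A where "A = 3 * (\<integral>\<omega>. (X0 \<omega>)\<^sup>2 \<partial>M)"
  have A: "0 \<le> A" by (simp add: A_def)
  have tame_le: "(\<integral>\<omega>. (Xtame K t \<omega>)\<^sup>2 \<partial>M) \<le> A * exp (\<kappa> * t)" if K: "0 \<le> K" and t: "0 \<le> t" "t \<le> T" for K t
  proof (rule Gronwall_contraction[where u="\<lambda>t. \<integral>\<omega>. (Xtame K t \<omega>)\<^sup>2 \<partial>M" and g="\<lambda>t. exp (\<kappa> * t)"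
        and A=A and t=t and S="{0..T}" and G="exp (\<kappa> * T)" and \<beta>="K\<^sup>2"])
    fix \<theta> t assume \<theta>: "0 \<le> \<theta>" and le: "\<And>t. t \<in> {0..T} \<Longrightarrow> (\<integral>\<omega>. (Xtame K t \<omega>)\<^sup>2 \<partial>M) \<le> (A + \<theta>) * exp (\<kappa> * t)"
      and t: "t \<in> {0..T}"
    show "(\<integral>\<omega>. (Xtame K t \<omega>)\<^sup>2 \<partial>M) \<le> A + (A + \<theta>) * (exp (\<kappa> * t) - 1)"
      unfolding A_def
      by (rule Xtame_step[OF _ _ K _ \<kappa>]) (use t \<theta> A le in \<open>auto simp: A_def\<close>)
  qed (use A K t \<kappa> Xtame_L2F(2) in auto)
  have main: "X t \<in> L2 M \<and> (\<integral>\<omega>. (X t \<omega>)\<^sup>2 \<partial>M) \<le> A * exp (\<kappa> * t)" if t: "0 \<le> t" "t \<le> T" for t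
  proof -
    have L: "Xtame (real n) t \<in> L2 M" for n by (rule L2F_L2[OF Xtame_L2F(1)[OF t(1)]]) simp
    have lim: "AE \<omega> in M. (\<lambda>n. Xtame (real n) t \<omega>) \<longlonglongrightarrow> X t \<omega>"
      using X_continuous AE_space
    proof eventually_elim
      case (elim \<omega>)
      have "eventually (\<lambda>n. Xtame (real n) t \<omega> = X t \<omega>) sequentially"
        using tame_exhausts[OF elim t(1)] by eventually_elim simp
      then show ?case by (rule tendsto_eventually)
    qed
    show ?thesis using L2_Fatou[OF L X_measurable_M[OF t(1)] lim tame_le[OF _ t]] by simp
  qed
  show ?thesis
  proof (rule that[of "A * exp (\<kappa> * T) + 1"])
    show "0 < A * exp (\<kappa> * T) + 1" using A by (simp add: add_nonneg_pos)
    fix t assume t: "0 \<le> t" "t \<le> T"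
    show "X t \<in> L2F t" using main[OF t] X_measurable[OF t(1)] by (simp add: L2F_def)
    have "A * exp (\<kappa> * t) \<le> A * exp (\<kappa> * T)" using A t \<kappa> by (intro mult_left_mono) auto
    then show "(\<integral>\<omega>. (X t \<omega>)\<^sup>2 \<partial>M) \<le> A * exp (\<kappa> * T) + 1" using main[OF t] by linarith
  qed
qed

lemma X_L2F: "0 \<le> t \<Longrightarrow> X t \<in> L2F t"
  using second_moment_locally_bounded[of t] by (metis order_refl)

end

section \<open>Mean-square expansion of the solution over a short step\<close>

lemma (in finite_measure) L2_product_sqrt_bound:
  assumes "f \<in> L2 M" "g \<in> L2 M" "0 < h"
    and "(\<integral>x. (f x)\<^sup>2 \<partial>M) \<le> A * h" "(\<integral>x. (g x)\<^sup>2 \<partial>M) \<le> C * h\<^sup>2"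
  shows "2 * \<bar>\<integral>x. f x * g x \<partial>M\<bar> \<le> (A + C) * (h * sqrt h)"
proof -
  have s: "0 < sqrt h" "h / sqrt h = sqrt h" using assms(3) by (auto simp: real_div_sqrt)
  \<comment> \<open>The weight \<open>sqrt h\<close> balances a factor of size \<open>sqrt h\<close>
    against one of size h.\<close>
  have "2 * \<bar>\<integral>x. f x * g x \<partial>M\<bar> \<le> sqrt h * (\<integral>x. (f x)\<^sup>2 \<partial>M) + (\<integral>x. (g x)\<^sup>2 \<partial>M) / sqrt h"
    by (rule L2_abs_product_bound[OF assms(1,2) s(1)])
  also have "\<dots> \<le> sqrt h * (A * h) + (C * h\<^sup>2) / sqrt h"
    using s assms by (intro add_mono mult_left_mono divide_right_mono) auto
  also have "(C * h\<^sup>2) / sqrt h = C * (h * (h / sqrt h))" by (simp add: power2_eq_square)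
  also have "sqrt h * (A * h) + C * (h * (h / sqrt h)) = (A + C) * (h * sqrt h)"
    unfolding s(2) by (simp add: algebra_simps)
  finally show ?thesis .
qed

lemma L2_inner_add:
  assumes "\<xi> \<in> L2 M" "f \<in> L2 M" "g \<in> L2 M"
  shows "(\<integral>x. \<xi> x * (f x + g x) \<partial>M) = (\<integral>x. \<xi> x * f x \<partial>M) + (\<integral>x. \<xi> x * g x \<partial>M)"
  using L2_mult_integrable[OF assms(1,2)] L2_mult_integrable[OF assms(1,3)] by (simp add: distrib_left)

lemma power2_le_sqrt: "0 \<le> h \<Longrightarrow> h \<le> 1 \<Longrightarrow> h\<^sup>2 \<le> h * sqrt (h :: real)"
proof -
  assume h: "0 \<le> h" "h \<le> 1"
  have "h\<^sup>2 \<le> h" using mult_left_mono[OF h(2) h(1)] by (simp add: power2_eq_square)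
  then have "h \<le> sqrt h" by (rule real_le_rsqrt)
  then show ?thesis using h by (simp add: power2_eq_square mult_left_mono)
qed

context pantograph
begin

lemma lin_L2F:
  assumes t: "0 \<le> t"
  shows "(\<lambda>\<omega>. \<alpha> * X t \<omega> + \<beta> * X (q * t) \<omega>) \<in> L2F t"
    and "(\<integral>\<omega>. (\<alpha> * X t \<omega> + \<beta> * X (q * t) \<omega>)\<^sup>2 \<partial>M)
      \<le> 2 * \<alpha>\<^sup>2 * (\<integral>\<omega>. (X t \<omega>)\<^sup>2 \<partial>M) + 2 * \<beta>\<^sup>2 * (\<integral>\<omega>. (X (q * t) \<omega>)\<^sup>2 \<partial>M)"
proof -
  note XL = X_L2F[OF t] and XqL = L2F_mono[OF X_L2F[OF q_mult(1)[OF t]] q_mult(2)[OF t]]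
  show "(\<lambda>\<omega>. \<alpha> * X t \<omega> + \<beta> * X (q * t) \<omega>) \<in> L2F t"
    by (intro L2F_add L2F_cmult XL XqL)
  have "(\<integral>\<omega>. (\<alpha> * X t \<omega> + \<beta> * X (q * t) \<omega>)\<^sup>2 \<partial>M)
      \<le> 2 * (\<integral>\<omega>. (\<alpha> * X t \<omega>)\<^sup>2 \<partial>M) + 2 * (\<integral>\<omega>. (\<beta> * X (q * t) \<omega>)\<^sup>2 \<partial>M)"
    by (intro L2_add_bound L2_cmult L2F_L2[OF XL] L2F_L2[OF XqL])
  then show "(\<integral>\<omega>. (\<alpha> * X t \<omega> + \<beta> * X (q * t) \<omega>)\<^sup>2 \<partial>M)
      \<le> 2 * \<alpha>\<^sup>2 * (\<integral>\<omega>. (X t \<omega>)\<^sup>2 \<partial>M) + 2 * \<beta>\<^sup>2 * (\<integral>\<omega>. (X (q * t) \<omega>)\<^sup>2 \<partial>M)"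
    by (simp add: power_mult_distrib mult.assoc)
qed

lemma drift_L2F: "0 \<le> t \<Longrightarrow> drift t \<in> L2F t"
  unfolding drift_def[abs_def] by (rule lin_L2F(1))

lemma diffusion_L2F: "0 \<le> t \<Longrightarrow> diffusion t \<in> L2F t"
  unfolding diffusion_def[abs_def] by (rule lin_L2F(1))

lemma lin_bound:
  assumes "0 \<le> t" "(\<integral>\<omega>. (X t \<omega>)\<^sup>2 \<partial>M) \<le> C" "(\<integral>\<omega>. (X (q * t) \<omega>)\<^sup>2 \<partial>M) \<le> C"
  shows "(\<integral>\<omega>. (\<alpha> * X t \<omega> + \<beta> * X (q * t) \<omega>)\<^sup>2 \<partial>M) \<le> 2 * (\<alpha>\<^sup>2 + \<beta>\<^sup>2) * C"
proof -
  have "2 * \<alpha>\<^sup>2 * (\<integral>\<omega>. (X t \<omega>)\<^sup>2 \<partial>M) \<le> 2 * \<alpha>\<^sup>2 * C" "2 * \<beta>\<^sup>2 * (\<integral>\<omega>. (X (q * t) \<omega>)\<^sup>2 \<partial>M) \<le> 2 * \<beta>\<^sup>2 * C"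
    using assms by (intro mult_left_mono; simp)+
  then show ?thesis using lin_L2F(2)[OF assms(1), of \<alpha> \<beta>] by (simp add: algebra_simps)
qed

text \<open>The case of frozen coefficient 0: the isometry as an upper bound, and the martingale
  property of \<open>I\<close>.\<close>

lemma I_increment_L2:
  assumes st: "0 \<le> s" "s \<le> t"
    and bound: "\<And>r. s \<le> r \<Longrightarrow> r \<le> t \<Longrightarrow> (\<integral>\<omega>. (diffusion r \<omega>)\<^sup>2 \<partial>M) \<le> K"
  shows "(\<lambda>\<omega>. I t \<omega> - I s \<omega>) \<in> L2F t"
    and "(\<integral>\<omega>. (I t \<omega> - I s \<omega>)\<^sup>2 \<partial>M) \<le> K * (t - s)"
    and "\<eta> \<in> L2F s \<Longrightarrow> (\<integral>\<omega>. \<eta> \<omega> * (I t \<omega> - I s \<omega>) \<partial>M) = 0"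
proof -
  have L: "diffusion r \<in> L2 M" if "s \<le> r" "r \<le> t" for r
    using that st by (intro L2F_L2[OF diffusion_L2F]) auto
  have z: "(\<lambda>\<omega>. 0) \<in> L2F s" by (intro L2F_intro L2_zero borel_measurable_const)
  note It = ito_integral_L2[OF ito_diffusion diffusion_adapted diffusion_continuous st L z, of K, simplified]
  show "(\<lambda>\<omega>. I t \<omega> - I s \<omega>) \<in> L2F t" by (rule It(1)[OF bound])
  show "(\<integral>\<omega>. (I t \<omega> - I s \<omega>)\<^sup>2 \<partial>M) \<le> K * (t - s)" by (rule It(2)[OF bound])
  show "\<eta> \<in> L2F s \<Longrightarrow> (\<integral>\<omega>. \<eta> \<omega> * (I t \<omega> - I s \<omega>) \<partial>M) = 0" by (rule It(3)[OF bound])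
qed

text \<open>The local error of one Euler-Maruyama step from \<open>s\<close> to
  \<open>t\<close>.\<close>

definition remainder :: "real \<Rightarrow> real \<Rightarrow> 'a \<Rightarrow> real" where
  "remainder s t \<omega> = X t \<omega> - X s \<omega> - (t - s) * drift s \<omega> - diffusion s \<omega> * dB s t \<omega>"

lemma remainder_L2F:
  assumes "0 \<le> s" "s \<le> t" shows "remainder s t \<in> L2F t"
  unfolding remainder_def[abs_def] using assms
  by (intro L2F_diff L2F_cmult L2F_mono[OF drift_L2F] L2F_mono[OF X_L2F] X_L2F
      increment_mult_dB(1) diffusion_L2F) auto

text \<open>The remainder splits into the error of freezing the drift, with second moment of order
  \<open>h\<^sup>3\<close>, and the error of freezing the diffusion, of order
  \<open>h\<^sup>2\<close> but orthogonal to everything known at \<open>s\<close>. Against such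
  variables only the first part is felt, which improves the pairing from order h to order
  \<open>h * sqrt h\<close>.\<close>

lemma local_expansion:
  assumes T: "0 \<le> T"
  obtains C where "0 < C" "\<And>t. 0 \<le> t \<Longrightarrow> t \<le> T \<Longrightarrow> (\<integral>\<omega>. (X t \<omega>)\<^sup>2 \<partial>M) \<le> C"
    "\<And>s t. 0 \<le> s \<Longrightarrow> s \<le> t \<Longrightarrow> t \<le> T \<Longrightarrow> t - s \<le> 1 \<Longrightarrow> (\<integral>\<omega>. (X t \<omega> - X s \<omega>)\<^sup>2 \<partial>M) \<le> C * (t - s)"
    "\<And>s t. 0 \<le> s \<Longrightarrow> s < t \<Longrightarrow> t \<le> T \<Longrightarrow> t - s \<le> 1 \<Longrightarrow> (\<integral>\<omega>. (remainder s t \<omega>)\<^sup>2 \<partial>M) \<le> C * (t - s)\<^sup>2"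
    "\<And>s t \<xi>. 0 \<le> s \<Longrightarrow> s < t \<Longrightarrow> t \<le> T \<Longrightarrow> t - s \<le> 1 \<Longrightarrow> \<xi> \<in> L2F s \<Longrightarrow>
      2 * \<bar>\<integral>\<omega>. \<xi> \<omega> * remainder s t \<omega> \<partial>M\<bar> \<le> ((\<integral>\<omega>. (\<xi> \<omega>)\<^sup>2 \<partial>M) + C) * ((t - s) * sqrt (t - s))"
proof -
  obtain C0 where C0: "0 < C0" "\<And>t. 0 \<le> t \<Longrightarrow> t \<le> T \<Longrightarrow> (\<integral>\<omega>. (X t \<omega>)\<^sup>2 \<partial>M) \<le> C0"
    using second_moment_locally_bounded[OF T] by metis
  define L where "L = 2 * (a\<^sup>2 + b\<^sup>2) + 2 * (\<sigma>\<^sup>2 + \<rho>\<^sup>2)"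
  have L0: "0 \<le> L" and La: "2 * (a\<^sup>2 + b\<^sup>2) \<le> L" and Ls: "2 * (\<sigma>\<^sup>2 + \<rho>\<^sup>2) \<le> L" by (auto simp: L_def)
  have qT: "0 \<le> q * r" "q * r \<le> T" if "0 \<le> r" "r \<le> T" for r using q_mult[OF that(1)] that by auto
  have drift_b: "(\<integral>\<omega>. (drift r \<omega>)\<^sup>2 \<partial>M) \<le> L * C0" and diff_b: "(\<integral>\<omega>. (diffusion r \<omega>)\<^sup>2 \<partial>M) \<le> L * C0"
    if r: "0 \<le> r" "r \<le> T" for r
    using lin_bound[OF r(1) C0(2)[OF r] C0(2)[OF qT[OF r]], of a b]
      lin_bound[OF r(1) C0(2)[OF r] C0(2)[OF qT[OF r]], of \<sigma> \<rho>]
      mult_right_mono[OF La, of C0] mult_right_mono[OF Ls, of C0] C0(1)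
    unfolding drift_def diffusion_def by linarith+
  \<comment> \<open>A factor 2 from the square of a sum, taken for the drift part and the diffusion
    part alike; for \<open>t - s \<le> 1\<close> both have second moment at most
    \<open>L * C0 * (t - s)\<close>.\<close>
  define C1 where "C1 = 4 * (L * C0)"
  have C1: "0 \<le> C1" using L0 C0 by (simp add: C1_def)
  have inc: "(\<integral>\<omega>. (X t \<omega> - X s \<omega>)\<^sup>2 \<partial>M) \<le> C1 * (t - s)" if st: "0 \<le> s" "s \<le> t" "t \<le> T" "t - s \<le> 1" for s t
  proof -
    let ?J = "\<lambda>\<omega>. I t \<omega> - I s \<omega>"
    let ?D = "\<lambda>\<omega>. X t \<omega> - X s \<omega> - (I t \<omega> - I s \<omega>)"
    have db: "(\<integral>\<omega>. (diffusion r \<omega>)\<^sup>2 \<partial>M) \<le> L * C0" if "s \<le> r" "r \<le> t" for r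
      using diff_b[of r] that st by simp
    note J = I_increment_L2[OF st(1,2) db]
    have J1: "?J \<in> L2F t" by (rule J(1))
    have J2: "(\<integral>\<omega>. (?J \<omega>)\<^sup>2 \<partial>M) \<le> L * C0 * (t - s)" by (rule J(2))
    have XM: "X t \<in> borel_measurable M" "X s \<in> borel_measurable M" using X_measurable_M st by auto
    have DM: "?D \<in> borel_measurable M"
      by (intro borel_measurable_diff XM F_measurable_M[OF L2F_measurable[OF J1]])
    have dL: "drift r \<in> L2 M" "(\<integral>\<omega>. (drift r \<omega>)\<^sup>2 \<partial>M) \<le> L * C0" if "s \<le> r" "r \<le> t" for r
      using L2F_L2[OF drift_L2F[of r]] drift_b[of r] that st by auto
    note D = L2_integral_bound[OF st(2) dL DM X_increment[OF st(1,2)]]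
    have D1: "?D \<in> L2 M" by (rule D(1))
    have D2: "(\<integral>\<omega>. (?D \<omega>)\<^sup>2 \<partial>M) \<le> L * C0 * (t - s)\<^sup>2" by (rule D(2))
    have "(\<integral>\<omega>. (?D \<omega> + ?J \<omega>)\<^sup>2 \<partial>M) \<le> 2 * (\<integral>\<omega>. (?D \<omega>)\<^sup>2 \<partial>M) + 2 * (\<integral>\<omega>. (?J \<omega>)\<^sup>2 \<partial>M)"
      by (rule L2_add_bound[OF D1 L2F_L2[OF J1]])
    also have "\<dots> \<le> 2 * (L * C0 * (t - s)\<^sup>2) + 2 * (L * C0 * (t - s))" using D2 J2 by linarith
    also have "\<dots> \<le> 2 * (L * C0 * (t - s)) + 2 * (L * C0 * (t - s))"
    proof -
      have "(t - s)\<^sup>2 \<le> t - s" using st mult_left_mono[of "t - s" 1 "t - s"] by (simp add: power2_eq_square)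
      then show ?thesis using L0 C0 by (intro add_right_mono mult_left_mono) auto
    qed
    also have "\<dots> = C1 * (t - s)" by (simp add: C1_def)
    finally show ?thesis by simp
  qed
  have lin_inc: "(\<integral>\<omega>. ((\<alpha> * X r \<omega> + \<beta> * X (q * r) \<omega>) - (\<alpha> * X s \<omega> + \<beta> * X (q * s) \<omega>))\<^sup>2 \<partial>M) \<le> L * C1 * h"
    if st: "0 \<le> s" "s \<le> r" "r \<le> T" "r - s \<le> h" "h \<le> 1" and L': "2 * (\<alpha>\<^sup>2 + \<beta>\<^sup>2) \<le> L" for \<alpha> \<beta> s r h
  proof -
    have r0: "0 \<le> r" using st by simp
    have qd: "q * r - q * s \<le> r - s" "q * s \<le> q * r" using q st mult_left_le_one_le[of "r - s" q]
      by (auto simp: right_diff_distrib mult_left_mono)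
    have i1: "(\<integral>\<omega>. (X r \<omega> - X s \<omega>)\<^sup>2 \<partial>M) \<le> C1 * h"
      using inc[of s r] st mult_left_mono[OF st(4) C1] by simp
    have "(\<integral>\<omega>. (X (q * r) \<omega> - X (q * s) \<omega>)\<^sup>2 \<partial>M) \<le> C1 * (q * r - q * s)"
      by (rule inc) (use q_mult[of s] qT[of r] qd st in auto)
    also have "\<dots> \<le> C1 * h" using C1 qd st by (intro mult_left_mono) auto
    finally have i2: "(\<integral>\<omega>. (X (q * r) \<omega> - X (q * s) \<omega>)\<^sup>2 \<partial>M) \<le> C1 * h" .
    have L1: "(\<lambda>\<omega>. X r \<omega> - X s \<omega>) \<in> L2 M" "(\<lambda>\<omega>. X (q * r) \<omega> - X (q * s) \<omega>) \<in> L2 M"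
      using st r0 q_mult(1)[of s] q_mult(1)[of r] by (intro L2_diff L2F_L2[OF X_L2F]; simp)+
    have "(\<integral>\<omega>. (\<alpha> * (X r \<omega> - X s \<omega>) + \<beta> * (X (q * r) \<omega> - X (q * s) \<omega>))\<^sup>2 \<partial>M)
      \<le> 2 * (\<integral>\<omega>. (\<alpha> * (X r \<omega> - X s \<omega>))\<^sup>2 \<partial>M) + 2 * (\<integral>\<omega>. (\<beta> * (X (q * r) \<omega> - X (q * s) \<omega>))\<^sup>2 \<partial>M)"
      by (intro L2_add_bound L2_cmult L1)
    also have "\<dots> = 2 * \<alpha>\<^sup>2 * (\<integral>\<omega>. (X r \<omega> - X s \<omega>)\<^sup>2 \<partial>M) + 2 * \<beta>\<^sup>2 * (\<integral>\<omega>. (X (q * r) \<omega> - X (q * s) \<omega>)\<^sup>2 \<partial>M)"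
      by (simp add: power_mult_distrib)
    also have "\<dots> \<le> 2 * \<alpha>\<^sup>2 * (C1 * h) + 2 * \<beta>\<^sup>2 * (C1 * h)"
      using i1 i2 by (intro add_mono mult_left_mono) auto
    also have "\<dots> = 2 * (\<alpha>\<^sup>2 + \<beta>\<^sup>2) * (C1 * h)" by (simp add: algebra_simps)
    also have "\<dots> \<le> L * (C1 * h)" using C1 st by (intro mult_right_mono L' mult_nonneg_nonneg) auto
    finally show ?thesis by (simp add: algebra_simps)
  qed
  define E1 where "E1 = L * C1"
  have E1: "0 \<le> E1" using L0 C1 by (simp add: E1_def)
  have rem: "(\<integral>\<omega>. (remainder s t \<omega>)\<^sup>2 \<partial>M) \<le> 4 * E1 * (t - s)\<^sup>2 \<and>
    (\<xi> \<in> L2F s \<longrightarrow> 2 * \<bar>\<integral>\<omega>. \<xi> \<omega> * remainder s t \<omega> \<partial>M\<bar> \<le> ((\<integral>\<omega>. (\<xi> \<omega>)\<^sup>2 \<partial>M) + E1) * ((t - s) * sqrt (t - s)))"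
    if st: "0 \<le> s" "s < t" "t \<le> T" "t - s \<le> 1" for s t \<xi>
  proof -
    let ?R = "\<lambda>\<omega>. I t \<omega> - I s \<omega> - diffusion s \<omega> * dB s t \<omega>"
    let ?D = "\<lambda>\<omega>. X t \<omega> - X s \<omega> - (I t \<omega> - I s \<omega>) - (t - s) * drift s \<omega>"
    have st': "0 \<le> s" "s \<le> t" using st by auto
    have h: "0 < t - s" using st by simp
    have L: "diffusion r \<in> L2 M" if "s \<le> r" "r \<le> t" for r
      using that st by (intro L2F_L2[OF diffusion_L2F]) auto
    have b1: "(\<integral>\<omega>. (diffusion r \<omega> - diffusion s \<omega>)\<^sup>2 \<partial>M) \<le> E1 * (t - s)" if "s \<le> r" "r \<le> t" for r
      unfolding diffusion_def E1_def using that st by (intro lin_inc Ls) auto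
    note R = ito_integral_L2[OF ito_diffusion diffusion_adapted diffusion_continuous st' L diffusion_L2F[OF st(1)] b1]
    have R1: "?R \<in> L2F t" by (rule R(1))
    have R2: "(\<integral>\<omega>. (?R \<omega>)\<^sup>2 \<partial>M) \<le> E1 * (t - s) * (t - s)" by (rule R(2))
    have R3: "(\<integral>\<omega>. \<eta> \<omega> * ?R \<omega> \<partial>M) = 0" if "\<eta> \<in> L2F s" for \<eta> by (rule R(3)) (use that in auto)
    have IM: "(\<lambda>\<omega>. I t \<omega> - I s \<omega>) \<in> borel_measurable M"
    proof -
      have "I t \<in> borel_measurable M" "I s \<in> borel_measurable M"
        using F_measurable_M[OF I_measurable[of t]] F_measurable_M[OF I_measurable[of s]] st by auto
      then show ?thesis by (rule borel_measurable_diff)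
    qed
    have DM: "?D \<in> borel_measurable M"
      using st by (intro borel_measurable_diff IM borel_measurable_times borel_measurable_const
          L2_measurable[OF L2F_L2[OF drift_L2F]] X_measurable_M) auto
    have dL: "(\<lambda>\<omega>. drift r \<omega> - drift s \<omega>) \<in> L2 M"
      "(\<integral>\<omega>. (drift r \<omega> - drift s \<omega>)\<^sup>2 \<partial>M) \<le> E1 * (t - s)" if "s \<le> r" "r \<le> t" for r
    proof -
      show "(\<lambda>\<omega>. drift r \<omega> - drift s \<omega>) \<in> L2 M"
        using that st by (intro L2_diff L2F_L2[OF drift_L2F]) auto
      show "(\<integral>\<omega>. (drift r \<omega> - drift s \<omega>)\<^sup>2 \<partial>M) \<le> E1 * (t - s)"
        unfolding drift_def E1_def using that st by (intro lin_inc La) auto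
    qed
    have "AE \<omega> in M. continuous_on {s..t} (\<lambda>r. drift r \<omega> - drift s \<omega>) \<and>
      ?D \<omega> = integral {s..t} (\<lambda>r. drift r \<omega> - drift s \<omega>)"
      using X_increment[OF st']
    proof eventually_elim
      case (elim \<omega>)
      have "integral {s..t} (\<lambda>r. drift r \<omega> - drift s \<omega>) = integral {s..t} (\<lambda>r. drift r \<omega>) - (t - s) * drift s \<omega>"
        using elim st by (subst Henstock_Kurzweil_Integration.integral_diff) (auto intro: integrable_continuous_interval)
      then show ?case using elim by (auto intro: continuous_intros)
    qed
    note D = L2_integral_bound[OF st'(2) dL DM this]
    have D1: "?D \<in> L2 M" by (rule D(1))
    have D2: "(\<integral>\<omega>. (?D \<omega>)\<^sup>2 \<partial>M) \<le> E1 * (t - s) * (t - s)\<^sup>2" by (rule D(2))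
    have eq: "remainder s t \<omega> = ?D \<omega> + ?R \<omega>" for \<omega> by (simp add: remainder_def)
    have "(\<integral>\<omega>. (remainder s t \<omega>)\<^sup>2 \<partial>M) \<le> 2 * (\<integral>\<omega>. (?D \<omega>)\<^sup>2 \<partial>M) + 2 * (\<integral>\<omega>. (?R \<omega>)\<^sup>2 \<partial>M)"
      unfolding eq by (rule L2_add_bound[OF D1 L2F_L2[OF R1]])
    also have "\<dots> \<le> 2 * (E1 * (t - s) * (t - s)\<^sup>2) + 2 * (E1 * (t - s) * (t - s))" using D2 R2 by linarith
    also have "\<dots> \<le> 2 * (E1 * 1 * (t - s)\<^sup>2) + 2 * (E1 * (t - s) * (t - s))"
      using E1 st by (intro add_right_mono mult_left_mono mult_right_mono) auto
    also have "\<dots> = 4 * E1 * (t - s)\<^sup>2" by (simp add: power2_eq_square)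
    finally have 1: "(\<integral>\<omega>. (remainder s t \<omega>)\<^sup>2 \<partial>M) \<le> 4 * E1 * (t - s)\<^sup>2" .
    have 2: "2 * \<bar>\<integral>\<omega>. \<xi> \<omega> * remainder s t \<omega> \<partial>M\<bar> \<le> ((\<integral>\<omega>. (\<xi> \<omega>)\<^sup>2 \<partial>M) + E1) * ((t - s) * sqrt (t - s))"
      if \<xi>: "\<xi> \<in> L2F s"
    proof -
      note \<xi>L = L2F_L2[OF \<xi>]
      have "(\<integral>\<omega>. \<xi> \<omega> * remainder s t \<omega> \<partial>M) = (\<integral>\<omega>. \<xi> \<omega> * ?D \<omega> \<partial>M) + (\<integral>\<omega>. \<xi> \<omega> * ?R \<omega> \<partial>M)"
        unfolding eq by (rule L2_inner_add[OF \<xi>L D1 L2F_L2[OF R1]])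
      then have e: "(\<integral>\<omega>. \<xi> \<omega> * remainder s t \<omega> \<partial>M) = (\<integral>\<omega>. \<xi> \<omega> * ?D \<omega> \<partial>M)" using R3[OF \<xi>] by simp
      \<comment> \<open>With the weight \<open>h * sqrt h\<close> the drift part, of order
        \<open>h\<^sup>3\<close>, and the test variable, of order 1, contribute the same power of
        h.\<close>
      have c: "0 < (t - s) * sqrt (t - s)" using h by simp
      have "2 * \<bar>\<integral>\<omega>. \<xi> \<omega> * ?D \<omega> \<partial>M\<bar>
        \<le> (t - s) * sqrt (t - s) * (\<integral>\<omega>. (\<xi> \<omega>)\<^sup>2 \<partial>M) + (\<integral>\<omega>. (?D \<omega>)\<^sup>2 \<partial>M) / ((t - s) * sqrt (t - s))"
        by (rule L2_abs_product_bound[OF \<xi>L D1 c])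
      also have "\<dots> \<le> (t - s) * sqrt (t - s) * (\<integral>\<omega>. (\<xi> \<omega>)\<^sup>2 \<partial>M)
          + E1 * (t - s) * (t - s)\<^sup>2 / ((t - s) * sqrt (t - s))"
        using D2 c by (intro add_left_mono divide_right_mono) auto
      also have "E1 * (t - s) * (t - s)\<^sup>2 / ((t - s) * sqrt (t - s)) = E1 * ((t - s) * ((t - s) / sqrt (t - s)))"
        using h by (simp add: power2_eq_square)
      also have "(t - s) / sqrt (t - s) = sqrt (t - s)" using h by (simp add: real_div_sqrt)
      finally show ?thesis unfolding e by (simp add: algebra_simps)
    qed
    show ?thesis using 1 2 by blast
  qed
  define C where "C = C0 + C1 + 4 * E1"
  show ?thesis
  proof (rule that[of C])
    show "0 < C" using C0 C1 E1 by (simp add: C_def)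
    show "(\<integral>\<omega>. (X t \<omega>)\<^sup>2 \<partial>M) \<le> C" if "0 \<le> t" "t \<le> T" for t
      using C0(2)[OF that] C1 E1 by (simp add: C_def)
    show "(\<integral>\<omega>. (X t \<omega> - X s \<omega>)\<^sup>2 \<partial>M) \<le> C * (t - s)" if "0 \<le> s" "s \<le> t" "t \<le> T" "t - s \<le> 1" for s t
      using inc[OF that] mult_right_mono[of C1 C "t - s"] that C0 E1 by (simp add: C_def)
    show "(\<integral>\<omega>. (remainder s t \<omega>)\<^sup>2 \<partial>M) \<le> C * (t - s)\<^sup>2" if "0 \<le> s" "s < t" "t \<le> T" "t - s \<le> 1" for s t
      using rem[OF that, THEN conjunct1] mult_right_mono[of "4 * E1" C "(t - s)\<^sup>2"] C0 C1 by (simp add: C_def)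
    show "2 * \<bar>\<integral>\<omega>. \<xi> \<omega> * remainder s t \<omega> \<partial>M\<bar> \<le> ((\<integral>\<omega>. (\<xi> \<omega>)\<^sup>2 \<partial>M) + C) * ((t - s) * sqrt (t - s))"
      if st: "0 \<le> s" "s < t" "t \<le> T" "t - s \<le> 1" and "\<xi> \<in> L2F s" for s t \<xi>
    proof -
      have "((\<integral>\<omega>. (\<xi> \<omega>)\<^sup>2 \<partial>M) + E1) * ((t - s) * sqrt (t - s)) \<le> ((\<integral>\<omega>. (\<xi> \<omega>)\<^sup>2 \<partial>M) + C) * ((t - s) * sqrt (t - s))"
        using st C0 C1 E1 by (intro mult_right_mono) (auto simp: C_def)
      then show ?thesis using rem[OF st, of \<xi>] that(5) by simp
    qed
  qed
qed

abbreviation m2 :: "real \<Rightarrow> real" where "m2 t \<equiv> (\<integral>\<omega>. (X t \<omega>)\<^sup>2 \<partial>M)"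

text \<open>The difference of the moments is the pairing of \<open>X t + X s\<close> with
  \<open>X t - X s\<close>; the weight \<open>sqrt (t - s)\<close> yields Hoelder continuity of
  order 1/2.\<close>

lemma m2_continuous:
  assumes T: "0 \<le> T" obtains C where "0 \<le> C"
    "\<And>s t. 0 \<le> s \<Longrightarrow> s < t \<Longrightarrow> t \<le> T \<Longrightarrow> t - s \<le> 1 \<Longrightarrow> \<bar>m2 t - m2 s\<bar> \<le> C * sqrt (t - s)"
proof -
  obtain C where C: "0 < C" "\<And>t. 0 \<le> t \<Longrightarrow> t \<le> T \<Longrightarrow> m2 t \<le> C"
    "\<And>s t. 0 \<le> s \<Longrightarrow> s \<le> t \<Longrightarrow> t \<le> T \<Longrightarrow> t - s \<le> 1 \<Longrightarrow> (\<integral>\<omega>. (X t \<omega> - X s \<omega>)\<^sup>2 \<partial>M) \<le> C * (t - s)"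
    by (rule local_expansion[OF T]) (rule that; assumption)
  show ?thesis
  proof (rule that[of "5 * C"])
    show "0 \<le> 5 * C" using C(1) by simp
    fix s t assume st: "0 \<le> s" "s < t" "t \<le> T" "t - s \<le> 1"
    have XL: "X t \<in> L2 M" "X s \<in> L2 M" using st by (auto intro!: L2F_L2[OF X_L2F])
    have h: "0 < sqrt (t - s)" using st by simp
    have "m2 t - m2 s = (\<integral>\<omega>. (X t \<omega> + X s \<omega>) * (X t \<omega> - X s \<omega>) \<partial>M)"
    proof -
      have "(X t \<omega> + X s \<omega>) * (X t \<omega> - X s \<omega>) = (X t \<omega>)\<^sup>2 - (X s \<omega>)\<^sup>2" for \<omega>
        by (simp add: power2_eq_square algebra_simps)
      then show ?thesis using XL by (simp add: L2_def)
    qed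
    then have "2 * \<bar>m2 t - m2 s\<bar> \<le> sqrt (t - s) * (\<integral>\<omega>. (X t \<omega> + X s \<omega>)\<^sup>2 \<partial>M)
        + (\<integral>\<omega>. (X t \<omega> - X s \<omega>)\<^sup>2 \<partial>M) / sqrt (t - s)"
      using L2_abs_product_bound[OF L2_add[OF XL] L2_diff[OF XL] h] by simp
    also have "\<dots> \<le> sqrt (t - s) * (4 * C) + C * (t - s) / sqrt (t - s)"
      using L2_add_bound[OF XL] C(2)[of t] C(2)[of s] C(3)[of s t] st h
      by (intro add_mono mult_left_mono divide_right_mono) auto
    also have "C * (t - s) / sqrt (t - s) = C * sqrt (t - s)" using st by (simp add: real_div_sqrt flip: times_divide_eq_right)
    finally have "2 * \<bar>m2 t - m2 s\<bar> \<le> 5 * C * sqrt (t - s)" by (simp add: algebra_simps)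
    then show "\<bar>m2 t - m2 s\<bar> \<le> 5 * C * sqrt (t - s)"
      using abs_ge_zero[of "m2 t - m2 s"] by argo
  qed
qed

text \<open>The derivative that Ito's formula for the square would assign to the second moment,
  arranged so that the undelayed term shows the rate
  \<open>2 * a + \<sigma>\<^sup>2\<close>.\<close>

definition growth :: "real \<Rightarrow> real" where
  "growth s = (2 * a + \<sigma>\<^sup>2) * m2 s + 2 * (b + \<sigma> * \<rho>) * (\<integral>\<omega>. X s \<omega> * X (q * s) \<omega> \<partial>M) + \<rho>\<^sup>2 * m2 (q * s)"

lemma growth_eq:
  assumes s: "0 \<le> s"
  shows "growth s = 2 * (\<integral>\<omega>. X s \<omega> * drift s \<omega> \<partial>M) + (\<integral>\<omega>. (diffusion s \<omega>)\<^sup>2 \<partial>M)"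
proof -
  have L: "X s \<in> L2 M" "X (q * s) \<in> L2 M" using L2F_L2[OF X_L2F] s q_mult(1)[OF s] by auto
  have i: "integrable M (\<lambda>\<omega>. (X s \<omega>)\<^sup>2)" "integrable M (\<lambda>\<omega>. (X (q * s) \<omega>)\<^sup>2)"
    "integrable M (\<lambda>\<omega>. X s \<omega> * X (q * s) \<omega>)"
    using L L2_mult_integrable[OF L] by (auto simp: L2_def)
  have 1: "X s \<omega> * drift s \<omega> = a * (X s \<omega>)\<^sup>2 + b * (X s \<omega> * X (q * s) \<omega>)" for \<omega>
    by (simp add: drift_def power2_eq_square algebra_simps)
  have 2: "(diffusion s \<omega>)\<^sup>2 = \<sigma>\<^sup>2 * (X s \<omega>)\<^sup>2 + 2 * \<sigma> * \<rho> * (X s \<omega> * X (q * s) \<omega>) + \<rho>\<^sup>2 * (X (q * s) \<omega>)\<^sup>2" for \<omega>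
    by (simp add: diffusion_def power2_eq_square algebra_simps)
  show ?thesis unfolding growth_def 1 2 using i by (simp add: algebra_simps)
qed

text \<open>Stands in for Ito's formula. The solution at \<open>t\<close> is a part
  \<open>?U\<close> known at \<open>s\<close>, a martingale part \<open>?V\<close> of size
  \<open>sqrt h\<close> and the remainder of size h: \<open>?U\<close> and \<open>?V\<close> are
  orthogonal, \<open>?U\<close> meets the remainder only through the improved pairing, and
  \<open>?V\<close> meets it at order \<open>h * sqrt h\<close>. What is left at order h is
  \<open>growth\<close>.\<close>

lemma m2_increment:
  assumes T: "0 \<le> T" obtains C where "0 \<le> C"
    "\<And>s t. 0 \<le> s \<Longrightarrow> s < t \<Longrightarrow> t \<le> T \<Longrightarrow> t - s \<le> 1 \<Longrightarrow>
      m2 t \<le> m2 s + (t - s) * growth s + C * ((t - s) * sqrt (t - s))"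
proof -
  obtain C where C: "0 < C" "\<And>t. 0 \<le> t \<Longrightarrow> t \<le> T \<Longrightarrow> m2 t \<le> C"
    "\<And>s t. 0 \<le> s \<Longrightarrow> s < t \<Longrightarrow> t \<le> T \<Longrightarrow> t - s \<le> 1 \<Longrightarrow> (\<integral>\<omega>. (remainder s t \<omega>)\<^sup>2 \<partial>M) \<le> C * (t - s)\<^sup>2"
    "\<And>s t \<xi>. 0 \<le> s \<Longrightarrow> s < t \<Longrightarrow> t \<le> T \<Longrightarrow> t - s \<le> 1 \<Longrightarrow> \<xi> \<in> L2F s \<Longrightarrow>
      2 * \<bar>\<integral>\<omega>. \<xi> \<omega> * remainder s t \<omega> \<partial>M\<bar> \<le> ((\<integral>\<omega>. (\<xi> \<omega>)\<^sup>2 \<partial>M) + C) * ((t - s) * sqrt (t - s))"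
    by (rule local_expansion[OF T]) (rule that; assumption)
  define L where "L = 2 * (a\<^sup>2 + b\<^sup>2) + 2 * (\<sigma>\<^sup>2 + \<rho>\<^sup>2)"
  have L0: "0 \<le> L" and La: "2 * (a\<^sup>2 + b\<^sup>2) \<le> L" and Ls: "2 * (\<sigma>\<^sup>2 + \<rho>\<^sup>2) \<le> L" by (auto simp: L_def)
  define K where "K = L * C"
  have K0: "0 \<le> K" using L0 C by (simp add: K_def)
  have b: "(\<integral>\<omega>. (drift r \<omega>)\<^sup>2 \<partial>M) \<le> K" "(\<integral>\<omega>. (diffusion r \<omega>)\<^sup>2 \<partial>M) \<le> K"
    if r: "0 \<le> r" "r \<le> T" for r
  proof -
    have qr: "0 \<le> q * r" "q * r \<le> T" using q_mult[OF r(1)] r by auto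
    show "(\<integral>\<omega>. (drift r \<omega>)\<^sup>2 \<partial>M) \<le> K" "(\<integral>\<omega>. (diffusion r \<omega>)\<^sup>2 \<partial>M) \<le> K"
      using lin_bound[OF r(1) C(2)[OF r] C(2)[OF qr], of a b] lin_bound[OF r(1) C(2)[OF r] C(2)[OF qr], of \<sigma> \<rho>]
        mult_right_mono[OF La, of C] mult_right_mono[OF Ls, of C] C(1)
      unfolding drift_def diffusion_def K_def by linarith+
  qed
  show ?thesis
  proof (rule that[of "4 * K + 5 * C"])
    show "0 \<le> 4 * K + 5 * C" using K0 C by simp
    fix s t assume st: "0 \<le> s" "s < t" "t \<le> T" "t - s \<le> 1"
    define h where "h = t - s"
    have h: "0 < h" "h \<le> 1" using st by (auto simp: h_def)
    have st': "0 \<le> s" "s \<le> t" "s \<le> T" using st by auto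
    let ?U = "\<lambda>\<omega>. X s \<omega> + h * drift s \<omega>"
    let ?V = "\<lambda>\<omega>. diffusion s \<omega> * dB s t \<omega>"
    let ?R = "remainder s t"
    have UF: "?U \<in> L2F s" by (intro L2F_add L2F_cmult X_L2F drift_L2F st')
    have UL: "?U \<in> L2 M" by (rule L2F_L2[OF UF])
    have V: "?V \<in> L2F t" "(\<integral>\<omega>. (?V \<omega>)\<^sup>2 \<partial>M) = (\<integral>\<omega>. (diffusion s \<omega>)\<^sup>2 \<partial>M) * h"
      unfolding h_def by (rule increment_mult_dB[OF st'(1,2) diffusion_L2F[OF st'(1)]])+
    have VL: "?V \<in> L2 M" by (rule L2F_L2[OF V(1)])
    have RL: "?R \<in> L2 M" by (rule L2F_L2[OF remainder_L2F[OF st'(1,2)]])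
    have UV: "(\<integral>\<omega>. ?U \<omega> * ?V \<omega> \<partial>M) = 0" by (rule increment_orthogonal[OF st'(1,2) diffusion_L2F[OF st'(1)] UF])
    have Xt: "X t \<omega> = (?U \<omega> + ?V \<omega>) + ?R \<omega>" for \<omega> by (simp add: remainder_def h_def)
    have U2: "(\<integral>\<omega>. (?U \<omega>)\<^sup>2 \<partial>M) = m2 s + 2 * h * (\<integral>\<omega>. X s \<omega> * drift s \<omega> \<partial>M) + h\<^sup>2 * (\<integral>\<omega>. (drift s \<omega>)\<^sup>2 \<partial>M)"
    proof -
      have "(\<integral>\<omega>. (?U \<omega>)\<^sup>2 \<partial>M) = m2 s + 2 * (\<integral>\<omega>. X s \<omega> * (h * drift s \<omega>) \<partial>M) + (\<integral>\<omega>. (h * drift s \<omega>)\<^sup>2 \<partial>M)"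
        by (intro L2_square_add L2_cmult L2F_L2[OF X_L2F] L2F_L2[OF drift_L2F] st')
      then show ?thesis by (simp add: power_mult_distrib mult.left_commute[of _ h])
    qed
    have U2b: "(\<integral>\<omega>. (?U \<omega>)\<^sup>2 \<partial>M) \<le> 2 * C + 2 * K"
    proof -
      have "(\<integral>\<omega>. (?U \<omega>)\<^sup>2 \<partial>M) \<le> 2 * m2 s + 2 * (\<integral>\<omega>. (h * drift s \<omega>)\<^sup>2 \<partial>M)"
        by (intro L2_add_bound L2_cmult L2F_L2[OF X_L2F] L2F_L2[OF drift_L2F] st')
      also have "(\<integral>\<omega>. (h * drift s \<omega>)\<^sup>2 \<partial>M) = h\<^sup>2 * (\<integral>\<omega>. (drift s \<omega>)\<^sup>2 \<partial>M)" by (simp add: power_mult_distrib)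
      also have "h\<^sup>2 * (\<integral>\<omega>. (drift s \<omega>)\<^sup>2 \<partial>M) \<le> 1 * K"
        using h b[OF st'(1,3)] by (intro mult_mono) (auto simp: power_le_one)
      finally show ?thesis using C(2)[OF st'(1,3)] by simp
    qed
    have PR: "2 * (\<integral>\<omega>. (?U \<omega> + ?V \<omega>) * ?R \<omega> \<partial>M) \<le> (3 * C + 2 * K) * (h * sqrt h) + (K + C) * (h * sqrt h)"
    proof -
      have "(\<integral>\<omega>. (?U \<omega> + ?V \<omega>) * ?R \<omega> \<partial>M) = (\<integral>\<omega>. ?U \<omega> * ?R \<omega> \<partial>M) + (\<integral>\<omega>. ?V \<omega> * ?R \<omega> \<partial>M)"
        using L2_mult_integrable[OF UL RL] L2_mult_integrable[OF VL RL] by (simp add: distrib_right)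
      moreover have "2 * \<bar>\<integral>\<omega>. ?U \<omega> * ?R \<omega> \<partial>M\<bar> \<le> ((\<integral>\<omega>. (?U \<omega>)\<^sup>2 \<partial>M) + C) * (h * sqrt h)"
        unfolding h_def by (rule C(4)[OF st UF[unfolded h_def]])
      moreover have "((\<integral>\<omega>. (?U \<omega>)\<^sup>2 \<partial>M) + C) * (h * sqrt h) \<le> (3 * C + 2 * K) * (h * sqrt h)"
        using U2b h by (intro mult_right_mono) auto
      moreover have "2 * \<bar>\<integral>\<omega>. ?V \<omega> * ?R \<omega> \<partial>M\<bar> \<le> (K + C) * (h * sqrt h)"
      proof (rule L2_product_sqrt_bound[OF VL RL h(1)])
        show "(\<integral>\<omega>. (?V \<omega>)\<^sup>2 \<partial>M) \<le> K * h" unfolding V(2) using b(2)[OF st'(1,3)] h by (intro mult_right_mono) auto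
        show "(\<integral>\<omega>. (?R \<omega>)\<^sup>2 \<partial>M) \<le> C * h\<^sup>2" unfolding h_def by (rule C(3)[OF st])
      qed
      ultimately show ?thesis by linarith
    qed
    have "m2 t = (\<integral>\<omega>. (?U \<omega> + ?V \<omega>)\<^sup>2 \<partial>M) + 2 * (\<integral>\<omega>. (?U \<omega> + ?V \<omega>) * ?R \<omega> \<partial>M) + (\<integral>\<omega>. (?R \<omega>)\<^sup>2 \<partial>M)"
      unfolding Xt by (rule L2_square_add[OF L2_add[OF UL VL] RL])
    also have "(\<integral>\<omega>. (?U \<omega> + ?V \<omega>)\<^sup>2 \<partial>M) = (\<integral>\<omega>. (?U \<omega>)\<^sup>2 \<partial>M) + (\<integral>\<omega>. (diffusion s \<omega>)\<^sup>2 \<partial>M) * h"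
      using L2_square_add[OF UL VL] UV V(2) by simp
    also have "(\<integral>\<omega>. (?U \<omega>)\<^sup>2 \<partial>M) + (\<integral>\<omega>. (diffusion s \<omega>)\<^sup>2 \<partial>M) * h
        = m2 s + h * growth s + h\<^sup>2 * (\<integral>\<omega>. (drift s \<omega>)\<^sup>2 \<partial>M)"
      unfolding U2 growth_eq[OF st'(1)] by (simp add: algebra_simps)
    finally have main: "m2 t = m2 s + h * growth s + h\<^sup>2 * (\<integral>\<omega>. (drift s \<omega>)\<^sup>2 \<partial>M)
      + 2 * (\<integral>\<omega>. (?U \<omega> + ?V \<omega>) * ?R \<omega> \<partial>M) + (\<integral>\<omega>. (?R \<omega>)\<^sup>2 \<partial>M)" .
    have "h\<^sup>2 * (\<integral>\<omega>. (drift s \<omega>)\<^sup>2 \<partial>M) \<le> (h * sqrt h) * K"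
      using power2_le_sqrt[of h] h b(1)[OF st'(1,3)] by (intro mult_mono) auto
    moreover have "(\<integral>\<omega>. (?R \<omega>)\<^sup>2 \<partial>M) \<le> C * (h * sqrt h)"
    proof -
      have "(\<integral>\<omega>. (?R \<omega>)\<^sup>2 \<partial>M) \<le> C * h\<^sup>2" unfolding h_def by (rule C(3)[OF st])
      also have "\<dots> \<le> C * (h * sqrt h)" using power2_le_sqrt[of h] h C(1) by (intro mult_left_mono) auto
      finally show ?thesis .
    qed
    ultimately have "m2 t \<le> m2 s + h * growth s + ((h * sqrt h) * K
        + ((3 * C + 2 * K) * (h * sqrt h) + (K + C) * (h * sqrt h)) + C * (h * sqrt h))"
      using main PR by linarith
    also have "(h * sqrt h) * K + ((3 * C + 2 * K) * (h * sqrt h) + (K + C) * (h * sqrt h)) + C * (h * sqrt h)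
      = (4 * K + 5 * C) * (h * sqrt h)" by (simp add: algebra_simps)
    finally show "m2 t \<le> m2 s + (t - s) * growth s + (4 * K + 5 * C) * ((t - s) * sqrt (t - s))"
      by (simp add: h_def)
  qed
qed

end

section \<open>Growth of the second moment\<close>

text \<open>The supremum of the times up to which \<open>f \<le> w\<close> cannot fall short of the
  target: by continuity the inequality holds at the supremum, and it extends to the right, either
  because it is strict there or by \<open>touch\<close>. Right-hand information at a touching point
  is what a one-step inequality supplies, and the premise on the whole past is what a delayed term
  consumes.\<close>

lemma forward_comparison:
  fixes f w :: "real \<Rightarrow> real"
  assumes f: "continuous_on {0..} f" and w: "continuous_on {0..} w" and start: "f 0 < w 0"
    and touch: "\<And>t. 0 \<le> t \<Longrightarrow> (\<And>s. 0 \<le> s \<Longrightarrow> s \<le> t \<Longrightarrow> f s \<le> w s) \<Longrightarrow> f t = w t \<Longrightarrow>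
      \<exists>\<delta>>0. \<forall>h. 0 < h \<longrightarrow> h < \<delta> \<longrightarrow> f (t + h) \<le> w (t + h)"
    and t: "0 \<le> t"
  shows "f t \<le> w t"
proof (rule ccontr)
  assume neg: "\<not> f t \<le> w t"
  define S where "S = {r. 0 \<le> r \<and> r \<le> t \<and> (\<forall>s. 0 \<le> s \<longrightarrow> s \<le> r \<longrightarrow> f s \<le> w s)}"
  have "0 \<in> S"
  proof -
    have "f s \<le> w s" if "0 \<le> s" "s \<le> 0" for s using that start by (cases "s = 0") auto
    then show ?thesis using t by (simp add: S_def)
  qed
  have bdd: "bdd_above S" unfolding S_def by (intro bdd_aboveI[of _ t]) simp
  define T where "T = Sup S"
  have T0: "0 \<le> T" unfolding T_def by (rule cSup_upper[OF \<open>0 \<in> S\<close> bdd])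
  have Tt: "T \<le> t" unfolding T_def using \<open>0 \<in> S\<close> by (intro cSup_least) (auto simp: S_def)
  have below: "f s \<le> w s" if s: "0 \<le> s" "s < T" for s
  proof -
    obtain r where "r \<in> S" "s < r" using less_cSupD[of S s] \<open>0 \<in> S\<close> s unfolding T_def by blast
    then show ?thesis using s by (simp add: S_def)
  qed
  define D where "D s = w s - f s" for s
  have D: "continuous_on {0..} D" unfolding D_def using f w by (intro continuous_intros)
  have DT: "0 \<le> D T"
  proof (rule ccontr)
    assume "\<not> 0 \<le> D T"
    then have e: "0 < - D T" by simp
    then have T_pos: "T \<noteq> 0" using start by (auto simp: D_def)
    obtain d where d: "0 < d" "\<forall>x\<in>{0..}. dist x T < d \<longrightarrow> dist (D x) (D T) < - D T"
      using D e T0 unfolding continuous_on_iff by (meson atLeast_iff)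
    define x where "x = max 0 (T - d / 2)"
    have x: "0 \<le> x" "x < T" "dist x T < d" using d(1) T0 T_pos by (auto simp: x_def dist_real_def)
    then have "dist (D x) (D T) < - D T" using d(2) by simp
    moreover have "0 \<le> D x" using below[OF x(1,2)] by (simp add: D_def)
    ultimately show False by (simp add: dist_real_def)
  qed
  have upto: "f s \<le> w s" if "0 \<le> s" "s \<le> T" for s
    using below[of s] DT that by (cases "s = T") (auto simp: D_def)
  have "\<exists>\<delta>>0. \<forall>h. 0 < h \<longrightarrow> h < \<delta> \<longrightarrow> f (T + h) \<le> w (T + h)"
  proof (cases "f T = w T")
    case True
    then show ?thesis by (intro touch T0 upto)
  next
    case False
    then have e: "0 < D T" using DT by (simp add: D_def)
    obtain d where d: "0 < d" "\<forall>x\<in>{0..}. dist x T < d \<longrightarrow> dist (D x) (D T) < D T"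
      using D e T0 unfolding continuous_on_iff by (meson atLeast_iff)
    show ?thesis
    proof (intro exI[of _ d] conjI allI impI d(1))
      fix h assume h: "0 < h" "h < d"
      then have "dist (D (T + h)) (D T) < D T" using d(2) T0 by (simp add: dist_real_def)
      then show "f (T + h) \<le> w (T + h)" by (simp add: dist_real_def D_def)
    qed
  qed
  then obtain \<delta> where \<delta>: "0 < \<delta>" "\<And>h. 0 < h \<Longrightarrow> h < \<delta> \<Longrightarrow> f (T + h) \<le> w (T + h)" by blast
  have "T \<noteq> t" using upto[of t] neg t by auto
  then have Tlt: "T < t" using Tt by simp
  define r where "r = min t (T + \<delta> / 2)"
  have r: "T < r" "r \<le> t" "r < T + \<delta>" using \<delta>(1) Tlt by (auto simp: r_def)
  have "f s \<le> w s" if "0 \<le> s" "s \<le> r" for s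
    using upto[of s] \<delta>(2)[of "s - T"] that r by (cases "s \<le> T") auto
  then have "r \<in> S" using r T0 by (simp add: S_def)
  then have "r \<le> T" unfolding T_def using bdd by (rule cSup_upper)
  then show False using r by simp
qed

text \<open>The majorant of the second moment: a bounded multiple of the exponential whose
  logarithmic derivative exceeds \<open>\<gamma>\<close> by just enough to absorb the delayed terms.\<close>

definition majorant :: "real \<Rightarrow> real \<Rightarrow> real \<Rightarrow> real \<Rightarrow> real" where
  "majorant \<gamma> \<kappa> \<mu> t = exp (\<gamma> * t + \<kappa> * (1 - exp (- \<mu> * t)))"

lemma majorant_deriv:
  "(majorant \<gamma> \<kappa> \<mu> has_real_derivative (\<gamma> + \<kappa> * \<mu> * exp (- \<mu> * t)) * majorant \<gamma> \<kappa> \<mu> t) (at t)"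
  unfolding majorant_def by (auto intro!: derivative_eq_intros simp: algebra_simps)

lemma majorant_continuous: "continuous_on A (majorant \<gamma> \<kappa> \<mu>)"
  unfolding majorant_def by (intro continuous_intros)

text \<open>The bounded correction increases in time, so passing to the delayed time can only lower
  it; the gain comes from the linear exponent.\<close>

lemma majorant_delay:
  assumes q: "0 < q" "q < 1" and "0 \<le> \<kappa>" "0 \<le> \<mu>" "0 \<le> t"
  shows "majorant \<gamma> \<kappa> \<mu> (q * t) \<le> exp (- (\<gamma> * (1 - q)) * t) * majorant \<gamma> \<kappa> \<mu> t"
proof -
  have "q * t \<le> 1 * t" using assms by (intro mult_right_mono) auto
  then have "\<mu> * (q * t) \<le> \<mu> * t" using assms(4) by (intro mult_left_mono) auto
  then have "exp (- \<mu> * t) \<le> exp (- \<mu> * (q * t))" by simp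
  then have "\<kappa> * (1 - exp (- \<mu> * (q * t))) \<le> \<kappa> * (1 - exp (- \<mu> * t))"
    using assms(3) by (intro mult_left_mono) auto
  then have "exp (\<gamma> * (q * t) + \<kappa> * (1 - exp (- \<mu> * (q * t))))
      \<le> exp (- (\<gamma> * (1 - q)) * t + (\<gamma> * t + \<kappa> * (1 - exp (- \<mu> * t))))"
    by (simp add: algebra_simps)
  then show ?thesis unfolding majorant_def exp_add[symmetric] .
qed

lemma majorant_le:
  assumes "0 \<le> \<kappa>" shows "majorant \<gamma> \<kappa> \<mu> t \<le> exp \<kappa> * exp (\<gamma> * t)"
proof -
  have "\<kappa> * (1 - exp (- \<mu> * t)) \<le> \<kappa> * 1" using assms by (intro mult_left_mono) auto
  then show ?thesis unfolding majorant_def exp_add[symmetric] by simp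
qed

lemma majorant_pos: "0 < majorant \<gamma> \<kappa> \<mu> t"
  by (simp add: majorant_def)

lemma eventually_small_sqrt:
  assumes "0 < \<eta>" "0 \<le> C"
  shows "eventually (\<lambda>h. C * sqrt h < \<eta>) (at_right 0)"
proof -
  have "((\<lambda>h. C * sqrt h) \<longlongrightarrow> C * sqrt 0) (at_right 0)" by (intro tendsto_intros)
  then show ?thesis using assms(1) by (intro order_tendstoD) auto
qed

context pantograph
begin

lemma m2_continuous_on: "continuous_on {0..} m2"
proof (rule continuous_onI)
  fix t e :: real assume t: "t \<in> {0..}" and e: "0 < e"
  have T: "0 \<le> t + 1" using t by simp
  obtain C where C: "0 \<le> C" "\<And>s r. 0 \<le> s \<Longrightarrow> s < r \<Longrightarrow> r \<le> t + 1 \<Longrightarrow> r - s \<le> 1 \<Longrightarrow> \<bar>m2 r - m2 s\<bar> \<le> C * sqrt (r - s)"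
    by (rule m2_continuous[OF T]) (rule that; assumption)
  obtain d where d: "0 < d" "\<And>h. 0 < h \<Longrightarrow> h < d \<Longrightarrow> C * sqrt h < e"
    using eventually_small_sqrt[OF e C(1)] unfolding eventually_at_right_field by auto
  show "\<exists>d>0. \<forall>x'\<in>{0..}. dist x' t < d \<longrightarrow> dist (m2 x') (m2 t) \<le> e"
  proof (intro exI[of _ "min d 1"] conjI ballI impI)
    show "0 < min d 1" using d by simp
    fix r assume r: "r \<in> {0..}" "dist r t < min d 1"
    show "dist (m2 r) (m2 t) \<le> e"
    proof (cases "r = t")
      case False
      then consider "r < t" | "t < r" by linarith
      then show ?thesis
      proof cases
        case 1
        have "\<bar>m2 t - m2 r\<bar> \<le> C * sqrt (t - r)" using 1 r t by (intro C(2)) (auto simp: dist_real_def)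
        moreover have "C * sqrt (t - r) < e" using 1 r by (intro d(2)) (auto simp: dist_real_def)
        ultimately show ?thesis by (simp add: dist_real_def abs_minus_commute)
      next
        case 2
        have "\<bar>m2 r - m2 t\<bar> \<le> C * sqrt (r - t)" using 2 r t by (intro C(2)) (auto simp: dist_real_def)
        moreover have "C * sqrt (r - t) < e" using 2 r by (intro d(2)) (auto simp: dist_real_def)
        ultimately show ?thesis by (simp add: dist_real_def)
      qed
    qed (use e in simp)
  qed
qed

text \<open>The denominator is the decay rate \<open>\<mu>\<close> used below, so
  \<open>\<kappa>2 * \<mu>\<close> is the total weight of the delayed terms in \<open>growth\<close>
  plus 1; the extra 1 buys strictness in the comparison.\<close>

definition \<kappa>2 :: real where
  "\<kappa>2 = (2 * \<bar>b + \<sigma> * \<rho>\<bar> + \<rho>\<^sup>2 + 1) / ((2 * a + \<sigma>\<^sup>2) * (1 - q) / 2)"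

text \<open>With \<open>x = exp (- \<mu> * t)\<close> the delayed second moment is at most
  \<open>x * x\<close> times the majorant, but the mixed moment of \<open>X t\<close> and
  \<open>X (q * t)\<close> only \<open>x\<close> times it. Taking \<open>\<mu>\<close> as half of
  \<open>\<gamma> * (1 - q)\<close> matches this weaker factor, and the derivative of the correction
  leaves one more \<open>x\<close> as a gap.\<close>

lemma growth_le_majorant:
  assumes lam: "0 < 2 * a + \<sigma>\<^sup>2" and A: "0 < A" and t: "0 \<le> t"
    and \<mu>_def: "\<mu> = (2 * a + \<sigma>\<^sup>2) * (1 - q) / 2"
    and below: "\<And>s. 0 \<le> s \<Longrightarrow> s \<le> t \<Longrightarrow> m2 s \<le> A * majorant (2 * a + \<sigma>\<^sup>2) \<kappa>2 \<mu> s"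
  shows "growth t + exp (- \<mu> * t) * (A * majorant (2 * a + \<sigma>\<^sup>2) \<kappa>2 \<mu> t)
    \<le> (2 * a + \<sigma>\<^sup>2 + \<kappa>2 * \<mu> * exp (- \<mu> * t)) * (A * majorant (2 * a + \<sigma>\<^sup>2) \<kappa>2 \<mu> t)"
proof -
  define \<gamma> where "\<gamma> = 2 * a + \<sigma>\<^sup>2"
  define \<beta> where "\<beta> = \<bar>b + \<sigma> * \<rho>\<bar>"
  define w where "w r = A * majorant \<gamma> \<kappa>2 \<mu> r" for r
  define x where "x = exp (- \<mu> * t)"
  have \<mu>: "0 < \<mu>" using lam q by (simp add: \<mu>_def)
  have \<kappa>\<mu>: "\<kappa>2 * \<mu> = 2 * \<beta> + \<rho>\<^sup>2 + 1" using \<mu> unfolding \<kappa>2_def \<beta>_def \<mu>_def[symmetric] by simp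
  then have "0 \<le> \<kappa>2 * \<mu>" by (simp add: \<beta>_def)
  then have \<kappa>: "0 \<le> \<kappa>2" using \<mu> by (simp add: zero_le_mult_iff)
  have x: "0 < x" "x \<le> 1" using \<mu> t by (auto simp: x_def)
  have wt: "0 < w t" using A majorant_pos by (simp add: w_def)
  have "exp (- (\<gamma> * (1 - q)) * t) = x * x" by (simp add: x_def \<gamma>_def \<mu>_def exp_add[symmetric])
  then have wq: "w (q * t) \<le> x * x * w t"
    using majorant_delay[OF q \<kappa> less_imp_le[OF \<mu>] t, of \<gamma>] A mult_left_mono[of _ _ A]
    unfolding w_def by (simp add: mult.left_commute)
  have mt: "m2 t \<le> w t" and mq: "m2 (q * t) \<le> x * x * w t"
    using below[of t] below[of "q * t"] q_mult[OF t] t wq by (auto simp: w_def \<gamma>_def)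
  have XL: "X t \<in> L2 M" "X (q * t) \<in> L2 M" using L2F_L2[OF X_L2F] t q_mult(1)[OF t] by auto
  have prod: "2 * \<bar>\<integral>\<omega>. X t \<omega> * X (q * t) \<omega> \<partial>M\<bar> \<le> 2 * (x * w t)"
  proof -
    have "2 * \<bar>\<integral>\<omega>. X t \<omega> * X (q * t) \<omega> \<partial>M\<bar> \<le> x * m2 t + m2 (q * t) / x"
      by (rule L2_abs_product_bound[OF XL x(1)])
    also have "\<dots> \<le> x * w t + (x * x * w t) / x"
      using mt mq x by (intro add_mono mult_left_mono divide_right_mono) auto
    finally show ?thesis using x by simp
  qed
  have "growth t \<le> \<gamma> * m2 t + \<beta> * (2 * \<bar>\<integral>\<omega>. X t \<omega> * X (q * t) \<omega> \<partial>M\<bar>) + \<rho>\<^sup>2 * m2 (q * t)"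
  proof -
    have "(b + \<sigma> * \<rho>) * (\<integral>\<omega>. X t \<omega> * X (q * t) \<omega> \<partial>M) \<le> \<bar>(b + \<sigma> * \<rho>) * (\<integral>\<omega>. X t \<omega> * X (q * t) \<omega> \<partial>M)\<bar>" by simp
    also have "\<dots> = \<beta> * \<bar>\<integral>\<omega>. X t \<omega> * X (q * t) \<omega> \<partial>M\<bar>" by (simp add: abs_mult \<beta>_def)
    finally show ?thesis unfolding growth_def \<gamma>_def by linarith
  qed
  also have "\<dots> \<le> \<gamma> * w t + \<beta> * (2 * (x * w t)) + \<rho>\<^sup>2 * (x * w t)"
  proof -
    have "x * x * w t \<le> x * w t" using x wt by (simp add: mult_left_le_one_le)
    then have "m2 (q * t) \<le> x * w t" using mq by simp
    then show ?thesis using mt prod lam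
      by (intro add_mono mult_left_mono) (auto simp: \<gamma>_def \<beta>_def)
  qed
  also have "\<dots> = (\<gamma> + (2 * \<beta> + \<rho>\<^sup>2) * x) * w t" by (simp add: algebra_simps)
  finally have "growth t + x * w t \<le> (\<gamma> + \<kappa>2 * \<mu> * x) * w t"
    unfolding \<kappa>\<mu> by (simp add: algebra_simps)
  then show ?thesis unfolding w_def x_def \<gamma>_def .
qed

text \<open>At a touching point the growth term lies below the derivative of the majorant by at
  least \<open>\<eta>\<close>. Half of this gap pays for the difference quotient and half for the
  one-step error \<open>C * sqrt h\<close>, so the moment stays below for a short while.\<close>

lemma second_moment_majorant:
  assumes lam: "0 < 2 * a + \<sigma>\<^sup>2" and A: "(\<integral>\<omega>. (X0 \<omega>)\<^sup>2 \<partial>M) < A" and t: "0 \<le> t"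
    and \<mu>_def: "\<mu> = (2 * a + \<sigma>\<^sup>2) * (1 - q) / 2"
  shows "m2 t \<le> A * majorant (2 * a + \<sigma>\<^sup>2) \<kappa>2 \<mu> t"
proof -
  define w where "w r = A * majorant (2 * a + \<sigma>\<^sup>2) \<kappa>2 \<mu> r" for r
  have "0 \<le> (\<integral>\<omega>. (X0 \<omega>)\<^sup>2 \<partial>M)" by simp
  then have A0: "0 < A" using A by linarith
  have "m2 0 = (\<integral>\<omega>. (X0 \<omega>)\<^sup>2 \<partial>M)"
    using X_zero X_measurable_M[of 0] L2_measurable[OF L2F_L2[OF X0_L2F]]
    by (intro integral_cong_AE borel_measurable_power) auto
  then have start: "m2 0 < w 0" using A by (simp add: w_def majorant_def)
  have "m2 t \<le> w t"
  proof (rule forward_comparison[where f="\<lambda>t. m2 t" and w=w, OF m2_continuous_on _ start _ t])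
    show "continuous_on {0..} w" unfolding w_def by (intro continuous_intros majorant_continuous)
    fix t :: real assume t: "0 \<le> t" and below: "\<And>s. 0 \<le> s \<Longrightarrow> s \<le> t \<Longrightarrow> m2 s \<le> w s" and eq: "m2 t = w t"
    have T: "0 \<le> t + 1" using t by simp
    obtain C where C: "0 \<le> C" "\<And>s r. 0 \<le> s \<Longrightarrow> s < r \<Longrightarrow> r \<le> t + 1 \<Longrightarrow> r - s \<le> 1 \<Longrightarrow>
      m2 r \<le> m2 s + (r - s) * growth s + C * ((r - s) * sqrt (r - s))"
      by (rule m2_increment[OF T]) (rule that; assumption)
    define \<eta> where "\<eta> = exp (- \<mu> * t) * w t"
    define w' where "w' = (2 * a + \<sigma>\<^sup>2 + \<kappa>2 * \<mu> * exp (- \<mu> * t)) * w t"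
    have \<eta>: "0 < \<eta>" using A0 majorant_pos by (simp add: \<eta>_def w_def)
    have g: "growth t + \<eta> \<le> w'"
      using growth_le_majorant[OF lam A0 t \<mu>_def below[unfolded w_def]] by (simp add: \<eta>_def w'_def w_def)
    have "(w has_real_derivative w') (at t)"
      unfolding w_def[abs_def] w'_def
      by (rule derivative_eq_intros majorant_deriv refl | simp add: algebra_simps)+
    then have "((\<lambda>h. (w (t + h) - w t) / h) \<longlongrightarrow> w') (at 0)" by (simp add: DERIV_def)
    then have "((\<lambda>h. (w (t + h) - w t) / h) \<longlongrightarrow> w') (at_right 0)"
      by (rule tendsto_within_subset) simp
    then have ev: "eventually (\<lambda>h. w' - \<eta> / 2 < (w (t + h) - w t) / h) (at_right 0)"
      using \<eta> by (intro order_tendstoD) auto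
    have "eventually (\<lambda>h. w' - \<eta> / 2 < (w (t + h) - w t) / h \<and> C * sqrt h < \<eta> / 2) (at_right 0)"
      using ev eventually_small_sqrt[of "\<eta> / 2" C] \<eta> C(1) by (intro eventually_conj) auto
    then obtain d where d: "0 < d"
      "\<And>h. 0 < h \<Longrightarrow> h < d \<Longrightarrow> w' - \<eta> / 2 < (w (t + h) - w t) / h \<and> C * sqrt h < \<eta> / 2"
      unfolding eventually_at_right_field by auto
    show "\<exists>\<delta>>0. \<forall>h. 0 < h \<longrightarrow> h < \<delta> \<longrightarrow> m2 (t + h) \<le> w (t + h)"
    proof (intro exI[of _ "min d 1"] conjI allI impI)
      show "0 < min d 1" using d by simp
      fix h assume h: "0 < h" "h < min d 1"
      have "m2 (t + h) \<le> m2 t + h * growth t + C * (h * sqrt h)"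
        using C(2)[of t "t + h"] t h by simp
      moreover have "h * (w' - \<eta> / 2) \<le> w (t + h) - w t"
        using d(2)[of h] h by (simp add: pos_less_divide_eq mult.commute less_imp_le)
      moreover have "h * growth t + C * (h * sqrt h) \<le> h * (w' - \<eta> / 2)"
      proof -
        have "growth t + C * sqrt h \<le> w' - \<eta> / 2" using g d(2)[of h] h by simp
        from mult_left_mono[OF this, of h] show ?thesis using h by (simp add: algebra_simps)
      qed
      ultimately show "m2 (t + h) \<le> w (t + h)" using eq by linarith
    qed
  qed
  then show ?thesis by (simp add: w_def)
qed

text \<open>The comparison requires a start strictly below the majorant, so \<open>A\<close> is kept
  above the initial second moment and lowered to it at the end. In this way the constant multiplies
  the initial moment itself, also when that moment is 0.\<close>

lemma second_moment_growth:
  assumes lam: "0 < 2 * a + \<sigma>\<^sup>2" and t: "0 \<le> t"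
  shows "m2 t \<le> exp \<kappa>2 * (\<integral>\<omega>. (X0 \<omega>)\<^sup>2 \<partial>M) * exp ((2 * a + \<sigma>\<^sup>2) * t)"
proof -
  define \<mu> where "\<mu> = (2 * a + \<sigma>\<^sup>2) * (1 - q) / 2"
  have \<mu>: "0 < \<mu>" using lam q by (simp add: \<mu>_def)
  have \<kappa>: "0 \<le> \<kappa>2" unfolding \<kappa>2_def \<mu>_def[symmetric] using \<mu> by (intro divide_nonneg_pos) auto
  let ?E = "\<integral>\<omega>. (X0 \<omega>)\<^sup>2 \<partial>M" and ?c = "exp \<kappa>2 * exp ((2 * a + \<sigma>\<^sup>2) * t)"
  have "m2 t \<le> A * ?c" if "?E < A" for A
  proof -
    have "0 \<le> ?E" by simp
    then have "0 \<le> A" using that by linarith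
    then have "A * majorant (2 * a + \<sigma>\<^sup>2) \<kappa>2 \<mu> t \<le> A * ?c" using majorant_le[OF \<kappa>] by (intro mult_left_mono)
    then show ?thesis using second_moment_majorant[OF lam that t \<mu>_def] by linarith
  qed
  then have *: "m2 t / ?c \<le> A" if "?E < A" for A using that by (simp add: pos_divide_le_eq)
  have "m2 t / ?c \<le> ?E" by (rule dense_ge) (rule *)
  then have "m2 t \<le> ?E * ?c" by (simp add: pos_divide_le_eq)
  then show ?thesis by (simp add: mult_ac)
qed

end

section \<open>A maximal inequality\<close>

context brownian_filtration
begin

lemma square_indicator: "(x * indicator A w)\<^sup>2 = x\<^sup>2 * (indicator A w :: real)"
  by (simp add: indicator_def)

text \<open>Kolmogorov's inequality. The event is split by the first index at which the threshold is
  reached; on the i-th piece \<open>(S n)\<^sup>2\<close> is at least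
  \<open>c\<^sup>2 + 2 * S i * (S n - S i)\<close>, and the cross term has mean 0 since the piece is
  known at \<open>u i\<close>.\<close>

lemma discrete_maximal_inequality:
  fixes u :: "nat \<Rightarrow> real" and S :: "nat \<Rightarrow> 'a \<Rightarrow> real"
  assumes u: "mono u" and S: "\<And>i. i \<le> n \<Longrightarrow> S i \<in> L2F (u i)"
    and orth: "\<And>i \<eta>. i \<le> n \<Longrightarrow> \<eta> \<in> L2F (u i) \<Longrightarrow> (\<integral>\<omega>. \<eta> \<omega> * (S n \<omega> - S i \<omega>) \<partial>M) = 0"
    and c: "0 < c"
  shows "prob {\<omega>\<in>space M. \<exists>i\<le>n. c \<le> \<bar>S i \<omega>\<bar>} \<le> (\<integral>\<omega>. (S n \<omega>)\<^sup>2 \<partial>M) / c\<^sup>2"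
proof -
  have SF: "S i \<in> borel_measurable (F (u j))" if "i \<le> j" "j \<le> n" for i j
    using F_measurable_mono[OF L2F_measurable[OF S[of i]] monoD[OF u that(1)]] that by simp
  define A where "A i = {\<omega>\<in>space M. c \<le> \<bar>S i \<omega>\<bar> \<and> (\<forall>j<i. \<bar>S j \<omega>\<bar> < c)}" for i
  have A: "A i \<in> sets (F (u i))" if "i \<le> n" for i
  proof -
    have 1: "{\<omega>\<in>space (F (u i)). c \<le> \<bar>S i \<omega>\<bar>} \<in> sets (F (u i))"
      by (intro borel_measurable_le borel_measurable_const borel_measurable_abs SF that order_refl)
    have 2: "{\<omega>\<in>space (F (u i)). \<forall>j\<in>{..<i}. \<bar>S j \<omega>\<bar> < c} \<in> sets (F (u i))"
      using that by (intro sets.sets_Collect_finite_All borel_measurable_less borel_measurable_abs borel_measurable_const SF) auto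
    have "A i = {\<omega>\<in>space (F (u i)). c \<le> \<bar>S i \<omega>\<bar>} \<inter> {\<omega>\<in>space (F (u i)). \<forall>j\<in>{..<i}. \<bar>S j \<omega>\<bar> < c}"
      by (auto simp: A_def F_space)
    then show ?thesis using 1 2 by (simp only: sets.Int)
  qed
  have AM: "A i \<in> events" if "i \<le> n" for i using A[OF that] F_sets by blast
  have disj: "disjoint_family_on A {..n}"
    unfolding disjoint_family_on_def A_def by (auto simp: not_le[symmetric]) (metis linorder_neqE_nat not_less)
  have un: "{\<omega>\<in>space M. \<exists>i\<le>n. c \<le> \<bar>S i \<omega>\<bar>} = (\<Union>i\<in>{..n}. A i)"
  proof (intro equalityI subsetI)
    fix \<omega> assume "\<omega> \<in> {\<omega>\<in>space M. \<exists>i\<le>n. c \<le> \<bar>S i \<omega>\<bar>}"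
    then obtain i where \<omega>: "\<omega> \<in> space M" and i: "i \<le> n" "c \<le> \<bar>S i \<omega>\<bar>" by auto
    define k where "k = (LEAST k. c \<le> \<bar>S k \<omega>\<bar>)"
    have "c \<le> \<bar>S k \<omega>\<bar>" unfolding k_def by (rule LeastI[of _ i]) (rule i(2))
    moreover have "k \<le> i" unfolding k_def by (rule Least_le) (rule i(2))
    moreover have "\<bar>S j \<omega>\<bar> < c" if "j < k" for j
      using not_less_Least[of j "\<lambda>k. c \<le> \<bar>S k \<omega>\<bar>"] that by (simp add: k_def)
    ultimately show "\<omega> \<in> (\<Union>i\<in>{..n}. A i)" using i \<omega> by (auto simp: A_def intro!: bexI[of _ k])
  qed (auto simp: A_def)
  have Sn: "S n \<in> L2 M" by (rule L2F_L2[OF S[OF order_refl]])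
  have int2: "integrable M (\<lambda>\<omega>. (S n \<omega>)\<^sup>2 * indicator (A i) \<omega>)" if "i \<le> n" for i
    using L2_integrable_square[OF L2_indicator[OF Sn AM[OF that]]] by (simp only: square_indicator)
  have part: "c\<^sup>2 * prob (A i) \<le> (\<integral>\<omega>. (S n \<omega>)\<^sup>2 * indicator (A i) \<omega> \<partial>M)" if i: "i \<le> n" for i
  proof -
    let ?\<eta> = "\<lambda>\<omega>. S i \<omega> * indicator (A i) \<omega>"
    have \<eta>: "?\<eta> \<in> L2F (u i)" by (rule L2F_indicator[OF S[OF i] A[OF i]])
    have Si: "S i \<in> L2 M" by (rule L2F_L2[OF S[OF i]])
    have int1: "integrable M (\<lambda>\<omega>. ?\<eta> \<omega> * (S n \<omega> - S i \<omega>))"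
      by (intro L2_mult_integrable L2F_L2[OF \<eta>] L2_diff Sn Si)
    have intI: "integrable M (indicator (A i) :: 'a \<Rightarrow> real)"
      by (rule integrable_real_indicator[OF AM[OF i]]) (simp add: less_top[symmetric])
    have "c\<^sup>2 * prob (A i) = (\<integral>\<omega>. c\<^sup>2 * indicator (A i) \<omega> + 2 * (?\<eta> \<omega> * (S n \<omega> - S i \<omega>)) \<partial>M)"
    proof (subst Bochner_Integration.integral_add)
      show "integrable M (\<lambda>\<omega>. c\<^sup>2 * indicator (A i) \<omega>)" using intI by (intro Bochner_Integration.integrable_mult_right)
      show "integrable M (\<lambda>\<omega>. 2 * (?\<eta> \<omega> * (S n \<omega> - S i \<omega>)))" using int1 by (intro Bochner_Integration.integrable_mult_right)
      show "c\<^sup>2 * prob (A i) = (\<integral>\<omega>. c\<^sup>2 * indicator (A i) \<omega> \<partial>M) + (\<integral>\<omega>. 2 * (?\<eta> \<omega> * (S n \<omega> - S i \<omega>)) \<partial>M)"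
        using orth[OF i \<eta>] sets.sets_into_space[OF AM[OF i]] by (simp add: Int_absorb2)
    qed
    also have "\<dots> \<le> (\<integral>\<omega>. (S n \<omega>)\<^sup>2 * indicator (A i) \<omega> \<partial>M)"
    proof (rule integral_mono)
      show "integrable M (\<lambda>\<omega>. c\<^sup>2 * indicator (A i) \<omega> + 2 * (?\<eta> \<omega> * (S n \<omega> - S i \<omega>)))"
        using int1 intI by (intro Bochner_Integration.integrable_add Bochner_Integration.integrable_mult_right)
      show "integrable M (\<lambda>\<omega>. (S n \<omega>)\<^sup>2 * indicator (A i) \<omega>)" by (rule int2[OF i])
      fix \<omega>
      show "c\<^sup>2 * indicator (A i) \<omega> + 2 * (?\<eta> \<omega> * (S n \<omega> - S i \<omega>)) \<le> (S n \<omega>)\<^sup>2 * indicator (A i) \<omega>"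
      proof (cases "\<omega> \<in> A i")
        case True
        then have "\<bar>c\<bar> \<le> \<bar>S i \<omega>\<bar>" using c by (simp add: A_def)
        then have "c\<^sup>2 \<le> (S i \<omega>)\<^sup>2" by (simp only: abs_le_square_iff)
        moreover have "(S n \<omega>)\<^sup>2 - (S i \<omega>)\<^sup>2 - 2 * (S i \<omega> * (S n \<omega> - S i \<omega>)) = (S n \<omega> - S i \<omega>)\<^sup>2"
          by (simp add: power2_eq_square algebra_simps)
        moreover have "0 \<le> (S n \<omega> - S i \<omega>)\<^sup>2" by simp
        ultimately have "c\<^sup>2 + 2 * (S i \<omega> * (S n \<omega> - S i \<omega>)) \<le> (S n \<omega>)\<^sup>2" by linarith
        then show ?thesis using True by simp
      qed simp
    qed
    finally show ?thesis .
  qed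
  have "c\<^sup>2 * prob {\<omega>\<in>space M. \<exists>i\<le>n. c \<le> \<bar>S i \<omega>\<bar>} = (\<Sum>i\<le>n. c\<^sup>2 * prob (A i))"
    unfolding un using AM disj
    by (subst finite_measure_finite_Union) (auto simp: sum_distrib_left)
  also have "\<dots> \<le> (\<Sum>i\<le>n. \<integral>\<omega>. (S n \<omega>)\<^sup>2 * indicator (A i) \<omega> \<partial>M)" by (rule sum_mono) (use part in auto)
  also have "\<dots> = (\<integral>\<omega>. (\<Sum>i\<le>n. (S n \<omega>)\<^sup>2 * indicator (A i) \<omega>) \<partial>M)"
  proof (rule Bochner_Integration.integral_sum[symmetric])
    fix i assume "i \<in> {..n}"
    then show "integrable M (\<lambda>\<omega>. (S n \<omega>)\<^sup>2 * indicator (A i) \<omega>)"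
      by (intro int2) simp
  qed
  also have "\<dots> \<le> (\<integral>\<omega>. (S n \<omega>)\<^sup>2 \<partial>M)"
  proof (rule integral_mono)
    show "integrable M (\<lambda>\<omega>. \<Sum>i\<le>n. (S n \<omega>)\<^sup>2 * indicator (A i) \<omega>)"
    proof (rule Bochner_Integration.integrable_sum)
      fix i assume "i \<in> {..n}"
      then show "integrable M (\<lambda>\<omega>. (S n \<omega>)\<^sup>2 * indicator (A i) \<omega>)"
        by (intro int2) simp
    qed
    show "integrable M (\<lambda>\<omega>. (S n \<omega>)\<^sup>2)" by (rule L2_integrable_square[OF Sn])
    fix \<omega>
    have "(\<Sum>i\<le>n. indicator (A i) \<omega>) = (indicator (\<Union>i\<in>{..n}. A i) \<omega> :: real)"
      using disj by (intro indicator_UN_disjoint[symmetric]) auto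
    then show "(\<Sum>i\<le>n. (S n \<omega>)\<^sup>2 * indicator (A i) \<omega>) \<le> (S n \<omega>)\<^sup>2"
      by (simp add: sum_distrib_left[symmetric] mult_left_le indicator_le_1)
  qed
  finally show ?thesis using c by (simp add: pos_le_divide_eq mult.commute)
qed

text \<open>Dyadic grids are nested, so the events of reaching the threshold on the grid increase
  and their union inherits the common bound; outside the union a continuous path is at most
  \<open>c\<close> by density. The conclusion is phrased with an event and continuous paths, because
  the supremum over an interval is not known to be measurable.\<close>

lemma continuous_maximal_inequality:
  fixes S :: "real \<Rightarrow> 'a \<Rightarrow> real"
  assumes st: "s \<le> t" and S: "\<And>r. s \<le> r \<Longrightarrow> r \<le> t \<Longrightarrow> S r \<in> L2F r"
    and orth: "\<And>r \<eta>. s \<le> r \<Longrightarrow> r \<le> t \<Longrightarrow> \<eta> \<in> L2F r \<Longrightarrow> (\<integral>\<omega>. \<eta> \<omega> * (S t \<omega> - S r \<omega>) \<partial>M) = 0"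
    and c: "0 < c"
  shows "\<exists>A\<in>events. prob A \<le> (\<integral>\<omega>. (S t \<omega>)\<^sup>2 \<partial>M) / c\<^sup>2 \<and>
    (\<forall>\<omega>\<in>space M - A. continuous_on {s..t} (\<lambda>r. S r \<omega>) \<longrightarrow> (\<forall>r\<in>{s..t}. \<bar>S r \<omega>\<bar> \<le> c))"
proof -
  define u where "u k i = s + (t - s) * (real (min i (2^k)) / 2^k)" for k i :: nat
  have u_mono: "mono (u k)" for k
  proof (rule monoI)
    fix i j :: nat assume "i \<le> j"
    then have "real (min i (2^k)) \<le> real (min j (2^k))" unfolding of_nat_le_iff by (simp add: min_def)
    then show "u k i \<le> u k j" unfolding u_def
      using st by (intro add_left_mono mult_left_mono divide_right_mono) auto
  qed
  have u_end: "u k 0 = s" "u k (2^k) = t" for k by (simp_all add: u_def)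
  have u_range: "s \<le> u k i" "i \<le> 2^k \<Longrightarrow> u k i \<le> t" for k i
    using monoD[OF u_mono, of 0 i k] monoD[OF u_mono, of i "2^k" k] u_end by auto
  define E where "E k = {\<omega>\<in>space M. \<exists>i\<le>2^k. c \<le> \<bar>S (u k i) \<omega>\<bar>}" for k
  have Ep: "prob (E k) \<le> (\<integral>\<omega>. (S t \<omega>)\<^sup>2 \<partial>M) / c\<^sup>2" for k
  proof -
    have "prob {\<omega>\<in>space M. \<exists>i\<le>2^k. c \<le> \<bar>S (u k i) \<omega>\<bar>} \<le> (\<integral>\<omega>. (S (u k (2^k)) \<omega>)\<^sup>2 \<partial>M) / c\<^sup>2"
    proof (rule discrete_maximal_inequality[OF u_mono[of k] _ _ c])
      show "S (u k i) \<in> L2F (u k i)" if "i \<le> 2^k" for i using S u_range that by auto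
      show "(\<integral>\<omega>. \<eta> \<omega> * (S (u k (2^k)) \<omega> - S (u k i) \<omega>) \<partial>M) = 0" if "i \<le> 2^k" "\<eta> \<in> L2F (u k i)" for i \<eta>
        unfolding u_end using u_range that by (intro orth) auto
    qed
    then show ?thesis unfolding E_def u_end .
  qed
  have EM: "E k \<in> events" for k
  proof -
    have "{\<omega>\<in>space M. c \<le> \<bar>S (u k i) \<omega>\<bar>} \<in> events" if "i \<le> 2^k" for i
    proof -
      have "S (u k i) \<in> borel_measurable M" by (rule L2_measurable[OF L2F_L2[OF S]]) (rule u_range that)+
      then show ?thesis by (rule borel_measurable_le[OF borel_measurable_const borel_measurable_abs])
    qed
    then have "(\<Union>i\<in>{..2^k}. {\<omega>\<in>space M. c \<le> \<bar>S (u k i) \<omega>\<bar>}) \<in> events"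
      by (intro sets.finite_UN) (simp, blast)
    moreover have "E k = (\<Union>i\<in>{..2^k}. {\<omega>\<in>space M. c \<le> \<bar>S (u k i) \<omega>\<bar>})"
      unfolding E_def by blast
    ultimately show ?thesis by (simp only:)
  qed
  have Einc: "incseq E"
  proof (rule incseq_SucI)
    fix k
    show "E k \<le> E (Suc k)"
    proof
      fix \<omega> assume "\<omega> \<in> E k"
      then obtain i where i: "\<omega> \<in> space M" "i \<le> 2^k" "c \<le> \<bar>S (u k i) \<omega>\<bar>" by (auto simp: E_def)
      have "u (Suc k) (2 * i) = u k i" using i(2) by (simp add: u_def min_def)
      then show "\<omega> \<in> E (Suc k)" using i by (auto simp: E_def intro!: exI[of _ "2 * i"])
    qed
  qed
  show ?thesis
  proof (intro bexI[of _ "\<Union>k. E k"] conjI ballI impI)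
    show "(\<Union>k. E k) \<in> events" using EM by auto
    have "(\<lambda>k. prob (E k)) \<longlonglongrightarrow> prob (\<Union>k. E k)"
      using EM Einc by (intro finite_Lim_measure_incseq) auto
    then show "prob (\<Union>k. E k) \<le> (\<integral>\<omega>. (S t \<omega>)\<^sup>2 \<partial>M) / c\<^sup>2"
      by (rule LIMSEQ_le_const2) (use Ep in auto)
    fix \<omega> r assume \<omega>: "\<omega> \<in> space M - (\<Union>k. E k)" and cont: "continuous_on {s..t} (\<lambda>r. S r \<omega>)" and r: "r \<in> {s..t}"
    have Sc: "\<bar>S (u k i) \<omega>\<bar> < c" if "i \<le> 2^k" for k i
    proof -
      have "\<omega> \<in> space M" "\<omega> \<notin> E k" using \<omega> by blast+
      then have "\<not> (\<exists>i\<le>2^k. c \<le> \<bar>S (u k i) \<omega>\<bar>)" unfolding E_def by blast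
      then have "\<not> c \<le> \<bar>S (u k i) \<omega>\<bar>" using that by blast
      then show ?thesis by (simp only: not_le)
    qed
    \<comment> \<open>The grid point at or just to the left of \<open>r\<close>. For
      \<open>s = t\<close> the quotient is 0 and the point is \<open>s\<close>.\<close>
    define v where "v k = u k (nat \<lfloor>(r - s) / (t - s) * 2^k\<rfloor>)" for k
    have small: "\<bar>S (v k) \<omega>\<bar> \<le> c \<and> v k \<in> {s..t} \<and> \<bar>v k - r\<bar> \<le> (t - s) * (1/2)^k" for k
    proof (cases "s = t")
      case True
      then have "v k = s" by (simp add: v_def u_def)
      moreover have "\<bar>S (u k 0) \<omega>\<bar> < c" by (rule Sc) simp
      ultimately show ?thesis using True r by (simp add: u_end)
    next
      case False
      then have pos: "0 < t - s" using st by simp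
      define y where "y = (r - s) / (t - s)"
      have y: "0 \<le> y" "y \<le> 1" using r pos by (auto simp: y_def)
      define i where "i = nat \<lfloor>y * 2^k\<rfloor>"
      have fl: "real i \<le> y * 2^k" "y * 2^k < real i + 1" using y by (auto simp: i_def)
      have "y * 2^k \<le> 1 * 2^k" using y by (intro mult_right_mono) auto
      then have "real i \<le> 2^k" using fl by linarith
      then have i: "i \<le> 2^k" by simp
      have v: "v k = u k i" by (simp add: v_def i_def y_def)
      have "\<bar>S (u k i) \<omega>\<bar> < c" by (rule Sc[OF i])
      moreover have "\<bar>v k - r\<bar> \<le> (t - s) * (1/2)^k"
      proof -
        have r_eq: "r = s + (t - s) * y" using pos by (simp add: y_def)
        have "v k - r = (t - s) * (real i / 2^k - y)"
          unfolding v u_def using i by (simp add: r_eq algebra_simps)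
        moreover have "\<bar>real i / 2^k - y\<bar> \<le> (1/2)^k"
        proof -
          have "real i / 2^k \<le> y" using fl(1) by (simp add: pos_divide_le_eq)
          moreover have "y - real i / 2^k \<le> 1 / 2^k"
          proof -
            have "y \<le> (real i + 1) / 2^k" using fl(2) by (simp add: pos_le_divide_eq less_imp_le)
            then show ?thesis by (simp add: add_divide_distrib)
          qed
          ultimately show ?thesis by (simp add: power_one_over)
        qed
        ultimately show ?thesis using pos by (simp add: abs_mult)
      qed
      ultimately show ?thesis using u_range(1)[of k i] u_range(2)[OF i] by (auto simp: v)
    qed
    have "(\<lambda>k. (1/2 :: real)^k) \<longlonglongrightarrow> 0" by (rule LIMSEQ_power_zero) simp
    then have null: "(\<lambda>k. (t - s) * (1/2)^k) \<longlonglongrightarrow> 0" by (rule tendsto_mult_right_zero)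
    have "norm (v k - r) \<le> (t - s) * (1/2)^k" for k
      unfolding real_norm_def by (rule small[THEN conjunct2, THEN conjunct2])
    then have "eventually (\<lambda>k. norm (v k - r) \<le> (t - s) * (1/2)^k) sequentially"
      by (rule always_eventually[OF allI])
    then have "(\<lambda>k. v k - r) \<longlonglongrightarrow> 0" using null by (rule Lim_null_comparison)
    then have "v \<longlonglongrightarrow> r" by (rule LIM_zero_cancel)
    then have "(\<lambda>k. S (v k) \<omega>) \<longlonglongrightarrow> S r \<omega>"
      by (rule continuous_on_tendsto_compose[OF cont _ r]) (rule always_eventually, rule allI, rule small[THEN conjunct2, THEN conjunct1])
    then have "(\<lambda>k. \<bar>S (v k) \<omega>\<bar>) \<longlonglongrightarrow> \<bar>S r \<omega>\<bar>" by (rule tendsto_rabs)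
    then show "\<bar>S r \<omega>\<bar> \<le> c"
      by (rule LIMSEQ_le_const2) (intro exI[of _ 0] allI impI, rule small[THEN conjunct1])
  qed
qed

end

section \<open>Almost sure growth\<close>

text \<open>Exponents above \<open>r\<close> by \<open>1 / Suc k\<close> suffice, since the factor
  \<open>K\<close> disappears in \<open>ln K / t\<close>. Zeros of \<open>f\<close> are harmless, as
  \<open>elog\<close> is then minus infinity.\<close>

lemma Limsup_log_le:
  fixes f :: "real \<Rightarrow> real"
  assumes bound: "\<And>k. \<exists>K T. 0 < K \<and> (\<forall>t\<ge>T. \<bar>f t\<bar> \<le> K * exp ((r + 1 / real (Suc k)) * t))"
  shows "Limsup at_top (\<lambda>t. ereal (1 / t) * elog \<bar>f t\<bar>) \<le> ereal r"
proof (rule ereal_le_epsilon2)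
  fix e :: real assume e: "0 < e"
  from e have "0 < e / 2" by simp
  then obtain k where k: "1 / real (Suc k) < e / 2" by (rule nat_approx_posE)
  obtain K T where K: "0 < K" and le: "\<And>t. T \<le> t \<Longrightarrow> \<bar>f t\<bar> \<le> K * exp ((r + 1 / real (Suc k)) * t)"
    using bound[of k] by blast
  have "((\<lambda>t. ln K / t) \<longlongrightarrow> 0) at_top" by (rule real_tendsto_divide_at_top[OF tendsto_const filterlim_ident])
  then have "eventually (\<lambda>t. ln K / t < e / 2) at_top" using e by (intro order_tendstoD) auto
  then have "eventually (\<lambda>t. ereal (1 / t) * elog \<bar>f t\<bar> \<le> ereal r + ereal e) at_top"
    using eventually_ge_at_top[of T] eventually_gt_at_top[of 0]
  proof eventually_elim
    case (elim t)
    show ?case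
    proof (cases "f t = 0")
      case True
      then show ?thesis using elim by (simp add: elog_def)
    next
      case False
      have "ln \<bar>f t\<bar> \<le> ln (K * exp ((r + 1 / real (Suc k)) * t))"
        using False le[OF elim(2)] by (intro ln_mono) auto
      also have "\<dots> = ln K + (r + 1 / real (Suc k)) * t" using K by (simp add: ln_mult)
      finally have "ln \<bar>f t\<bar> / t \<le> (ln K + (r + 1 / real (Suc k)) * t) / t"
        using elim by (intro divide_right_mono) auto
      also have "\<dots> = ln K / t + (r + 1 / real (Suc k))" using elim by (simp add: add_divide_distrib)
      also have "\<dots> \<le> r + e" using elim k by linarith
      finally show ?thesis using False by (simp add: elog_def)
    qed
  qed
  then show "Limsup at_top (\<lambda>t. ereal (1 / t) * elog \<bar>f t\<bar>) \<le> ereal r + ereal e"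
    by (rule Limsup_bounded)
qed

text \<open>Borel-Cantelli in a form where \<open>P n\<close> may fail to be an event: it has to
  hold almost surely off an event of geometrically small probability. This fits pathwise statements
  over a whole time interval.\<close>

lemma (in prob_space) geometric_events_eventually:
  assumes x: "0 \<le> x" "x < 1"
    and ev: "\<And>n. \<exists>A\<in>events. prob A \<le> C * x ^ n \<and> (AE \<omega> in M. \<omega> \<notin> A \<longrightarrow> P n \<omega>)"
  shows "AE \<omega> in M. eventually (\<lambda>n. P n \<omega>) sequentially"
proof -
  define A where "A n = (SOME A. A \<in> events \<and> prob A \<le> C * x ^ n \<and> (AE \<omega> in M. \<omega> \<notin> A \<longrightarrow> P n \<omega>))" for n
  have A: "A n \<in> events \<and> prob (A n) \<le> C * x ^ n \<and> (AE \<omega> in M. \<omega> \<notin> A n \<longrightarrow> P n \<omega>)" for n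
    unfolding A_def by (rule someI_ex) (use ev[of n] in blast)
  have An: "A n \<in> events" for n using A[of n] by (elim conjE)
  have "AE \<omega> in M. eventually (\<lambda>n. \<omega> \<in> space M - A n) sequentially"
  proof (rule borel_cantelli_AE1[OF An])
    show "emeasure M (A n) < \<infinity>" for n by (simp add: less_top[symmetric])
    show "summable (\<lambda>n. prob (A n))"
    proof (rule summable_comparison_test[of _ "\<lambda>n. C * x ^ n"])
      have "prob (A n) \<le> C * x ^ n" for n using A[of n] by (elim conjE)
      then show "\<exists>N. \<forall>n\<ge>N. norm (prob (A n)) \<le> C * x ^ n" by simp
      show "summable (\<lambda>n. C * x ^ n)" using x by (intro summable_mult summable_geometric) simp
    qed
  qed
  moreover have "AE \<omega> in M. \<forall>n. \<omega> \<notin> A n \<longrightarrow> P n \<omega>"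
    unfolding AE_all_countable
  proof
    fix n show "AE \<omega> in M. \<omega> \<notin> A n \<longrightarrow> P n \<omega>" using A[of n] by (elim conjE)
  qed
  ultimately show ?thesis
  proof eventually_elim
    case (elim \<omega>)
    from elim(1) show ?case by eventually_elim (use elim(2) in blast)
  qed
qed

lemma (in prob_space) L2_Markov:
  assumes "f \<in> L2 M" "0 < c"
  shows "{\<omega>\<in>space M. c \<le> \<bar>f \<omega>\<bar>} \<in> events" "prob {\<omega>\<in>space M. c \<le> \<bar>f \<omega>\<bar>} \<le> (\<integral>\<omega>. (f \<omega>)\<^sup>2 \<partial>M) / c\<^sup>2"
proof -
  show "{\<omega>\<in>space M. c \<le> \<bar>f \<omega>\<bar>} \<in> events"
    by (intro borel_measurable_le borel_measurable_const borel_measurable_abs L2_measurable[OF assms(1)])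
  have "c \<le> \<bar>x\<bar> \<longleftrightarrow> c\<^sup>2 \<le> x\<^sup>2" for x :: real using abs_le_square_iff[of c x] assms(2) by simp
  then have "prob {\<omega>\<in>space M. c \<le> \<bar>f \<omega>\<bar>} = prob {\<omega>\<in>space M. c\<^sup>2 \<le> (f \<omega>)\<^sup>2}" by presburger
  also have "\<dots> \<le> (\<integral>\<omega>. (f \<omega>)\<^sup>2 \<partial>M) / c\<^sup>2"
    using assms(2) by (intro integral_Markov_inequality_measure[where A="{}"] L2_integrable_square[OF assms(1)]) auto
  finally show "prob {\<omega>\<in>space M. c \<le> \<bar>f \<omega>\<bar>} \<le> (\<integral>\<omega>. (f \<omega>)\<^sup>2 \<partial>M) / c\<^sup>2" .
qed

context pantograph
begin

lemma I_continuous: "AE \<omega> in M. continuous_on {0..} (\<lambda>t. I t \<omega>)"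
  using I_ito unfolding ito_integral_def continuous_process_def by simp

text \<open>On a unit block the solution is at most its initial value plus the integral of the
  modulus of the drift plus the fluctuation of \<open>I\<close>. Each exceeds \<open>c\<close> with
  probability of order \<open>exp (\<gamma> * n) / c\<^sup>2\<close>, by Chebyshev for the first two
  and by the maximal inequality for the third; \<open>c = exp (r * n)\<close> makes this geometric
  in \<open>n\<close>.\<close>

lemma block_bound:
  fixes n :: nat
  assumes lam: "0 < \<gamma>" and K: "\<And>t. 0 \<le> t \<Longrightarrow> m2 t \<le> K * exp (\<gamma> * t)"
    and L: "L = 2 * (a\<^sup>2 + b\<^sup>2) + 2 * (\<sigma>\<^sup>2 + \<rho>\<^sup>2)" and r: "0 < r"
  shows "\<exists>A\<in>events. prob A \<le> ((1 + 2 * L * exp \<gamma>) * K) * (exp (\<gamma> - 2 * r)) ^ n \<and>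
    (AE \<omega> in M. \<omega> \<notin> A \<longrightarrow> (\<forall>t\<in>{real n..real n + 1}. \<bar>X t \<omega>\<bar> \<le> 3 * exp (r * real n)))"
proof -
  define c where "c = exp (r * real n)"
  have c: "0 < c" by (simp add: c_def)
  have K0: "0 \<le> K"
  proof -
    have "0 \<le> m2 0" "m2 0 \<le> K" using K[of 0] by simp_all
    then show ?thesis by (rule order_trans)
  qed
  have L0: "0 \<le> L" and La: "2 * (a\<^sup>2 + b\<^sup>2) \<le> L" and Ls: "2 * (\<sigma>\<^sup>2 + \<rho>\<^sup>2) \<le> L" by (auto simp: L)
  define E where "E = exp (\<gamma> * real n)"
  define Q where "Q = L * (K * (exp \<gamma> * E))"
  have n01: "real n \<le> real n + 1" "0 \<le> real n" by simp_all
  have mb: "m2 s \<le> K * (exp \<gamma> * E)" if "0 \<le> s" "s \<le> real n + 1" for s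
  proof -
    have "exp (\<gamma> * s) \<le> exp (\<gamma> * (real n + 1))" using that lam by simp
    also have "\<dots> = exp \<gamma> * E" by (simp add: E_def exp_add[symmetric] algebra_simps)
    finally show ?thesis using K[OF that(1)] mult_left_mono[of "exp (\<gamma> * s)" "exp \<gamma> * E" K] K0 by linarith
  qed
  have KE: "0 \<le> K * (exp \<gamma> * E)" using K0 by (simp add: E_def)
  have bd: "(\<integral>\<omega>. (drift s \<omega>)\<^sup>2 \<partial>M) \<le> Q" "(\<integral>\<omega>. (diffusion s \<omega>)\<^sup>2 \<partial>M) \<le> Q"
    if s: "real n \<le> s" "s \<le> real n + 1" for s
  proof -
    have s0: "0 \<le> s" using s by simp
    have qs: "0 \<le> q * s" "q * s \<le> real n + 1" using q_mult[OF s0] s by auto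
    show "(\<integral>\<omega>. (drift s \<omega>)\<^sup>2 \<partial>M) \<le> Q" "(\<integral>\<omega>. (diffusion s \<omega>)\<^sup>2 \<partial>M) \<le> Q"
      using lin_bound[OF s0 mb[OF s0 s(2)] mb[OF qs], of a b] lin_bound[OF s0 mb[OF s0 s(2)] mb[OF qs], of \<sigma> \<rho>]
        mult_right_mono[OF La KE] mult_right_mono[OF Ls KE]
      unfolding drift_def diffusion_def Q_def by linarith+
  qed
  have Xn: "X (real n) \<in> L2 M" by (rule L2F_L2[OF X_L2F[OF n01(2)]])
  define A1 where "A1 = {\<omega>\<in>space M. c \<le> \<bar>X (real n) \<omega>\<bar>}"
  have A1: "A1 \<in> events" "prob A1 \<le> K * E / c\<^sup>2"
  proof -
    show "A1 \<in> events" unfolding A1_def by (rule L2_Markov(1)[OF Xn c])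
    have "prob A1 \<le> m2 (real n) / c\<^sup>2" unfolding A1_def by (rule L2_Markov(2)[OF Xn c])
    also have "\<dots> \<le> K * E / c\<^sup>2" using K[OF n01(2)] c by (intro divide_right_mono) (auto simp: E_def)
    finally show "prob A1 \<le> K * E / c\<^sup>2" .
  qed
  have dm: "(\<lambda>\<omega>. \<bar>drift s \<omega>\<bar>) \<in> L2 M" if "real n \<le> s" "s \<le> real n + 1" for s
    using that by (intro L2_abs L2F_L2[OF drift_L2F]) simp
  \<comment> \<open>The integral of the modulus, rather than of the drift, dominates the partial
    integrals up to every time of the block at once.\<close>
  have "\<exists>D\<in>borel_measurable M. \<forall>\<omega>. continuous_on {real n..real n + 1} (\<lambda>s. \<bar>drift s \<omega>\<bar>) \<longrightarrow>
      D \<omega> = integral {real n..real n + 1} (\<lambda>s. \<bar>drift s \<omega>\<bar>)"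
    by (rule measurable_integral_version[OF n01(1)]) (rule L2_measurable[OF dm])
  then obtain D where D: "D \<in> borel_measurable M"
    "\<And>\<omega>. continuous_on {real n..real n + 1} (\<lambda>s. \<bar>drift s \<omega>\<bar>) \<Longrightarrow> D \<omega> = integral {real n..real n + 1} (\<lambda>s. \<bar>drift s \<omega>\<bar>)"
    by blast
  have Dae: "AE \<omega> in M. continuous_on {real n..real n + 1} (\<lambda>s. \<bar>drift s \<omega>\<bar>) \<and>
      D \<omega> = integral {real n..real n + 1} (\<lambda>s. \<bar>drift s \<omega>\<bar>)"
    using drift_continuous
  proof eventually_elim
    case (elim \<omega>)
    have "continuous_on {real n..real n + 1} (\<lambda>s. \<bar>drift s \<omega>\<bar>)"
      by (intro continuous_on_rabs continuous_on_subset[OF elim]) auto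
    then show ?case using D(2) by blast
  qed
  have dbd: "(\<integral>\<omega>. \<bar>drift s \<omega>\<bar>\<^sup>2 \<partial>M) \<le> Q" if "real n \<le> s" "s \<le> real n + 1" for s
    using bd(1)[OF that] by simp
  have DL: "D \<in> L2 M" by (rule L2_integral_bound(1)[OF n01(1) dm dbd D(1) Dae])
  have DQ: "(\<integral>\<omega>. (D \<omega>)\<^sup>2 \<partial>M) \<le> Q * (real n + 1 - real n)\<^sup>2"
    by (rule L2_integral_bound(2)[OF n01(1) dm dbd D(1) Dae])
  define A2 where "A2 = {\<omega>\<in>space M. c \<le> \<bar>D \<omega>\<bar>}"
  have A2: "A2 \<in> events" "prob A2 \<le> Q / c\<^sup>2"
  proof -
    show "A2 \<in> events" unfolding A2_def by (rule L2_Markov(1)[OF DL c])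
    have "prob A2 \<le> (\<integral>\<omega>. (D \<omega>)\<^sup>2 \<partial>M) / c\<^sup>2" unfolding A2_def by (rule L2_Markov(2)[OF DL c])
    also have "\<dots> \<le> Q / c\<^sup>2" using DQ c by (intro divide_right_mono) auto
    finally show "prob A2 \<le> Q / c\<^sup>2" .
  qed
  have "\<exists>A\<in>events. prob A \<le> (\<integral>\<omega>. (I (real n + 1) \<omega> - I (real n) \<omega>)\<^sup>2 \<partial>M) / c\<^sup>2 \<and>
    (\<forall>\<omega>\<in>space M - A. continuous_on {real n..real n + 1} (\<lambda>t. I t \<omega> - I (real n) \<omega>) \<longrightarrow>
      (\<forall>t\<in>{real n..real n + 1}. \<bar>I t \<omega> - I (real n) \<omega>\<bar> \<le> c))"
  proof (rule continuous_maximal_inequality[OF n01(1) _ _ c])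
    fix s assume s: "real n \<le> s" "s \<le> real n + 1"
    show "(\<lambda>\<omega>. I s \<omega> - I (real n) \<omega>) \<in> L2F s"
      by (rule I_increment_L2(1)[OF n01(2) s(1)], rule bd(2)) (use s in auto)
    fix \<eta> assume \<eta>: "\<eta> \<in> L2F s"
    have "(\<integral>\<omega>. \<eta> \<omega> * (I (real n + 1) \<omega> - I s \<omega>) \<partial>M) = 0"
      by (rule I_increment_L2(3)[OF _ s(2) _ \<eta>], use s in simp, rule bd(2)) (use s in auto)
    then show "(\<integral>\<omega>. \<eta> \<omega> * (I (real n + 1) \<omega> - I (real n) \<omega> - (I s \<omega> - I (real n) \<omega>)) \<partial>M) = 0" by simp
  qed
  then obtain A3 where A3: "A3 \<in> events" "prob A3 \<le> (\<integral>\<omega>. (I (real n + 1) \<omega> - I (real n) \<omega>)\<^sup>2 \<partial>M) / c\<^sup>2"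
    "\<And>\<omega>. \<omega> \<in> space M - A3 \<Longrightarrow> continuous_on {real n..real n + 1} (\<lambda>t. I t \<omega> - I (real n) \<omega>) \<Longrightarrow>
      \<forall>t\<in>{real n..real n + 1}. \<bar>I t \<omega> - I (real n) \<omega>\<bar> \<le> c" by blast
  have I2: "(\<integral>\<omega>. (I (real n + 1) \<omega> - I (real n) \<omega>)\<^sup>2 \<partial>M) \<le> Q * (real n + 1 - real n)"
    by (rule I_increment_L2(2)[OF n01(2,1)]) (rule bd(2))
  have A3p: "prob A3 \<le> Q / c\<^sup>2"
  proof -
    have "(\<integral>\<omega>. (I (real n + 1) \<omega> - I (real n) \<omega>)\<^sup>2 \<partial>M) / c\<^sup>2 \<le> Q / c\<^sup>2"
      using I2 by (intro divide_right_mono) auto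
    then show ?thesis using A3(2) by linarith
  qed
  show ?thesis
  proof (intro bexI[of _ "A1 \<union> (A2 \<union> A3)"] conjI)
    show "A1 \<union> (A2 \<union> A3) \<in> events" using A1 A2 A3 by auto
    have "prob (A1 \<union> (A2 \<union> A3)) \<le> prob A1 + prob (A2 \<union> A3)" using A1 A2 A3 by (intro measure_Un_le) auto
    moreover have "prob (A2 \<union> A3) \<le> prob A2 + prob A3" using A2 A3 by (intro measure_Un_le) auto
    ultimately have "prob (A1 \<union> (A2 \<union> A3)) \<le> K * E / c\<^sup>2 + Q / c\<^sup>2 + Q / c\<^sup>2"
      using A1(2) A2(2) A3p by linarith
    also have "\<dots> = ((1 + 2 * L * exp \<gamma>) * K) * (E / c\<^sup>2)"
      by (simp add: Q_def algebra_simps add_divide_distrib)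
    also have "E / c\<^sup>2 = (exp (\<gamma> - 2 * r)) ^ n"
    proof -
      have "E / c\<^sup>2 = exp (\<gamma> * real n - 2 * (r * real n))"
        by (simp add: E_def c_def exp_diff exp_double[symmetric] mult.commute)
      also have "\<dots> = exp (real n * (\<gamma> - 2 * r))" by (simp add: algebra_simps)
      finally show ?thesis by (simp add: exp_of_nat_mult)
    qed
    finally show "prob (A1 \<union> (A2 \<union> A3)) \<le> ((1 + 2 * L * exp \<gamma>) * K) * (exp (\<gamma> - 2 * r)) ^ n" .
    show "AE \<omega> in M. \<omega> \<notin> A1 \<union> (A2 \<union> A3) \<longrightarrow> (\<forall>t\<in>{real n..real n + 1}. \<bar>X t \<omega>\<bar> \<le> 3 * exp (r * real n))"
      using Dae I_continuous X_equation drift_continuous AE_space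
    proof (eventually_elim, intro impI ballI)
      fix \<omega> t
      assume D1: "continuous_on {real n..real n + 1} (\<lambda>s. \<bar>drift s \<omega>\<bar>) \<and> D \<omega> = integral {real n..real n + 1} (\<lambda>s. \<bar>drift s \<omega>\<bar>)"
        and Ic: "continuous_on {0..} (\<lambda>t. I t \<omega>)"
        and eq: "\<forall>t\<ge>0. X t \<omega> = X0 \<omega> + integral {0..t} (\<lambda>s. a * X s \<omega> + b * X (q * s) \<omega>) + I t \<omega>"
        and dc: "continuous_on {0..} (\<lambda>t. drift t \<omega>)" and sp: "\<omega> \<in> space M"
        and nA: "\<omega> \<notin> A1 \<union> (A2 \<union> A3)" and t: "t \<in> {real n..real n + 1}"
      have b1: "\<bar>X (real n) \<omega>\<bar> \<le> c" using nA sp by (auto simp: A1_def)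
      have b2: "\<bar>D \<omega>\<bar> \<le> c" using nA sp by (auto simp: A2_def)
      have "continuous_on {real n..real n + 1} (\<lambda>t. I t \<omega> - I (real n) \<omega>)"
        by (intro continuous_on_diff continuous_on_const continuous_on_subset[OF Ic]) auto
      then have b3: "\<bar>I t \<omega> - I (real n) \<omega>\<bar> \<le> c" using A3(3)[of \<omega>] nA sp t by blast
      have ci: "(\<lambda>s. drift s \<omega>) integrable_on {u..v}" if "0 \<le> u" for u v
        by (intro integrable_continuous_interval continuous_on_subset[OF dc]) (use that in auto)
      have ai: "(\<lambda>s. \<bar>drift s \<omega>\<bar>) integrable_on {u..v}" if "0 \<le> u" for u v
        by (intro integrable_continuous_interval continuous_on_rabs continuous_on_subset[OF dc]) (use that in auto)
      have "integral {0..real n} (\<lambda>s. drift s \<omega>) + integral {real n..t} (\<lambda>s. drift s \<omega>) = integral {0..t} (\<lambda>s. drift s \<omega>)"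
        using t by (intro Henstock_Kurzweil_Integration.integral_combine ci) auto
      then have Xt: "X t \<omega> = X (real n) \<omega> + integral {real n..t} (\<lambda>s. drift s \<omega>) + (I t \<omega> - I (real n) \<omega>)"
        using eq[rule_format, of t] eq[rule_format, of "real n"] t by (simp add: drift_def)
      have "\<bar>integral {real n..t} (\<lambda>s. drift s \<omega>)\<bar> \<le> integral {real n..t} (\<lambda>s. \<bar>drift s \<omega>\<bar>)"
        using integral_norm_bound_integral[of "\<lambda>s. drift s \<omega>" "{real n..t}" "\<lambda>s. \<bar>drift s \<omega>\<bar>"] ci[of "real n" t] ai[of "real n" t] by simp
      also have "\<dots> \<le> integral {real n..real n + 1} (\<lambda>s. \<bar>drift s \<omega>\<bar>)"
        using t by (intro integral_subset_le ai) auto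
      also have "\<dots> \<le> c" using b2 D1 by simp
      finally have "\<bar>X t \<omega>\<bar> \<le> 3 * c" unfolding Xt using b1 b3 by linarith
      then show "\<bar>X t \<omega>\<bar> \<le> 3 * exp (r * real n)" by (simp add: c_def)
    qed
  qed
qed

text \<open>For \<open>r\<close> above \<open>\<gamma> / 2\<close> the ratio
  \<open>exp (\<gamma> - 2 * r)\<close> is below 1; the halved exponent is the square root between
  second moment and modulus. Countably many \<open>r\<close> decreasing to
  \<open>\<gamma> / 2\<close> are treated on one null set.\<close>

lemma almost_sure_growth_of_second_moment:
  assumes lam: "0 < \<gamma>" and K: "\<And>t. 0 \<le> t \<Longrightarrow> m2 t \<le> K * exp (\<gamma> * t)"
  shows "AE \<omega> in M. Limsup at_top (\<lambda>t. ereal (1 / t) * elog \<bar>X t \<omega>\<bar>) \<le> ereal (\<gamma> / 2)"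
proof -
  define L where "L = 2 * (a\<^sup>2 + b\<^sup>2) + 2 * (\<sigma>\<^sup>2 + \<rho>\<^sup>2)"
  have "AE \<omega> in M. \<forall>k. eventually (\<lambda>n. \<forall>t\<in>{real n..real n + 1}. \<bar>X t \<omega>\<bar> \<le> 3 * exp ((\<gamma> / 2 + 1 / real (Suc k)) * real n)) sequentially"
    unfolding AE_all_countable
  proof
    fix k
    let ?r = "\<gamma> / 2 + 1 / real (Suc k)"
    have r: "0 < ?r" using lam by (simp add: add_pos_pos)
    show "AE \<omega> in M. eventually (\<lambda>n. \<forall>t\<in>{real n..real n + 1}. \<bar>X t \<omega>\<bar> \<le> 3 * exp (?r * real n)) sequentially"
      by (rule geometric_events_eventually[where x="exp (\<gamma> - 2 * ?r)" and C="(1 + 2 * L * exp \<gamma>) * K"])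
        (simp, simp, rule block_bound[OF lam K L_def r])
  qed
  then show ?thesis
  proof eventually_elim
    case (elim \<omega>)
    show ?case
    proof (rule Limsup_log_le)
      fix k
      let ?r = "\<gamma> / 2 + 1 / real (Suc k)"
      have r: "0 < ?r" using lam by (simp add: add_pos_pos)
      obtain N where N: "\<And>n t. N \<le> n \<Longrightarrow> t \<in> {real n..real n + 1} \<Longrightarrow> \<bar>X t \<omega>\<bar> \<le> 3 * exp (?r * real n)"
        using elim[rule_format, of k] unfolding eventually_sequentially by blast
      show "\<exists>K T. 0 < K \<and> (\<forall>t\<ge>T. \<bar>X t \<omega>\<bar> \<le> K * exp (?r * t))"
      proof (rule exI[of _ 3], rule exI[of _ "real N"], intro conjI allI impI)
        fix t assume t: "real N \<le> t"
        define n where "n = nat \<lfloor>t\<rfloor>"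
        have n: "real n \<le> t" "t \<le> real n + 1" using t by (auto simp: n_def)
        have "N \<le> n" using t by (simp add: n_def le_nat_floor)
        then have "\<bar>X t \<omega>\<bar> \<le> 3 * exp (?r * real n)" using n by (intro N) auto
        also have "\<dots> \<le> 3 * exp (?r * t)"
        proof -
          have "?r * real n \<le> ?r * t" using n r by (intro mult_left_mono) auto
          then show ?thesis by simp
        qed
        finally show "\<bar>X t \<omega>\<bar> \<le> 3 * exp (?r * t)" .
      qed simp
    qed
  qed
qed

end

section \<open>Variation of constants\<close>

lemma exp_second_order:
  fixes x :: real
  shows "\<bar>exp x - 1 - x\<bar> \<le> x\<^sup>2 * exp \<bar>x\<bar>"
proof -
  obtain t where t: "\<bar>t\<bar> \<le> \<bar>x\<bar>" "exp x = (\<Sum>m<2. x ^ m / fact m) + exp t / fact 2 * x ^ 2"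
    using Maclaurin_exp_le[of x 2] by blast
  have "exp x - 1 - x = x\<^sup>2 * (exp t / 2)" using t(2) by (simp add: numeral_2_eq_2)
  then have "\<bar>exp x - 1 - x\<bar> = x\<^sup>2 * (exp t / 2)" by (simp only: abs_mult) simp
  also have "\<dots> \<le> x\<^sup>2 * exp \<bar>x\<bar>"
  proof (rule mult_left_mono)
    have "exp t \<le> exp \<bar>x\<bar>" using t(1) by simp
    then show "exp t / 2 \<le> exp \<bar>x\<bar>" using exp_gt_zero[of t] by linarith
  qed simp
  finally show ?thesis .
qed

lemma exp_second_order_scaled:
  fixes k h :: real
  assumes "0 \<le> h" "h \<le> 1"
  shows "\<bar>exp (k * h) - 1 - k * h\<bar> \<le> k\<^sup>2 * exp \<bar>k\<bar> * h\<^sup>2"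
proof -
  have "\<bar>k * h\<bar> \<le> \<bar>k\<bar>" using assms by (simp add: abs_mult mult_left_le)
  then have "(k * h)\<^sup>2 * exp \<bar>k * h\<bar> \<le> (k * h)\<^sup>2 * exp \<bar>k\<bar>" by (intro mult_left_mono) auto
  then show ?thesis using exp_second_order[of "k * h"] by (simp add: power_mult_distrib mult_ac)
qed

lemma neg_mult_le_abs: "0 \<le> c \<Longrightarrow> - (c * x) \<le> c * \<bar>x :: real\<bar>"
  using mult_left_mono[OF abs_ge_minus_self[of x], of c] by (simp only: mult_minus_right)

lemma small_powers:
  fixes h :: real assumes "0 \<le> h" "h \<le> 1" shows "h\<^sup>2 \<le> h" "h * h\<^sup>2 \<le> h\<^sup>2"
  using mult_left_mono[OF assms(2,1)] mult_right_mono[OF assms(2), of "h\<^sup>2"] by (auto simp: power2_eq_square)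

section \<open>Geometric Brownian motion and its one-step expansion\<close>

context brownian_filtration
begin

text \<open>The solution with value 1 at time \<open>s\<close> of the linear equation with drift
  \<open>\<alpha>\<close> and noise \<open>\<sigma>\<close>. The formula is used for
  \<open>t < s\<close> as well, where it gives the reciprocal of the forward value.\<close>

definition gbm :: "real \<Rightarrow> real \<Rightarrow> real \<Rightarrow> real \<Rightarrow> 'a \<Rightarrow> real" where
  "gbm \<alpha> \<sigma> s t \<omega> = exp ((\<alpha> - \<sigma>\<^sup>2 / 2) * (t - s) + \<sigma> * dB s t \<omega>)"

lemma gbm_pos: "0 < gbm \<alpha> \<sigma> s t \<omega>"
  by (simp add: gbm_def)

lemma gbm_mult: "gbm \<alpha> \<sigma> r s \<omega> * gbm \<alpha> \<sigma> s t \<omega> = gbm \<alpha> \<sigma> r t \<omega>"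
  unfolding gbm_def exp_add[symmetric] by (simp add: field_simps)

lemma gbm_measurable:
  assumes "0 \<le> s" "s \<le> t" shows "gbm \<alpha> \<sigma> s t \<in> borel_measurable (F t)"
  unfolding gbm_def[abs_def]
  by (intro borel_measurable_exp[THEN measurable_compose[rotated]] borel_measurable_add borel_measurable_times
      borel_measurable_const dB_measurable[OF assms])

lemma gbm_moments:
  assumes st: "0 \<le> s" "s \<le> t"
  shows "gbm \<alpha> \<sigma> s t \<in> L2 M"
    and "(\<integral>\<omega>. gbm \<alpha> \<sigma> s t \<omega> \<partial>M) = exp (\<alpha> * (t - s))"
    and "(\<integral>\<omega>. (gbm \<alpha> \<sigma> s t \<omega>)\<^sup>2 \<partial>M) = exp ((2 * \<alpha> + \<sigma>\<^sup>2) * (t - s))"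
    and "(\<integral>\<omega>. gbm \<alpha> \<sigma> s t \<omega> * dB s t \<omega> \<partial>M) = \<sigma> * (t - s) * exp (\<alpha> * (t - s))"
proof -
  let ?c = "exp ((\<alpha> - \<sigma>\<^sup>2 / 2) * (t - s))"
  have eq: "gbm \<alpha> \<sigma> s t \<omega> = ?c * exp (\<sigma> * dB s t \<omega>)" for \<omega> by (simp add: gbm_def exp_add)
  have sq: "(gbm \<alpha> \<sigma> s t \<omega>)\<^sup>2 = ?c\<^sup>2 * exp (2 * \<sigma> * dB s t \<omega>)" for \<omega>
    by (simp add: eq power_mult_distrib exp_double[symmetric] mult.assoc)
  note E = exp_dB[OF st]
  have "integrable M (\<lambda>\<omega>. (gbm \<alpha> \<sigma> s t \<omega>)\<^sup>2)"
    unfolding sq by (intro Bochner_Integration.integrable_mult_right E)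
  then show "gbm \<alpha> \<sigma> s t \<in> L2 M"
    using F_measurable_M[OF gbm_measurable[OF st]] by (simp add: L2_def)
  have "(\<integral>\<omega>. gbm \<alpha> \<sigma> s t \<omega> \<partial>M) = ?c * exp (\<sigma>\<^sup>2 * (t - s) / 2)"
    unfolding eq by (subst Bochner_Integration.integral_mult_right) (simp_all add: E)
  also have "\<dots> = exp (\<alpha> * (t - s))" unfolding exp_add[symmetric] by (simp add: algebra_simps)
  finally show "(\<integral>\<omega>. gbm \<alpha> \<sigma> s t \<omega> \<partial>M) = exp (\<alpha> * (t - s))" .
  have "(\<integral>\<omega>. (gbm \<alpha> \<sigma> s t \<omega>)\<^sup>2 \<partial>M) = ?c\<^sup>2 * exp ((2 * \<sigma>)\<^sup>2 * (t - s) / 2)"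
    unfolding sq by (subst Bochner_Integration.integral_mult_right) (simp_all add: E)
  also have "\<dots> = exp ((2 * \<alpha> + \<sigma>\<^sup>2) * (t - s))"
    unfolding exp_double[symmetric] exp_add[symmetric] by (simp add: field_simps power2_eq_square)
  finally show "(\<integral>\<omega>. (gbm \<alpha> \<sigma> s t \<omega>)\<^sup>2 \<partial>M) = exp ((2 * \<alpha> + \<sigma>\<^sup>2) * (t - s))" .
  have "gbm \<alpha> \<sigma> s t \<omega> * dB s t \<omega> = ?c * (dB s t \<omega> * exp (\<sigma> * dB s t \<omega>))" for \<omega> by (simp add: eq mult_ac)
  then have "(\<integral>\<omega>. gbm \<alpha> \<sigma> s t \<omega> * dB s t \<omega> \<partial>M) = ?c * (\<sigma> * (t - s) * exp (\<sigma>\<^sup>2 * (t - s) / 2))"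
    using E(4)[of \<sigma>] by (simp only: Bochner_Integration.integral_mult_right_zero)
  also have "\<dots> = \<sigma> * (t - s) * (?c * exp (\<sigma>\<^sup>2 * (t - s) / 2))" by simp
  also have "?c * exp (\<sigma>\<^sup>2 * (t - s) / 2) = exp (\<alpha> * (t - s))" unfolding exp_add[symmetric] by (simp add: algebra_simps)
  finally show "(\<integral>\<omega>. gbm \<alpha> \<sigma> s t \<omega> * dB s t \<omega> \<partial>M) = \<sigma> * (t - s) * exp (\<alpha> * (t - s))" .
qed

lemma gbm_mult_L2F:
  assumes st: "0 \<le> s" "s \<le> t" and \<xi>: "\<xi> \<in> L2F s"
  shows "(\<lambda>\<omega>. \<xi> \<omega> * gbm \<alpha> \<sigma> s t \<omega>) \<in> L2F t"
    and "(\<integral>\<omega>. (\<xi> \<omega> * gbm \<alpha> \<sigma> s t \<omega>)\<^sup>2 \<partial>M) = (\<integral>\<omega>. (\<xi> \<omega>)\<^sup>2 \<partial>M) * exp ((2 * \<alpha> + \<sigma>\<^sup>2) * (t - s))"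
proof -
  let ?g = "\<lambda>x. exp ((\<alpha> - \<sigma>\<^sup>2 / 2) * (t - s) + \<sigma> * x)"
  have g: "?g \<in> borel_measurable borel" by simp
  have gL: "(\<lambda>\<omega>. ?g (dB s t \<omega>)) \<in> L2 M"
    using gbm_moments(1)[OF st, of \<alpha> \<sigma>] by (simp add: gbm_def[abs_def])
  note P = increment_L2[OF st \<xi> g gL]
  show "(\<lambda>\<omega>. \<xi> \<omega> * gbm \<alpha> \<sigma> s t \<omega>) \<in> L2F t"
  proof (rule L2F_intro)
    show "(\<lambda>\<omega>. \<xi> \<omega> * gbm \<alpha> \<sigma> s t \<omega>) \<in> L2 M" using P(1) by (simp add: gbm_def)
    show "(\<lambda>\<omega>. \<xi> \<omega> * gbm \<alpha> \<sigma> s t \<omega>) \<in> borel_measurable (F t)"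
      by (intro borel_measurable_times gbm_measurable st L2F_measurable[OF L2F_mono[OF \<xi> st(2)]])
  qed
  show "(\<integral>\<omega>. (\<xi> \<omega> * gbm \<alpha> \<sigma> s t \<omega>)\<^sup>2 \<partial>M) = (\<integral>\<omega>. (\<xi> \<omega>)\<^sup>2 \<partial>M) * exp ((2 * \<alpha> + \<sigma>\<^sup>2) * (t - s))"
    using P(2) gbm_moments(3)[OF st, of \<alpha> \<sigma>] by (simp add: gbm_def)
qed

lemma gbm_mult_expectation:
  assumes st: "0 \<le> s" "s \<le> t" and \<xi>: "\<xi> \<in> borel_measurable (F s)" "integrable M \<xi>"
  shows "integrable M (\<lambda>\<omega>. \<xi> \<omega> * gbm \<alpha> \<sigma> s t \<omega>)"
    and "(\<integral>\<omega>. \<xi> \<omega> * gbm \<alpha> \<sigma> s t \<omega> \<partial>M) = (\<integral>\<omega>. \<xi> \<omega> \<partial>M) * exp (\<alpha> * (t - s))"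
proof -
  let ?g = "\<lambda>x. exp ((\<alpha> - \<sigma>\<^sup>2 / 2) * (t - s) + \<sigma> * x)"
  have g: "?g \<in> borel_measurable borel" by simp
  have gi: "integrable M (\<lambda>\<omega>. ?g (dB s t \<omega>))"
    using L2_integrable[OF gbm_moments(1)[OF st, of \<alpha> \<sigma>]] by (simp add: gbm_def[abs_def])
  note P = increment_product[OF st \<xi> g gi]
  show "integrable M (\<lambda>\<omega>. \<xi> \<omega> * gbm \<alpha> \<sigma> s t \<omega>)" using P(1) by (simp add: gbm_def)
  show "(\<integral>\<omega>. \<xi> \<omega> * gbm \<alpha> \<sigma> s t \<omega> \<partial>M) = (\<integral>\<omega>. \<xi> \<omega> \<partial>M) * exp (\<alpha> * (t - s))"
    using P(2) gbm_moments(2)[OF st, of \<alpha> \<sigma>] by (simp add: gbm_def)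
qed

text \<open>All moments are explicit for a normal increment, so the estimates reduce to Taylor
  expansion of \<open>exp (\<alpha> * h)\<close> and \<open>exp (\<nu> * h)\<close>, with
  second-order errors \<open>R1\<close> and \<open>R2\<close>. One Euler step of the geometric
  Brownian motion has an error whose mean and second moment are both of order
  \<open>h\<^sup>2\<close>; independence carries this over to coefficients from the past. The last
  estimate exploits the small mean.\<close>

lemma gbm_expansion:
  obtains C where "0 < C"
    "\<And>s t \<xi>. 0 \<le> s \<Longrightarrow> s \<le> t \<Longrightarrow> t - s \<le> 1 \<Longrightarrow> \<xi> \<in> L2F s \<Longrightarrow>
      (\<lambda>\<omega>. \<xi> \<omega> * (gbm \<alpha> \<sigma> s t \<omega> - 1)) \<in> L2 M \<and>
      (\<integral>\<omega>. (\<xi> \<omega> * (gbm \<alpha> \<sigma> s t \<omega> - 1))\<^sup>2 \<partial>M) \<le> C * (t - s) * (\<integral>\<omega>. (\<xi> \<omega>)\<^sup>2 \<partial>M)"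
    "\<And>s t \<xi>. 0 \<le> s \<Longrightarrow> s \<le> t \<Longrightarrow> t - s \<le> 1 \<Longrightarrow> \<xi> \<in> L2F s \<Longrightarrow>
      (\<lambda>\<omega>. \<xi> \<omega> * (1 + \<alpha> * (t - s) + \<sigma> * dB s t \<omega> - gbm \<alpha> \<sigma> s t \<omega>)) \<in> L2 M \<and>
      (\<integral>\<omega>. (\<xi> \<omega> * (1 + \<alpha> * (t - s) + \<sigma> * dB s t \<omega> - gbm \<alpha> \<sigma> s t \<omega>))\<^sup>2 \<partial>M) \<le> C * (t - s)\<^sup>2 * (\<integral>\<omega>. (\<xi> \<omega>)\<^sup>2 \<partial>M)"
    "\<And>s t \<xi> \<eta>. 0 \<le> s \<Longrightarrow> s \<le> t \<Longrightarrow> t - s \<le> 1 \<Longrightarrow> \<xi> \<in> L2F s \<Longrightarrow> \<eta> \<in> L2F s \<Longrightarrow>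
      2 * \<bar>\<integral>\<omega>. \<eta> \<omega> * (\<xi> \<omega> * (1 + \<alpha> * (t - s) + \<sigma> * dB s t \<omega> - gbm \<alpha> \<sigma> s t \<omega>)) \<partial>M\<bar>
        \<le> C * (t - s)\<^sup>2 * ((\<integral>\<omega>. (\<eta> \<omega>)\<^sup>2 \<partial>M) + (\<integral>\<omega>. (\<xi> \<omega>)\<^sup>2 \<partial>M))"
proof -
  define \<nu> where "\<nu> = 2 * \<alpha> + \<sigma>\<^sup>2"
  define K1 where "K1 = \<alpha>\<^sup>2 * exp \<bar>\<alpha>\<bar>"
  define K2 where "K2 = \<nu>\<^sup>2 * exp \<bar>\<nu>\<bar>"
  have K: "0 \<le> K1" "0 \<le> K2" by (simp_all add: K1_def K2_def)
  define C where "C = \<sigma>\<^sup>2 + 2 * K1 + K2 + \<alpha>\<^sup>2 + 2 * (1 + \<bar>\<alpha>\<bar>) * K1 + 2 * \<sigma>\<^sup>2 * \<bar>\<alpha>\<bar> + 2 * \<sigma>\<^sup>2 * K1 + 1"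
  have C0: "0 < C" using K by (simp add: C_def add_nonneg_pos)
  have C1: "\<sigma>\<^sup>2 + 2 * K1 + K2 \<le> C" using K by (simp add: C_def)
  have C2: "\<alpha>\<^sup>2 + K2 + 2 * (1 + \<bar>\<alpha>\<bar>) * K1 + 2 * \<sigma>\<^sup>2 * \<bar>\<alpha>\<bar> + 2 * \<sigma>\<^sup>2 * K1 \<le> C" using K by (simp add: C_def)
  have C3: "K1 \<le> C" using K by (simp add: C_def)
  have est: "(\<integral>\<omega>. (gbm \<alpha> \<sigma> s t \<omega> - 1)\<^sup>2 \<partial>M) \<le> C * (t - s)"
    "(\<integral>\<omega>. (1 + \<alpha> * (t - s) + \<sigma> * dB s t \<omega> - gbm \<alpha> \<sigma> s t \<omega>)\<^sup>2 \<partial>M) \<le> C * (t - s)\<^sup>2"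
    "\<bar>\<integral>\<omega>. 1 + \<alpha> * (t - s) + \<sigma> * dB s t \<omega> - gbm \<alpha> \<sigma> s t \<omega> \<partial>M\<bar> \<le> C * (t - s)\<^sup>2"
    if st: "0 \<le> s" "s \<le> t" "t - s \<le> 1" for s t
  proof -
    define h where "h = t - s"
    have h: "0 \<le> h" "h \<le> 1" using st by (auto simp: h_def)
    define R1 where "R1 = exp (\<alpha> * h) - 1 - \<alpha> * h"
    define R2 where "R2 = exp (\<nu> * h) - 1 - \<nu> * h"
    have R: "\<bar>R1\<bar> \<le> K1 * h\<^sup>2" "\<bar>R2\<bar> \<le> K2 * h\<^sup>2"
      using exp_second_order_scaled[OF h] by (auto simp: R1_def R2_def K1_def K2_def)
    note m = gbm_moments[OF st(1,2), of \<alpha> \<sigma>, folded h_def \<nu>_def] and d = dB_L2[OF st(1,2), folded h_def]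
    let ?P = "gbm \<alpha> \<sigma> s t" and ?b = "dB s t"
    have i: "integrable M ?P" "integrable M (\<lambda>\<omega>. (?P \<omega>)\<^sup>2)" "integrable M (\<lambda>\<omega>. dB s t \<omega>)" "integrable M (\<lambda>\<omega>. (dB s t \<omega>)\<^sup>2)"
      "integrable M (\<lambda>\<omega>. ?P \<omega> * dB s t \<omega>)"
      using L2_integrable[OF m(1)] L2_integrable_square[OF m(1)] L2_integrable[OF d(1)] L2_integrable_square[OF d(1)]
        L2_mult_integrable[OF m(1) d(1)] by auto
    have "(?P \<omega> - 1)\<^sup>2 = (?P \<omega>)\<^sup>2 - 2 * ?P \<omega> + 1" for \<omega> by (simp add: power2_diff)
    then have "(\<integral>\<omega>. (?P \<omega> - 1)\<^sup>2 \<partial>M) = exp (\<nu> * h) - 2 * exp (\<alpha> * h) + 1"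
      using i m by (simp add: prob_space)
    also have "\<dots> = \<sigma>\<^sup>2 * h + R2 - 2 * R1" by (simp add: R1_def R2_def \<nu>_def algebra_simps)
    also have "\<dots> \<le> \<sigma>\<^sup>2 * h + K2 * h\<^sup>2 + 2 * (K1 * h\<^sup>2)" using R by linarith
    also have "\<dots> \<le> \<sigma>\<^sup>2 * h + K2 * h + 2 * (K1 * h)"
      using small_powers(1)[OF h] K by (intro add_mono mult_left_mono order_refl) auto
    also have "\<dots> = (\<sigma>\<^sup>2 + 2 * K1 + K2) * h" by (simp add: algebra_simps)
    also have "\<dots> \<le> C * h" using C1 h by (intro mult_right_mono) auto
    finally show "(\<integral>\<omega>. (?P \<omega> - 1)\<^sup>2 \<partial>M) \<le> C * (t - s)" by (simp add: h_def)
    have "(\<integral>\<omega>. 1 + \<alpha> * h + \<sigma> * dB s t \<omega> - ?P \<omega> \<partial>M) = - R1"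
      using i m d by (simp add: prob_space R1_def)
    then have "\<bar>\<integral>\<omega>. 1 + \<alpha> * h + \<sigma> * dB s t \<omega> - ?P \<omega> \<partial>M\<bar> \<le> K1 * h\<^sup>2" using R by simp
    also have "\<dots> \<le> C * h\<^sup>2" using C3 by (intro mult_right_mono) auto
    finally show "\<bar>\<integral>\<omega>. 1 + \<alpha> * (t - s) + \<sigma> * dB s t \<omega> - ?P \<omega> \<partial>M\<bar> \<le> C * (t - s)\<^sup>2" by (simp only: h_def)
    have "(1 + \<alpha> * h + \<sigma> * dB s t \<omega> - ?P \<omega>)\<^sup>2 = (1 + \<alpha> * h)\<^sup>2 + \<sigma>\<^sup>2 * (dB s t \<omega>)\<^sup>2 + (?P \<omega>)\<^sup>2
        + 2 * (1 + \<alpha> * h) * \<sigma> * dB s t \<omega> - 2 * (1 + \<alpha> * h) * ?P \<omega> - 2 * \<sigma> * (?P \<omega> * dB s t \<omega>)" for \<omega>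
      by (simp add: power2_eq_square algebra_simps)
    then have "(\<integral>\<omega>. (1 + \<alpha> * h + \<sigma> * dB s t \<omega> - ?P \<omega>)\<^sup>2 \<partial>M) = (1 + \<alpha> * h)\<^sup>2 + \<sigma>\<^sup>2 * h + exp (\<nu> * h)
        - 2 * (1 + \<alpha> * h) * exp (\<alpha> * h) - 2 * \<sigma> * (\<sigma> * h * exp (\<alpha> * h))"
      using i m d by (simp add: prob_space)
    \<comment> \<open>The terms of order 0 and 1 in h cancel.\<close>
    also have "\<dots> = - (\<alpha>\<^sup>2 * h\<^sup>2) + R2 - 2 * ((1 + \<alpha> * h) * R1) - 2 * \<sigma>\<^sup>2 * \<alpha> * h\<^sup>2 - 2 * \<sigma>\<^sup>2 * (h * R1)"
      by (simp add: R1_def R2_def \<nu>_def power2_eq_square algebra_simps)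
    also have "\<dots> \<le> \<alpha>\<^sup>2 * h\<^sup>2 + K2 * h\<^sup>2 + 2 * ((1 + \<bar>\<alpha>\<bar>) * (K1 * h\<^sup>2)) + 2 * \<sigma>\<^sup>2 * \<bar>\<alpha>\<bar> * h\<^sup>2 + 2 * \<sigma>\<^sup>2 * (K1 * h\<^sup>2)"
    proof -
      have "\<bar>(1 + \<alpha> * h) * R1\<bar> \<le> (1 + \<bar>\<alpha>\<bar>) * (K1 * h\<^sup>2)"
        unfolding abs_mult
      proof (rule mult_mono)
        have "\<bar>\<alpha> * h\<bar> \<le> \<bar>\<alpha>\<bar>" using h by (simp add: abs_mult mult_left_le)
        then show "\<bar>1 + \<alpha> * h\<bar> \<le> 1 + \<bar>\<alpha>\<bar>" by linarith
      qed (use R in auto)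
      moreover have "\<bar>h * R1\<bar> \<le> 1 * (K1 * h\<^sup>2)"
        unfolding abs_mult using h R by (intro mult_mono) auto
      then have "2 * \<sigma>\<^sup>2 * \<bar>h * R1\<bar> \<le> 2 * \<sigma>\<^sup>2 * (K1 * h\<^sup>2)" by (intro mult_left_mono) auto
      moreover have "- (2 * \<sigma>\<^sup>2 * (h * R1)) \<le> 2 * \<sigma>\<^sup>2 * \<bar>h * R1\<bar>"
        by (rule neg_mult_le_abs) simp
      moreover have "- (2 * \<sigma>\<^sup>2 * \<alpha> * h\<^sup>2) \<le> 2 * \<sigma>\<^sup>2 * \<bar>\<alpha>\<bar> * h\<^sup>2"
        using neg_mult_le_abs[of "2 * \<sigma>\<^sup>2 * h\<^sup>2" \<alpha>] by (simp only: mult_ac) simp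
      moreover have "0 \<le> \<alpha>\<^sup>2 * h\<^sup>2" by simp
      ultimately show ?thesis using R by linarith
    qed
    also have "\<dots> = (\<alpha>\<^sup>2 + K2 + 2 * (1 + \<bar>\<alpha>\<bar>) * K1 + 2 * \<sigma>\<^sup>2 * \<bar>\<alpha>\<bar> + 2 * \<sigma>\<^sup>2 * K1) * h\<^sup>2"
      by (simp add: algebra_simps)
    also have "\<dots> \<le> C * h\<^sup>2" using C2 by (intro mult_right_mono) auto
    finally show "(\<integral>\<omega>. (1 + \<alpha> * (t - s) + \<sigma> * dB s t \<omega> - ?P \<omega>)\<^sup>2 \<partial>M) \<le> C * (t - s)\<^sup>2" by (simp only: h_def)
  qed
  show ?thesis
  proof (rule that[OF C0])
    fix s t and \<xi> :: "'a \<Rightarrow> real" assume st: "0 \<le> s" "s \<le> t" "t - s \<le> 1" and \<xi>: "\<xi> \<in> L2F s"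
    have E\<xi>: "0 \<le> (\<integral>\<omega>. (\<xi> \<omega>)\<^sup>2 \<partial>M)" by simp
    let ?g1 = "\<lambda>x. exp ((\<alpha> - \<sigma>\<^sup>2 / 2) * (t - s) + \<sigma> * x) - 1"
    let ?g2 = "\<lambda>x. 1 + \<alpha> * (t - s) + \<sigma> * x - exp ((\<alpha> - \<sigma>\<^sup>2 / 2) * (t - s) + \<sigma> * x)"
    have g: "?g1 \<in> borel_measurable borel" "?g2 \<in> borel_measurable borel" by simp_all
    note PL = gbm_moments(1)[OF st(1,2), of \<alpha> \<sigma>] and dL = dB_L2(1)[OF st(1,2)]
    have L1: "(\<lambda>\<omega>. ?g1 (dB s t \<omega>)) \<in> L2 M"
      using L2_diff[OF PL L2_const[of 1]] by (simp add: gbm_def)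
    have L2': "(\<lambda>\<omega>. ?g2 (dB s t \<omega>)) \<in> L2 M"
      using L2_diff[OF L2_add[OF L2_const[of "1 + \<alpha> * (t - s)"] L2_cmult[OF dL, of \<sigma>]] PL] by (simp add: gbm_def)
    have eq: "gbm \<alpha> \<sigma> s t \<omega> - 1 = ?g1 (dB s t \<omega>)"
      "1 + \<alpha> * (t - s) + \<sigma> * dB s t \<omega> - gbm \<alpha> \<sigma> s t \<omega> = ?g2 (dB s t \<omega>)" for \<omega>
      by (simp_all add: gbm_def)
    note I1 = increment_L2[OF st(1,2) \<xi> g(1) L1] and I2 = increment_L2[OF st(1,2) \<xi> g(2) L2']
    show "(\<lambda>\<omega>. \<xi> \<omega> * (gbm \<alpha> \<sigma> s t \<omega> - 1)) \<in> L2 M \<and>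
      (\<integral>\<omega>. (\<xi> \<omega> * (gbm \<alpha> \<sigma> s t \<omega> - 1))\<^sup>2 \<partial>M) \<le> C * (t - s) * (\<integral>\<omega>. (\<xi> \<omega>)\<^sup>2 \<partial>M)"
      unfolding eq(1) I1(2) using I1(1) mult_left_mono[OF est(1)[OF st, unfolded eq(1)] E\<xi>]
      by (simp only: mult.commute simp_thms)
    show "(\<lambda>\<omega>. \<xi> \<omega> * (1 + \<alpha> * (t - s) + \<sigma> * dB s t \<omega> - gbm \<alpha> \<sigma> s t \<omega>)) \<in> L2 M \<and>
      (\<integral>\<omega>. (\<xi> \<omega> * (1 + \<alpha> * (t - s) + \<sigma> * dB s t \<omega> - gbm \<alpha> \<sigma> s t \<omega>))\<^sup>2 \<partial>M) \<le> C * (t - s)\<^sup>2 * (\<integral>\<omega>. (\<xi> \<omega>)\<^sup>2 \<partial>M)"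
      unfolding eq(2) I2(2) using I2(1) mult_left_mono[OF est(2)[OF st, unfolded eq(2)] E\<xi>]
      by (simp only: mult.commute simp_thms)
    fix \<eta> :: "'a \<Rightarrow> real" assume \<eta>: "\<eta> \<in> L2F s"
    note int = L2_mult_integrable[OF L2F_L2[OF \<eta>] L2F_L2[OF \<xi>]]
    have "(\<integral>\<omega>. (\<eta> \<omega> * \<xi> \<omega>) * ?g2 (dB s t \<omega>) \<partial>M) = (\<integral>\<omega>. \<eta> \<omega> * \<xi> \<omega> \<partial>M) * (\<integral>\<omega>. ?g2 (dB s t \<omega>) \<partial>M)"
      by (rule increment_product(2)[OF st(1,2) _ int g(2) L2_integrable[OF L2']])
        (rule borel_measurable_times[OF L2F_measurable[OF \<eta>] L2F_measurable[OF \<xi>]])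
    then have "2 * \<bar>\<integral>\<omega>. \<eta> \<omega> * (\<xi> \<omega> * ?g2 (dB s t \<omega>)) \<partial>M\<bar>
        = (2 * \<bar>\<integral>\<omega>. \<eta> \<omega> * \<xi> \<omega> \<partial>M\<bar>) * \<bar>\<integral>\<omega>. ?g2 (dB s t \<omega>) \<partial>M\<bar>" by (simp add: mult.assoc abs_mult)
    also have "\<dots> \<le> ((\<integral>\<omega>. (\<eta> \<omega>)\<^sup>2 \<partial>M) + (\<integral>\<omega>. (\<xi> \<omega>)\<^sup>2 \<partial>M)) * (C * (t - s)\<^sup>2)"
    proof (rule mult_mono)
      show "2 * \<bar>\<integral>\<omega>. \<eta> \<omega> * \<xi> \<omega> \<partial>M\<bar> \<le> (\<integral>\<omega>. (\<eta> \<omega>)\<^sup>2 \<partial>M) + (\<integral>\<omega>. (\<xi> \<omega>)\<^sup>2 \<partial>M)"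
        using L2_abs_product_bound[OF L2F_L2[OF \<eta>] L2F_L2[OF \<xi>], of 1] by simp
      show "\<bar>\<integral>\<omega>. ?g2 (dB s t \<omega>) \<partial>M\<bar> \<le> C * (t - s)\<^sup>2" by (rule est(3)[OF st, unfolded eq(2)])
    qed (use E\<xi> in auto)
    finally show "2 * \<bar>\<integral>\<omega>. \<eta> \<omega> * (\<xi> \<omega> * (1 + \<alpha> * (t - s) + \<sigma> * dB s t \<omega> - gbm \<alpha> \<sigma> s t \<omega>)) \<partial>M\<bar>
        \<le> C * (t - s)\<^sup>2 * ((\<integral>\<omega>. (\<eta> \<omega>)\<^sup>2 \<partial>M) + (\<integral>\<omega>. (\<xi> \<omega>)\<^sup>2 \<partial>M))"
      unfolding eq(2) by (simp only: mult.commute)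
  qed
qed

end

lemma sum_cross_terms_le:
  fixes x1 x2 x3 x4 :: real
  assumes "d = p + 2 * (x1 + (x2 + x3) + x4) + r"
    and "2 * \<bar>x1\<bar> \<le> c1" "2 * \<bar>x2\<bar> \<le> c2" "2 * \<bar>x3\<bar> \<le> c3" "2 * \<bar>x4\<bar> \<le> c4"
  shows "d \<le> p + (c1 + c2 + c3 + c4) + r"
proof -
  have dbl: "2 * x \<le> y" if "2 * \<bar>x\<bar> \<le> y" for x y :: real
    using that by (cases "0 \<le> x") auto
  note c = dbl[OF assms(2)] dbl[OF assms(3)] dbl[OF assms(4)] dbl[OF assms(5)]
  have "2 * (x1 + (x2 + x3) + x4) = 2 * x1 + 2 * x2 + 2 * x3 + 2 * x4" by (simp add: algebra_simps)
  also have "\<dots> \<le> c1 + c2 + c3 + c4" by (intro add_mono c)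
  finally show ?thesis unfolding assms(1) by simp
qed

lemma continuous_zero_on_Rats:
  fixes f :: "real \<Rightarrow> real"
  assumes c: "continuous_on {0..T} f" and z: "\<And>p. p \<in> \<rat> \<Longrightarrow> 0 \<le> p \<Longrightarrow> f p = 0" and t: "0 \<le> t" "t < T"
  shows "f t = 0"
proof (rule ccontr)
  assume n: "f t \<noteq> 0"
  then have e: "0 < \<bar>f t\<bar>" by simp
  have "t \<in> {0..T}" using t by simp
  then obtain d where d: "0 < d" "\<forall>x\<in>{0..T}. dist x t < d \<longrightarrow> dist (f x) (f t) < \<bar>f t\<bar>"
    using c e unfolding continuous_on_iff by meson
  obtain p where p: "p \<in> \<rat>" "t < p" "p < min T (t + d)" using Rats_dense_in_real[of t "min T (t + d)"] d(1) t by auto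
  have "dist (f p) (f t) < \<bar>f t\<bar>" using d(2) p t by (simp add: dist_real_def)
  then show False using z[OF p(1)] p t by (simp add: dist_real_def)
qed

text \<open>With \<open>n\<close> equal steps of length h the errors add up to at most
  \<open>n * exp (L * T) * C * h * sqrt h\<close>, and \<open>n * h = T\<close> leaves a factor
  \<open>sqrt h\<close> that tends to 0. An error of order h per step would not vanish, which is why
  the exponent 3/2 is pursued in the expansions.\<close>

lemma vanishing_error_recursion:
  fixes d :: "real \<Rightarrow> real"
  assumes T: "0 < T" and d0: "d 0 \<le> 0" and L: "0 \<le> L" and C: "0 \<le> C"
    and step: "\<And>s t. 0 \<le> s \<Longrightarrow> s < t \<Longrightarrow> t \<le> T \<Longrightarrow> t - s \<le> 1 \<Longrightarrow>
      d t \<le> exp (L * (t - s)) * d s + C * ((t - s) * sqrt (t - s))"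
  shows "d T \<le> 0"
proof -
  have bound: "d T \<le> (exp (L * T) * C * T) * sqrt (T / real n)" if n: "T \<le> real n" "0 < n" for n :: nat
  proof -
    define h where "h = T / real n"
    have h: "0 < h" "h \<le> 1" using n T by (auto simp: h_def)
    define c where "c = C * (h * sqrt h)"
    have c: "0 \<le> c" using C h by (simp add: c_def)
    have nh: "real n * h = T" using n by (simp add: h_def)
    have "d (real i * h) \<le> real i * exp (L * (real i * h)) * c" if "i \<le> n" for i
      using that
    proof (induction i)
      case 0
      then show ?case using d0 by simp
    next
      case (Suc i)
      have le: "real (Suc i) * h \<le> real n * h" using Suc.prems h by (intro mult_right_mono) auto
      have dh: "real (Suc i) * h - real i * h = h" by (simp add: algebra_simps)
      have "d (real (Suc i) * h) \<le> exp (L * (real (Suc i) * h - real i * h)) * d (real i * h)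
          + C * ((real (Suc i) * h - real i * h) * sqrt (real (Suc i) * h - real i * h))"
        by (rule step) (use h le nh dh in auto)
      also have "\<dots> = exp (L * h) * d (real i * h) + c" by (simp only: dh c_def)
      also have "\<dots> \<le> exp (L * h) * (real i * exp (L * (real i * h)) * c) + 1 * c"
        using Suc by (intro add_mono mult_left_mono) auto
      also have "\<dots> \<le> exp (L * h) * (real i * exp (L * (real i * h)) * c) + exp (L * (real (Suc i) * h)) * c"
        using L h c by (intro add_left_mono mult_right_mono) auto
      also have "exp (L * h) * (real i * exp (L * (real i * h)) * c) = real i * (exp (L * h) * exp (L * (real i * h))) * c"
        by simp
      also have "exp (L * h) * exp (L * (real i * h)) = exp (L * (real (Suc i) * h))"
        unfolding exp_add[symmetric] by (simp add: algebra_simps)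
      finally show ?case by (simp add: algebra_simps)
    qed
    from this[of n] have "d T \<le> real n * exp (L * T) * c" by (simp add: nh)
    also have "\<dots> = exp (L * T) * C * (real n * h) * sqrt h" by (simp add: c_def)
    finally show ?thesis unfolding nh by (simp add: h_def)
  qed
  have "(\<lambda>n. (exp (L * T) * C * T) * sqrt (T / real n)) \<longlonglongrightarrow> (exp (L * T) * C * T) * sqrt 0"
    by (intro tendsto_mult tendsto_const tendsto_real_sqrt lim_const_over_n)
  moreover have "eventually (\<lambda>n. d T \<le> (exp (L * T) * C * T) * sqrt (T / real n)) sequentially"
  proof -
    obtain n0 :: nat where "T \<le> real n0" using real_arch_simple by blast
    then have "T \<le> real n \<and> 0 < n" if "n0 \<le> n" for n
    proof -
      have "T \<le> real n" using that \<open>T \<le> real n0\<close> by linarith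
      then show ?thesis using T by auto
    qed
    then show ?thesis using bound unfolding eventually_sequentially by blast
  qed
  ultimately have "d T \<le> (exp (L * T) * C * T) * sqrt 0" by (rule tendsto_lowerbound) simp
  then show ?thesis by simp
qed

section \<open>The defect of the variation of constants formula\<close>

context pantograph
begin

text \<open>The integrand in \<open>r\<close> of the variation of constants formula up to time
  \<open>t\<close>, without the factor \<open>b\<close>.\<close>

definition delayed :: "real \<Rightarrow> real \<Rightarrow> 'a \<Rightarrow> real" where
  "delayed t r \<omega> = X (q * r) \<omega> * gbm a \<sigma> r t \<omega>"

lemma delayed_continuous: "AE \<omega> in M. \<forall>t. continuous_on {0..} (\<lambda>r. delayed t r \<omega>)"
  using B_continuous lin_continuous[of 0 1]
proof eventually_elim
  case (elim \<omega>)
  show ?case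
  proof
    fix t
    have "continuous_on {0..} (\<lambda>r. (0 * X r \<omega> + 1 * X (q * r) \<omega>) * gbm a \<sigma> r t \<omega>)"
      unfolding gbm_def by (intro continuous_intros elim)
    then show "continuous_on {0..} (\<lambda>r. delayed t r \<omega>)" by (simp add: delayed_def)
  qed
qed

lemma Xq_L2F: "0 \<le> r \<Longrightarrow> X (q * r) \<in> L2F r"
  by (intro L2F_mono[OF X_L2F[OF q_mult(1)] q_mult(2)])

lemma delayed_L2F:
  assumes "0 \<le> r" "r \<le> t"
  shows "delayed t r \<in> L2F t"
    and "(\<integral>\<omega>. (delayed t r \<omega>)\<^sup>2 \<partial>M) = m2 (q * r) * exp ((2 * a + \<sigma>\<^sup>2) * (t - r))"
  unfolding delayed_def[abs_def] by (rule gbm_mult_L2F[OF assms Xq_L2F[OF assms(1)]])+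

text \<open>The pathwise integral is defined only where the path is continuous, that is up to a null set;
  the choice fixes a version that is measurable at time \<open>t\<close>.\<close>

definition conv :: "real \<Rightarrow> real \<Rightarrow> 'a \<Rightarrow> real" where
  "conv s t = (SOME D. D \<in> borel_measurable (F t) \<and>
    (\<forall>\<omega>. continuous_on {s..t} (\<lambda>r. delayed t r \<omega>) \<longrightarrow> D \<omega> = integral {s..t} (\<lambda>r. delayed t r \<omega>)))"

lemma conv_some:
  assumes "0 \<le> s" "s \<le> t"
  shows "conv s t \<in> borel_measurable (F t) \<and>
    (\<forall>\<omega>. continuous_on {s..t} (\<lambda>r. delayed t r \<omega>) \<longrightarrow> conv s t \<omega> = integral {s..t} (\<lambda>r. delayed t r \<omega>))"
  unfolding conv_def
proof (rule someI_ex[where P="\<lambda>D. D \<in> borel_measurable (F t) \<and>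
    (\<forall>\<omega>. continuous_on {s..t} (\<lambda>r. delayed t r \<omega>) \<longrightarrow> D \<omega> = integral {s..t} (\<lambda>r. delayed t r \<omega>))"])
  have "delayed t r \<in> borel_measurable (F t)" if "s \<le> r" "r \<le> t" for r
    by (rule L2F_measurable[OF delayed_L2F(1)[OF _ that(2)]]) (use assms that in simp)
  then have "\<exists>D\<in>borel_measurable (F t). \<forall>\<omega>. continuous_on {s..t} (\<lambda>r. delayed t r \<omega>) \<longrightarrow>
      D \<omega> = integral {s..t} (\<lambda>r. delayed t r \<omega>)"
    by (rule measurable_integral_version[OF assms(2)])
  then show "\<exists>D. D \<in> borel_measurable (F t) \<and>
    (\<forall>\<omega>. continuous_on {s..t} (\<lambda>r. delayed t r \<omega>) \<longrightarrow> D \<omega> = integral {s..t} (\<lambda>r. delayed t r \<omega>))"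
    by blast
qed

lemma conv_measurable: "0 \<le> s \<Longrightarrow> s \<le> t \<Longrightarrow> conv s t \<in> borel_measurable (F t)"
  by (rule conv_some[THEN conjunct1])

lemma conv_AE:
  assumes "0 \<le> s" "s \<le> t"
  shows "AE \<omega> in M. continuous_on {s..t} (\<lambda>r. delayed t r \<omega>) \<and> conv s t \<omega> = integral {s..t} (\<lambda>r. delayed t r \<omega>)"
  using delayed_continuous
proof eventually_elim
  case (elim \<omega>)
  have "continuous_on {s..t} (\<lambda>r. delayed t r \<omega>)"
    by (rule continuous_on_subset[OF elim[rule_format]]) (use assms in auto)
  then show ?case using conv_some[OF assms, THEN conjunct2] by blast
qed

text \<open>The multiplicative property of \<open>gbm\<close> moves the past part of the integral
  from final time \<open>s\<close> to final time \<open>t\<close> by one factor.\<close>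

lemma conv_split:
  assumes "0 \<le> s" "s \<le> t"
  shows "AE \<omega> in M. conv 0 t \<omega> = conv 0 s \<omega> * gbm a \<sigma> s t \<omega> + conv s t \<omega>"
  using conv_AE[OF order_refl assms(1)] conv_AE[OF assms] conv_AE[OF order_refl order_trans[OF assms]]
proof eventually_elim
  case (elim \<omega>)
  have "integral {0..s} (\<lambda>r. delayed t r \<omega>) + integral {s..t} (\<lambda>r. delayed t r \<omega>) = integral {0..t} (\<lambda>r. delayed t r \<omega>)"
    using elim(3) assms by (intro Henstock_Kurzweil_Integration.integral_combine integrable_continuous_interval) auto
  moreover have "delayed t r \<omega> = delayed s r \<omega> * gbm a \<sigma> s t \<omega>" for r
    unfolding delayed_def by (simp add: mult.assoc gbm_mult)
  then have "integral {0..s} (\<lambda>r. delayed t r \<omega>) = integral {0..s} (\<lambda>r. delayed s r \<omega>) * gbm a \<sigma> s t \<omega>"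
    by (simp only: integral_mult_left)
  ultimately show ?case using elim by simp
qed

text \<open>The defect of the variation of constants formula is transported by the geometric Brownian
  motion up to a one-step error whose mean square is of smaller order than the step, so it vanishes.\<close>

definition dev :: "real \<Rightarrow> 'a \<Rightarrow> real" where
  "dev t \<omega> = X t \<omega> - X0 \<omega> * gbm a \<sigma> 0 t \<omega> - b * conv 0 t \<omega>"

definition err :: "real \<Rightarrow> real \<Rightarrow> 'a \<Rightarrow> real" where
  "err s t \<omega> = X t \<omega> - X s \<omega> * gbm a \<sigma> s t \<omega> - b * conv s t \<omega>"

lemma dev_recursion:
  assumes "0 \<le> s" "s \<le> t"
  shows "AE \<omega> in M. dev t \<omega> = dev s \<omega> * gbm a \<sigma> s t \<omega> + err s t \<omega>"
  using conv_split[OF assms]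
proof eventually_elim
  case (elim \<omega>)
  have "gbm a \<sigma> 0 t \<omega> = gbm a \<sigma> 0 s \<omega> * gbm a \<sigma> s t \<omega>" by (rule gbm_mult[symmetric])
  then show ?case unfolding dev_def err_def elim by (simp only:) (simp add: algebra_simps)
qed

lemma conv_L2F:
  assumes st: "0 \<le> s" "s \<le> t" "t \<le> T" and m: "\<And>r. 0 \<le> r \<Longrightarrow> r \<le> T \<Longrightarrow> m2 r \<le> C"
  shows "conv s t \<in> L2F t" "(\<integral>\<omega>. (conv s t \<omega>)\<^sup>2 \<partial>M) \<le> C * exp (\<bar>2 * a + \<sigma>\<^sup>2\<bar> * T) * (t - s)\<^sup>2"
proof -
  have L: "delayed t r \<in> L2 M" if "s \<le> r" "r \<le> t" for r
    by (rule L2F_L2[OF delayed_L2F(1)[OF _ that(2)]]) (use st that in simp)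
  have b: "(\<integral>\<omega>. (delayed t r \<omega>)\<^sup>2 \<partial>M) \<le> C * exp (\<bar>2 * a + \<sigma>\<^sup>2\<bar> * T)" if r: "s \<le> r" "r \<le> t" for r
  proof -
    have r0: "0 \<le> r" using st r by simp
    have "(2 * a + \<sigma>\<^sup>2) * (t - r) \<le> \<bar>2 * a + \<sigma>\<^sup>2\<bar> * T" using r r0 st by (intro mult_mono) auto
    moreover have "m2 (q * r) \<le> C" using q_mult[OF r0] r st by (intro m) auto
    moreover have "0 \<le> m2 (q * r)" by simp
    moreover have "0 \<le> C" using calculation(2,3) by linarith
    ultimately show ?thesis unfolding delayed_L2F(2)[OF r0 r(2)] by (intro mult_mono) auto
  qed
  note M = F_measurable_M[OF conv_measurable[OF st(1,2)]]
  have "conv s t \<in> L2 M" by (rule L2_integral_bound(1)[OF st(2) L b M conv_AE[OF st(1,2)]])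
  then show "conv s t \<in> L2F t" by (rule L2F_intro[OF _ conv_measurable[OF st(1,2)]])
  show "(\<integral>\<omega>. (conv s t \<omega>)\<^sup>2 \<partial>M) \<le> C * exp (\<bar>2 * a + \<sigma>\<^sup>2\<bar> * T) * (t - s)\<^sup>2"
    by (rule L2_integral_bound(2)[OF st(2) L b M conv_AE[OF st(1,2)]])
qed

lemma conv_in_L2F: "0 \<le> s \<Longrightarrow> s \<le> t \<Longrightarrow> conv s t \<in> L2F t"
proof -
  assume st: "0 \<le> s" "s \<le> t"
  obtain C where "0 < C" "\<And>r. 0 \<le> r \<Longrightarrow> r \<le> t \<Longrightarrow> m2 r \<le> C"
    by (rule second_moment_locally_bounded[OF order_trans[OF st]]) (rule that; assumption)
  then show ?thesis using conv_L2F(1)[OF st order_refl] by blast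
qed

lemma dev_L2F:
  assumes "0 \<le> t" shows "dev t \<in> L2F t"
  unfolding dev_def[abs_def]
  by (intro L2F_diff L2F_cmult X_L2F gbm_mult_L2F(1)[OF order_refl assms X0_L2F] conv_in_L2F assms order_refl)

lemma dev_bounded:
  assumes T: "0 \<le> T" obtains C where "0 \<le> C" "\<And>t. 0 \<le> t \<Longrightarrow> t \<le> T \<Longrightarrow> (\<integral>\<omega>. (dev t \<omega>)\<^sup>2 \<partial>M) \<le> C"
proof -
  obtain C where C: "0 < C" "\<And>r. 0 \<le> r \<Longrightarrow> r \<le> T \<Longrightarrow> m2 r \<le> C"
    by (rule second_moment_locally_bounded[OF T]) (rule that; assumption)
  define e where "e = exp (\<bar>2 * a + \<sigma>\<^sup>2\<bar> * T)"
  define K where "K = 4 * C + 4 * ((\<integral>\<omega>. (X0 \<omega>)\<^sup>2 \<partial>M) * e) + 2 * (b\<^sup>2 * (C * e * T\<^sup>2))"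
  have X00: "0 \<le> (\<integral>\<omega>. (X0 \<omega>)\<^sup>2 \<partial>M)" by simp
  show ?thesis
  proof (rule that[of K])
    show "0 \<le> K" unfolding K_def using C X00 by (intro add_nonneg_nonneg mult_nonneg_nonneg) (auto simp: e_def)
    fix t assume t: "0 \<le> t" "t \<le> T"
    note G = gbm_mult_L2F[OF order_refl t(1) X0_L2F, of a \<sigma>]
    note V = conv_L2F[OF order_refl t C(2), folded e_def]
    have VL: "conv 0 t \<in> L2 M" by (rule L2F_L2[OF conv_in_L2F[OF order_refl t(1)]])
    have V2: "(\<integral>\<omega>. (conv 0 t \<omega>)\<^sup>2 \<partial>M) \<le> C * e * T\<^sup>2"
    proof -
      have "(\<integral>\<omega>. (conv 0 t \<omega>)\<^sup>2 \<partial>M) \<le> C * e * (t - 0)\<^sup>2" by (rule V(2))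
      also have "\<dots> \<le> C * e * T\<^sup>2" using t C by (intro mult_left_mono power_mono) (auto simp: e_def)
      finally show ?thesis .
    qed
    have "(2 * a + \<sigma>\<^sup>2) * (t - 0) \<le> \<bar>2 * a + \<sigma>\<^sup>2\<bar> * T" using t by (intro mult_mono) auto
    then have G2: "(\<integral>\<omega>. (X0 \<omega> * gbm a \<sigma> 0 t \<omega>)\<^sup>2 \<partial>M) \<le> (\<integral>\<omega>. (X0 \<omega>)\<^sup>2 \<partial>M) * e"
      unfolding G(2) e_def using X00 by (intro mult_left_mono) auto
    note XL = L2F_L2[OF X_L2F[OF t(1)]] and GL = L2F_L2[OF G(1)]
    have "(\<integral>\<omega>. (dev t \<omega>)\<^sup>2 \<partial>M) \<le> 2 * (\<integral>\<omega>. (X t \<omega> - X0 \<omega> * gbm a \<sigma> 0 t \<omega>)\<^sup>2 \<partial>M) + 2 * (\<integral>\<omega>. (b * conv 0 t \<omega>)\<^sup>2 \<partial>M)"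
      unfolding dev_def by (intro L2_diff_bound L2_diff L2_cmult XL GL VL)
    moreover have "(\<integral>\<omega>. (X t \<omega> - X0 \<omega> * gbm a \<sigma> 0 t \<omega>)\<^sup>2 \<partial>M) \<le> 2 * m2 t + 2 * (\<integral>\<omega>. (X0 \<omega> * gbm a \<sigma> 0 t \<omega>)\<^sup>2 \<partial>M)"
      by (rule L2_diff_bound[OF XL GL])
    moreover have "(\<integral>\<omega>. (b * conv 0 t \<omega>)\<^sup>2 \<partial>M) \<le> b\<^sup>2 * (C * e * T\<^sup>2)"
      using mult_left_mono[OF V2, of "b\<^sup>2"] by (simp add: power_mult_distrib)
    ultimately show "(\<integral>\<omega>. (dev t \<omega>)\<^sup>2 \<partial>M) \<le> K" unfolding K_def using G2 C(2)[OF t] by linarith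
  qed
qed

text \<open>The one-step error consists of the Euler error \<open>?U\<close> of the geometric
  Brownian motion, \<open>b\<close> times the error \<open>?V\<close> of freezing the delayed
  integrand, and the remainder of the equation. Its second moment is of order
  \<open>h\<^sup>2\<close>, but its pairing with \<open>dev s\<close> has to be of order
  \<open>h * sqrt h\<close>: for \<open>?U\<close> by the small mean, for \<open>?V\<close> by its
  second moment of order \<open>h\<^sup>3\<close>, for the remainder by orthogonality. Vanishing of
  \<open>\<rho>\<close> enters through \<open>err_eq\<close>: the noise is then the same multiple of
  the current value as in \<open>gbm\<close>.\<close>

lemma dev_step:
  assumes rho: "\<rho> = 0" and T: "0 \<le> T"
  obtains C where "0 \<le> C" "\<And>s t. 0 \<le> s \<Longrightarrow> s < t \<Longrightarrow> t \<le> T \<Longrightarrow> t - s \<le> 1 \<Longrightarrow>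
      (\<integral>\<omega>. (dev t \<omega>)\<^sup>2 \<partial>M) \<le> exp (\<bar>2 * a + \<sigma>\<^sup>2\<bar> * (t - s)) * (\<integral>\<omega>. (dev s \<omega>)\<^sup>2 \<partial>M) + C * ((t - s) * sqrt (t - s))"
proof -
  obtain C where C: "0 < C" "\<And>t. 0 \<le> t \<Longrightarrow> t \<le> T \<Longrightarrow> m2 t \<le> C"
    "\<And>s t. 0 \<le> s \<Longrightarrow> s \<le> t \<Longrightarrow> t \<le> T \<Longrightarrow> t - s \<le> 1 \<Longrightarrow> (\<integral>\<omega>. (X t \<omega> - X s \<omega>)\<^sup>2 \<partial>M) \<le> C * (t - s)"
    "\<And>s t. 0 \<le> s \<Longrightarrow> s < t \<Longrightarrow> t \<le> T \<Longrightarrow> t - s \<le> 1 \<Longrightarrow> (\<integral>\<omega>. (remainder s t \<omega>)\<^sup>2 \<partial>M) \<le> C * (t - s)\<^sup>2"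
    "\<And>s t \<xi>. 0 \<le> s \<Longrightarrow> s < t \<Longrightarrow> t \<le> T \<Longrightarrow> t - s \<le> 1 \<Longrightarrow> \<xi> \<in> L2F s \<Longrightarrow>
      2 * \<bar>\<integral>\<omega>. \<xi> \<omega> * remainder s t \<omega> \<partial>M\<bar> \<le> ((\<integral>\<omega>. (\<xi> \<omega>)\<^sup>2 \<partial>M) + C) * ((t - s) * sqrt (t - s))"
    by (rule local_expansion[OF T]) (rule that; assumption)
  obtain G where G: "0 < G"
    "\<And>s t \<xi>. 0 \<le> s \<Longrightarrow> s \<le> t \<Longrightarrow> t - s \<le> 1 \<Longrightarrow> \<xi> \<in> L2F s \<Longrightarrow>
      (\<lambda>\<omega>. \<xi> \<omega> * (gbm a \<sigma> s t \<omega> - 1)) \<in> L2 M \<and>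
      (\<integral>\<omega>. (\<xi> \<omega> * (gbm a \<sigma> s t \<omega> - 1))\<^sup>2 \<partial>M) \<le> G * (t - s) * (\<integral>\<omega>. (\<xi> \<omega>)\<^sup>2 \<partial>M)"
    "\<And>s t \<xi>. 0 \<le> s \<Longrightarrow> s \<le> t \<Longrightarrow> t - s \<le> 1 \<Longrightarrow> \<xi> \<in> L2F s \<Longrightarrow>
      (\<lambda>\<omega>. \<xi> \<omega> * (1 + a * (t - s) + \<sigma> * dB s t \<omega> - gbm a \<sigma> s t \<omega>)) \<in> L2 M \<and>
      (\<integral>\<omega>. (\<xi> \<omega> * (1 + a * (t - s) + \<sigma> * dB s t \<omega> - gbm a \<sigma> s t \<omega>))\<^sup>2 \<partial>M) \<le> G * (t - s)\<^sup>2 * (\<integral>\<omega>. (\<xi> \<omega>)\<^sup>2 \<partial>M)"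
    "\<And>s t \<xi> \<eta>. 0 \<le> s \<Longrightarrow> s \<le> t \<Longrightarrow> t - s \<le> 1 \<Longrightarrow> \<xi> \<in> L2F s \<Longrightarrow> \<eta> \<in> L2F s \<Longrightarrow>
      2 * \<bar>\<integral>\<omega>. \<eta> \<omega> * (\<xi> \<omega> * (1 + a * (t - s) + \<sigma> * dB s t \<omega> - gbm a \<sigma> s t \<omega>)) \<partial>M\<bar>
        \<le> G * (t - s)\<^sup>2 * ((\<integral>\<omega>. (\<eta> \<omega>)\<^sup>2 \<partial>M) + (\<integral>\<omega>. (\<xi> \<omega>)\<^sup>2 \<partial>M))"
    by (rule gbm_expansion[of a \<sigma>]) (rule that; assumption)
  obtain E where E: "0 \<le> E" "\<And>t. 0 \<le> t \<Longrightarrow> t \<le> T \<Longrightarrow> (\<integral>\<omega>. (dev t \<omega>)\<^sup>2 \<partial>M) \<le> E"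
    by (rule dev_bounded[OF T]) (rule that; assumption)
  define K where "K = 2 * C + 2 * (G * C)"
  have K0: "0 \<le> K" using C(1) G(1) by (simp add: K_def)
  define N where "N = 2 * (G * C) + 4 * (b\<^sup>2 * K) + 4 * C"
  have N0: "0 \<le> N" using C(1) G(1) K0 by (simp add: N_def)
  define Z where "Z = G * (E + C) + (E + b\<^sup>2 * K) + (E + C) + (G * E + N) + N"
  have Z0: "0 \<le> Z" using C(1) G(1) K0 N0 E(1) by (simp add: Z_def)
  show ?thesis
  proof (rule that[OF Z0])
    fix s t assume st: "0 \<le> s" "s < t" "t \<le> T" "t - s \<le> 1"
    define h where "h = t - s"
    have h: "0 < h" "h \<le> 1" using st by (auto simp: h_def)
    have st': "0 \<le> s" "s \<le> t" "t - s \<le> 1" "s \<le> T" using st by auto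
    let ?P = "gbm a \<sigma> s t"
    let ?U = "\<lambda>\<omega>. X s \<omega> * (1 + a * (t - s) + \<sigma> * dB s t \<omega> - ?P \<omega>)"
    let ?V = "\<lambda>\<omega>. (t - s) * X (q * s) \<omega> - conv s t \<omega>"
    let ?R = "remainder s t"
    have err_eq: "err s t \<omega> = ?U \<omega> + (b * ?V \<omega> + ?R \<omega>)" for \<omega>
      unfolding err_def remainder_def drift_def diffusion_def using rho by (simp add: algebra_simps)
    have UL: "?U \<in> L2 M" and U2: "(\<integral>\<omega>. (?U \<omega>)\<^sup>2 \<partial>M) \<le> G * C * h\<^sup>2"
    proof -
      note U = G(3)[OF st'(1,2,3) X_L2F[OF st(1)]]
      show "?U \<in> L2 M" by (rule U[THEN conjunct1])
      have "(\<integral>\<omega>. (?U \<omega>)\<^sup>2 \<partial>M) \<le> G * (t - s)\<^sup>2 * m2 s" by (rule U[THEN conjunct2])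
      also have "\<dots> \<le> G * (t - s)\<^sup>2 * C" using C(2)[OF st'(1,4)] G(1) by (intro mult_left_mono) auto
      finally show "(\<integral>\<omega>. (?U \<omega>)\<^sup>2 \<partial>M) \<le> G * C * h\<^sup>2" by (simp add: h_def mult_ac)
    qed
    have VL: "?V \<in> L2 M" and V2: "(\<integral>\<omega>. (?V \<omega>)\<^sup>2 \<partial>M) \<le> K * h * h\<^sup>2"
    proof -
      have L: "(\<lambda>\<omega>. X (q * s) \<omega> - delayed t r \<omega>) \<in> L2 M"
        and b': "(\<integral>\<omega>. (X (q * s) \<omega> - delayed t r \<omega>)\<^sup>2 \<partial>M) \<le> K * h" if r: "s \<le> r" "r \<le> t" for r
      proof -
        have r0: "0 \<le> r" using st r by simp
        note XsL = L2F_L2[OF Xq_L2F[OF st'(1)]] and XrL = L2F_L2[OF Xq_L2F[OF r0]]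
        show "(\<lambda>\<omega>. X (q * s) \<omega> - delayed t r \<omega>) \<in> L2 M"
          by (intro L2_diff XsL L2F_L2[OF delayed_L2F(1)[OF r0 r(2)]])
        have tr: "t - r \<le> 1" using r st by simp
        note g = G(2)[OF r0 r(2) tr Xq_L2F[OF r0]]
        have q_le: "q * s \<le> q * r" "q * r - q * s \<le> h" "q * r \<le> T"
        proof -
          show "q * s \<le> q * r" using q r by (intro mult_left_mono) auto
          have "q * (r - s) \<le> r - s" using q_mult(2)[of "r - s"] r by simp
          then show "q * r - q * s \<le> h" using r by (simp add: right_diff_distrib h_def)
          show "q * r \<le> T" using q_mult(2)[OF r0] r st by simp
        qed
        have i1: "(\<integral>\<omega>. (X (q * r) \<omega> - X (q * s) \<omega>)\<^sup>2 \<partial>M) \<le> C * h"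
        proof -
          have "(\<integral>\<omega>. (X (q * r) \<omega> - X (q * s) \<omega>)\<^sup>2 \<partial>M) \<le> C * (q * r - q * s)"
            using q_le h q_mult(1)[OF st'(1)] by (intro C(3)) auto
          also have "\<dots> \<le> C * h" using C(1) q_le by (intro mult_left_mono) auto
          finally show ?thesis .
        qed
        have i2: "(\<integral>\<omega>. (X (q * r) \<omega> * (gbm a \<sigma> r t \<omega> - 1))\<^sup>2 \<partial>M) \<le> G * C * h"
        proof -
          have "(\<integral>\<omega>. (X (q * r) \<omega> * (gbm a \<sigma> r t \<omega> - 1))\<^sup>2 \<partial>M) \<le> G * (t - r) * m2 (q * r)"
            by (rule g[THEN conjunct2])
          also have "\<dots> \<le> G * h * C"
            using C(2)[OF q_mult(1)[OF r0] q_le(3)] G(1) r C(1) h by (intro mult_mono mult_nonneg_nonneg) (auto simp: h_def)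
          finally show ?thesis by (simp add: mult_ac)
        qed
        \<comment> \<open>The deviation of the integrand combines an increment of the solution along
          the delayed times with the deviation of \<open>gbm\<close> from 1; both have second moment
          of order h.\<close>
        have eq: "X (q * s) \<omega> - delayed t r \<omega> = - (X (q * r) \<omega> - X (q * s) \<omega>) - X (q * r) \<omega> * (gbm a \<sigma> r t \<omega> - 1)" for \<omega>
          by (simp add: delayed_def algebra_simps)
        have "(\<integral>\<omega>. (X (q * s) \<omega> - delayed t r \<omega>)\<^sup>2 \<partial>M)
            \<le> 2 * (\<integral>\<omega>. (- (X (q * r) \<omega> - X (q * s) \<omega>))\<^sup>2 \<partial>M) + 2 * (\<integral>\<omega>. (X (q * r) \<omega> * (gbm a \<sigma> r t \<omega> - 1))\<^sup>2 \<partial>M)"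
          unfolding eq using L2_cmult[OF L2_diff[OF XrL XsL], of "-1"] g by (intro L2_diff_bound) auto
        also have "\<dots> \<le> 2 * (C * h) + 2 * (G * C * h)" using i1 i2 unfolding power2_minus by linarith
        also have "\<dots> = K * h" by (simp add: K_def algebra_simps)
        finally show "(\<integral>\<omega>. (X (q * s) \<omega> - delayed t r \<omega>)\<^sup>2 \<partial>M) \<le> K * h" .
      qed
      have VM: "?V \<in> borel_measurable M"
        by (intro L2_measurable L2_diff L2_cmult L2F_L2[OF Xq_L2F[OF st'(1)]] L2F_L2[OF conv_in_L2F[OF st'(1,2)]])
      have Vae: "AE \<omega> in M. continuous_on {s..t} (\<lambda>r. X (q * s) \<omega> - delayed t r \<omega>) \<and>
        ?V \<omega> = integral {s..t} (\<lambda>r. X (q * s) \<omega> - delayed t r \<omega>)"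
        using conv_AE[OF st'(1,2)]
      proof eventually_elim
        case (elim \<omega>)
        have "integral {s..t} (\<lambda>r. X (q * s) \<omega> - delayed t r \<omega>) = (t - s) * X (q * s) \<omega> - integral {s..t} (\<lambda>r. delayed t r \<omega>)"
          using elim st by (subst Henstock_Kurzweil_Integration.integral_diff) (auto intro: integrable_continuous_interval)
        then show ?case using elim by (auto intro: continuous_intros)
      qed
      show "?V \<in> L2 M" by (rule L2_integral_bound(1)[OF st'(2) L b' VM Vae])
      have "(\<integral>\<omega>. (?V \<omega>)\<^sup>2 \<partial>M) \<le> K * h * (t - s)\<^sup>2" by (rule L2_integral_bound(2)[OF st'(2) L b' VM Vae])
      then show "(\<integral>\<omega>. (?V \<omega>)\<^sup>2 \<partial>M) \<le> K * h * h\<^sup>2" by (simp only: h_def)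
    qed
    have RL: "?R \<in> L2 M" by (rule L2F_L2[OF remainder_L2F[OF st'(1,2)]])
    have R2: "(\<integral>\<omega>. (?R \<omega>)\<^sup>2 \<partial>M) \<le> C * h\<^sup>2" unfolding h_def by (rule C(4)[OF st])
    have bVL: "(\<lambda>\<omega>. b * ?V \<omega>) \<in> L2 M" by (rule L2_cmult[OF VL])
    have bV2: "(\<integral>\<omega>. (b * ?V \<omega>)\<^sup>2 \<partial>M) \<le> b\<^sup>2 * K * (h * h\<^sup>2)"
      using mult_left_mono[OF V2, of "b\<^sup>2"] by (simp add: power_mult_distrib mult_ac)
    have errL: "err s t \<in> L2 M" unfolding err_eq[abs_def] by (intro L2_add UL bVL RL)
    have err2: "(\<integral>\<omega>. (err s t \<omega>)\<^sup>2 \<partial>M) \<le> N * h\<^sup>2"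
    proof -
      have "(\<integral>\<omega>. (err s t \<omega>)\<^sup>2 \<partial>M) \<le> 2 * (\<integral>\<omega>. (?U \<omega>)\<^sup>2 \<partial>M) + 2 * (\<integral>\<omega>. (b * ?V \<omega> + ?R \<omega>)\<^sup>2 \<partial>M)"
        unfolding err_eq by (rule L2_add_bound[OF UL L2_add[OF bVL RL]])
      moreover have "(\<integral>\<omega>. (b * ?V \<omega> + ?R \<omega>)\<^sup>2 \<partial>M) \<le> 2 * (\<integral>\<omega>. (b * ?V \<omega>)\<^sup>2 \<partial>M) + 2 * (\<integral>\<omega>. (?R \<omega>)\<^sup>2 \<partial>M)"
        by (rule L2_add_bound[OF bVL RL])
      moreover have "b\<^sup>2 * K * (h * h\<^sup>2) \<le> b\<^sup>2 * K * h\<^sup>2"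
        using small_powers(2)[of h] h K0 by (intro mult_left_mono) auto
      ultimately have "(\<integral>\<omega>. (err s t \<omega>)\<^sup>2 \<partial>M) \<le> 2 * (G * C * h\<^sup>2) + 4 * (b\<^sup>2 * K * h\<^sup>2) + 4 * (C * h\<^sup>2)"
        using U2 bV2 R2 by linarith
      also have "\<dots> = N * h\<^sup>2" by (simp add: N_def algebra_simps)
      finally show ?thesis .
    qed
    let ?\<xi> = "dev s"
    have \<xi>: "?\<xi> \<in> L2F s" by (rule dev_L2F[OF st(1)])
    note \<xi>L = L2F_L2[OF \<xi>]
    have \<xi>E: "(\<integral>\<omega>. (?\<xi> \<omega>)\<^sup>2 \<partial>M) \<le> E" by (rule E(2)[OF st'(1,4)])
    \<comment> \<open>The target order of all cross terms. Since
      \<open>h * h\<^sup>2 = z * z\<close>, the weight \<open>z\<close> suits a second moment of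
      order \<open>h\<^sup>3\<close>.\<close>
    define z where "z = h * sqrt h"
    have z: "0 < z" "h\<^sup>2 \<le> z" using h power2_le_sqrt[of h] by (auto simp: z_def)
    have e1: "2 * \<bar>\<integral>\<omega>. ?\<xi> \<omega> * ?U \<omega> \<partial>M\<bar> \<le> G * (E + C) * z"
    proof -
      have "2 * \<bar>\<integral>\<omega>. ?\<xi> \<omega> * ?U \<omega> \<partial>M\<bar> \<le> G * (t - s)\<^sup>2 * ((\<integral>\<omega>. (?\<xi> \<omega>)\<^sup>2 \<partial>M) + m2 s)"
        by (rule G(4)[OF st'(1,2,3) X_L2F[OF st(1)] \<xi>])
      also have "\<dots> \<le> G * z * (E + C)"
        using \<xi>E C(1) C(2)[OF st'(1,4)] G(1) z E(1) by (intro mult_mono add_mono mult_nonneg_nonneg add_nonneg_nonneg) (auto simp: h_def)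
      finally show ?thesis by (simp add: mult_ac)
    qed
    have e2: "2 * \<bar>\<integral>\<omega>. ?\<xi> \<omega> * (b * ?V \<omega>) \<partial>M\<bar> \<le> (E + b\<^sup>2 * K) * z"
    proof -
      have "2 * \<bar>\<integral>\<omega>. ?\<xi> \<omega> * (b * ?V \<omega>) \<partial>M\<bar> \<le> z * (\<integral>\<omega>. (?\<xi> \<omega>)\<^sup>2 \<partial>M) + (\<integral>\<omega>. (b * ?V \<omega>)\<^sup>2 \<partial>M) / z"
        by (rule L2_abs_product_bound[OF \<xi>L bVL z(1)])
      also have "\<dots> \<le> z * E + b\<^sup>2 * K * (h * h\<^sup>2) / z"
        using \<xi>E bV2 z by (intro add_mono mult_left_mono divide_right_mono) auto
      also have "b\<^sup>2 * K * (h * h\<^sup>2) / z = b\<^sup>2 * K * z"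
      proof -
        have "h * h\<^sup>2 = z * z" using h by (simp add: z_def power2_eq_square)
        then show ?thesis using z by simp
      qed
      finally show ?thesis by (simp add: algebra_simps)
    qed
    have e3: "2 * \<bar>\<integral>\<omega>. ?\<xi> \<omega> * ?R \<omega> \<partial>M\<bar> \<le> (E + C) * z"
    proof -
      have "2 * \<bar>\<integral>\<omega>. ?\<xi> \<omega> * ?R \<omega> \<partial>M\<bar> \<le> ((\<integral>\<omega>. (?\<xi> \<omega>)\<^sup>2 \<partial>M) + C) * z"
        unfolding z_def h_def by (rule C(5)[OF st \<xi>])
      also have "\<dots> \<le> (E + C) * z" using \<xi>E z by (intro mult_right_mono) auto
      finally show ?thesis .
    qed
    \<comment> \<open>In the cross term \<open>dev s * gbm\<close> is split into
      \<open>dev s\<close> and \<open>dev s * (gbm - 1)\<close>. The second part has size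
      \<open>sqrt h\<close>, so against an error of size h no cancellation is required.\<close>
    let ?W = "\<lambda>\<omega>. ?\<xi> \<omega> * (?P \<omega> - 1)"
    note W = G(2)[OF st'(1,2,3) \<xi>]
    have WL: "?W \<in> L2 M" by (rule W[THEN conjunct1])
    have W2: "(\<integral>\<omega>. (?W \<omega>)\<^sup>2 \<partial>M) \<le> (G * E) * h"
    proof -
      have "(\<integral>\<omega>. (?W \<omega>)\<^sup>2 \<partial>M) \<le> G * (t - s) * (\<integral>\<omega>. (?\<xi> \<omega>)\<^sup>2 \<partial>M)" by (rule W[THEN conjunct2])
      also have "\<dots> \<le> G * (t - s) * E" using \<xi>E G(1) st by (intro mult_left_mono) auto
      finally show ?thesis by (simp add: h_def mult_ac)
    qed
    have e4: "2 * \<bar>\<integral>\<omega>. ?W \<omega> * err s t \<omega> \<partial>M\<bar> \<le> (G * E + N) * z"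
      unfolding z_def by (rule L2_product_sqrt_bound[OF WL errL h(1) W2 err2])
    note PL = gbm_mult_L2F[OF st'(1,2) \<xi>, of a \<sigma>]
    have "(\<integral>\<omega>. (dev t \<omega>)\<^sup>2 \<partial>M) = (\<integral>\<omega>. (?\<xi> \<omega> * ?P \<omega> + err s t \<omega>)\<^sup>2 \<partial>M)"
    proof (rule integral_cong_AE)
      show "(\<lambda>\<omega>. (dev t \<omega>)\<^sup>2) \<in> borel_measurable M"
        using L2_measurable[OF L2F_L2[OF dev_L2F[OF order_trans[OF st'(1,2)]]]] by (rule borel_measurable_power)
      show "(\<lambda>\<omega>. (?\<xi> \<omega> * ?P \<omega> + err s t \<omega>)\<^sup>2) \<in> borel_measurable M"
        using L2_measurable[OF L2_add[OF L2F_L2[OF PL(1)] errL]] by (rule borel_measurable_power)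
      show "AE \<omega> in M. (dev t \<omega>)\<^sup>2 = (?\<xi> \<omega> * ?P \<omega> + err s t \<omega>)\<^sup>2"
        using dev_recursion[OF st'(1,2)] by eventually_elim simp
    qed
    also have "\<dots> = (\<integral>\<omega>. (?\<xi> \<omega> * ?P \<omega>)\<^sup>2 \<partial>M) + 2 * (\<integral>\<omega>. ?\<xi> \<omega> * ?P \<omega> * err s t \<omega> \<partial>M) + (\<integral>\<omega>. (err s t \<omega>)\<^sup>2 \<partial>M)"
      by (rule L2_square_add[OF L2F_L2[OF PL(1)] errL])
    also have "(\<integral>\<omega>. ?\<xi> \<omega> * ?P \<omega> * err s t \<omega> \<partial>M) = (\<integral>\<omega>. ?\<xi> \<omega> * err s t \<omega> \<partial>M) + (\<integral>\<omega>. ?W \<omega> * err s t \<omega> \<partial>M)"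
    proof -
      have "?\<xi> \<omega> * ?P \<omega> * err s t \<omega> = ?\<xi> \<omega> * err s t \<omega> + ?W \<omega> * err s t \<omega>" for \<omega> by (simp add: algebra_simps)
      then show ?thesis using L2_mult_integrable[OF \<xi>L errL] L2_mult_integrable[OF WL errL] by simp
    qed
    also have "(\<integral>\<omega>. ?\<xi> \<omega> * err s t \<omega> \<partial>M)
        = (\<integral>\<omega>. ?\<xi> \<omega> * ?U \<omega> \<partial>M) + ((\<integral>\<omega>. ?\<xi> \<omega> * (b * ?V \<omega>) \<partial>M) + (\<integral>\<omega>. ?\<xi> \<omega> * ?R \<omega> \<partial>M))"
      unfolding err_eq using L2_inner_add[OF \<xi>L UL L2_add[OF bVL RL]] L2_inner_add[OF \<xi>L bVL RL] by (simp only:)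
    finally have main: "(\<integral>\<omega>. (dev t \<omega>)\<^sup>2 \<partial>M) \<le> (\<integral>\<omega>. (?\<xi> \<omega> * ?P \<omega>)\<^sup>2 \<partial>M)
      + (G * (E + C) * z + (E + b\<^sup>2 * K) * z + (E + C) * z + (G * E + N) * z) + (\<integral>\<omega>. (err s t \<omega>)\<^sup>2 \<partial>M)"
      by (rule sum_cross_terms_le[OF _ e1 e2 e3 e4])
    have "(\<integral>\<omega>. (?\<xi> \<omega> * ?P \<omega>)\<^sup>2 \<partial>M) \<le> exp (\<bar>2 * a + \<sigma>\<^sup>2\<bar> * (t - s)) * (\<integral>\<omega>. (?\<xi> \<omega>)\<^sup>2 \<partial>M)"
    proof -
      have "(2 * a + \<sigma>\<^sup>2) * (t - s) \<le> \<bar>2 * a + \<sigma>\<^sup>2\<bar> * (t - s)" using st by (intro mult_right_mono) auto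
      then have "(\<integral>\<omega>. (?\<xi> \<omega>)\<^sup>2 \<partial>M) * exp ((2 * a + \<sigma>\<^sup>2) * (t - s)) \<le> (\<integral>\<omega>. (?\<xi> \<omega>)\<^sup>2 \<partial>M) * exp (\<bar>2 * a + \<sigma>\<^sup>2\<bar> * (t - s))"
        by (intro mult_left_mono) auto
      then show ?thesis unfolding PL(2) by (simp only: mult.commute)
    qed
    moreover have "(\<integral>\<omega>. (err s t \<omega>)\<^sup>2 \<partial>M) \<le> N * z"
      using err2 mult_left_mono[OF z(2) N0] by linarith
    moreover have "G * (E + C) * z + (E + b\<^sup>2 * K) * z + (E + C) * z + (G * E + N) * z + N * z = Z * z"
      by (simp add: Z_def algebra_simps)
    ultimately show "(\<integral>\<omega>. (dev t \<omega>)\<^sup>2 \<partial>M)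
      \<le> exp (\<bar>2 * a + \<sigma>\<^sup>2\<bar> * (t - s)) * (\<integral>\<omega>. (dev s \<omega>)\<^sup>2 \<partial>M) + Z * ((t - s) * sqrt (t - s))"
      using main unfolding z_def h_def by linarith
  qed
qed

text \<open>The mean square of the defect starts from 0, grows by at most an exponential factor per
  step, and the step errors vanish in total as the steps shrink.\<close>

lemma dev_zero:
  assumes rho: "\<rho> = 0" and t: "0 \<le> t"
  shows "AE \<omega> in M. dev t \<omega> = 0"
proof -
  have z: "AE \<omega> in M. dev 0 \<omega> = 0"
    using X_zero conv_AE[OF order_refl order_refl]
    by eventually_elim (simp add: dev_def gbm_def)
  have d0: "(\<integral>\<omega>. (dev 0 \<omega>)\<^sup>2 \<partial>M) \<le> 0"
  proof -
    have "(\<integral>\<omega>. (dev 0 \<omega>)\<^sup>2 \<partial>M) = 0" by (rule integral_eq_zero_AE) (use z in eventually_elim, simp)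
    then show ?thesis by simp
  qed
  show ?thesis
  proof (cases "t = 0")
    case True
    then show ?thesis using z by simp
  next
    case False
    then have t0: "0 < t" using t by simp
    obtain C where C: "0 \<le> C" "\<And>s r. 0 \<le> s \<Longrightarrow> s < r \<Longrightarrow> r \<le> t \<Longrightarrow> r - s \<le> 1 \<Longrightarrow>
      (\<integral>\<omega>. (dev r \<omega>)\<^sup>2 \<partial>M) \<le> exp (\<bar>2 * a + \<sigma>\<^sup>2\<bar> * (r - s)) * (\<integral>\<omega>. (dev s \<omega>)\<^sup>2 \<partial>M) + C * ((r - s) * sqrt (r - s))"
      by (rule dev_step[OF rho t]) (rule that; assumption)
    have "(\<integral>\<omega>. (dev t \<omega>)\<^sup>2 \<partial>M) \<le> 0"
      by (rule vanishing_error_recursion[where d="\<lambda>t. \<integral>\<omega>. (dev t \<omega>)\<^sup>2 \<partial>M" and L="\<bar>2 * a + \<sigma>\<^sup>2\<bar>" and C=C, OF t0 d0 _ C(1) C(2)]) simp_all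
    moreover have "0 \<le> (\<integral>\<omega>. (dev t \<omega>)\<^sup>2 \<partial>M)" by simp
    ultimately have e: "(\<integral>\<omega>. (dev t \<omega>)\<^sup>2 \<partial>M) = 0" by linarith
    have "AE \<omega> in M. (dev t \<omega>)\<^sup>2 = 0"
      using e integral_nonneg_eq_0_iff_AE[OF L2_integrable_square[OF L2F_L2[OF dev_L2F[OF t]]]] by simp
    then show ?thesis by eventually_elim simp
  qed
qed

text \<open>The defect vanishes almost surely at each fixed time, hence simultaneously at all
  rational times, and continuity in \<open>t\<close> does the rest. For continuity the dependence of
  the integrand on \<open>t\<close> is removed: the factor \<open>gbm a \<sigma> 0 t\<close> leaves
  the integral, whose integrand becomes \<open>delayed 0 r\<close>, with \<open>gbm\<close> run
  backwards from \<open>r\<close> to 0.\<close>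

lemma variation_of_constants:
  assumes rho: "\<rho> = 0"
  shows "AE \<omega> in M. \<forall>t\<ge>0. X t \<omega> = X0 \<omega> * gbm a \<sigma> 0 t \<omega> + b * integral {0..t} (\<lambda>r. delayed t r \<omega>)"
proof -
  have "AE \<omega> in M. \<forall>p\<in>{p \<in> \<rat>. 0 \<le> p}. dev p \<omega> = 0 \<and> conv 0 p \<omega> = integral {0..p} (\<lambda>r. delayed p r \<omega>)"
  proof (subst AE_ball_countable)
    show "countable {p \<in> \<rat>. 0 \<le> (p :: real)}" using countable_rat by (rule countable_subset[rotated]) auto
    show "\<forall>p\<in>{p \<in> \<rat>. 0 \<le> p}. AE \<omega> in M. dev p \<omega> = 0 \<and> conv 0 p \<omega> = integral {0..p} (\<lambda>r. delayed p r \<omega>)"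
    proof
      fix p :: real assume "p \<in> {p \<in> \<rat>. 0 \<le> p}"
      then have p: "0 \<le> p" by simp
      show "AE \<omega> in M. dev p \<omega> = 0 \<and> conv 0 p \<omega> = integral {0..p} (\<lambda>r. delayed p r \<omega>)"
        using dev_zero[OF rho p] conv_AE[OF order_refl p] by eventually_elim blast
    qed
  qed
  then show ?thesis
    using X_continuous B_continuous delayed_continuous
  proof eventually_elim
    case (elim \<omega>)
    define Y where "Y t = gbm a \<sigma> 0 t \<omega>" for t
    have Yc: "continuous_on {0..} Y" unfolding Y_def gbm_def by (intro continuous_intros elim(3))
    have split: "delayed t r \<omega> = Y t * delayed 0 r \<omega>" for t r
    proof -
      have "gbm a \<sigma> r t \<omega> = Y t * gbm a \<sigma> r 0 \<omega>" unfolding Y_def using gbm_mult[of a \<sigma> r 0 \<omega> t] by (simp add: mult.commute)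
      then show ?thesis by (simp add: delayed_def)
    qed
    have int: "integral {0..t} (\<lambda>r. delayed t r \<omega>) = Y t * integral {0..t} (\<lambda>r. delayed 0 r \<omega>)" for t
      unfolding split[of t] by (rule integral_mult_right)
    define f where "f t = X t \<omega> - X0 \<omega> * Y t - b * (Y t * integral {0..t} (\<lambda>r. delayed 0 r \<omega>))" for t
    have fz: "f p = 0" if "p \<in> \<rat>" "0 \<le> p" for p
    proof -
      have "dev p \<omega> = 0 \<and> conv 0 p \<omega> = integral {0..p} (\<lambda>r. delayed p r \<omega>)" using elim(1) that by blast
      then show ?thesis by (simp add: f_def dev_def Y_def int)
    qed
    have "f t = 0" if t: "0 \<le> t" for t
    proof (rule continuous_zero_on_Rats[OF _ fz t])
      \<comment> \<open>The interval is extended to \<open>t + 1\<close> since the approximating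
        rational times lie to the right of \<open>t\<close>.\<close>
      have sub: "{0..t + 1} \<subseteq> {0..}" by auto
      have "continuous_on {0..t + 1} (\<lambda>t. integral {0..t} (\<lambda>r. delayed 0 r \<omega>))"
        by (intro indefinite_integral_continuous_1 integrable_continuous_interval continuous_on_subset[OF elim(4)[rule_format] sub])
      then show "continuous_on {0..t + 1} f"
        unfolding f_def
        by (intro continuous_intros continuous_on_subset[OF elim(2) sub] continuous_on_subset[OF Yc sub])
    qed simp_all
    then have Xt: "X t \<omega> - X0 \<omega> * Y t - b * (Y t * integral {0..t} (\<lambda>r. delayed 0 r \<omega>)) = 0" if "0 \<le> t" for t
      using that unfolding f_def .
    show ?case
    proof (intro allI impI)
      fix t :: real assume "0 \<le> t"
      from Xt[OF this] show "X t \<omega> = X0 \<omega> * gbm a \<sigma> 0 t \<omega> + b * integral {0..t} (\<lambda>r. delayed t r \<omega>)"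
        unfolding int Y_def by linarith
    qed
  qed
qed

end

section \<open>The case without delay in the diffusion\<close>

text \<open>With \<open>\<gamma> = 0\<close> the majorant solves the linear equation with kernel
  \<open>\<kappa> * \<mu> * exp (- \<mu> * r)\<close>, so the integral in the Gronwall step is
  exactly \<open>g - 1\<close>, as \<open>Gronwall_contraction\<close> expects. For positive
  \<open>\<mu>\<close> the kernel has total mass \<open>\<kappa>\<close>, which explains the bound
  \<open>exp \<kappa>\<close>.\<close>

lemma majorant_integral:
  assumes "0 \<le> t"
  shows "((\<lambda>r. \<kappa> * \<mu> * exp (- \<mu> * r) * majorant 0 \<kappa> \<mu> r) has_integral (majorant 0 \<kappa> \<mu> t - 1)) {0..t}"
proof -
  have "((\<lambda>r. \<kappa> * \<mu> * exp (- \<mu> * r) * majorant 0 \<kappa> \<mu> r) has_integral (majorant 0 \<kappa> \<mu> t - majorant 0 \<kappa> \<mu> 0)) {0..t}"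
  proof (rule fundamental_theorem_of_calculus[OF assms])
    fix r
    have "(majorant 0 \<kappa> \<mu> has_real_derivative (0 + \<kappa> * \<mu> * exp (- \<mu> * r)) * majorant 0 \<kappa> \<mu> r) (at r within {0..t})"
      using majorant_deriv by (rule has_field_derivative_at_within)
    then show "(majorant 0 \<kappa> \<mu> has_vector_derivative \<kappa> * \<mu> * exp (- \<mu> * r) * majorant 0 \<kappa> \<mu> r) (at r within {0..t})"
      by (simp add: has_real_derivative_iff_has_vector_derivative)
  qed
  then show ?thesis by (simp add: majorant_def)
qed

lemma majorant_zero_delay:
  assumes "0 < q" "q < 1" "0 \<le> \<kappa>" "0 \<le> \<mu>" "0 \<le> t"
  shows "majorant 0 \<kappa> \<mu> (q * t) \<le> majorant 0 \<kappa> \<mu> t"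
  using majorant_delay[OF assms, of 0] by simp

lemma majorant_zero_ge_1:
  assumes "0 \<le> \<kappa>" "0 \<le> \<mu>" "0 \<le> t" shows "1 \<le> majorant 0 \<kappa> \<mu> t"
proof -
  have "0 \<le> \<mu> * t" using assms by simp
  then have "exp (- \<mu> * t) \<le> 1" by simp
  then have "0 \<le> \<kappa> * (1 - exp (- \<mu> * t))" using assms(1) by (intro mult_nonneg_nonneg) auto
  then show ?thesis by (simp add: majorant_def)
qed

lemma majorant_zero_le: "0 \<le> \<kappa> \<Longrightarrow> majorant 0 \<kappa> \<mu> t \<le> exp \<kappa>"
  using majorant_le[of \<kappa> 0 \<mu> t] by simp

text \<open>After division by \<open>exp (\<alpha> * t)\<close> the delayed term carries the kernel
  \<open>L * \<beta> * exp (- \<mu> * r)\<close> with \<open>\<mu> = a - \<alpha> * q\<close>, which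
  is integrable since \<open>\<alpha> * q < a\<close>. So a rate \<open>\<alpha>\<close> slightly
  above \<open>a\<close> in the a priori bound is not amplified by the iteration.\<close>

lemma pantograph_pathwise_growth:
  fixes x :: "real \<Rightarrow> real"
  assumes q: "0 < q" "q < 1" and x: "continuous_on {0..} x"
    and nn: "0 \<le> L" "0 \<le> c" "0 \<le> \<beta>" and rate: "\<alpha> * q < a"
    and bound: "\<And>t. 0 \<le> t \<Longrightarrow> \<bar>x t\<bar> \<le> L * exp (\<alpha> * t) * (c + \<beta> * integral {0..t} (\<lambda>r. exp (- a * r) * \<bar>x (q * r)\<bar>))"
  shows "\<exists>K>0. \<forall>t\<ge>0. \<bar>x t\<bar> \<le> K * exp (\<alpha> * t)"
proof -
  define \<mu> where "\<mu> = a - \<alpha> * q"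
  have \<mu>: "0 < \<mu>" using rate by (simp add: \<mu>_def)
  define \<kappa> where "\<kappa> = L * \<beta> / \<mu>"
  have \<kappa>: "0 \<le> \<kappa>" using nn \<mu> by (simp add: \<kappa>_def)
  have \<kappa>\<mu>: "\<kappa> * \<mu> = L * \<beta>" using \<mu> by (simp add: \<kappa>_def)
  define g where "g = majorant 0 \<kappa> \<mu>"
  have A: "0 \<le> L * c" using nn by simp
  have main: "\<bar>x t\<bar> * exp (- \<alpha> * t) \<le> L * c * g t" if T: "0 \<le> t" for t
  proof -
    have "compact ((\<lambda>s. \<bar>x s\<bar> * exp (- \<alpha> * s)) ` {0..t})"
      by (intro compact_continuous_image continuous_intros continuous_on_subset[OF x]) auto
    then have "bounded ((\<lambda>s. \<bar>x s\<bar> * exp (- \<alpha> * s)) ` {0..t})" by (rule compact_imp_bounded)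
    then obtain \<beta>' where "\<forall>y\<in>(\<lambda>s. \<bar>x s\<bar> * exp (- \<alpha> * s)) ` {0..t}. norm y \<le> \<beta>'" unfolding bounded_iff by (elim exE)
    then have bd: "\<bar>x s\<bar> * exp (- \<alpha> * s) \<le> \<beta>'" if "s \<in> {0..t}" for s using that by auto
    show ?thesis
    proof (rule Gronwall_contraction[where u="\<lambda>s. \<bar>x s\<bar> * exp (- \<alpha> * s)" and g=g and A="L * c" and t=t
          and S="{0..t}" and G="exp \<kappa>" and \<beta>=\<beta>', OF A _ _ bd])
      fix s assume "s \<in> {0..t}"
      then show "1 \<le> g s" unfolding g_def using \<kappa> \<mu> by (intro majorant_zero_ge_1) auto
      show "g s \<le> exp \<kappa>" unfolding g_def by (rule majorant_zero_le[OF \<kappa>])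
    next
      fix \<theta> s assume \<theta>: "0 \<le> \<theta>" and le: "\<And>r. r \<in> {0..t} \<Longrightarrow> \<bar>x r\<bar> * exp (- \<alpha> * r) \<le> (L * c + \<theta>) * g r"
        and s: "s \<in> {0..t}"
      have s0: "0 \<le> s" using s by simp
      have qc: "continuous_on {0..s} (\<lambda>r. exp (- a * r) * \<bar>x (q * r)\<bar>)"
      proof (intro continuous_intros)
        show "continuous_on {0..s} (\<lambda>r. x (q * r))"
          by (rule continuous_on_compose2[OF x]) (use q in \<open>auto intro!: continuous_intros\<close>)
      qed
      have "L * \<beta> * integral {0..s} (\<lambda>r. exp (- a * r) * \<bar>x (q * r)\<bar>)
          = integral {0..s} (\<lambda>r. L * \<beta> * (exp (- a * r) * \<bar>x (q * r)\<bar>))" by (simp only: integral_mult_right)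
      also have "\<dots> \<le> integral {0..s} (\<lambda>r. (L * c + \<theta>) * (\<kappa> * \<mu> * exp (- \<mu> * r) * g r))"
      proof (rule integral_le)
        show "(\<lambda>r. L * \<beta> * (exp (- a * r) * \<bar>x (q * r)\<bar>)) integrable_on {0..s}"
          by (intro integrable_continuous_interval continuous_on_mult continuous_on_const qc)
        show "(\<lambda>r. (L * c + \<theta>) * (\<kappa> * \<mu> * exp (- \<mu> * r) * g r)) integrable_on {0..s}"
          unfolding g_def by (intro integrable_continuous_interval continuous_intros majorant_continuous)
        fix r assume r: "r \<in> {0..s}"
        have r0: "0 \<le> r" using r by simp
        have "q * r \<le> 1 * r" using q r0 by (intro mult_right_mono) auto
        then have qr: "q * r \<in> {0..t}" using q r s by auto
        have "\<bar>x (q * r)\<bar> * exp (- \<alpha> * (q * r)) \<le> (L * c + \<theta>) * g (q * r)" by (rule le[OF qr])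
        also have "\<dots> \<le> (L * c + \<theta>) * g r"
          unfolding g_def using A \<theta> by (intro mult_left_mono majorant_zero_delay q \<kappa> less_imp_le[OF \<mu>] r0) auto
        finally have "exp (- \<mu> * r) * (\<bar>x (q * r)\<bar> * exp (- \<alpha> * (q * r))) \<le> exp (- \<mu> * r) * ((L * c + \<theta>) * g r)"
          by (rule mult_left_mono) simp
        moreover have "exp (- \<mu> * r) * exp (- \<alpha> * (q * r)) = exp (- a * r)"
          unfolding exp_add[symmetric] \<mu>_def by (simp add: algebra_simps)
        ultimately have "exp (- a * r) * \<bar>x (q * r)\<bar> \<le> exp (- \<mu> * r) * ((L * c + \<theta>) * g r)"
          by (simp only: mult_ac)
        then have "L * \<beta> * (exp (- a * r) * \<bar>x (q * r)\<bar>) \<le> L * \<beta> * (exp (- \<mu> * r) * ((L * c + \<theta>) * g r))"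
          using nn by (intro mult_left_mono) auto
        then show "L * \<beta> * (exp (- a * r) * \<bar>x (q * r)\<bar>) \<le> (L * c + \<theta>) * (\<kappa> * \<mu> * exp (- \<mu> * r) * g r)"
          unfolding \<kappa>\<mu> by (simp only: mult_ac)
      qed
      also have "\<dots> = (L * c + \<theta>) * integral {0..s} (\<lambda>r. \<kappa> * \<mu> * exp (- \<mu> * r) * g r)" by (simp only: integral_mult_right)
      also have "integral {0..s} (\<lambda>r. \<kappa> * \<mu> * exp (- \<mu> * r) * g r) = g s - 1"
        unfolding g_def by (rule integral_unique[OF majorant_integral[OF s0]])
      finally have int: "L * \<beta> * integral {0..s} (\<lambda>r. exp (- a * r) * \<bar>x (q * r)\<bar>) \<le> (L * c + \<theta>) * (g s - 1)" .
      have "\<bar>x s\<bar> * exp (- \<alpha> * s)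
          \<le> L * exp (\<alpha> * s) * (c + \<beta> * integral {0..s} (\<lambda>r. exp (- a * r) * \<bar>x (q * r)\<bar>)) * exp (- \<alpha> * s)"
        by (rule mult_right_mono[OF bound[OF s0]]) simp
      also have "\<dots> = L * (c + \<beta> * integral {0..s} (\<lambda>r. exp (- a * r) * \<bar>x (q * r)\<bar>)) * (exp (\<alpha> * s) * exp (- \<alpha> * s))"
        by (simp only: mult_ac)
      also have "exp (\<alpha> * s) * exp (- \<alpha> * s) = 1" unfolding exp_add[symmetric] by simp
      finally show "\<bar>x s\<bar> * exp (- \<alpha> * s) \<le> L * c + (L * c + \<theta>) * (g s - 1)"
        using int by (simp add: distrib_left mult.assoc)
    qed (use T in auto)
  qed
  show ?thesis
  proof (rule exI[of _ "L * c * exp \<kappa> + 1"], intro conjI allI impI)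
    show "0 < L * c * exp \<kappa> + 1" using A by (simp add: add_nonneg_pos)
    fix t :: real assume t: "0 \<le> t"
    have "\<bar>x t\<bar> * exp (- \<alpha> * t) \<le> L * c * exp \<kappa>"
      using main[OF t] mult_left_mono[OF majorant_zero_le[OF \<kappa>, of \<mu> t] A] by (simp add: g_def)
    then have "\<bar>x t\<bar> * exp (- \<alpha> * t) * exp (\<alpha> * t) \<le> (L * c * exp \<kappa> + 1) * exp (\<alpha> * t)"
      by (intro mult_right_mono) auto
    moreover have "\<bar>x t\<bar> * exp (- \<alpha> * t) * exp (\<alpha> * t) = \<bar>x t\<bar>"
      unfolding mult.assoc exp_add[symmetric] by simp
    ultimately show "\<bar>x t\<bar> \<le> (L * c * exp \<kappa> + 1) * exp (\<alpha> * t)" by (simp only:)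
  qed
qed

text \<open>Fatou for first moments, where the majorizing limit \<open>z\<close> is asked to exist
  path by path. It can thus be the pathwise integral of the modulus of \<open>delayed\<close>, whose
  dependence on \<open>\<omega>\<close> has not been shown measurable.\<close>

lemma L1_Fatou:
  fixes Z :: "nat \<Rightarrow> 'a \<Rightarrow> real" and Y :: "'a \<Rightarrow> real"
  assumes Z: "\<And>m. integrable M (Z m)" "\<And>m x. 0 \<le> Z m x" and Y: "Y \<in> borel_measurable M"
    and lim: "AE x in M. \<exists>z. (\<lambda>m. Z m x) \<longlonglongrightarrow> z \<and> \<bar>Y x\<bar> \<le> z"
    and le: "\<And>m. (\<integral>x. Z m x \<partial>M) \<le> c m" and c: "c \<longlonglongrightarrow> C"
  shows "(\<integral>x. \<bar>Y x\<bar> \<partial>M) \<le> C"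
proof -
  have Zm: "Z m \<in> borel_measurable M" for m using Z(1) by (rule borel_measurable_integrable)
  have Z0: "0 \<le> (\<integral>x. Z m x \<partial>M)" for m by (intro Bochner_Integration.integral_nonneg_AE AE_I2 Z(2))
  have c0: "0 \<le> c m" for m using Z0[of m] le[of m] by linarith
  have C0: "0 \<le> C" by (rule LIMSEQ_le_const[OF c]) (use c0 in auto)
  have "(\<integral>\<^sup>+x. ennreal \<bar>Y x\<bar> \<partial>M) \<le> (\<integral>\<^sup>+x. liminf (\<lambda>m. ennreal (Z m x)) \<partial>M)"
  proof (rule nn_integral_mono_AE)
    show "AE x in M. ennreal \<bar>Y x\<bar> \<le> liminf (\<lambda>m. ennreal (Z m x))"
      using lim
    proof eventually_elim
      case (elim x)
      then obtain z where z: "(\<lambda>m. Z m x) \<longlonglongrightarrow> z" "\<bar>Y x\<bar> \<le> z" by blast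
      have "(\<lambda>m. ennreal (Z m x)) \<longlonglongrightarrow> ennreal z" by (rule tendsto_ennrealI[OF z(1)])
      then have "liminf (\<lambda>m. ennreal (Z m x)) = ennreal z" by (metis lim_imp_Liminf trivial_limit_sequentially)
      then show ?case using z(2) by (simp add: ennreal_leI)
    qed
  qed
  also have "\<dots> \<le> liminf (\<lambda>m. \<integral>\<^sup>+x. ennreal (Z m x) \<partial>M)"
    by (rule nn_integral_liminf) (use Zm in simp)
  also have "\<dots> \<le> liminf (\<lambda>m. ennreal (c m))"
  proof (rule Liminf_mono, rule always_eventually, rule allI)
    fix m
    have "(\<integral>\<^sup>+x. ennreal (Z m x) \<partial>M) = ennreal (\<integral>x. Z m x \<partial>M)"
      by (rule nn_integral_eq_integral[OF Z(1)]) (use Z(2) in simp)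
    then show "(\<integral>\<^sup>+x. ennreal (Z m x) \<partial>M) \<le> ennreal (c m)" using le[of m] by (simp add: ennreal_leI)
  qed
  also have "\<dots> = ennreal C"
    using tendsto_ennrealI[OF c] by (metis lim_imp_Liminf trivial_limit_sequentially)
  finally show ?thesis using C0 by (intro integral_real_bounded)
qed

context brownian_filtration
begin

text \<open>The strong law for \<open>B\<close>, as a linear bound with arbitrarily small slope. The
  maximal inequality on \<open>[0, 2 ^ Suc n]\<close> with threshold \<open>e * 2 ^ n\<close> gives
  probabilities at most \<open>2 / e\<^sup>2 * (1 / 2) ^ n\<close>, and for times above
  \<open>2 ^ n\<close> the threshold is at most \<open>e * t\<close>.\<close>

lemma brownian_linear_bound:
  "AE \<omega> in M. \<forall>k. \<exists>K\<ge>0. \<forall>t\<ge>0. \<bar>B t \<omega> - B 0 \<omega>\<bar> \<le> K + t / real (Suc k)"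
  unfolding AE_all_countable
proof
  fix k
  define e where "e = 1 / real (Suc k)"
  have e: "0 < e" by (simp add: e_def)
  have "AE \<omega> in M. eventually (\<lambda>n. \<forall>t\<in>{0..2 ^ Suc n}. \<bar>dB 0 t \<omega>\<bar> \<le> e * 2 ^ n) sequentially"
  proof (rule geometric_events_eventually[where x="1/2" and C="2 / e\<^sup>2"])
    fix n
    have T: "(0::real) \<le> 2 ^ Suc n" by simp
    have c: "0 < e * 2 ^ n" using e by simp
    have SL: "dB 0 r \<in> L2F r" if "0 \<le> r" for r
      by (rule L2F_intro[OF dB_L2(1)[OF order_refl that] dB_measurable[OF order_refl that]])
    have "\<exists>A\<in>events. prob A \<le> (\<integral>\<omega>. (dB 0 (2 ^ Suc n) \<omega>)\<^sup>2 \<partial>M) / (e * 2 ^ n)\<^sup>2 \<and>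
      (\<forall>\<omega>\<in>space M - A. continuous_on {0..2 ^ Suc n} (\<lambda>r. dB 0 r \<omega>) \<longrightarrow> (\<forall>r\<in>{0..2 ^ Suc n}. \<bar>dB 0 r \<omega>\<bar> \<le> e * 2 ^ n))"
    proof (rule continuous_maximal_inequality[OF T _ _ c])
      fix r :: real assume r: "0 \<le> r" "r \<le> 2 ^ Suc n"
      show "dB 0 r \<in> L2F r" by (rule SL[OF r(1)])
      fix \<eta> assume \<eta>: "\<eta> \<in> L2F r"
      have one: "(\<lambda>_. 1) \<in> L2F r" by (rule L2F_intro[OF L2_const borel_measurable_const])
      have "(\<integral>\<omega>. \<eta> \<omega> * (1 * dB r (2 ^ Suc n) \<omega>) \<partial>M) = 0" by (rule increment_orthogonal[OF r one \<eta>])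
      then show "(\<integral>\<omega>. \<eta> \<omega> * (dB 0 (2 ^ Suc n) \<omega> - dB 0 r \<omega>) \<partial>M) = 0" by simp
    qed
    then obtain A where A: "A \<in> events" "prob A \<le> (\<integral>\<omega>. (dB 0 (2 ^ Suc n) \<omega>)\<^sup>2 \<partial>M) / (e * 2 ^ n)\<^sup>2"
      "\<forall>\<omega>\<in>space M - A. continuous_on {0..2 ^ Suc n} (\<lambda>r. dB 0 r \<omega>) \<longrightarrow> (\<forall>r\<in>{0..2 ^ Suc n}. \<bar>dB 0 r \<omega>\<bar> \<le> e * 2 ^ n)"
      by blast
    have "(\<integral>\<omega>. (dB 0 (2 ^ Suc n) \<omega>)\<^sup>2 \<partial>M) / (e * 2 ^ n)\<^sup>2 = 2 / e\<^sup>2 * (1 / 2) ^ n"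
      unfolding dB_L2(3)[OF order_refl T] by (simp add: power_mult_distrib power2_eq_square power_one_over)
    then have p: "prob A \<le> 2 / e\<^sup>2 * (1 / 2) ^ n" using A(2) by (simp only:)
    have "AE \<omega> in M. \<omega> \<notin> A \<longrightarrow> (\<forall>t\<in>{0..2 ^ Suc n}. \<bar>dB 0 t \<omega>\<bar> \<le> e * 2 ^ n)"
      using B_continuous AE_space
    proof eventually_elim
      case (elim \<omega>)
      have "continuous_on {0..2 ^ Suc n} (\<lambda>r. dB 0 r \<omega>)"
        by (intro continuous_on_diff continuous_on_const continuous_on_subset[OF elim(1)]) auto
      then show ?case using A(3) elim(2) by blast
    qed
    then show "\<exists>A\<in>events. prob A \<le> 2 / e\<^sup>2 * (1 / 2) ^ n \<and>
      (AE \<omega> in M. \<omega> \<notin> A \<longrightarrow> (\<forall>t\<in>{0..2 ^ Suc n}. \<bar>dB 0 t \<omega>\<bar> \<le> e * 2 ^ n))"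
      using A(1) p by blast
  qed simp_all
  then show "AE \<omega> in M. \<exists>K\<ge>0. \<forall>t\<ge>0. \<bar>B t \<omega> - B 0 \<omega>\<bar> \<le> K + t / real (Suc k)"
  proof eventually_elim
    case (elim \<omega>)
    then obtain n0 where n0: "\<And>n t. n0 \<le> n \<Longrightarrow> t \<in> {0..2 ^ Suc n} \<Longrightarrow> \<bar>dB 0 t \<omega>\<bar> \<le> e * 2 ^ n"
      unfolding eventually_sequentially by blast
    show ?case
    proof (rule exI[of _ "e * 2 ^ n0"], intro conjI allI impI)
      show "0 \<le> e * 2 ^ n0" using e by simp
      fix t :: real assume t: "0 \<le> t"
      have et: "e * t = t / real (Suc k)" by (simp add: e_def)
      show "\<bar>B t \<omega> - B 0 \<omega>\<bar> \<le> e * 2 ^ n0 + t / real (Suc k)"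
      proof (cases "t \<le> 2 ^ Suc n0")
        case True
        then have "\<bar>dB 0 t \<omega>\<bar> \<le> e * 2 ^ n0" using t by (intro n0) auto
        moreover have "0 \<le> e * t" using e t by simp
        ultimately show ?thesis using et by linarith
      next
        case False
        \<comment> \<open>The dyadic block of \<open>t\<close>: minimality gives
          \<open>2 ^ n < t\<close>, where \<open>n0 < n\<close> provides the predecessor to which
          minimality is applied.\<close>
        define n where "n = (LEAST n. t \<le> 2 ^ Suc n)"
        have "\<exists>n. t \<le> 2 ^ Suc n"
        proof -
          obtain j where "t < 2 ^ j" using real_arch_pow[of 2 t] by auto
          moreover have "(2::real) ^ j \<le> 2 ^ Suc j" by simp
          ultimately show ?thesis by (meson less_imp_le order_trans)
        qed
        then have tn: "t \<le> 2 ^ Suc n" unfolding n_def by (rule LeastI_ex)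
        have "n0 < n"
        proof (rule ccontr)
          assume "\<not> n0 < n"
          then have "(2::real) ^ Suc n \<le> 2 ^ Suc n0" by (intro power_increasing) auto
          then show False using tn False by linarith
        qed
        then obtain n' where n': "n = Suc n'" "n0 \<le> n'" by (cases n) auto
        have "\<not> t \<le> 2 ^ Suc n'" using not_less_Least[of n' "\<lambda>n. t \<le> 2 ^ Suc n"] n'(1) unfolding n_def by simp
        then have "2 ^ n < t" using n'(1) by simp
        moreover have "\<bar>dB 0 t \<omega>\<bar> \<le> e * 2 ^ n" using t tn \<open>n0 < n\<close> by (intro n0) auto
        ultimately have "\<bar>dB 0 t \<omega>\<bar> \<le> e * t" using e mult_left_mono[of "2 ^ n" t e] by linarith
        moreover have "0 \<le> e * 2 ^ n0" using e by simp
        ultimately show ?thesis using et by linarith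
      qed
    qed
  qed
qed

end

context pantograph
begin

abbreviation m1 :: "real \<Rightarrow> real" where "m1 t \<equiv> (\<integral>\<omega>. \<bar>X t \<omega>\<bar> \<partial>M)"

lemma X_integrable: "0 \<le> t \<Longrightarrow> integrable M (\<lambda>\<omega>. \<bar>X t \<omega>\<bar>)"
  by (intro integrable_abs L2_integrable L2F_L2[OF X_L2F])

lemma delayed_expectation:
  assumes "0 \<le> r" "r \<le> t"
  shows "integrable M (\<lambda>\<omega>. \<bar>delayed t r \<omega>\<bar>)" and "(\<integral>\<omega>. \<bar>delayed t r \<omega>\<bar> \<partial>M) = m1 (q * r) * exp (a * (t - r))"
proof -
  have eq: "\<bar>delayed t r \<omega>\<bar> = \<bar>X (q * r) \<omega>\<bar> * gbm a \<sigma> r t \<omega>" for \<omega>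
    using gbm_pos[of a \<sigma> r t \<omega>] by (simp add: delayed_def abs_mult)
  have m: "(\<lambda>\<omega>. \<bar>X (q * r) \<omega>\<bar>) \<in> borel_measurable (F r)"
    by (rule borel_measurable_abs[OF Xq_measurable[OF assms(1)]])
  note G = gbm_mult_expectation[OF assms m X_integrable[OF q_mult(1)[OF assms(1)]], of a \<sigma>]
  show "integrable M (\<lambda>\<omega>. \<bar>delayed t r \<omega>\<bar>)" unfolding eq by (rule G(1))
  show "(\<integral>\<omega>. \<bar>delayed t r \<omega>\<bar> \<partial>M) = m1 (q * r) * exp (a * (t - r))" unfolding eq by (rule G(2))
qed

text \<open>Expectation and time integral are interchanged on Riemann sums, where independence is
  applied term by term, and the limit is taken by Fatou. After discounting by
  \<open>exp (- a * s)\<close> the kernel is \<open>\<bar>b\<bar> * exp (- \<mu> * r)\<close> with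
  \<open>\<mu> = a * (1 - q)\<close>; its total mass \<open>\<kappa>\<close> is the exponent of the
  constant.\<close>

lemma first_moment_growth:
  assumes rho: "\<rho> = 0" and a: "0 < a" and t: "0 \<le> t"
  shows "m1 t \<le> exp (\<bar>b\<bar> / (a * (1 - q))) * (\<integral>\<omega>. \<bar>X0 \<omega>\<bar> \<partial>M) * exp (a * t)"
proof -
  define \<mu> where "\<mu> = a * (1 - q)"
  have \<mu>: "0 < \<mu>" using a q by (simp add: \<mu>_def)
  define \<kappa> where "\<kappa> = \<bar>b\<bar> / \<mu>"
  have \<kappa>: "0 \<le> \<kappa>" using \<mu> by (simp add: \<kappa>_def)
  have \<kappa>\<mu>: "\<kappa> * \<mu> = \<bar>b\<bar>" using \<mu> by (simp add: \<kappa>_def)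
  define g where "g = majorant 0 \<kappa> \<mu>"
  define A where "A = (\<integral>\<omega>. \<bar>X0 \<omega>\<bar> \<partial>M)"
  have A: "0 \<le> A" by (simp add: A_def)
  obtain C where C: "0 < C" "\<And>s. 0 \<le> s \<Longrightarrow> s \<le> t \<Longrightarrow> m2 s \<le> C"
    by (rule second_moment_locally_bounded[OF t]) (rule that; assumption)
  \<comment> \<open>The second moment supplies the finite bound with which the iteration starts,
    through \<open>\<bar>x\<bar> \<le> x\<^sup>2 + 1\<close>.\<close>
  have bd: "exp (- a * s) * m1 s \<le> C + 1" if s: "s \<in> {0..t}" for s
  proof -
    have s0: "0 \<le> s" "s \<le> t" using s by auto
    have "\<bar>x\<bar> \<le> x\<^sup>2 + 1" for x :: real using abs_mult_le_squares[of x 1] by simp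
    then have "m1 s \<le> (\<integral>\<omega>. (X s \<omega>)\<^sup>2 + 1 \<partial>M)"
      using X_integrable[OF s0(1)] L2_integrable_square[OF L2F_L2[OF X_L2F[OF s0(1)]]]
      by (intro integral_mono Bochner_Integration.integrable_add integrable_const)
    also have "\<dots> = m2 s + 1" using L2_integrable_square[OF L2F_L2[OF X_L2F[OF s0(1)]]] by (simp add: prob_space)
    finally have "m1 s \<le> C + 1" using C(2)[OF s0] by linarith
    moreover have "exp (- a * s) \<le> 1" using a s0 by simp
    moreover have "0 \<le> m1 s" by simp
    ultimately have "exp (- a * s) * m1 s \<le> 1 * (C + 1)" by (intro mult_mono) auto
    then show ?thesis by simp
  qed
  have "exp (- a * t) * m1 t \<le> A * g t"
  proof (rule Gronwall_contraction[where u="\<lambda>s. exp (- a * s) * m1 s" and g=g and A=A and t=t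
        and S="{0..t}" and G="exp \<kappa>" and \<beta>="C + 1", OF A _ _ bd])
    fix s assume "s \<in> {0..t}"
    then show "1 \<le> g s" unfolding g_def using \<kappa> \<mu> by (intro majorant_zero_ge_1) auto
    show "g s \<le> exp \<kappa>" unfolding g_def by (rule majorant_zero_le[OF \<kappa>])
  next
    fix \<theta> s assume \<theta>: "0 \<le> \<theta>" and le: "\<And>r. r \<in> {0..t} \<Longrightarrow> exp (- a * r) * m1 r \<le> (A + \<theta>) * g r"
      and s: "s \<in> {0..t}"
    have s0: "0 \<le> s" using s by simp
    define k where "k r = \<kappa> * \<mu> * exp (- \<mu> * r) * g r" for r
    have kc: "continuous_on {0..s} k" unfolding k_def g_def by (intro continuous_intros majorant_continuous)
    have kint: "integral {0..s} k = g s - 1"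
      unfolding k_def[abs_def] g_def by (rule integral_unique[OF majorant_integral[OF s0]])
    obtain N u where P: "fine_partitions 0 s N u" using fine_partitions_exist[OF s0] .
    note PD = fine_partitionsD[OF P]
    have u0: "0 \<le> u m i" for m i using PD(5) .
    have us: "u m i \<le> s" if "i < N m" for m i using PD(6)[of i m] that by simp
    have du: "0 \<le> u m (Suc i) - u m i" for m i using PD(7)[of m i] by simp
    have X0m: "(\<lambda>\<omega>. \<bar>X0 \<omega>\<bar>) \<in> borel_measurable (F 0)" by (rule borel_measurable_abs[OF L2F_measurable[OF X0_L2F]])
    have X0i: "integrable M (\<lambda>\<omega>. \<bar>X0 \<omega>\<bar>)" by (intro integrable_abs L2_integrable L2F_L2[OF X0_L2F])
    note X0g = gbm_mult_expectation[OF order_refl s0 X0m X0i, of a \<sigma>]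
    define Z where "Z m \<omega> = \<bar>X0 \<omega>\<bar> * gbm a \<sigma> 0 s \<omega> + \<bar>b\<bar> * (\<Sum>i<N m. \<bar>delayed s (u m i) \<omega>\<bar> * (u m (Suc i) - u m i))" for m \<omega>
    have sumi: "integrable M (\<lambda>\<omega>. \<Sum>i<N m. \<bar>delayed s (u m i) \<omega>\<bar> * (u m (Suc i) - u m i))" for m
      by (intro Bochner_Integration.integrable_sum Bochner_Integration.integrable_mult_left delayed_expectation(1) u0 us) simp
    have Zi: "integrable M (Z m)" for m
      unfolding Z_def[abs_def]
      by (intro Bochner_Integration.integrable_add Bochner_Integration.integrable_mult_right X0g(1) sumi)
    have Z0: "0 \<le> Z m \<omega>" for m \<omega>
      unfolding Z_def using du gbm_pos[of a \<sigma> 0 s \<omega>]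
      by (intro add_nonneg_nonneg mult_nonneg_nonneg sum_nonneg) auto
    have lim: "AE \<omega> in M. \<exists>z. (\<lambda>m. Z m \<omega>) \<longlonglongrightarrow> z \<and> \<bar>X s \<omega>\<bar> \<le> z"
      using variation_of_constants[OF rho] delayed_continuous
    proof eventually_elim
      case (elim \<omega>)
      have dc: "continuous_on {0..s} (\<lambda>r. delayed s r \<omega>)" by (rule continuous_on_subset[OF elim(2)[rule_format]]) auto
      have ac: "continuous_on {0..s} (\<lambda>r. \<bar>delayed s r \<omega>\<bar>)" by (rule continuous_on_rabs[OF dc])
      let ?z = "\<bar>X0 \<omega>\<bar> * gbm a \<sigma> 0 s \<omega> + \<bar>b\<bar> * integral {0..s} (\<lambda>r. \<bar>delayed s r \<omega>\<bar>)"
      have "(\<lambda>m. Z m \<omega>) \<longlonglongrightarrow> ?z"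
        unfolding Z_def by (intro tendsto_add tendsto_mult tendsto_const Riemann_sums_tendsto[OF ac P])
      moreover have "\<bar>X s \<omega>\<bar> \<le> ?z"
      proof -
        have "\<bar>integral {0..s} (\<lambda>r. delayed s r \<omega>)\<bar> \<le> integral {0..s} (\<lambda>r. \<bar>delayed s r \<omega>\<bar>)"
          using integral_norm_bound_integral[of "\<lambda>r. delayed s r \<omega>" "{0..s}" "\<lambda>r. \<bar>delayed s r \<omega>\<bar>"]
            integrable_continuous_interval[OF dc] integrable_continuous_interval[OF ac] by simp
        then have "\<bar>b\<bar> * \<bar>integral {0..s} (\<lambda>r. delayed s r \<omega>)\<bar> \<le> \<bar>b\<bar> * integral {0..s} (\<lambda>r. \<bar>delayed s r \<omega>\<bar>)"
          by (rule mult_left_mono) simp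
        moreover have "\<bar>X s \<omega>\<bar> \<le> \<bar>X0 \<omega> * gbm a \<sigma> 0 s \<omega>\<bar> + \<bar>b * integral {0..s} (\<lambda>r. delayed s r \<omega>)\<bar>"
          using elim(1)[rule_format, OF s0] abs_triangle_ineq by simp
        ultimately show ?thesis using gbm_pos[of a \<sigma> 0 s \<omega>] unfolding abs_mult by simp
      qed
      ultimately show ?case by blast
    qed
    have Zle: "(\<integral>\<omega>. Z m \<omega> \<partial>M) \<le> exp (a * s) * (A + (A + \<theta>) * (\<Sum>i<N m. k (u m i) * (u m (Suc i) - u m i)))" for m
    proof -
      have "(\<integral>\<omega>. Z m \<omega> \<partial>M) = (\<integral>\<omega>. \<bar>X0 \<omega>\<bar> * gbm a \<sigma> 0 s \<omega> \<partial>M)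
          + \<bar>b\<bar> * (\<integral>\<omega>. (\<Sum>i<N m. \<bar>delayed s (u m i) \<omega>\<bar> * (u m (Suc i) - u m i)) \<partial>M)"
        unfolding Z_def using X0g(1) sumi[of m]
        by (subst Bochner_Integration.integral_add) (auto intro: Bochner_Integration.integrable_mult_right)
      also have "(\<integral>\<omega>. \<bar>X0 \<omega>\<bar> * gbm a \<sigma> 0 s \<omega> \<partial>M) = A * exp (a * (s - 0))" unfolding A_def by (rule X0g(2))
      also have "(\<integral>\<omega>. (\<Sum>i<N m. \<bar>delayed s (u m i) \<omega>\<bar> * (u m (Suc i) - u m i)) \<partial>M)
          = (\<Sum>i<N m. \<integral>\<omega>. \<bar>delayed s (u m i) \<omega>\<bar> * (u m (Suc i) - u m i) \<partial>M)"
        by (intro Bochner_Integration.integral_sum Bochner_Integration.integrable_mult_left delayed_expectation(1) u0 us) simp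
      also have "\<dots> = (\<Sum>i<N m. m1 (q * u m i) * exp (a * (s - u m i)) * (u m (Suc i) - u m i))"
        using delayed_expectation(2)[OF u0 us] by (intro sum.cong refl) simp
      also have "\<bar>b\<bar> * \<dots> = (\<Sum>i<N m. \<bar>b\<bar> * (m1 (q * u m i) * exp (a * (s - u m i))) * (u m (Suc i) - u m i))"
        by (simp add: sum_distrib_left mult.assoc)
      also have "A * exp (a * (s - 0)) + \<dots> \<le> A * exp (a * (s - 0)) + (\<Sum>i<N m. exp (a * s) * ((A + \<theta>) * k (u m i)) * (u m (Suc i) - u m i))"
      proof (intro add_left_mono sum_mono mult_right_mono du)
        fix i assume "i \<in> {..<N m}"
        then have i: "i < N m" by simp
        let ?r = "u m i"
        have qr: "q * ?r \<in> {0..t}" using q_mult[OF u0[of m i]] us[OF i] s by auto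
        have "exp (- a * (q * ?r)) * m1 (q * ?r) \<le> (A + \<theta>) * g (q * ?r)" by (rule le[OF qr])
        also have "\<dots> \<le> (A + \<theta>) * g ?r"
          unfolding g_def using A \<theta> by (intro mult_left_mono majorant_zero_delay q \<kappa> less_imp_le[OF \<mu>] u0) auto
        finally have le1: "(\<bar>b\<bar> * exp (a * s) * exp (- \<mu> * ?r)) * (exp (- a * (q * ?r)) * m1 (q * ?r))
            \<le> (\<bar>b\<bar> * exp (a * s) * exp (- \<mu> * ?r)) * ((A + \<theta>) * g ?r)"
          by (rule mult_left_mono) simp
        \<comment> \<open>The exponent \<open>a * r\<close> is divided into
          \<open>a * q * r\<close>, which discounts the delayed moment, and
          \<open>\<mu> * r\<close>, which is left as the decaying kernel.\<close>
        have ee: "exp (a * (s - ?r)) = exp (a * s) * (exp (- \<mu> * ?r) * exp (- a * (q * ?r)))"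
          unfolding exp_add[symmetric] \<mu>_def by (simp add: algebra_simps)
        have "\<bar>b\<bar> * (m1 (q * ?r) * exp (a * (s - ?r)))
            = (\<bar>b\<bar> * exp (a * s) * exp (- \<mu> * ?r)) * (exp (- a * (q * ?r)) * m1 (q * ?r))"
          unfolding ee by (simp only: mult_ac)
        from ord_eq_le_trans[OF this le1] show "\<bar>b\<bar> * (m1 (q * ?r) * exp (a * (s - ?r))) \<le> exp (a * s) * ((A + \<theta>) * k ?r)"
          unfolding k_def \<kappa>\<mu> by (simp only: mult_ac)
      qed
      also have "\<dots> = exp (a * s) * (A + (A + \<theta>) * (\<Sum>i<N m. k (u m i) * (u m (Suc i) - u m i)))"
        by (simp add: sum_distrib_left algebra_simps)
      finally show ?thesis .
    qed
    have "m1 s \<le> exp (a * s) * (A + (A + \<theta>) * integral {0..s} k)"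
      by (rule L1_Fatou[OF Zi Z0 X_measurable_M[OF s0] lim Zle])
        (intro tendsto_mult tendsto_add tendsto_const Riemann_sums_tendsto[OF kc P])
    then have "exp (- a * s) * m1 s \<le> exp (- a * s) * (exp (a * s) * (A + (A + \<theta>) * (g s - 1)))"
      unfolding kint by (rule mult_left_mono) simp
    also have "\<dots> = (exp (- a * s) * exp (a * s)) * (A + (A + \<theta>) * (g s - 1))" by (simp only: mult.assoc)
    also have "exp (- a * s) * exp (a * s) = 1" unfolding exp_add[symmetric] by simp
    finally show "exp (- a * s) * m1 s \<le> A + (A + \<theta>) * (g s - 1)" by simp
  qed (use t in auto)
  also have "\<dots> \<le> A * exp \<kappa>" unfolding g_def using A by (intro mult_left_mono majorant_zero_le \<kappa>)
  finally have "exp (a * t) * (exp (- a * t) * m1 t) \<le> exp (a * t) * (A * exp \<kappa>)" by (rule mult_left_mono) simp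
  moreover have "exp (a * t) * exp (- a * t) = 1" unfolding exp_add[symmetric] by simp
  ultimately have "m1 t \<le> exp (a * t) * (A * exp \<kappa>)" by (simp only: mult.assoc[symmetric] mult_1)
  then show ?thesis by (simp only: A_def \<kappa>_def \<mu>_def mult_ac)
qed

text \<open>A Brownian bound with small slope inflates the rate of \<open>gbm\<close> from
  \<open>a\<close> to \<open>a + \<delta>\<close>. As \<open>(a + \<delta>) * q < a\<close> for
  small \<open>\<delta>\<close>, the delayed integral does not raise the rate further, and
  \<open>\<delta>\<close> is arbitrarily small.\<close>

lemma almost_sure_growth_without_noise_delay:
  assumes rho: "\<rho> = 0" and a: "0 < a"
  shows "AE \<omega> in M. Limsup at_top (\<lambda>t. ereal (1 / t) * elog \<bar>X t \<omega>\<bar>) \<le> ereal a"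
  using variation_of_constants[OF rho] delayed_continuous X_continuous brownian_linear_bound lin_continuous[of 0 1]
proof eventually_elim
  case (elim \<omega>)
  show ?case
  proof (rule Limsup_log_le)
    fix k
    define \<delta> where "\<delta> = min (1 / real (Suc k)) (a * (1 - q) / 2)"
    have aq: "0 < a * (1 - q)" using a q by simp
    have \<delta>: "0 < \<delta>" "\<delta> \<le> 1 / real (Suc k)" "\<delta> \<le> a * (1 - q) / 2" using aq by (auto simp: \<delta>_def)
    \<comment> \<open>The 2 accounts for the two values of \<open>B\<close> in an increment; the
      added 1 covers \<open>\<sigma> = 0\<close>.\<close>
    have "0 < \<delta> / (2 * (\<bar>\<sigma>\<bar> + 1))" using \<delta>(1) by (intro divide_pos_pos) auto
    then obtain j where "1 / real (Suc j) < \<delta> / (2 * (\<bar>\<sigma>\<bar> + 1))" by (rule nat_approx_posE)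
    define e where "e = 1 / real (Suc j)"
    have e: "0 < e" "e * (2 * (\<bar>\<sigma>\<bar> + 1)) < \<delta>"
    proof -
      show "0 < e" by (simp add: e_def)
      have "0 < 2 * (\<bar>\<sigma>\<bar> + 1)" by simp
      then show "e * (2 * (\<bar>\<sigma>\<bar> + 1)) < \<delta>"
        using \<open>1 / real (Suc j) < _\<close> unfolding e_def by (simp only: pos_less_divide_eq)
    qed
    have \<sigma>e: "2 * (\<bar>\<sigma>\<bar> * e) \<le> \<delta>"
    proof -
      have "e * (2 * (\<bar>\<sigma>\<bar> + 1)) = 2 * (\<bar>\<sigma>\<bar> * e) + 2 * e" by (simp add: algebra_simps)
      then show ?thesis using e by linarith
    qed
    obtain K0 where K0: "0 \<le> K0" "\<And>t. 0 \<le> t \<Longrightarrow> \<bar>B t \<omega> - B 0 \<omega>\<bar> \<le> K0 + t * e"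
      using elim(4)[rule_format, of j] unfolding e_def by auto
    define L where "L = exp (2 * (\<bar>\<sigma>\<bar> * K0))"
    have gb: "gbm a \<sigma> r t \<omega> \<le> L * exp ((a + \<delta>) * t) * exp (- a * r)" if r: "0 \<le> r" "r \<le> t" for r t
    proof -
      have "\<bar>B t \<omega> - B r \<omega>\<bar> \<le> 2 * K0 + 2 * (t * e)"
      proof -
        have t0: "0 \<le> t" using r by simp
        have "r * e \<le> t * e" using r e by (intro mult_right_mono) auto
        then show ?thesis using K0(2)[OF r(1)] K0(2)[OF t0] by linarith
      qed
      then have "\<bar>\<sigma>\<bar> * \<bar>B t \<omega> - B r \<omega>\<bar> \<le> \<bar>\<sigma>\<bar> * (2 * K0 + 2 * (t * e))" by (rule mult_left_mono) simp
      moreover have "\<sigma> * dB r t \<omega> \<le> \<bar>\<sigma>\<bar> * \<bar>B t \<omega> - B r \<omega>\<bar>" unfolding abs_mult[symmetric] by simp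
      moreover have "\<bar>\<sigma>\<bar> * (2 * K0 + 2 * (t * e)) = 2 * (\<bar>\<sigma>\<bar> * K0) + 2 * (\<bar>\<sigma>\<bar> * e) * t" by (simp add: algebra_simps)
      moreover have "2 * (\<bar>\<sigma>\<bar> * e) * t \<le> \<delta> * t" using \<sigma>e r by (intro mult_right_mono) auto
      \<comment> \<open>The negative correction to the exponent is dropped, since the asserted rate
        is \<open>a\<close>.\<close>
      moreover have "(a - \<sigma>\<^sup>2 / 2) * (t - r) \<le> a * (t - r)" using r by (intro mult_right_mono) auto
      ultimately have "(a - \<sigma>\<^sup>2 / 2) * (t - r) + \<sigma> * dB r t \<omega> \<le> a * (t - r) + (2 * (\<bar>\<sigma>\<bar> * K0) + \<delta> * t)"
        by linarith
      also have "\<dots> = 2 * (\<bar>\<sigma>\<bar> * K0) + ((a + \<delta>) * t + - a * r)" by (simp add: algebra_simps)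
      finally have "gbm a \<sigma> r t \<omega> \<le> exp (2 * (\<bar>\<sigma>\<bar> * K0) + ((a + \<delta>) * t + - a * r))"
        unfolding gbm_def exp_le_cancel_iff .
      then show ?thesis unfolding L_def exp_add by (simp only: mult.assoc)
    qed
    have "\<exists>K>0. \<forall>t\<ge>0. \<bar>X t \<omega>\<bar> \<le> K * exp ((a + \<delta>) * t)"
    proof (rule pantograph_pathwise_growth[where L=L and c="\<bar>X0 \<omega>\<bar>" and \<beta>="\<bar>b\<bar>" and a=a, OF q elim(3)])
      show "(a + \<delta>) * q < a"
      proof -
        have "\<delta> * q \<le> \<delta> * 1" using \<delta>(1) q by (intro mult_left_mono) auto
        then have "(a + \<delta>) * q \<le> a * q + a * (1 - q) / 2" using \<delta>(3) by (simp add: distrib_right)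
        also have "\<dots> < a * q + a * (1 - q)" using aq by simp
        also have "\<dots> = a" by (simp add: algebra_simps)
        finally show ?thesis .
      qed
      fix t :: real assume t: "0 \<le> t"
      have dc: "continuous_on {0..t} (\<lambda>r. delayed t r \<omega>)" by (rule continuous_on_subset[OF elim(2)[rule_format]]) auto
      have ac: "continuous_on {0..t} (\<lambda>r. \<bar>delayed t r \<omega>\<bar>)" by (rule continuous_on_rabs[OF dc])
      have xq: "continuous_on {0..t} (\<lambda>r. X (q * r) \<omega>)"
        using continuous_on_subset[OF elim(5), of "{0..t}"] by simp
      define E where "E = L * exp ((a + \<delta>) * t)"
      have E0: "0 \<le> E" by (simp add: E_def L_def)
      have "\<bar>integral {0..t} (\<lambda>r. delayed t r \<omega>)\<bar> \<le> integral {0..t} (\<lambda>r. \<bar>delayed t r \<omega>\<bar>)"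
        using integral_norm_bound_integral[of "\<lambda>r. delayed t r \<omega>" "{0..t}" "\<lambda>r. \<bar>delayed t r \<omega>\<bar>"]
          integrable_continuous_interval[OF dc] integrable_continuous_interval[OF ac] by simp
      also have "\<dots> \<le> integral {0..t} (\<lambda>r. E * (exp (- a * r) * \<bar>X (q * r) \<omega>\<bar>))"
      proof (rule integral_le)
        show "(\<lambda>r. \<bar>delayed t r \<omega>\<bar>) integrable_on {0..t}" by (rule integrable_continuous_interval[OF ac])
        show "(\<lambda>r. E * (exp (- a * r) * \<bar>X (q * r) \<omega>\<bar>)) integrable_on {0..t}"
          by (intro integrable_continuous_interval continuous_intros xq)
        fix r assume r: "r \<in> {0..t}"
        have "\<bar>delayed t r \<omega>\<bar> = \<bar>X (q * r) \<omega>\<bar> * gbm a \<sigma> r t \<omega>"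
          using gbm_pos[of a \<sigma> r t \<omega>] by (simp add: delayed_def abs_mult)
        also have "\<dots> \<le> \<bar>X (q * r) \<omega>\<bar> * (E * exp (- a * r))"
          unfolding E_def using r by (intro mult_left_mono gb) auto
        finally show "\<bar>delayed t r \<omega>\<bar> \<le> E * (exp (- a * r) * \<bar>X (q * r) \<omega>\<bar>)" by (simp only: mult_ac)
      qed
      also have "\<dots> = E * integral {0..t} (\<lambda>r. exp (- a * r) * \<bar>X (q * r) \<omega>\<bar>)" by (simp only: integral_mult_right)
      finally have i1: "\<bar>integral {0..t} (\<lambda>r. delayed t r \<omega>)\<bar> \<le> E * integral {0..t} (\<lambda>r. exp (- a * r) * \<bar>X (q * r) \<omega>\<bar>)" .
      have i2: "\<bar>X0 \<omega> * gbm a \<sigma> 0 t \<omega>\<bar> \<le> \<bar>X0 \<omega>\<bar> * E"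
        unfolding abs_mult using gb[OF order_refl t] gbm_pos[of a \<sigma> 0 t \<omega>]
        by (intro mult_left_mono) (auto simp: E_def)
      have i3: "\<bar>b * integral {0..t} (\<lambda>r. delayed t r \<omega>)\<bar> \<le> \<bar>b\<bar> * (E * integral {0..t} (\<lambda>r. exp (- a * r) * \<bar>X (q * r) \<omega>\<bar>))"
        unfolding abs_mult by (rule mult_left_mono[OF i1]) simp
      have "\<bar>X t \<omega>\<bar> \<le> \<bar>X0 \<omega> * gbm a \<sigma> 0 t \<omega>\<bar> + \<bar>b * integral {0..t} (\<lambda>r. delayed t r \<omega>)\<bar>"
        using elim(1)[rule_format, OF t] abs_triangle_ineq by simp
      also have "\<dots> \<le> \<bar>X0 \<omega>\<bar> * E + \<bar>b\<bar> * (E * integral {0..t} (\<lambda>r. exp (- a * r) * \<bar>X (q * r) \<omega>\<bar>))"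
        by (rule add_mono[OF i2 i3])
      also have "\<dots> = E * (\<bar>X0 \<omega>\<bar> + \<bar>b\<bar> * integral {0..t} (\<lambda>r. exp (- a * r) * \<bar>X (q * r) \<omega>\<bar>))"
        by (simp add: distrib_left mult_ac)
      finally show "\<bar>X t \<omega>\<bar> \<le> L * exp ((a + \<delta>) * t) * (\<bar>X0 \<omega>\<bar> + \<bar>b\<bar> * integral {0..t} (\<lambda>r. exp (- a * r) * \<bar>X (q * r) \<omega>\<bar>))"
        by (simp only: E_def)
    qed (simp_all add: L_def)
    then obtain K where K: "0 < K" "\<And>t. 0 \<le> t \<Longrightarrow> \<bar>X t \<omega>\<bar> \<le> K * exp ((a + \<delta>) * t)" by blast
    show "\<exists>K T. 0 < K \<and> (\<forall>t\<ge>T. \<bar>X t \<omega>\<bar> \<le> K * exp ((a + 1 / real (Suc k)) * t))"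
    proof (rule exI[of _ K], rule exI[of _ 0], intro conjI allI impI K(1))
      fix t :: real assume t: "0 \<le> t"
      have "(a + \<delta>) * t \<le> (a + 1 / real (Suc k)) * t" using \<delta>(2) t by (intro mult_right_mono) auto
      then have "K * exp ((a + \<delta>) * t) \<le> K * exp ((a + 1 / real (Suc k)) * t)" using K(1) by simp
      then show "\<bar>X t \<omega>\<bar> \<le> K * exp ((a + 1 / real (Suc k)) * t)" using K(2)[OF t] by linarith
    qed
  qed
qed

end

section \<open>The theorem\<close>

text \<open>The Lebesgue integral of the solution concept and the gauge integral of the locale agree
  along continuous paths, and the witness \<open>I\<close> becomes a parameter of the
  locale.\<close>

lemma pantograph_solution_locale:
  assumes B: "brownian_motion M B" and q: "0 < q" "q < 1"
    and X0: "independent_of_process M X0 B" "integrable M (\<lambda>\<omega>. \<bar>X0 \<omega>\<bar>\<^sup>2)"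
    and X: "pantograph_solution M B a b \<sigma> \<rho> q X0 X"
  shows "\<exists>I. pantograph M (completed_filtration M X0 B) B a b \<sigma> \<rho> q X0 X I"
proof -
  let ?F = "completed_filtration M X0 B"
  interpret brownian_filtration M ?F B by (rule brownian_filtration_completed[OF B X0(1)])
  obtain I where I: "ito_integral M ?F B (\<lambda>s \<omega>. \<sigma> * X s \<omega> + \<rho> * X (q * s) \<omega>) I"
    and eq: "AE \<omega> in M. \<forall>t\<ge>0. X t \<omega> = X0 \<omega> + (LBINT s:{0..t}. a * X s \<omega> + b * X (q * s) \<omega>) + I t \<omega>"
    using X unfolding pantograph_solution_def by blast
  have Xc: "AE \<omega> in M. continuous_on {0..} (\<lambda>t. X t \<omega>)" and Xa: "adapted_process ?F X"
    using X unfolding pantograph_solution_def continuous_process_def by blast+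
  have "pantograph M ?F B a b \<sigma> \<rho> q X0 X I"
  proof (unfold_locales)
    show "X0 \<in> L2F 0"
      using X0(2) by (intro L2F_I completed_filtration_generators(3)[OF B X0(1)]) simp
    show "AE \<omega> in M. \<forall>t\<ge>0. X t \<omega> = X0 \<omega> + integral {0..t} (\<lambda>s. a * X s \<omega> + b * X (q * s) \<omega>) + I t \<omega>"
      using eq Xc
    proof eventually_elim
      case (elim \<omega>)
      have "(LBINT s:{0..t}. a * X s \<omega> + b * X (q * s) \<omega>) = integral {0..t} (\<lambda>s. a * X s \<omega> + b * X (q * s) \<omega>)" for t
      proof (rule set_borel_integral_eq_integral(2), rule borel_integrable_atLeastAtMost')
        have "continuous_on {0..t} (\<lambda>s. X s \<omega>)" by (rule continuous_on_subset[OF elim(2)]) auto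
        moreover have "continuous_on {0..t} (\<lambda>s. X (q * s) \<omega>)"
          by (rule continuous_on_compose2[OF elim(2)]) (use q in \<open>auto intro!: continuous_intros\<close>)
        ultimately show "continuous_on {0..t} (\<lambda>s. a * X s \<omega> + b * X (q * s) \<omega>)" by (intro continuous_intros)
      qed
      then show ?case using elim(1) by (simp only:)
    qed
  qed (rule q Xa Xc I)+
  then show ?thesis by blast
qed

theorem theorem7:
  fixes M :: "'a measure" and B :: "real \<Rightarrow> 'a \<Rightarrow> real"
    and a b \<sigma> \<rho> q :: real
  assumes "prob_space M" and "brownian_motion M B" and "0 < q" and "q < 1"
  shows
    "(\<rho> = 0 \<and> a > 0 \<longrightarrow>
       (\<exists>C>0. \<forall>X0 X.
          independent_of_process M X0 B \<and> integrable M (\<lambda>\<omega>. \<bar>X0 \<omega>\<bar>\<^sup>2) \<and>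
          pantograph_solution M B a b \<sigma> \<rho> q X0 X \<longrightarrow>
            (\<forall>t\<ge>0. integrable M (\<lambda>\<omega>. \<bar>X t \<omega>\<bar>) \<and>
               (\<integral>\<omega>. \<bar>X t \<omega>\<bar> \<partial>M) \<le> C * (\<integral>\<omega>. \<bar>X0 \<omega>\<bar> \<partial>M) * exp (a * t)) \<and>
            (AE \<omega> in M. Limsup at_top (\<lambda>t. ereal (1 / t) * elog \<bar>X t \<omega>\<bar>) \<le> ereal a))) \<and>
     (\<rho> \<noteq> 0 \<and> 2 * a + \<sigma>\<^sup>2 > 0 \<longrightarrow>
       (\<exists>C>0. \<forall>X0 X.
          independent_of_process M X0 B \<and> integrable M (\<lambda>\<omega>. \<bar>X0 \<omega>\<bar>\<^sup>2) \<and>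
          pantograph_solution M B a b \<sigma> \<rho> q X0 X \<longrightarrow>
            (\<forall>t\<ge>0. integrable M (\<lambda>\<omega>. \<bar>X t \<omega>\<bar>\<^sup>2) \<and>
               (\<integral>\<omega>. \<bar>X t \<omega>\<bar>\<^sup>2 \<partial>M)
                 \<le> C * (\<integral>\<omega>. \<bar>X0 \<omega>\<bar>\<^sup>2 \<partial>M) * exp ((2 * a + \<sigma>\<^sup>2) * t)) \<and>
            (AE \<omega> in M. Limsup at_top (\<lambda>t. ereal (1 / t) * elog \<bar>X t \<omega>\<bar>)
               \<le> ereal (a + \<sigma>\<^sup>2 / 2))))"
proof (intro conjI impI)
  assume i: "\<rho> = 0 \<and> a > 0"
  show "\<exists>C>0. \<forall>X0 X.
          independent_of_process M X0 B \<and> integrable M (\<lambda>\<omega>. \<bar>X0 \<omega>\<bar>\<^sup>2) \<and>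
          pantograph_solution M B a b \<sigma> \<rho> q X0 X \<longrightarrow>
            (\<forall>t\<ge>0. integrable M (\<lambda>\<omega>. \<bar>X t \<omega>\<bar>) \<and>
               (\<integral>\<omega>. \<bar>X t \<omega>\<bar> \<partial>M) \<le> C * (\<integral>\<omega>. \<bar>X0 \<omega>\<bar> \<partial>M) * exp (a * t)) \<and>
            (AE \<omega> in M. Limsup at_top (\<lambda>t. ereal (1 / t) * elog \<bar>X t \<omega>\<bar>) \<le> ereal a)"
  \<comment> \<open>The witness depends on \<open>a\<close>, \<open>b\<close> and \<open>q\<close>
    only and is fixed before \<open>X0\<close> and \<open>X\<close>, as the order of quantifiers
    requires.\<close>
  proof (rule exI[of _ "exp (\<bar>b\<bar> / (a * (1 - q)))"], rule conjI, simp, intro allI impI)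
    fix X0 X
    assume h: "independent_of_process M X0 B \<and> integrable M (\<lambda>\<omega>. \<bar>X0 \<omega>\<bar>\<^sup>2) \<and>
          pantograph_solution M B a b \<sigma> \<rho> q X0 X"
    then obtain I where P: "pantograph M (completed_filtration M X0 B) B a b \<sigma> \<rho> q X0 X I"
      using pantograph_solution_locale[OF assms(2-4)] by blast
    show "(\<forall>t\<ge>0. integrable M (\<lambda>\<omega>. \<bar>X t \<omega>\<bar>) \<and>
               (\<integral>\<omega>. \<bar>X t \<omega>\<bar> \<partial>M) \<le> exp (\<bar>b\<bar> / (a * (1 - q))) * (\<integral>\<omega>. \<bar>X0 \<omega>\<bar> \<partial>M) * exp (a * t)) \<and>
            (AE \<omega> in M. Limsup at_top (\<lambda>t. ereal (1 / t) * elog \<bar>X t \<omega>\<bar>) \<le> ereal a)"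
      using pantograph.X_integrable[OF P] pantograph.first_moment_growth[OF P conjunct1[OF i] conjunct2[OF i]]
        pantograph.almost_sure_growth_without_noise_delay[OF P conjunct1[OF i] conjunct2[OF i]] by blast
  qed
next
  assume i: "\<rho> \<noteq> 0 \<and> 2 * a + \<sigma>\<^sup>2 > 0"
  \<comment> \<open>The expression of \<open>\<kappa>2\<close>, repeated because the witness has to
    be chosen before the locale is instantiated for a particular \<open>X0\<close> and
    \<open>X\<close>.\<close>
  define \<kappa> where "\<kappa> = (2 * \<bar>b + \<sigma> * \<rho>\<bar> + \<rho>\<^sup>2 + 1) / ((2 * a + \<sigma>\<^sup>2) * (1 - q) / 2)"
  show "\<exists>C>0. \<forall>X0 X.
          independent_of_process M X0 B \<and> integrable M (\<lambda>\<omega>. \<bar>X0 \<omega>\<bar>\<^sup>2) \<and>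
          pantograph_solution M B a b \<sigma> \<rho> q X0 X \<longrightarrow>
            (\<forall>t\<ge>0. integrable M (\<lambda>\<omega>. \<bar>X t \<omega>\<bar>\<^sup>2) \<and>
               (\<integral>\<omega>. \<bar>X t \<omega>\<bar>\<^sup>2 \<partial>M)
                 \<le> C * (\<integral>\<omega>. \<bar>X0 \<omega>\<bar>\<^sup>2 \<partial>M) * exp ((2 * a + \<sigma>\<^sup>2) * t)) \<and>
            (AE \<omega> in M. Limsup at_top (\<lambda>t. ereal (1 / t) * elog \<bar>X t \<omega>\<bar>)
               \<le> ereal (a + \<sigma>\<^sup>2 / 2))"
  proof (rule exI[of _ "exp \<kappa>"], rule conjI, simp, intro allI impI)
    fix X0 X
    assume h: "independent_of_process M X0 B \<and> integrable M (\<lambda>\<omega>. \<bar>X0 \<omega>\<bar>\<^sup>2) \<and>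
          pantograph_solution M B a b \<sigma> \<rho> q X0 X"
    then obtain I where P: "pantograph M (completed_filtration M X0 B) B a b \<sigma> \<rho> q X0 X I"
      using pantograph_solution_locale[OF assms(2-4)] by blast
    interpret pantograph M "completed_filtration M X0 B" B a b \<sigma> \<rho> q X0 X I by (rule P)
    note growth = second_moment_growth[OF conjunct2[OF i], unfolded \<kappa>2_def, folded \<kappa>_def]
    have half: "(2 * a + \<sigma>\<^sup>2) / 2 = a + \<sigma>\<^sup>2 / 2" by (simp add: add_divide_distrib)
    have "AE \<omega> in M. Limsup at_top (\<lambda>t. ereal (1 / t) * elog \<bar>X t \<omega>\<bar>) \<le> ereal (a + \<sigma>\<^sup>2 / 2)"
      unfolding half[symmetric] by (rule almost_sure_growth_of_second_moment[OF conjunct2[OF i] growth])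
    moreover have "integrable M (\<lambda>\<omega>. (X t \<omega>)\<^sup>2)" if "0 \<le> t" for t
      by (rule L2_integrable_square[OF L2F_L2[OF X_L2F[OF that]]])
    ultimately show "(\<forall>t\<ge>0. integrable M (\<lambda>\<omega>. \<bar>X t \<omega>\<bar>\<^sup>2) \<and>
               (\<integral>\<omega>. \<bar>X t \<omega>\<bar>\<^sup>2 \<partial>M)
                 \<le> exp \<kappa> * (\<integral>\<omega>. \<bar>X0 \<omega>\<bar>\<^sup>2 \<partial>M) * exp ((2 * a + \<sigma>\<^sup>2) * t)) \<and>
            (AE \<omega> in M. Limsup at_top (\<lambda>t. ereal (1 / t) * elog \<bar>X t \<omega>\<bar>)
               \<le> ereal (a + \<sigma>\<^sup>2 / 2))"
      unfolding power2_abs using growth by blast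
  qed
qed

end
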